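(* Let $X$ be a finite space, let $X'$ be a ringed finite space, and let $\pi\colon X\times X'\to X$ be the natural projection. For any quasi-coherent sheaf (of modules) $\mathcal{M}$ on $X\times X'$ and any $i\geq 0$, the $\mathcal{O}_X$-module $R^i\pi_*\mathcal{M}$ is quasi-coherent.
   Context: A ringed finite space is a ringed space (with a sheaf of commutative unital rings) whose underlying topological space is finite. For a point $p$, $U_p$ is the smallest open subset containing $p$; $p\leq q$ means $q\in U_p$; the stalk at $p$ is $\mathcal{O}_p=\mathcal{O}(U_p)$, and for $p\leq q$ there is the restriction $r_{pq}\colon\mathcal{O}_p\to\mathcal{O}_q$. A finite space is a ringed finite space such that $r_{pq}$ is flat for all $p\leq q$. The product $X\times X'$ is taken over a fixed base ring $k$ (e.g. $k=\mathbb{Z}$) over which $X$ and $X'$ are defined: its underlying space is the product of the topological spaces and its sheaf of rings has stalks $\mathcal{O}_{(x,x')}=\mathcal{O}_x\otimes_k\mathcal{O}_{x'}$ with the obvious restriction maps. A module on a ringed space is quasi-coherent if it is locally a cokernel of a morphism of (arbitrary rank) free modules. *)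

theory Defs
  imports
    "HOL-Algebra.Module"
    "HOL-Algebra.AbelCoset"
    "HOL-Algebra.Free_Abelian_Groups"
    "HOL-Analysis.Product_Topology"
begin

section \<open>Modules, tensor products and flatness\<close>

text \<open>Module records of HOL-Algebra extend ring records, but the locale \<^locale>\<open>Module.module\<close> does not
  look at the fields \<^const>\<open>monoid.mult\<close> and \<^const>\<open>monoid.one\<close> of the module; they are left unspecified.\<close>

definition mk_module ::
  "'m set \<Rightarrow> 'm \<Rightarrow> ('m \<Rightarrow> 'm \<Rightarrow> 'm) \<Rightarrow> ('a \<Rightarrow> 'm \<Rightarrow> 'm) \<Rightarrow> ('a, 'm) module" where
  "mk_module S z ad sm =
     \<lparr>carrier = S, monoid.mult = undefined, monoid.one = undefined, ring.zero = z, add = ad, smult = sm\<rparr>"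

definition mod_hom ::
  "('a, 'x) ring_scheme \<Rightarrow> ('a, 'm) module \<Rightarrow> ('a, 'n) module \<Rightarrow> ('m \<Rightarrow> 'n) set" where
  "mod_hom A M N = {f \<in> carrier M \<rightarrow> carrier N.
     (\<forall>x\<in>carrier M. \<forall>y\<in>carrier M. f (x \<oplus>\<^bsub>M\<^esub> y) = f x \<oplus>\<^bsub>N\<^esub> f y) \<and>
     (\<forall>r\<in>carrier A. \<forall>x\<in>carrier M. f (r \<odot>\<^bsub>M\<^esub> x) = r \<odot>\<^bsub>N\<^esub> f x)}"

definition restrict_scalars :: "('a \<Rightarrow> 'b) \<Rightarrow> ('b, 'm) module \<Rightarrow> ('a, 'm) module" where
  "restrict_scalars f M = mk_module (carrier M) \<zero>\<^bsub>M\<^esub> (\<lambda>x y. x \<oplus>\<^bsub>M\<^esub> y) (\<lambda>r x. f r \<odot>\<^bsub>M\<^esub> x)"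

definition alg_module :: "('a \<Rightarrow> 'b) \<Rightarrow> 'b ring \<Rightarrow> ('a, 'b) module" where
  "alg_module f B = mk_module (carrier B) \<zero>\<^bsub>B\<^esub> (\<lambda>x y. x \<oplus>\<^bsub>B\<^esub> y) (\<lambda>r x. f r \<otimes>\<^bsub>B\<^esub> x)"

text \<open>The quotient \<open>Z / H\<close> of a submodule \<open>Z\<close> of \<open>M\<close> by a submodule \<open>H \<subseteq> Z\<close>.\<close>

definition quot_module :: "('a, 'm) module \<Rightarrow> 'm set \<Rightarrow> 'm set \<Rightarrow> ('a, 'm set) module" where
  "quot_module M Z H = mk_module ((\<lambda>x. H +>\<^bsub>M\<^esub> x) ` Z) H (\<lambda>C D. C <+>\<^bsub>M\<^esub> D)
     (\<lambda>r C. \<Union>x\<in>C. H +>\<^bsub>M\<^esub> (r \<odot>\<^bsub>M\<^esub> x))"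

text \<open>\<open>M \<otimes>\<^sub>A N\<close> is the free abelian group on \<open>M \<times> N\<close> modulo the bilinear, \<open>A\<close>-balanced relations.\<close>

definition tensor_free :: "('a, 'm) module \<Rightarrow> ('a, 'n) module \<Rightarrow> ('m \<times> 'n \<Rightarrow>\<^sub>0 int) monoid" where
  "tensor_free M N = free_Abelian_group (carrier M \<times> carrier N)"

definition tensor_rel ::
  "('a, 'x) ring_scheme \<Rightarrow> ('a, 'm) module \<Rightarrow> ('a, 'n) module \<Rightarrow> ('m \<times> 'n \<Rightarrow>\<^sub>0 int) set" where
  "tensor_rel A M N = generate (tensor_free M N)
    ({frag_of (x \<oplus>\<^bsub>M\<^esub> x', y) - frag_of (x, y) - frag_of (x', y) | x x' y.
        x \<in> carrier M \<and> x' \<in> carrier M \<and> y \<in> carrier N} \<union>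
     {frag_of (x, y \<oplus>\<^bsub>N\<^esub> y') - frag_of (x, y) - frag_of (x, y') | x y y'.
        x \<in> carrier M \<and> y \<in> carrier N \<and> y' \<in> carrier N} \<union>
     {frag_of (r \<odot>\<^bsub>M\<^esub> x, y) - frag_of (x, r \<odot>\<^bsub>N\<^esub> y) | r x y.
        r \<in> carrier A \<and> x \<in> carrier M \<and> y \<in> carrier N})"

definition tensor ::
  "('a, 'x) ring_scheme \<Rightarrow> ('a, 'm) module \<Rightarrow> ('a, 'n) module \<Rightarrow> ('m \<times> 'n \<Rightarrow>\<^sub>0 int) set monoid" where
  "tensor A M N = tensor_free M N Mod tensor_rel A M N"

definition pure_tensor ::
  "('a, 'x) ring_scheme \<Rightarrow> ('a, 'm) module \<Rightarrow> ('a, 'n) module \<Rightarrow> 'm \<Rightarrow> 'n \<Rightarrow> ('m \<times> 'n \<Rightarrow>\<^sub>0 int) set" where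
  "pure_tensor A M N x y = tensor_rel A M N #>\<^bsub>tensor_free M N\<^esub> frag_of (x, y)"

text \<open>The map \<open>f \<otimes> g\<close> into \<open>M' \<otimes>\<^sub>A N'\<close>.\<close>

definition tensor_map ::
  "('a, 'x) ring_scheme \<Rightarrow> ('a, 'm1) module \<Rightarrow> ('a, 'n1) module \<Rightarrow> ('m \<Rightarrow> 'm1) \<Rightarrow> ('n \<Rightarrow> 'n1) \<Rightarrow>
    ('m \<times> 'n \<Rightarrow>\<^sub>0 int) set \<Rightarrow> ('m1 \<times> 'n1 \<Rightarrow>\<^sub>0 int) set" where
  "tensor_map A M' N' f g C =
     (\<Union>c\<in>C. tensor_rel A M' N' #>\<^bsub>tensor_free M' N'\<^esub> frag_extend (\<lambda>(x, y). frag_of (f x, g y)) c)"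

text \<open>A module \<open>P\<close> is flat if tensoring with \<open>P\<close> preserves injective homomorphisms. In HOL the test
  modules must have carriers in a fixed type. The type chosen has room for \<open>A\<^sup>n / K\<close>, i.e. for every
  finitely generated \<open>A\<close>-module up to isomorphism. This tests flatness against arbitrary modules,
  since tensor products commute with filtered unions.\<close>

definition flat_module :: "'a ring \<Rightarrow> ('a, 'm) module \<Rightarrow> bool" where
  "flat_module A P \<longleftrightarrow> Module.module A P \<and>
     (\<forall>(N' :: ('a, (nat \<Rightarrow> 'a) set) module) (N :: ('a, (nat \<Rightarrow> 'a) set) module) f.
        Module.module A N' \<longrightarrow> Module.module A N \<longrightarrow> f \<in> mod_hom A N' N \<longrightarrow> inj_on f (carrier N') \<longrightarrow>
        inj_on (tensor_map A N P f (\<lambda>y. y)) (carrier (tensor A N' P)))"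

definition flat_ring_hom :: "'a ring \<Rightarrow> 'b ring \<Rightarrow> ('a \<Rightarrow> 'b) \<Rightarrow> bool" where
  "flat_ring_hom A B f \<longleftrightarrow> f \<in> ring_hom A B \<and> flat_module A (alg_module f B)"

text \<open>The ring \<open>A \<otimes>\<^sub>k B\<close> for \<open>k\<close>-algebras with structure maps \<open>f: k \<rightarrow> A\<close> and \<open>g: k \<rightarrow> B\<close>;
  the multiplication extends \<open>(x \<otimes> y) (x' \<otimes> y') = x x' \<otimes> y y'\<close> bilinearly.\<close>

definition tensor_ring ::
  "'k ring \<Rightarrow> 'a ring \<Rightarrow> ('k \<Rightarrow> 'a) \<Rightarrow> 'b ring \<Rightarrow> ('k \<Rightarrow> 'b) \<Rightarrow> ('a \<times> 'b \<Rightarrow>\<^sub>0 int) set ring" where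
  "tensor_ring k A f B g =
     (let M = alg_module f A; N = alg_module g B in
     \<lparr>carrier = carrier (tensor k M N),
      monoid.mult = (\<lambda>C D. \<Union>c\<in>C. \<Union>d\<in>D. tensor_rel k M N #>\<^bsub>tensor_free M N\<^esub>
        frag_extend (\<lambda>(x, y). frag_extend (\<lambda>(x', y'). frag_of (x \<otimes>\<^bsub>A\<^esub> x', y \<otimes>\<^bsub>B\<^esub> y')) d) c),
      monoid.one = pure_tensor k M N \<one>\<^bsub>A\<^esub> \<one>\<^bsub>B\<^esub>,
      ring.zero = \<one>\<^bsub>tensor k M N\<^esub>,
      add = (\<lambda>C D. C \<otimes>\<^bsub>tensor k M N\<^esub> D)\<rparr>)"


section \<open>Ringed finite spaces\<close>

text \<open>In the following predicates \<open>S U\<close> is the set of sections over \<open>U\<close> and \<open>r U V\<close> is the restriction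
  from \<open>U\<close> to \<open>V \<subseteq> U\<close>; their values on sets that are not open are irrelevant. Covers may be empty, so
  a sheaf has exactly one section over the empty set.\<close>

definition presheaf_on :: "'p topology \<Rightarrow> ('p set \<Rightarrow> 'a set) \<Rightarrow> ('p set \<Rightarrow> 'p set \<Rightarrow> 'a \<Rightarrow> 'a) \<Rightarrow> bool" where
  "presheaf_on T S r \<longleftrightarrow>
     (\<forall>U V. openin T U \<longrightarrow> openin T V \<longrightarrow> V \<subseteq> U \<longrightarrow> r U V \<in> S U \<rightarrow> S V) \<and>
     (\<forall>U. openin T U \<longrightarrow> (\<forall>s\<in>S U. r U U s = s)) \<and>
     (\<forall>U V W. openin T U \<longrightarrow> openin T V \<longrightarrow> openin T W \<longrightarrow> W \<subseteq> V \<longrightarrow> V \<subseteq> U \<longrightarrow>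
        (\<forall>s\<in>S U. r V W (r U V s) = r U W s))"

definition sheaf_on :: "'p topology \<Rightarrow> ('p set \<Rightarrow> 'a set) \<Rightarrow> ('p set \<Rightarrow> 'p set \<Rightarrow> 'a \<Rightarrow> 'a) \<Rightarrow> bool" where
  "sheaf_on T S r \<longleftrightarrow> presheaf_on T S r \<and>
     (\<forall>\<U> s. (\<forall>V\<in>\<U>. openin T V \<and> s V \<in> S V) \<longrightarrow>
        (\<forall>V\<in>\<U>. \<forall>W\<in>\<U>. r V (V \<inter> W) (s V) = r W (V \<inter> W) (s W)) \<longrightarrow>
        (\<exists>!t. t \<in> S (\<Union>\<U>) \<and> (\<forall>V\<in>\<U>. r (\<Union>\<U>) V t = s V)))"

record ('p, 'r) ringed_space =
  topo :: "'p topology"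
  sec :: "'p set \<Rightarrow> 'r ring"
  res :: "'p set \<Rightarrow> 'p set \<Rightarrow> 'r \<Rightarrow> 'r"

locale ringed_space =
  fixes X :: "('p, 'r) ringed_space"
  assumes cring_sec: "openin (topo X) U \<Longrightarrow> cring (sec X U)"
    and res_hom: "openin (topo X) U \<Longrightarrow> openin (topo X) V \<Longrightarrow> V \<subseteq> U \<Longrightarrow>
      res X U V \<in> ring_hom (sec X U) (sec X V)"
    and sheaf_sec: "sheaf_on (topo X) (\<lambda>U. carrier (sec X U)) (res X)"

locale ringed_finite_space = ringed_space X for X :: "('p, 'r) ringed_space" +
  assumes finite_topspace: "finite (topspace (topo X))"

text \<open>\<open>U\<^sub>p\<close>; the order \<open>p \<le> q\<close> of the points is expressed as \<open>q \<in> min_open T p\<close>.\<close>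

definition min_open :: "'p topology \<Rightarrow> 'p \<Rightarrow> 'p set" where
  "min_open T p = \<Inter>{U. openin T U \<and> p \<in> U}"

definition stalk :: "('p, 'r) ringed_space \<Rightarrow> 'p \<Rightarrow> 'r ring" where
  "stalk X p = sec X (min_open (topo X) p)"

definition stalk_res :: "('p, 'r) ringed_space \<Rightarrow> 'p \<Rightarrow> 'p \<Rightarrow> 'r \<Rightarrow> 'r" where
  "stalk_res X p q = res X (min_open (topo X) p) (min_open (topo X) q)"

locale finite_space = ringed_finite_space X for X :: "('p, 'r) ringed_space" +
  assumes flat_stalk_res: "p \<in> topspace (topo X) \<Longrightarrow> q \<in> min_open (topo X) p \<Longrightarrow>
    flat_ring_hom (stalk X p) (stalk X q) (stalk_res X p q)"

text \<open>\<open>a U\<close> is the structure map \<open>k \<rightarrow> \<O>(U)\<close>.\<close>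

definition over_base :: "'k ring \<Rightarrow> ('p, 'r) ringed_space \<Rightarrow> ('p set \<Rightarrow> 'k \<Rightarrow> 'r) \<Rightarrow> bool" where
  "over_base k X a \<longleftrightarrow>
     (\<forall>U. openin (topo X) U \<longrightarrow> a U \<in> ring_hom k (sec X U)) \<and>
     (\<forall>U V. openin (topo X) U \<longrightarrow> openin (topo X) V \<longrightarrow> V \<subseteq> U \<longrightarrow>
        (\<forall>c\<in>carrier k. res X U V (a U c) = a V c))"

definition stalk_struct ::
  "('p, 'r) ringed_space \<Rightarrow> ('p set \<Rightarrow> 'k \<Rightarrow> 'r) \<Rightarrow> 'p \<Rightarrow> 'k \<Rightarrow> 'r" where
  "stalk_struct X a p = a (min_open (topo X) p)"

text \<open>On a finite space a sheaf is determined by its stalks \<open>S p\<close> and the maps \<open>r p q: S p \<rightarrow> S q\<close> for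
  \<open>p \<le> q\<close>: the sections over \<open>U\<close> form the limit of the stalks at the points of \<open>U\<close>.\<close>

definition stalks_sec ::
  "'p topology \<Rightarrow> ('p \<Rightarrow> 'r ring) \<Rightarrow> ('p \<Rightarrow> 'p \<Rightarrow> 'r \<Rightarrow> 'r) \<Rightarrow> 'p set \<Rightarrow> ('p \<Rightarrow> 'r) ring" where
  "stalks_sec T S r U =
     \<lparr>carrier = {s \<in> \<Pi>\<^sub>E p\<in>U. carrier (S p). \<forall>p\<in>U. \<forall>q\<in>min_open T p. r p q (s p) = s q},
      monoid.mult = (\<lambda>s t. \<lambda>p\<in>U. s p \<otimes>\<^bsub>S p\<^esub> t p),
      monoid.one = (\<lambda>p\<in>U. \<one>\<^bsub>S p\<^esub>),
      ring.zero = (\<lambda>p\<in>U. \<zero>\<^bsub>S p\<^esub>),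
      add = (\<lambda>s t. \<lambda>p\<in>U. s p \<oplus>\<^bsub>S p\<^esub> t p)\<rparr>"

definition product_stalk ::
  "'k ring \<Rightarrow> ('p, 'r) ringed_space \<Rightarrow> ('p set \<Rightarrow> 'k \<Rightarrow> 'r) \<Rightarrow>
   ('q, 's) ringed_space \<Rightarrow> ('q set \<Rightarrow> 'k \<Rightarrow> 's) \<Rightarrow> 'p \<times> 'q \<Rightarrow> ('r \<times> 's \<Rightarrow>\<^sub>0 int) set ring" where
  "product_stalk k X a X' a' z =
     tensor_ring k (stalk X (fst z)) (stalk_struct X a (fst z))
                   (stalk X' (snd z)) (stalk_struct X' a' (snd z))"

definition product_stalk_res ::
  "'k ring \<Rightarrow> ('p, 'r) ringed_space \<Rightarrow> ('p set \<Rightarrow> 'k \<Rightarrow> 'r) \<Rightarrow>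
   ('q, 's) ringed_space \<Rightarrow> ('q set \<Rightarrow> 'k \<Rightarrow> 's) \<Rightarrow> 'p \<times> 'q \<Rightarrow> 'p \<times> 'q \<Rightarrow>
   ('r \<times> 's \<Rightarrow>\<^sub>0 int) set \<Rightarrow> ('r \<times> 's \<Rightarrow>\<^sub>0 int) set" where
  "product_stalk_res k X a X' a' z w =
     tensor_map k (alg_module (stalk_struct X a (fst w)) (stalk X (fst w)))
                  (alg_module (stalk_struct X' a' (snd w)) (stalk X' (snd w)))
                  (stalk_res X (fst z) (fst w)) (stalk_res X' (snd z) (snd w))"

definition product_space ::
  "'k ring \<Rightarrow> ('p, 'r) ringed_space \<Rightarrow> ('p set \<Rightarrow> 'k \<Rightarrow> 'r) \<Rightarrow>
   ('q, 's) ringed_space \<Rightarrow> ('q set \<Rightarrow> 'k \<Rightarrow> 's) \<Rightarrow>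
   ('p \<times> 'q, 'p \<times> 'q \<Rightarrow> ('r \<times> 's \<Rightarrow>\<^sub>0 int) set) ringed_space" where
  "product_space k X a X' a' =
     (let T = prod_topology (topo X) (topo X') in
     \<lparr>topo = T,
      sec = stalks_sec T (product_stalk k X a X' a') (product_stalk_res k X a X' a'),
      res = (\<lambda>W W' s. restrict s W')\<rparr>)"

text \<open>The ring map \<open>\<O>\<^sub>X(U) \<rightarrow> \<O>\<^bsub>X\<times>X'\<^esub>(U \<times> X')\<close> of the projection to \<open>X\<close>; on stalks it is \<open>s \<mapsto> s \<otimes> 1\<close>.\<close>

definition proj_sharp ::
  "'k ring \<Rightarrow> ('p, 'r) ringed_space \<Rightarrow> ('p set \<Rightarrow> 'k \<Rightarrow> 'r) \<Rightarrow>
   ('q, 's) ringed_space \<Rightarrow> ('q set \<Rightarrow> 'k \<Rightarrow> 's) \<Rightarrow>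
   'p set \<Rightarrow> 'r \<Rightarrow> 'p \<times> 'q \<Rightarrow> ('r \<times> 's \<Rightarrow>\<^sub>0 int) set" where
  "proj_sharp k X a X' a' U s = (\<lambda>(p, p')\<in>U \<times> topspace (topo X').
     pure_tensor k (alg_module (stalk_struct X a p) (stalk X p))
                   (alg_module (stalk_struct X' a' p') (stalk X' p'))
                   (res X U (min_open (topo X) p) s) \<one>\<^bsub>stalk X' p'\<^esub>)"


section \<open>Sheaves of modules\<close>

record ('p, 'r, 'm) module_sheaf =
  msec :: "'p set \<Rightarrow> ('r, 'm) module"
  mres :: "'p set \<Rightarrow> 'p set \<Rightarrow> 'm \<Rightarrow> 'm"

definition sheaf_of_modules :: "('p, 'r) ringed_space \<Rightarrow> ('p, 'r, 'm) module_sheaf \<Rightarrow> bool" where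
  "sheaf_of_modules X M \<longleftrightarrow>
     (\<forall>U. openin (topo X) U \<longrightarrow> Module.module (sec X U) (msec M U)) \<and>
     (\<forall>U V. openin (topo X) U \<longrightarrow> openin (topo X) V \<longrightarrow> V \<subseteq> U \<longrightarrow>
        mres M U V \<in> mod_hom (sec X U) (msec M U) (restrict_scalars (res X U V) (msec M V))) \<and>
     sheaf_on (topo X) (\<lambda>U. carrier (msec M U)) (mres M)"

definition sheaf_hom ::
  "('p, 'r) ringed_space \<Rightarrow> ('p, 'r, 'm) module_sheaf \<Rightarrow> ('p, 'r, 'n) module_sheaf \<Rightarrow>
   ('p set \<Rightarrow> 'm \<Rightarrow> 'n) set" where
  "sheaf_hom X M N = {f.
     (\<forall>U. openin (topo X) U \<longrightarrow> f U \<in> mod_hom (sec X U) (msec M U) (msec N U)) \<and>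
     (\<forall>U V. openin (topo X) U \<longrightarrow> openin (topo X) V \<longrightarrow> V \<subseteq> U \<longrightarrow>
        (\<forall>s\<in>carrier (msec M U). f V (mres M U V s) = mres N U V (f U s)))}"

definition mstalk :: "('p, 'r) ringed_space \<Rightarrow> ('p, 'r, 'm) module_sheaf \<Rightarrow> 'p \<Rightarrow> ('r, 'm) module" where
  "mstalk X M p = msec M (min_open (topo X) p)"

text \<open>Exactness of \<open>L \<rightarrow> M \<rightarrow> N\<close>, injectivity and surjectivity of a morphism of sheaves are
  conditions on stalks, and the stalk at \<open>p\<close> is the module of sections over \<open>U\<^sub>p\<close>.\<close>

definition exact_at ::
  "('p, 'r) ringed_space \<Rightarrow> ('p, 'r, 'l) module_sheaf \<Rightarrow> ('p set \<Rightarrow> 'l \<Rightarrow> 'm) \<Rightarrow>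
   ('p, 'r, 'm) module_sheaf \<Rightarrow> ('p set \<Rightarrow> 'm \<Rightarrow> 'n) \<Rightarrow> ('p, 'r, 'n) module_sheaf \<Rightarrow> bool" where
  "exact_at X L f M g N \<longleftrightarrow> (\<forall>p\<in>topspace (topo X).
     f (min_open (topo X) p) ` carrier (mstalk X L p) =
     {x \<in> carrier (mstalk X M p). g (min_open (topo X) p) x = \<zero>\<^bsub>mstalk X N p\<^esub>})"

definition sheaf_mono ::
  "('p, 'r) ringed_space \<Rightarrow> ('p, 'r, 'm) module_sheaf \<Rightarrow> ('p set \<Rightarrow> 'm \<Rightarrow> 'n) \<Rightarrow> bool" where
  "sheaf_mono X M f \<longleftrightarrow> (\<forall>p\<in>topspace (topo X).
     inj_on (f (min_open (topo X) p)) (carrier (mstalk X M p)))"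

definition sheaf_epi ::
  "('p, 'r) ringed_space \<Rightarrow> ('p, 'r, 'm) module_sheaf \<Rightarrow> ('p set \<Rightarrow> 'm \<Rightarrow> 'n) \<Rightarrow>
   ('p, 'r, 'n) module_sheaf \<Rightarrow> bool" where
  "sheaf_epi X M f N \<longleftrightarrow> (\<forall>p\<in>topspace (topo X).
     f (min_open (topo X) p) ` carrier (mstalk X M p) = carrier (mstalk X N p))"

text \<open>The open ringed subspace \<open>U\<close>. Its open sets are the open sets of \<open>X\<close> contained in \<open>U\<close>, so a
  sheaf of modules on \<open>X\<close>, regarded on \<open>open_sub X U\<close>, is its restriction to \<open>U\<close>.\<close>

definition open_sub :: "('p, 'r) ringed_space \<Rightarrow> 'p set \<Rightarrow> ('p, 'r) ringed_space" where
  "open_sub X U = X\<lparr>topo := subtopology (topo X) U\<rparr>"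

text \<open>The free module \<open>\<O>\<^sup>(\<^sup>J\<^sup>)\<close>. The direct sum of the presheaves is already a sheaf, because the
  space is finite and hence noetherian.\<close>

definition free_sheaf ::
  "('p, 'r) ringed_space \<Rightarrow> 'j set \<Rightarrow> ('p, 'r, 'j \<Rightarrow> 'r) module_sheaf" where
  "free_sheaf X J =
     \<lparr>msec = (\<lambda>U. let A = sec X U in
        mk_module {x \<in> J \<rightarrow>\<^sub>E carrier A. finite {j \<in> J. x j \<noteq> \<zero>\<^bsub>A\<^esub>}}
          (\<lambda>j\<in>J. \<zero>\<^bsub>A\<^esub>) (\<lambda>x y. \<lambda>j\<in>J. x j \<oplus>\<^bsub>A\<^esub> y j) (\<lambda>r x. \<lambda>j\<in>J. r \<otimes>\<^bsub>A\<^esub> x j)),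
      mres = (\<lambda>U V x. \<lambda>j\<in>J. res X U V (x j))\<rparr>"

text \<open>\<open>M\<close> is the cokernel of a morphism \<open>\<O>\<^sup>(\<^sup>I\<^sup>) \<rightarrow> \<O>\<^sup>(\<^sup>J\<^sup>)\<close>.\<close>

definition free_cokernel ::
  "('p, 'r) ringed_space \<Rightarrow> 'i set \<Rightarrow> 'j set \<Rightarrow> ('p, 'r, 'm) module_sheaf \<Rightarrow> bool" where
  "free_cokernel X I J M \<longleftrightarrow>
     (\<exists>f\<in>sheaf_hom X (free_sheaf X I) (free_sheaf X J). \<exists>g\<in>sheaf_hom X (free_sheaf X J) M.
        exact_at X (free_sheaf X I) f (free_sheaf X J) g M \<and> sheaf_epi X (free_sheaf X J) g M)"

text \<open>The index sets of the free modules have to be taken from fixed types, which is no restriction: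
  if \<open>M\<close> has a presentation with arbitrary index sets near \<open>p\<close>, then it has one over \<open>U\<^sub>p\<close> with
  \<open>J = M\<^sub>p\<close> and \<open>I\<close> the kernel of \<open>\<O>\<^sub>p\<^sup>(\<^sup>J\<^sup>) \<rightarrow> M\<^sub>p\<close>, a set of functions from \<open>M\<^sub>p\<close> to \<open>\<O>\<^sub>p\<close>.\<close>

definition quasi_coherent :: "('p, 'r) ringed_space \<Rightarrow> ('p, 'r, 'm) module_sheaf \<Rightarrow> bool" where
  "quasi_coherent X M \<longleftrightarrow> sheaf_of_modules X M \<and>
     (\<forall>p\<in>topspace (topo X). \<exists>U. openin (topo X) U \<and> p \<in> U \<and>
        (\<exists>(I :: ('m \<Rightarrow> 'r) set) (J :: 'm set). free_cokernel (open_sub X U) I J M))"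

text \<open>Injective objects in the category of \<open>\<O>\<^sub>X\<close>-modules. In HOL the test monomorphisms \<open>A \<rightarrow> B\<close> must
  live in a fixed type; here it is the type of the sections of \<open>\<O>\<^sub>X\<close>. By Baer's criterion this tests
  injectivity against all modules: the modules \<open>\<O>\<^sub>U\<close> extended by zero, \<open>U\<close> open, are generators, and
  they and their submodules are ideal sheaves of \<open>\<O>\<^sub>X\<close>.\<close>

definition injective_sheaf :: "('p, 'r) ringed_space \<Rightarrow> ('p, 'r, 'm) module_sheaf \<Rightarrow> bool" where
  "injective_sheaf X Q \<longleftrightarrow> sheaf_of_modules X Q \<and>
     (\<forall>(A :: ('p, 'r, 'r) module_sheaf) (B :: ('p, 'r, 'r) module_sheaf) j f.
        sheaf_of_modules X A \<longrightarrow> sheaf_of_modules X B \<longrightarrow>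
        j \<in> sheaf_hom X A B \<longrightarrow> sheaf_mono X A j \<longrightarrow> f \<in> sheaf_hom X A Q \<longrightarrow>
        (\<exists>g\<in>sheaf_hom X B Q. \<forall>U. openin (topo X) U \<longrightarrow>
           (\<forall>s\<in>carrier (msec A U). g U (j U s) = f U s)))"

text \<open>\<open>0 \<rightarrow> M \<rightarrow> Q 0 \<rightarrow> Q 1 \<rightarrow> \<dots>\<close> with augmentation \<open>e\<close> and differentials \<open>d n: Q n \<rightarrow> Q (n + 1)\<close>.\<close>

definition injective_resolution ::
  "('p, 'r) ringed_space \<Rightarrow> ('p, 'r, 'm) module_sheaf \<Rightarrow> ('p set \<Rightarrow> 'm \<Rightarrow> 'i) \<Rightarrow>
   (nat \<Rightarrow> ('p, 'r, 'i) module_sheaf) \<Rightarrow> (nat \<Rightarrow> 'p set \<Rightarrow> 'i \<Rightarrow> 'i) \<Rightarrow> bool" where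
  "injective_resolution X M e Q d \<longleftrightarrow>
     (\<forall>n. injective_sheaf X (Q n)) \<and>
     e \<in> sheaf_hom X M (Q 0) \<and> (\<forall>n. d n \<in> sheaf_hom X (Q n) (Q (Suc n))) \<and>
     sheaf_mono X M e \<and> exact_at X M e (Q 0) (d 0) (Q 1) \<and>
     (\<forall>n. exact_at X (Q n) (d n) (Q (Suc n)) (d (Suc n)) (Q (Suc (Suc n))))"


section \<open>Higher direct images\<close>

definition preimage :: "('q, 's) ringed_space \<Rightarrow> ('q \<Rightarrow> 'p) \<Rightarrow> 'p set \<Rightarrow> 'q set" where
  "preimage Y f U = {y \<in> topspace (topo Y). f y \<in> U}"

text \<open>The direct image along \<open>(f, h): Y \<rightarrow> X\<close> with ring maps \<open>h U: \<O>\<^sub>X(U) \<rightarrow> \<O>\<^sub>Y(f\<^sup>-\<^sup>1 U)\<close>.\<close>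

definition direct_image ::
  "('q, 's) ringed_space \<Rightarrow> ('q \<Rightarrow> 'p) \<Rightarrow> ('p set \<Rightarrow> 'r \<Rightarrow> 's) \<Rightarrow> ('q, 's, 'm) module_sheaf \<Rightarrow>
   ('p, 'r, 'm) module_sheaf" where
  "direct_image Y f h M =
     \<lparr>msec = (\<lambda>U. restrict_scalars (h U) (msec M (preimage Y f U))),
      mres = (\<lambda>U V. mres M (preimage Y f U) (preimage Y f V))\<rparr>"

definition sheafify ::
  "('p, 'r) ringed_space \<Rightarrow> ('p, 'r, 'm) module_sheaf \<Rightarrow> ('p, 'r, 'p \<Rightarrow> 'm) module_sheaf" where
  "sheafify X P =
     \<lparr>msec = (\<lambda>U. mk_module
        {s \<in> \<Pi>\<^sub>E p\<in>U. carrier (mstalk X P p).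
           \<forall>p\<in>U. \<exists>V. openin (topo X) V \<and> p \<in> V \<and> V \<subseteq> U \<and>
             (\<exists>t\<in>carrier (msec P V). \<forall>q\<in>V. s q = mres P V (min_open (topo X) q) t)}
        (\<lambda>p\<in>U. \<zero>\<^bsub>mstalk X P p\<^esub>)
        (\<lambda>s t. \<lambda>p\<in>U. s p \<oplus>\<^bsub>mstalk X P p\<^esub> t p)
        (\<lambda>r s. \<lambda>p\<in>U. res X U (min_open (topo X) p) r \<odot>\<^bsub>mstalk X P p\<^esub> s p)),
      mres = (\<lambda>U V s. restrict s V)\<rparr>"

definition cocycles ::
  "(nat \<Rightarrow> ('p, 'r, 'm) module_sheaf) \<Rightarrow> (nat \<Rightarrow> 'p set \<Rightarrow> 'm \<Rightarrow> 'm) \<Rightarrow> nat \<Rightarrow> 'p set \<Rightarrow> 'm set" where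
  "cocycles K d i U = {x \<in> carrier (msec (K i) U). d i U x = \<zero>\<^bsub>msec (K (Suc i)) U\<^esub>}"

definition coboundaries ::
  "(nat \<Rightarrow> ('p, 'r, 'm) module_sheaf) \<Rightarrow> (nat \<Rightarrow> 'p set \<Rightarrow> 'm \<Rightarrow> 'm) \<Rightarrow> nat \<Rightarrow> 'p set \<Rightarrow> 'm set" where
  "coboundaries K d i U = (case i of 0 \<Rightarrow> {\<zero>\<^bsub>msec (K 0) U\<^esub>} | Suc j \<Rightarrow> d j U ` carrier (msec (K j) U))"

text \<open>The \<open>i\<close>-th cohomology sheaf of a complex \<open>0 \<rightarrow> K 0 \<rightarrow> K 1 \<rightarrow> \<dots>\<close> of \<open>\<O>\<^sub>X\<close>-modules is the sheaf
  associated with the presheaf \<open>U \<mapsto> H\<^sup>i(K(U))\<close>.\<close>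

definition cohomology_presheaf ::
  "(nat \<Rightarrow> ('p, 'r, 'm) module_sheaf) \<Rightarrow> (nat \<Rightarrow> 'p set \<Rightarrow> 'm \<Rightarrow> 'm) \<Rightarrow> nat \<Rightarrow>
   ('p, 'r, 'm set) module_sheaf" where
  "cohomology_presheaf K d i =
     \<lparr>msec = (\<lambda>U. quot_module (msec (K i) U) (cocycles K d i U) (coboundaries K d i U)),
      mres = (\<lambda>U V C. \<Union>x\<in>C. coboundaries K d i V +>\<^bsub>msec (K i) V\<^esub> mres (K i) U V x)\<rparr>"

definition cohomology_sheaf ::
  "('p, 'r) ringed_space \<Rightarrow> (nat \<Rightarrow> ('p, 'r, 'm) module_sheaf) \<Rightarrow> (nat \<Rightarrow> 'p set \<Rightarrow> 'm \<Rightarrow> 'm) \<Rightarrow> nat \<Rightarrow>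
   ('p, 'r, 'p \<Rightarrow> 'm set) module_sheaf" where
  "cohomology_sheaf X K d i = sheafify X (cohomology_presheaf K d i)"

text \<open>\<open>R\<^sup>i f\<^sub>* M = H\<^sup>i(f\<^sub>* Q)\<close>, computed from an injective resolution \<open>(Q, d)\<close> of \<open>M\<close>.\<close>

definition higher_direct_image ::
  "('q, 's) ringed_space \<Rightarrow> ('p, 'r) ringed_space \<Rightarrow> ('q \<Rightarrow> 'p) \<Rightarrow> ('p set \<Rightarrow> 'r \<Rightarrow> 's) \<Rightarrow>
   (nat \<Rightarrow> ('q, 's, 'i) module_sheaf) \<Rightarrow> (nat \<Rightarrow> 'q set \<Rightarrow> 'i \<Rightarrow> 'i) \<Rightarrow> nat \<Rightarrow>
   ('p, 'r, 'p \<Rightarrow> 'i set) module_sheaf" where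
  "higher_direct_image Y X f h Q d i =
     cohomology_sheaf X (\<lambda>n. direct_image Y f h (Q n)) (\<lambda>n U. d n (preimage Y f U)) i"

end

theory Submission
  imports Defs "HOL-Library.Product_Plus"
begin

text \<open>Quasi-coherence of \<open>R\<^sup>i\<pi>\<^sub>*M\<close> amounts to
  \<open>H\<^sup>i(U\<^sub>p \<times> X', M) \<otimes> \<O>\<^sub>q = H\<^sup>i(U\<^sub>q \<times> X', M)\<close> for \<open>p \<le> q\<close>, the tensor product being over \<open>\<O>\<^sub>p\<close>.
  For an injective resolution \<open>Q\<close> of \<open>M\<close>, let \<open>C(V)\<close> be the mapping cone of
  \<open>Q(U\<^sub>p \<times> V) \<otimes> \<O>\<^sub>q \<rightarrow> Q(U\<^sub>q \<times> V)\<close>, \<open>V\<close> open in \<open>X'\<close>. If \<open>V\<close> is the minimal open set of a point, both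
  complexes resolve the sections of \<open>M\<close>, by flatness and because \<open>U\<^sub>p \<times> V\<close> is again minimal, and
  \<open>C(V)\<close> is acyclic because \<open>M\<close> is quasi-coherent. In general \<open>V\<close> is the union of a minimal open set
  and a smaller open set; injective sheaves are flasque and flat base change preserves the gluing
  sequence, so Mayer--Vietoris and induction show that \<open>C(V)\<close> is acyclic for all \<open>V\<close>, in particular
  for \<open>V = X'\<close>. All tensor products are computed with representatives in the free abelian group,
  modulo the subgroup of relations.\<close>

text \<open>A cone needs source and target in one type. The target Q(U_q x V) is therefore written
  as its own tensor product with O_q over O_q, so both complexes are quotients of subgroups of the
  same free abelian group, and the flatness hypothesis for p = q covers the target. A complex is a
  pair of subgroups, numerator and denominator, and its identities are asserted modulo the
  denominator. Flatness is used again once the cone is known to be acyclic: it lets the cocycles of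
  the tensored resolution be read as tensors of cocycles. Two notions are tested on a fixed type,
  which shapes two arguments. A relation in a tensor product involves finitely many elements, so
  flatness against arbitrary modules is recovered by coding a finitely generated submodule by sets
  of coefficient sequences. Injectivity is tested on sheaves whose sections have the type of the
  structure sheaf, so extensions by zero are realised as ideal sheaves. To return from base change
  to quasi-coherence, U_p gets the presentation of the stalk at p with all elements as generators
  and all their relations; base change makes it exact at the other points of U_p.\<close>

definition subgrp :: "'x::ab_group_add set \<Rightarrow> bool" where
  "subgrp S \<longleftrightarrow> 0 \<in> S \<and> (\<forall>x\<in>S. \<forall>y\<in>S. x - y \<in> S)"

lemma subgrp_0: "subgrp S \<Longrightarrow> 0 \<in> S"
  and subgrp_diff: "subgrp S \<Longrightarrow> x \<in> S \<Longrightarrow> y \<in> S \<Longrightarrow> x - y \<in> S"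
  by (auto simp: subgrp_def)

lemma subgrp_uminus: "subgrp S \<Longrightarrow> x \<in> S \<Longrightarrow> - x \<in> S"
  using subgrp_diff[of S 0 x] subgrp_0[of S] by simp

lemma subgrp_add: "subgrp S \<Longrightarrow> x \<in> S \<Longrightarrow> y \<in> S \<Longrightarrow> x + y \<in> S"
  using subgrp_diff[of S x "- y"] subgrp_uminus[of S y] by simp

text \<open>Used throughout to compute modulo relations: membership may be tested on any congruent
  representative.\<close>

lemma subgrp_cong: "subgrp S \<Longrightarrow> x - y \<in> S \<Longrightarrow> x \<in> S \<longleftrightarrow> y \<in> S"
  using subgrp_diff[of S x "x - y"] subgrp_add[of S "x - y" y] by auto

lemma subgrp_sym: "subgrp S \<Longrightarrow> x - y \<in> S \<Longrightarrow> y - x \<in> S"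
  using subgrp_uminus[of S "x - y"] by simp

lemma subgrp_trans: "subgrp S \<Longrightarrow> x - y \<in> S \<Longrightarrow> y - z \<in> S \<Longrightarrow> x - z \<in> S"
  using subgrp_add[of S "x - y" "y - z"] by simp

lemma subgrp_sum: "subgrp S \<Longrightarrow> (\<And>i. i \<in> I \<Longrightarrow> f i \<in> S) \<Longrightarrow> sum f I \<in> S"
  by (induction I rule: infinite_finite_induct) (auto simp: subgrp_0 intro: subgrp_add)

section \<open>Homomorphisms of modules and of their additive groups\<close>

lemma module_add_closed: "Module.module A M \<Longrightarrow> x \<in> carrier M \<Longrightarrow> y \<in> carrier M \<Longrightarrow> x \<oplus>\<^bsub>M\<^esub> y \<in> carrier M"
  and module_zero_closed: "Module.module A M \<Longrightarrow> \<zero>\<^bsub>M\<^esub> \<in> carrier M"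
  and module_smult_closed: "Module.module A M \<Longrightarrow> r \<in> carrier A \<Longrightarrow> x \<in> carrier M \<Longrightarrow> r \<odot>\<^bsub>M\<^esub> x \<in> carrier M"
  and module_minus_closed: "Module.module A M \<Longrightarrow> x \<in> carrier M \<Longrightarrow> y \<in> carrier M \<Longrightarrow> x \<ominus>\<^bsub>M\<^esub> y \<in> carrier M"
  and module_uminus_closed: "Module.module A M \<Longrightarrow> x \<in> carrier M \<Longrightarrow> \<ominus>\<^bsub>M\<^esub> x \<in> carrier M"
  and module_abelian_group: "Module.module A M \<Longrightarrow> abelian_group M"
  and module_cring: "Module.module A M \<Longrightarrow> cring A"
  by (auto simp: Module.module_def abelian_group.axioms abelian_monoid.a_closed abelian_monoid.zero_closed
      abelian_group.minus_closed abelian_group.a_inv_closed Module.module.smult_closed)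

lemma mod_homD:
  assumes "f \<in> mod_hom A M N"
  shows "x \<in> carrier M \<Longrightarrow> f x \<in> carrier N"
    and "x \<in> carrier M \<Longrightarrow> y \<in> carrier M \<Longrightarrow> f (x \<oplus>\<^bsub>M\<^esub> y) = f x \<oplus>\<^bsub>N\<^esub> f y"
    and "r \<in> carrier A \<Longrightarrow> x \<in> carrier M \<Longrightarrow> f (r \<odot>\<^bsub>M\<^esub> x) = r \<odot>\<^bsub>N\<^esub> f x"
  using assms by (auto simp: mod_hom_def)

text \<open>The two scalar rings may differ, so that maps semilinear along a ring homomorphism, such
  as restriction from U_p to U_q, share the lemmas on zero and negatives with linear maps.\<close>

definition add_hom :: "('a, 'm) module \<Rightarrow> ('b, 'n) module \<Rightarrow> ('m \<Rightarrow> 'n) \<Rightarrow> bool" where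
  "add_hom M N f \<longleftrightarrow> f \<in> carrier M \<rightarrow> carrier N \<and>
     (\<forall>x\<in>carrier M. \<forall>y\<in>carrier M. f (x \<oplus>\<^bsub>M\<^esub> y) = f x \<oplus>\<^bsub>N\<^esub> f y)"

lemma mod_hom_add_hom: "f \<in> mod_hom A M N \<Longrightarrow> add_hom M N f"
  by (auto simp: mod_hom_def add_hom_def)

lemma add_hom_closed: "add_hom M N f \<Longrightarrow> x \<in> carrier M \<Longrightarrow> f x \<in> carrier N"
  and add_hom_add: "add_hom M N f \<Longrightarrow> x \<in> carrier M \<Longrightarrow> y \<in> carrier M \<Longrightarrow> f (x \<oplus>\<^bsub>M\<^esub> y) = f x \<oplus>\<^bsub>N\<^esub> f y"
  by (auto simp: add_hom_def)

lemma add_hom_zero: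
  assumes "abelian_group M" "abelian_group N" "add_hom M N f" shows "f \<zero>\<^bsub>M\<^esub> = \<zero>\<^bsub>N\<^esub>"
proof -
  interpret M: abelian_group M by fact
  interpret N: abelian_group N by fact
  have "f \<zero>\<^bsub>M\<^esub> \<oplus>\<^bsub>N\<^esub> f \<zero>\<^bsub>M\<^esub> = f \<zero>\<^bsub>M\<^esub>" "f \<zero>\<^bsub>M\<^esub> \<in> carrier N"
    using add_hom_add[OF assms(3), of "\<zero>\<^bsub>M\<^esub>" "\<zero>\<^bsub>M\<^esub>"] add_hom_closed[OF assms(3)] by auto
  then show ?thesis by (metis N.add.l_cancel_one)
qed

lemma add_hom_uminus:
  assumes "abelian_group M" "abelian_group N" "add_hom M N f" "x \<in> carrier M"
  shows "f (\<ominus>\<^bsub>M\<^esub> x) = \<ominus>\<^bsub>N\<^esub> f x"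
proof -
  interpret M: abelian_group M by fact
  interpret N: abelian_group N by fact
  have "f (\<ominus>\<^bsub>M\<^esub> x) \<oplus>\<^bsub>N\<^esub> f x = \<zero>\<^bsub>N\<^esub>" "f x \<in> carrier N" "f (\<ominus>\<^bsub>M\<^esub> x) \<in> carrier N"
    using add_hom_add[OF assms(3), of "\<ominus>\<^bsub>M\<^esub> x" x] add_hom_closed[OF assms(3)] assms(4)
      add_hom_zero[OF assms(1-3)] by (auto simp: M.l_neg)
  then show ?thesis by (metis N.minus_equality)
qed

lemma add_hom_minus:
  assumes "abelian_group M" "abelian_group N" "add_hom M N f" "x \<in> carrier M" "y \<in> carrier M"
  shows "f (x \<ominus>\<^bsub>M\<^esub> y) = f x \<ominus>\<^bsub>N\<^esub> f y"
  using add_hom_uminus[OF assms(1-3)] add_hom_add[OF assms(3)] assms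
  by (auto simp: a_minus_def abelian_group.a_inv_closed)

lemma mod_hom_zero:
  assumes "Module.module A M" "Module.module A N" "f \<in> mod_hom A M N" shows "f \<zero>\<^bsub>M\<^esub> = \<zero>\<^bsub>N\<^esub>"
  using assms by (meson add_hom_zero mod_hom_add_hom module_abelian_group)

lemma mod_hom_minus:
  assumes "Module.module A M" "Module.module A N" "f \<in> mod_hom A M N" "x \<in> carrier M" "y \<in> carrier M"
  shows "f (x \<ominus>\<^bsub>M\<^esub> y) = f x \<ominus>\<^bsub>N\<^esub> f y"
  using assms by (meson add_hom_minus mod_hom_add_hom module_abelian_group)

lemma module_minus_eq_zero_iff:
  assumes "Module.module A M" "x \<in> carrier M" "y \<in> carrier M"
  shows "x \<ominus>\<^bsub>M\<^esub> y = \<zero>\<^bsub>M\<^esub> \<longleftrightarrow> x = y"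
proof -
  interpret M: abelian_group M using assms(1) by (rule module_abelian_group)
  show ?thesis
  proof
    assume "x \<ominus>\<^bsub>M\<^esub> y = \<zero>\<^bsub>M\<^esub>"
    then have "(x \<ominus>\<^bsub>M\<^esub> y) \<oplus>\<^bsub>M\<^esub> y = y" using assms by simp
    then show "x = y" using assms by (simp add: M.minus_eq M.a_assoc M.l_neg)
  qed (use assms in \<open>simp add: M.minus_eq M.r_neg\<close>)
qed

lemma inj_on_mod_hom_iff:
  assumes "Module.module A M" "Module.module A N" "f \<in> mod_hom A M N"
  shows "inj_on f (carrier M) \<longleftrightarrow> (\<forall>x\<in>carrier M. f x = \<zero>\<^bsub>N\<^esub> \<longrightarrow> x = \<zero>\<^bsub>M\<^esub>)"
proof
  assume "inj_on f (carrier M)"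
  then show "\<forall>x\<in>carrier M. f x = \<zero>\<^bsub>N\<^esub> \<longrightarrow> x = \<zero>\<^bsub>M\<^esub>"
    using mod_hom_zero[OF assms] module_zero_closed[OF assms(1)] by (metis inj_onD)
next
  assume *: "\<forall>x\<in>carrier M. f x = \<zero>\<^bsub>N\<^esub> \<longrightarrow> x = \<zero>\<^bsub>M\<^esub>"
  show "inj_on f (carrier M)"
  proof (rule inj_onI)
    fix x y assume xy: "x \<in> carrier M" "y \<in> carrier M" "f x = f y"
    then have "f (x \<ominus>\<^bsub>M\<^esub> y) = \<zero>\<^bsub>N\<^esub>"
      using mod_hom_minus[OF assms] module_minus_eq_zero_iff[OF assms(2)] mod_homD(1)[OF assms(3)] by metis
    then show "x = y"
      using * xy module_minus_closed[OF assms(1)] module_minus_eq_zero_iff[OF assms(1)] by metis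
  qed
qed

section \<open>Tensor products\<close>

text \<open>The carrier of \<open>tensor_free\<close> as a plain set: the group operations are those
  of the type, so ordinary algebraic simplification applies and only the support has to be
  tracked.\<close>

definition tfree :: "('a, 'm) module \<Rightarrow> ('a, 'n) module \<Rightarrow> ('m \<times> 'n \<Rightarrow>\<^sub>0 int) set" where
  "tfree M N = {c. Poly_Mapping.keys c \<subseteq> carrier M \<times> carrier N}"

definition tensor_gens ::
  "('a, 'x) ring_scheme \<Rightarrow> ('a, 'm) module \<Rightarrow> ('a, 'n) module \<Rightarrow> ('m \<times> 'n \<Rightarrow>\<^sub>0 int) set" where
  "tensor_gens A M N =
    {frag_of (x \<oplus>\<^bsub>M\<^esub> x', y) - frag_of (x, y) - frag_of (x', y) | x x' y.
        x \<in> carrier M \<and> x' \<in> carrier M \<and> y \<in> carrier N} \<union>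
     {frag_of (x, y \<oplus>\<^bsub>N\<^esub> y') - frag_of (x, y) - frag_of (x, y') | x y y'.
        x \<in> carrier M \<and> y \<in> carrier N \<and> y' \<in> carrier N} \<union>
     {frag_of (r \<odot>\<^bsub>M\<^esub> x, y) - frag_of (x, r \<odot>\<^bsub>N\<^esub> y) | r x y.
        r \<in> carrier A \<and> x \<in> carrier M \<and> y \<in> carrier N}"

text \<open>The map on representatives that underlies \<open>tensor_map\<close>. It is additive on
  the whole type; that it respects relations depends on \<open>f\<close> and \<open>g\<close> and is
  proved separately.\<close>

definition tensor_frag :: "('m \<Rightarrow> 'm1) \<Rightarrow> ('n \<Rightarrow> 'n1) \<Rightarrow> ('m \<times> 'n \<Rightarrow>\<^sub>0 int) \<Rightarrow> ('m1 \<times> 'n1 \<Rightarrow>\<^sub>0 int)" where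
  "tensor_frag f g = frag_extend (\<lambda>(x, y). frag_of (f x, g y))"

lemma tensor_rel_eq: "tensor_rel A M N = generate (tensor_free M N) (tensor_gens A M N)"
  by (simp add: tensor_rel_def tensor_gens_def)

lemma carrier_tensor_free: "carrier (tensor_free M N) = tfree M N"
  by (auto simp: tfree_def tensor_free_def free_Abelian_group_def)

lemma subgrp_tfree: "subgrp (tfree M N)"
  using keys_diff by (fastforce simp: subgrp_def tfree_def)

lemma frag_of_tfree [simp]: "frag_of (x, y) \<in> tfree M N \<longleftrightarrow> x \<in> carrier M \<and> y \<in> carrier N"
  by (simp add: tfree_def)

lemma tfree_mono: "carrier M \<subseteq> carrier M' \<Longrightarrow> carrier N \<subseteq> carrier N' \<Longrightarrow> tfree M N \<subseteq> tfree M' N'"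
  by (auto simp: tfree_def)

text \<open>Statements compatible with subtraction need to be checked on pure tensors only;
  differences in place of sums spare a separate case for negatives.\<close>

lemma tfree_induct [consumes 1, case_names zero one diff]:
  assumes "c \<in> tfree M N" "P 0" "\<And>x y. x \<in> carrier M \<Longrightarrow> y \<in> carrier N \<Longrightarrow> P (frag_of (x, y))"
    "\<And>a b. a \<in> tfree M N \<Longrightarrow> b \<in> tfree M N \<Longrightarrow> P a \<Longrightarrow> P b \<Longrightarrow> P (a - b)"
  shows "P c"
proof -
  have "Poly_Mapping.keys c \<subseteq> carrier M \<times> carrier N" using assms(1) by (simp add: tfree_def)
  then have "c \<in> tfree M N \<and> P c"
    by (induction c rule: frag_induction) (auto simp: assms(2-4) subgrp_tfree subgrp_0 subgrp_diff)
  then show ?thesis ..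
qed

lemma tensor_gens_tfree:
  assumes "Module.module A M" "Module.module A N" shows "tensor_gens A M N \<subseteq> tfree M N"
  using assms unfolding tensor_gens_def
  by (auto intro!: subgrp_diff[OF subgrp_tfree] simp: module_add_closed module_smult_closed)

lemma inv_tensor_free: "c \<in> tfree M N \<Longrightarrow> inv\<^bsub>tensor_free M N\<^esub> c = - c"
  by (simp add: tensor_free_def tfree_def)

text \<open>Because the property is membership in a subgroup, the inverse and product steps of
  \<open>generate\<close> are automatic and only the three families of generators remain.\<close>

lemma tensor_rel_induct:
  assumes "Module.module A M" "Module.module A N" "c \<in> tensor_rel A M N" "subgrp S"
    and "\<And>x x' y. x \<in> carrier M \<Longrightarrow> x' \<in> carrier M \<Longrightarrow> y \<in> carrier N \<Longrightarrow>
          frag_of (x \<oplus>\<^bsub>M\<^esub> x', y) - frag_of (x, y) - frag_of (x', y) \<in> S"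
    and "\<And>x y y'. x \<in> carrier M \<Longrightarrow> y \<in> carrier N \<Longrightarrow> y' \<in> carrier N \<Longrightarrow>
          frag_of (x, y \<oplus>\<^bsub>N\<^esub> y') - frag_of (x, y) - frag_of (x, y') \<in> S"
    and "\<And>r x y. r \<in> carrier A \<Longrightarrow> x \<in> carrier M \<Longrightarrow> y \<in> carrier N \<Longrightarrow>
          frag_of (r \<odot>\<^bsub>M\<^esub> x, y) - frag_of (x, r \<odot>\<^bsub>N\<^esub> y) \<in> S"
  shows "c \<in> S"
proof -
  have gens: "tensor_gens A M N \<subseteq> S" using assms(5-7) by (auto simp: tensor_gens_def)
  show ?thesis
    using assms(3) unfolding tensor_rel_eq
  proof (induction c rule: generate.induct)
    case one show ?case using assms(4) by (simp add: tensor_free_def subgrp_0)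
  next
    case (incl h) then show ?case using gens by auto
  next
    case (inv h) then show ?case
      using gens tensor_gens_tfree[OF assms(1,2)] subgrp_uminus[OF assms(4)] by (auto simp: inv_tensor_free subset_iff)
  next
    case (eng h1 h2) then show ?case using subgrp_add[OF assms(4)] by (simp add: tensor_free_def)
  qed
qed

lemma tensor_rel_add_left: "x \<in> carrier M \<Longrightarrow> x' \<in> carrier M \<Longrightarrow> y \<in> carrier N \<Longrightarrow>
      frag_of (x \<oplus>\<^bsub>M\<^esub> x', y) - frag_of (x, y) - frag_of (x', y) \<in> tensor_rel A M N"
  and tensor_rel_add_right: "x \<in> carrier M \<Longrightarrow> y \<in> carrier N \<Longrightarrow> y' \<in> carrier N \<Longrightarrow>
      frag_of (x, y \<oplus>\<^bsub>N\<^esub> y') - frag_of (x, y) - frag_of (x, y') \<in> tensor_rel A M N"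
  and tensor_rel_smult: "r \<in> carrier A \<Longrightarrow> x \<in> carrier M \<Longrightarrow> y \<in> carrier N \<Longrightarrow>
      frag_of (r \<odot>\<^bsub>M\<^esub> x, y) - frag_of (x, r \<odot>\<^bsub>N\<^esub> y) \<in> tensor_rel A M N"
  unfolding tensor_rel_eq by (rule generate.incl, force simp: tensor_gens_def)+

lemma
  assumes "Module.module A M" "Module.module A N"
  shows subgrp_tensor_rel: "subgrp (tensor_rel A M N)"
    and tensor_rel_tfree: "tensor_rel A M N \<subseteq> tfree M N"
proof -
  have group: "group (tensor_free M N)" by (simp add: tensor_free_def)
  have sub: "subgroup (tensor_rel A M N) (tensor_free M N)"
    unfolding tensor_rel_eq
    by (rule group.generate_is_subgroup[OF group]) (simp add: carrier_tensor_free tensor_gens_tfree assms)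
  show tf: "tensor_rel A M N \<subseteq> tfree M N"
    using subgroup.subset[OF sub] by (simp add: carrier_tensor_free)
  have m: "- x \<in> tensor_rel A M N" if "x \<in> tensor_rel A M N" for x
    using subgroup.m_inv_closed[OF sub that] that tf by (auto simp: inv_tensor_free subset_iff)
  show "subgrp (tensor_rel A M N)"
    unfolding subgrp_def
    using subgroup.one_closed[OF sub] subgroup.m_closed[OF sub _ m] by (auto simp: tensor_free_def)
qed

lemma tensor_frag_of [simp]: "tensor_frag f g (frag_of (x, y)) = frag_of (f x, g y)"
  and tensor_frag_0 [simp]: "tensor_frag f g 0 = 0"
  and tensor_frag_diff: "tensor_frag f g (a - b) = tensor_frag f g a - tensor_frag f g b"
  and tensor_frag_add: "tensor_frag f g (a + b) = tensor_frag f g a + tensor_frag f g b"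
  by (simp_all add: tensor_frag_def frag_extend_diff frag_extend_add frag_extend_minus)

lemma tensor_frag_tfree:
  assumes "c \<in> tfree M N" "\<And>x. x \<in> carrier M \<Longrightarrow> f x \<in> carrier M'" "\<And>y. y \<in> carrier N \<Longrightarrow> g y \<in> carrier N'"
  shows "tensor_frag f g c \<in> tfree M' N'"
  using assms(1) by (induction c rule: tfree_induct)
    (auto simp: subgrp_tfree subgrp_0 subgrp_diff tensor_frag_diff assms)

lemma tensor_frag_cong:
  assumes "c \<in> tfree M N" "\<And>x. x \<in> carrier M \<Longrightarrow> f x = f' x" "\<And>y. y \<in> carrier N \<Longrightarrow> g y = g' y"
  shows "tensor_frag f g c = tensor_frag f' g' c"
  using assms(1) by (induction c rule: tfree_induct) (auto simp: tensor_frag_diff assms)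

lemma tensor_frag_comp: "tensor_frag f g (tensor_frag f' g' c) = tensor_frag (\<lambda>x. f (f' x)) (\<lambda>y. g (g' y)) c"
proof -
  have "Poly_Mapping.keys c \<subseteq> UNIV" by simp
  then show ?thesis
    by (induction c rule: frag_induction) (auto simp: tensor_frag_diff)
qed

lemma tensor_frag_id:
  "tensor_frag (\<lambda>x. x) (\<lambda>y. y) c = c"
proof -
  have "Poly_Mapping.keys c \<subseteq> UNIV" by simp
  then show ?thesis
    by (induction c rule: frag_induction) (auto simp: tensor_frag_diff)
qed

text \<open>The hypothesis on scalars covers maps that are semilinear along a ring homomorphism.\<close>

lemma tensor_frag_rel_gen:
  assumes "Module.module A M" "Module.module A N" "Module.module B M'" "Module.module B N'"
    and "add_hom M M' f" "add_hom N N' g"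
    and "\<And>r. r \<in> carrier A \<Longrightarrow> \<exists>s\<in>carrier B. (\<forall>x\<in>carrier M. f (r \<odot>\<^bsub>M\<^esub> x) = s \<odot>\<^bsub>M'\<^esub> f x) \<and>
            (\<forall>y\<in>carrier N. g (r \<odot>\<^bsub>N\<^esub> y) = s \<odot>\<^bsub>N'\<^esub> g y)"
    and "c \<in> tensor_rel A M N"
  shows "tensor_frag f g c \<in> tensor_rel B M' N'"
proof -
  let ?S = "{c. tensor_frag f g c \<in> tensor_rel B M' N'}"
  note sg = subgrp_tensor_rel[OF assms(3,4)]
  have "c \<in> ?S"
  proof (rule tensor_rel_induct[OF assms(1,2) assms(8)])
    show "subgrp ?S"
      by (auto simp: subgrp_def tensor_frag_diff subgrp_0[OF sg] subgrp_diff[OF sg])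
  next
    fix r x y assume *: "r \<in> carrier A" "x \<in> carrier M" "y \<in> carrier N"
    then obtain s where s: "s \<in> carrier B" "f (r \<odot>\<^bsub>M\<^esub> x) = s \<odot>\<^bsub>M'\<^esub> f x" "g (r \<odot>\<^bsub>N\<^esub> y) = s \<odot>\<^bsub>N'\<^esub> g y"
      using assms(7) by blast
    then show "frag_of (r \<odot>\<^bsub>M\<^esub> x, y) - frag_of (x, r \<odot>\<^bsub>N\<^esub> y) \<in> ?S"
      using tensor_rel_smult[OF s(1) add_hom_closed[OF assms(5) *(2)] add_hom_closed[OF assms(6) *(3)]]
      by (simp add: tensor_frag_diff)
  next
    fix x x' y assume "x \<in> carrier M" "x' \<in> carrier M" "y \<in> carrier N"
    then show "frag_of (x \<oplus>\<^bsub>M\<^esub> x', y) - frag_of (x, y) - frag_of (x', y) \<in> ?S"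
      using assms(5,6) by (simp add: tensor_frag_diff add_hom_add add_hom_closed tensor_rel_add_left)
  next
    fix x y y' assume "x \<in> carrier M" "y \<in> carrier N" "y' \<in> carrier N"
    then show "frag_of (x, y \<oplus>\<^bsub>N\<^esub> y') - frag_of (x, y) - frag_of (x, y') \<in> ?S"
      using assms(5,6) by (simp add: tensor_frag_diff add_hom_add add_hom_closed tensor_rel_add_right)
  qed
  then show ?thesis by simp
qed

lemma tensor_frag_rel:
  assumes "Module.module A M" "Module.module A N" "Module.module A M'" "f \<in> mod_hom A M M'"
    and "c \<in> tensor_rel A M N"
  shows "tensor_frag f (\<lambda>y. y) c \<in> tensor_rel A M' N"
proof (rule tensor_frag_rel_gen[OF assms(1-3) assms(2) mod_hom_add_hom[OF assms(4)] _ _ assms(5)])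
  show "add_hom N N (\<lambda>y. y)" by (simp add: add_hom_def)
  show "\<exists>s\<in>carrier A. (\<forall>x\<in>carrier M. f (r \<odot>\<^bsub>M\<^esub> x) = s \<odot>\<^bsub>M'\<^esub> f x) \<and>
            (\<forall>y\<in>carrier N. r \<odot>\<^bsub>N\<^esub> y = s \<odot>\<^bsub>N\<^esub> y)" if "r \<in> carrier A" for r
    using that mod_homD(3)[OF assms(4)] by blast
qed

lemma tensor_rel_minus_left:
  assumes "Module.module A M" "Module.module A N" "x \<in> carrier M" "x' \<in> carrier M" "y \<in> carrier N"
  shows "frag_of (x \<ominus>\<^bsub>M\<^esub> x', y) - (frag_of (x, y) - frag_of (x', y)) \<in> tensor_rel A M N"
proof -
  interpret M: abelian_group M using assms(1) by (rule module_abelian_group)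
  have "x = (x \<ominus>\<^bsub>M\<^esub> x') \<oplus>\<^bsub>M\<^esub> x'" using assms(3,4) by (simp add: M.minus_eq M.a_assoc M.l_neg)
  then have "frag_of (x, y) - frag_of (x \<ominus>\<^bsub>M\<^esub> x', y) - frag_of (x', y) \<in> tensor_rel A M N"
    using tensor_rel_add_left[of "x \<ominus>\<^bsub>M\<^esub> x'" M x' y N A] assms M.minus_closed by metis
  from subgrp_uminus[OF subgrp_tensor_rel[OF assms(1,2)] this] show ?thesis by (simp add: algebra_simps)
qed

lemma tensor_rel_zero_left:
  assumes "Module.module A M" "Module.module A N" "y \<in> carrier N"
  shows "frag_of (\<zero>\<^bsub>M\<^esub>, y) \<in> tensor_rel A M N"
proof -
  interpret M: abelian_group M using assms(1) by (rule module_abelian_group)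
  show ?thesis
    using subgrp_uminus[OF subgrp_tensor_rel[OF assms(1,2)] tensor_rel_add_left[of "\<zero>\<^bsub>M\<^esub>" M "\<zero>\<^bsub>M\<^esub>" y N A]] assms
    by simp
qed

lemma tensor_frag_zero_rel:
  assumes "Module.module A M'" "Module.module A N" "c \<in> tfree M N" "\<And>x. x \<in> carrier M \<Longrightarrow> f x = \<zero>\<^bsub>M'\<^esub>"
  shows "tensor_frag f (\<lambda>y. y) c \<in> tensor_rel A M' N"
  using assms(3)
proof (induction c rule: tfree_induct)
  case zero show ?case by (simp add: subgrp_0 subgrp_tensor_rel assms)
next
  case (one x y) then show ?case by (simp add: assms tensor_rel_zero_left)
next
  case (diff a b) then show ?case by (simp add: tensor_frag_diff subgrp_diff subgrp_tensor_rel assms)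
qed

text \<open>Cosets become congruence classes, so equality in the tensor product turns into
  membership of a difference in \<open>tensor_rel\<close>.\<close>

lemma tensor_coset_eq:
  "tensor_rel A M N #>\<^bsub>tensor_free M N\<^esub> c = {x. x - c \<in> tensor_rel A M N}"
proof -
  have "x \<in> tensor_rel A M N #>\<^bsub>tensor_free M N\<^esub> c \<longleftrightarrow> (\<exists>h\<in>tensor_rel A M N. x = h + c)" for x
    by (auto simp: r_coset_def tensor_free_def)
  then show ?thesis by (force simp: algebra_simps)
qed

lemma r_coset_tensor_rel_eq_iff:
  assumes "Module.module A M" "Module.module A N"
  shows "tensor_rel A M N #>\<^bsub>tensor_free M N\<^esub> c = tensor_rel A M N #>\<^bsub>tensor_free M N\<^esub> c' \<longleftrightarrow> c - c' \<in> tensor_rel A M N"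
proof -
  note sg = subgrp_tensor_rel[OF assms(1,2)]
  show ?thesis
    unfolding tensor_coset_eq
  proof
    assume "{x. x - c \<in> tensor_rel A M N} = {x. x - c' \<in> tensor_rel A M N}"
    moreover have "c \<in> {x. x - c \<in> tensor_rel A M N}" using subgrp_0[OF sg] by simp
    ultimately show "c - c' \<in> tensor_rel A M N" by blast
  next
    assume "c - c' \<in> tensor_rel A M N"
    then show "{x. x - c \<in> tensor_rel A M N} = {x. x - c' \<in> tensor_rel A M N}"
      using subgrp_trans[OF sg] subgrp_sym[OF sg] by blast
  qed
qed

lemma carrier_tensor:
  "carrier (tensor A M N) = (\<lambda>c. tensor_rel A M N #>\<^bsub>tensor_free M N\<^esub> c) ` tfree M N"
  by (auto simp: tensor_def FactGroup_def RCOSETS_def carrier_tensor_free)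

text \<open>All members of a coset are sent into one and the same coset, so the union in
  \<open>tensor_map\<close> collapses.\<close>

lemma tensor_map_coset:
  assumes "Module.module A M'" "Module.module A N'" "subgrp (tensor_rel A M N)"
    and rel: "\<And>c. c \<in> tensor_rel A M N \<Longrightarrow> tensor_frag f g c \<in> tensor_rel A M' N'"
  shows "tensor_map A M' N' f g (tensor_rel A M N #>\<^bsub>tensor_free M N\<^esub> c) =
    tensor_rel A M' N' #>\<^bsub>tensor_free M' N'\<^esub> tensor_frag f g c"
proof -
  note sg = subgrp_tensor_rel[OF assms(1,2)]
  have "x - tensor_frag f g b \<in> tensor_rel A M' N' \<longleftrightarrow> x - tensor_frag f g c \<in> tensor_rel A M' N'"
    if "b - c \<in> tensor_rel A M N" for b x
    using rel[OF that] by (intro subgrp_cong[OF sg]) (simp add: tensor_frag_diff subgrp_sym[OF sg])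
  moreover have "c - c \<in> tensor_rel A M N" using subgrp_0[OF assms(3)] by simp
  ultimately show ?thesis
    unfolding tensor_map_def tensor_coset_eq tensor_frag_def[symmetric] by blast
qed

section \<open>Images of modules, and submodules\<close>

lemma mk_module_simps [simp]:
  "carrier (mk_module S z ad sm) = S" "\<zero>\<^bsub>mk_module S z ad sm\<^esub> = z"
  "x \<oplus>\<^bsub>mk_module S z ad sm\<^esub> y = ad x y" "r \<odot>\<^bsub>mk_module S z ad sm\<^esub> x = sm r x"
  by (simp_all add: mk_module_def)

text \<open>The module axioms pass along any surjection that respects the operations. This one
  argument serves both quotients and structures transported along an injection.\<close>

lemma module_image:
  assumes M: "Module.module A M" and car: "carrier N = h ` carrier M"
    and add: "\<And>x y. x \<in> carrier M \<Longrightarrow> y \<in> carrier M \<Longrightarrow> h x \<oplus>\<^bsub>N\<^esub> h y = h (x \<oplus>\<^bsub>M\<^esub> y)"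
    and zero: "\<zero>\<^bsub>N\<^esub> = h \<zero>\<^bsub>M\<^esub>"
    and smult: "\<And>r x. r \<in> carrier A \<Longrightarrow> x \<in> carrier M \<Longrightarrow> r \<odot>\<^bsub>N\<^esub> h x = h (r \<odot>\<^bsub>M\<^esub> x)"
  shows "Module.module A N"
proof -
  interpret Module.module A M by fact
  have "abelian_group N"
  proof (rule abelian_groupI)
    fix x assume "x \<in> carrier N"
    then obtain x' where x': "x' \<in> carrier M" "x = h x'" by (auto simp: car)
    then show "\<exists>y\<in>carrier N. y \<oplus>\<^bsub>N\<^esub> x = \<zero>\<^bsub>N\<^esub>"
      by (intro bexI[of _ "h (\<ominus>\<^bsub>M\<^esub> x')"]) (auto simp: car add zero M.l_neg)
  qed (auto simp: car add zero M.a_ac)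
  then show ?thesis
    by (intro moduleI) (auto simp: car add smult is_cring smult_l_distr smult_r_distr smult_assoc1)
qed

lemma module_submodule:
  assumes "Module.module A M" "submodule H A M"
  shows "Module.module A (M\<lparr>carrier := H\<rparr>)"
  using assms by (rule submodule.submodule_is_module[rotated])

text \<open>Closure under negatives comes from scaling by minus one.\<close>

lemma submoduleI2:
  assumes M: "Module.module A M" and "H \<subseteq> carrier M" "\<zero>\<^bsub>M\<^esub> \<in> H"
    "\<And>x y. x \<in> H \<Longrightarrow> y \<in> H \<Longrightarrow> x \<oplus>\<^bsub>M\<^esub> y \<in> H" "\<And>r x. r \<in> carrier A \<Longrightarrow> x \<in> H \<Longrightarrow> r \<odot>\<^bsub>M\<^esub> x \<in> H"
  shows "submodule H A M"
proof -
  interpret Module.module A M by fact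
  have "\<ominus>\<^bsub>M\<^esub> x = (\<ominus>\<^bsub>A\<^esub> \<one>\<^bsub>A\<^esub>) \<odot>\<^bsub>M\<^esub> x" if "x \<in> H" for x
    using that assms(2) by (subst smult_l_minus) auto
  then show ?thesis
    by (intro submoduleI) (use assms in auto)
qed

lemma submodule_subset: "submodule H A M \<Longrightarrow> H \<subseteq> carrier M"
  using subgroup.subset[of H "add_monoid M"] by (simp add: submodule_def)

lemma submoduleD:
  assumes "submodule H A M"
  shows "\<zero>\<^bsub>M\<^esub> \<in> H" "x \<in> H \<Longrightarrow> y \<in> H \<Longrightarrow> x \<oplus>\<^bsub>M\<^esub> y \<in> H"
    "r \<in> carrier A \<Longrightarrow> x \<in> H \<Longrightarrow> r \<odot>\<^bsub>M\<^esub> x \<in> H"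
  using assms subgroup.one_closed[of H "add_monoid M"] subgroup.m_closed[of H "add_monoid M"]
  by (auto simp: submodule_def submodule_axioms_def)

lemma submodule_carrier: "Module.module A M \<Longrightarrow> submodule (carrier M) A M"
  by (rule Module.module.carrier_is_submodule)

lemma submodule_kernel:
  assumes "Module.module A M" "Module.module A N" "f \<in> mod_hom A M N"
  shows "submodule {x \<in> carrier M. f x = \<zero>\<^bsub>N\<^esub>} A M"
proof (rule submoduleI2[OF assms(1)])
  interpret N: Module.module A N by fact
  show "\<zero>\<^bsub>M\<^esub> \<in> {x \<in> carrier M. f x = \<zero>\<^bsub>N\<^esub>}"
    using assms by (simp add: module_zero_closed mod_hom_zero)
  show "x \<oplus>\<^bsub>M\<^esub> y \<in> {x \<in> carrier M. f x = \<zero>\<^bsub>N\<^esub>}"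
    if "x \<in> {x \<in> carrier M. f x = \<zero>\<^bsub>N\<^esub>}" "y \<in> {x \<in> carrier M. f x = \<zero>\<^bsub>N\<^esub>}" for x y
    using that assms by (auto simp: mod_homD module_add_closed)
  show "r \<odot>\<^bsub>M\<^esub> x \<in> {x \<in> carrier M. f x = \<zero>\<^bsub>N\<^esub>}"
    if "r \<in> carrier A" "x \<in> {x \<in> carrier M. f x = \<zero>\<^bsub>N\<^esub>}" for r x
    using that assms by (auto simp: mod_homD module_smult_closed)
qed auto

lemma submodule_image:
  assumes "Module.module A M" "Module.module A N" "f \<in> mod_hom A M N" "submodule H A M"
  shows "submodule (f ` H) A N"
proof (rule submoduleI2[OF assms(2)])
  note sub = submodule_subset[OF assms(4)] and D = submoduleD[OF assms(4)] and h = mod_homD[OF assms(3)]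
  show "f ` H \<subseteq> carrier N" using sub h(1) by auto
  show "\<zero>\<^bsub>N\<^esub> \<in> f ` H" using D(1) mod_hom_zero[OF assms(1-3)] by (metis imageI)
  show "x \<oplus>\<^bsub>N\<^esub> y \<in> f ` H" if "x \<in> f ` H" "y \<in> f ` H" for x y
  proof -
    from that obtain x' y' where "x' \<in> H" "y' \<in> H" "x = f x'" "y = f y'" by blast
    then show ?thesis using h(2)[of x' y'] sub D(2)[of x' y'] by (metis imageI subsetD)
  qed
  show "r \<odot>\<^bsub>N\<^esub> x \<in> f ` H" if "r \<in> carrier A" "x \<in> f ` H" for r x
  proof -
    from that obtain x' where "x' \<in> H" "x = f x'" by blast
    then show ?thesis using h(3)[of r x'] sub D(3)[of r x'] that(1) by (metis imageI subsetD)
  qed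
qed

lemma submodule_inter:
  assumes "Module.module A M" "submodule H A M" "submodule K A M" shows "submodule (H \<inter> K) A M"
  using submoduleD[OF assms(2)] submoduleD[OF assms(3)] submodule_subset[OF assms(2)]
  by (intro submoduleI2[OF assms(1)]) auto

lemma tensor_rel_mono:
  assumes "Module.module A M" "Module.module A N" "submodule H A M" "c \<in> tensor_rel A (M\<lparr>carrier := H\<rparr>) N"
  shows "c \<in> tensor_rel A M N"
  using tensor_frag_rel[OF module_submodule[OF assms(1,3)] assms(2,1) _ assms(4), of "\<lambda>x. x"]
    submodule_subset[OF assms(3)]
  by (auto simp: mod_hom_def tensor_frag_id)

section \<open>Flat modules\<close>

lemma flat_moduleD: "flat_module A P \<Longrightarrow> Module.module A P"
  by (simp add: flat_module_def)

text \<open>Injectivity on cosets is applied to the class of \<open>c\<close> and the class of 0.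
  The modules still have the type over which \<open>flat_module\<close> quantifies.\<close>

lemma flat_tensor_inj_test:
  fixes N' N :: "('a, (nat \<Rightarrow> 'a) set) module"
  assumes fl: "flat_module A P" and N': "Module.module A N'" and N: "Module.module A N"
    and f: "f \<in> mod_hom A N' N" "inj_on f (carrier N')"
    and c: "c \<in> tfree N' P" "tensor_frag f (\<lambda>y. y) c \<in> tensor_rel A N P"
  shows "c \<in> tensor_rel A N' P"
proof -
  note P = flat_moduleD[OF fl]
  let ?cos = "\<lambda>c. tensor_rel A N' P #>\<^bsub>tensor_free N' P\<^esub> c"
  have inj: "inj_on (tensor_map A N P f (\<lambda>y. y)) (carrier (tensor A N' P))"
    using fl N' N f unfolding flat_module_def by blast
  have map: "tensor_map A N P f (\<lambda>y. y) (?cos c) =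
      tensor_rel A N P #>\<^bsub>tensor_free N P\<^esub> tensor_frag f (\<lambda>y. y) c" for c
    by (rule tensor_map_coset[OF N P subgrp_tensor_rel[OF N' P] tensor_frag_rel[OF N' P N f(1)]])
  have "tensor_map A N P f (\<lambda>y. y) (?cos c) = tensor_map A N P f (\<lambda>y. y) (?cos 0)"
    unfolding map r_coset_tensor_rel_eq_iff[OF N P] using c(2) by simp
  then have "?cos c = ?cos 0"
    by (rule inj_onD[OF inj]) (use c(1) subgrp_0[OF subgrp_tfree] in \<open>auto simp: carrier_tensor\<close>)
  then show ?thesis
    unfolding r_coset_tensor_rel_eq_iff[OF N' P] by simp
qed

text \<open>The generators are adjoined one at a time, and a sequence of coefficients is turned into
  an element along the way. What is wanted from \<open>\<pi>\<close> is that it reaches all of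
  \<open>H\<close>: its fibres will be the names of the elements of \<open>H\<close> in the type of
  the test modules.\<close>

lemma finite_subset_submodule:
  fixes N :: "('a, 'n) module"
  assumes N: "Module.module A N" and "finite S" "S \<subseteq> carrier N"
  shows "\<exists>H \<pi>. submodule H A N \<and> S \<subseteq> H \<and> H \<subseteq> range (\<pi> :: (nat \<Rightarrow> 'a) \<Rightarrow> 'n)"
  using assms(2,3)
proof (induction S rule: finite_induct)
  case empty
  interpret Module.module A N by fact
  have "submodule {\<zero>\<^bsub>N\<^esub>} A N" by (rule submoduleI2[OF N]) auto
  then show ?case by (intro exI[of _ "{\<zero>\<^bsub>N\<^esub>}"] exI[of _ "\<lambda>_. \<zero>\<^bsub>N\<^esub>"]) auto
next
  case (insert g S)
  interpret Module.module A N by fact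
  from insert obtain H \<pi> where H: "submodule H A N" "S \<subseteq> H" "H \<subseteq> range (\<pi> :: (nat \<Rightarrow> 'a) \<Rightarrow> 'n)" by auto
  have g: "g \<in> carrier N" using insert by auto
  define H' where "H' = {h \<oplus>\<^bsub>N\<^esub> r \<odot>\<^bsub>N\<^esub> g | h r. h \<in> H \<and> r \<in> carrier A}"
  note sub = submodule_subset[OF H(1)] and D = submoduleD[OF H(1)]
  have H'I: "x \<in> H'" if "x = h \<oplus>\<^bsub>N\<^esub> r \<odot>\<^bsub>N\<^esub> g" "h \<in> H" "r \<in> carrier A" for x h r
    using that by (auto simp: H'_def)
  have "submodule H' A N"
  proof (rule submoduleI2[OF N])
    show "H' \<subseteq> carrier N" using sub g by (auto simp: H'_def)
    show "\<zero>\<^bsub>N\<^esub> \<in> H'" by (rule H'I[of _ "\<zero>\<^bsub>N\<^esub>" "\<zero>\<^bsub>A\<^esub>"]) (use D(1) g in auto)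
    show "x \<oplus>\<^bsub>N\<^esub> y \<in> H'" if "x \<in> H'" "y \<in> H'" for x y
    proof -
      from that obtain h r h' r' where *: "h \<in> H" "r \<in> carrier A" "h' \<in> H" "r' \<in> carrier A"
        "x = h \<oplus>\<^bsub>N\<^esub> r \<odot>\<^bsub>N\<^esub> g" "y = h' \<oplus>\<^bsub>N\<^esub> r' \<odot>\<^bsub>N\<^esub> g" by (auto simp: H'_def)
      then have "h \<in> carrier N" "h' \<in> carrier N" using sub by auto
      then have "x \<oplus>\<^bsub>N\<^esub> y = (h \<oplus>\<^bsub>N\<^esub> h') \<oplus>\<^bsub>N\<^esub> (r \<oplus>\<^bsub>A\<^esub> r') \<odot>\<^bsub>N\<^esub> g"
        using * g by (simp add: smult_l_distr M.a_ac)
      then show ?thesis by (rule H'I) (use * D in auto)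
    qed
    show "s \<odot>\<^bsub>N\<^esub> x \<in> H'" if "s \<in> carrier A" "x \<in> H'" for s x
    proof -
      from that obtain h r where *: "h \<in> H" "r \<in> carrier A" "x = h \<oplus>\<^bsub>N\<^esub> r \<odot>\<^bsub>N\<^esub> g" by (auto simp: H'_def)
      then have "h \<in> carrier N" using sub by auto
      then have "s \<odot>\<^bsub>N\<^esub> x = s \<odot>\<^bsub>N\<^esub> h \<oplus>\<^bsub>N\<^esub> (s \<otimes>\<^bsub>A\<^esub> r) \<odot>\<^bsub>N\<^esub> g"
        using * g that by (simp add: smult_r_distr smult_assoc1)
      then show ?thesis by (rule H'I) (use * D that in auto)
    qed
  qed
  moreover have "insert g S \<subseteq> H'"
  proof -
    have "x \<in> H'" if "x \<in> S" for x
      by (rule H'I[of _ x "\<zero>\<^bsub>A\<^esub>"]) (use that H(2) sub g in auto)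
    moreover have "g \<in> H'" by (rule H'I[of _ "\<zero>\<^bsub>N\<^esub>" "\<one>\<^bsub>A\<^esub>"]) (use g D(1) in auto)
    ultimately show ?thesis by auto
  qed
  \<comment> \<open>The coefficient of the new generator goes to position 0 and the earlier ones
    move up by one.\<close>
  moreover have "H' \<subseteq> range (\<lambda>u :: nat \<Rightarrow> 'a. \<pi> (\<lambda>i. u (Suc i)) \<oplus>\<^bsub>N\<^esub> u 0 \<odot>\<^bsub>N\<^esub> g)"
  proof
    fix x assume "x \<in> H'"
    then obtain h r where *: "h \<in> H" "x = h \<oplus>\<^bsub>N\<^esub> r \<odot>\<^bsub>N\<^esub> g" by (auto simp: H'_def)
    then obtain u where "h = \<pi> u" using H(3) by auto
    then have "x = (\<lambda>u. \<pi> (\<lambda>i. u (Suc i)) \<oplus>\<^bsub>N\<^esub> u 0 \<odot>\<^bsub>N\<^esub> g) (case_nat r u)" using * by simp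
    then show "x \<in> range (\<lambda>u :: nat \<Rightarrow> 'a. \<pi> (\<lambda>i. u (Suc i)) \<oplus>\<^bsub>N\<^esub> u 0 \<odot>\<^bsub>N\<^esub> g)" by blast
  qed
  ultimately show ?case by blast
qed

text \<open>A relation is a finite combination of generators, each of which mentions finitely many
  elements of \<open>N\<close>. The claim is made for every \<open>H\<close> above \<open>S\<close>,
  so that the sets belonging to two relations can be united.\<close>

lemma tensor_rel_finite_support:
  assumes N: "Module.module A N" and P: "Module.module A P" and c: "c \<in> tensor_rel A N P"
  shows "\<exists>S. finite S \<and> S \<subseteq> carrier N \<and>
    (\<forall>H. submodule H A N \<longrightarrow> S \<subseteq> H \<longrightarrow> c \<in> tensor_rel A (N\<lparr>carrier := H\<rparr>) P)"
proof -
  let ?Q = "\<lambda>c S. finite S \<and> S \<subseteq> carrier N \<and>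
    (\<forall>H. submodule H A N \<longrightarrow> S \<subseteq> H \<longrightarrow> c \<in> tensor_rel A (N\<lparr>carrier := H\<rparr>) P)"
  have "c \<in> {c. \<exists>S. ?Q c S}"
  proof (rule tensor_rel_induct[OF N P c])
    show "subgrp {c. \<exists>S. ?Q c S}"
      unfolding subgrp_def
    proof (intro conjI ballI)
      have "?Q 0 {}" using subgrp_0[OF subgrp_tensor_rel[OF module_submodule[OF N] P]] by auto
      then show "0 \<in> {c. \<exists>S. ?Q c S}" by blast
    next
      fix x y assume "x \<in> {c. \<exists>S. ?Q c S}" "y \<in> {c. \<exists>S. ?Q c S}"
      then obtain S T where "?Q x S" "?Q y T" by blast
      then have "?Q (x - y) (S \<union> T)"
        using subgrp_diff[OF subgrp_tensor_rel[OF module_submodule[OF N] P]] by auto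
      then show "x - y \<in> {c. \<exists>S. ?Q c S}" by blast
    qed
  next
    fix x x' y assume "x \<in> carrier N" "x' \<in> carrier N" "y \<in> carrier P"
    then have "?Q (frag_of (x \<oplus>\<^bsub>N\<^esub> x', y) - frag_of (x, y) - frag_of (x', y)) {x, x'}"
      using tensor_rel_add_left[of x "N\<lparr>carrier := H\<rparr>" x' y P A for H] by auto
    then show "frag_of (x \<oplus>\<^bsub>N\<^esub> x', y) - frag_of (x, y) - frag_of (x', y) \<in> {c. \<exists>S. ?Q c S}" by blast
  next
    fix x y y' assume "x \<in> carrier N" "y \<in> carrier P" "y' \<in> carrier P"
    then have "?Q (frag_of (x, y \<oplus>\<^bsub>P\<^esub> y') - frag_of (x, y) - frag_of (x, y')) {x}"
      using tensor_rel_add_right[of x "N\<lparr>carrier := H\<rparr>" y P y' A for H] by auto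
    then show "frag_of (x, y \<oplus>\<^bsub>P\<^esub> y') - frag_of (x, y) - frag_of (x, y') \<in> {c. \<exists>S. ?Q c S}" by blast
  next
    fix r x y assume "r \<in> carrier A" "x \<in> carrier N" "y \<in> carrier P"
    then have "?Q (frag_of (r \<odot>\<^bsub>N\<^esub> x, y) - frag_of (x, r \<odot>\<^bsub>P\<^esub> y)) {x}"
      using tensor_rel_smult[of r A x "N\<lparr>carrier := H\<rparr>" y P for H] by auto
    then show "frag_of (r \<odot>\<^bsub>N\<^esub> x, y) - frag_of (x, r \<odot>\<^bsub>P\<^esub> y) \<in> {c. \<exists>S. ?Q c S}" by blast
  qed
  then show ?thesis by blast
qed

text \<open>The copy of \<open>M\<close> along \<open>h\<close>. The operations go through
  \<open>the_inv_into\<close>, so the formula has its intended meaning when \<open>h\<close> is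
  injective on the carrier.\<close>

definition transport :: "('m \<Rightarrow> 'n) \<Rightarrow> ('a, 'm) module \<Rightarrow> ('a, 'n) module" where
  "transport h M = (let g = the_inv_into (carrier M) h in
    mk_module (h ` carrier M) (h \<zero>\<^bsub>M\<^esub>) (\<lambda>u v. h (g u \<oplus>\<^bsub>M\<^esub> g v)) (\<lambda>r u. h (r \<odot>\<^bsub>M\<^esub> g u)))"

lemma carrier_transport [simp]: "carrier (transport h M) = h ` carrier M"
  by (simp add: transport_def Let_def)

lemma
  assumes "inj_on h (carrier M)" "x \<in> carrier M"
  shows transport_add: "y \<in> carrier M \<Longrightarrow> h x \<oplus>\<^bsub>transport h M\<^esub> h y = h (x \<oplus>\<^bsub>M\<^esub> y)"
    and transport_smult: "r \<odot>\<^bsub>transport h M\<^esub> h x = h (r \<odot>\<^bsub>M\<^esub> x)"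
  using assms by (simp_all add: transport_def Let_def the_inv_into_f_f)

lemma module_transport:
  assumes "Module.module A M" "inj_on h (carrier M)" shows "Module.module A (transport h M)"
  by (rule module_image[OF assms(1), of _ h])
    (simp_all add: assms transport_add transport_smult transport_def Let_def the_inv_into_f_f)

lemma transport_hom: "inj_on h (carrier M) \<Longrightarrow> h \<in> mod_hom A M (transport h M)"
  by (simp add: mod_hom_def transport_add transport_smult)

lemma inv_transport_hom:
  assumes "Module.module A M" "inj_on h (carrier M)"
  shows "the_inv_into (carrier M) h \<in> mod_hom A (transport h M) M"
  using assms by (auto simp: mod_hom_def transport_add transport_smult the_inv_into_f_f module_add_closed module_smult_closed)

lemma the_inv_into_hom:
  assumes "Module.module A M" "f \<in> mod_hom A M N" "inj_on f (carrier M)"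
  shows "the_inv_into (carrier M) f \<in> mod_hom A (N\<lparr>carrier := f ` carrier M\<rparr>) M"
proof -
  have "the_inv_into (carrier M) f (f x \<oplus>\<^bsub>N\<^esub> f y) = x \<oplus>\<^bsub>M\<^esub> y" if "x \<in> carrier M" "y \<in> carrier M" for x y
    using assms(3) module_add_closed[OF assms(1) that] mod_homD(2)[OF assms(2) that]
    by (metis the_inv_into_f_f)
  moreover have "the_inv_into (carrier M) f (r \<odot>\<^bsub>N\<^esub> f x) = r \<odot>\<^bsub>M\<^esub> x" if "r \<in> carrier A" "x \<in> carrier M" for r x
    using assms(3) module_smult_closed[OF assms(1) that] mod_homD(3)[OF assms(2) that]
    by (metis the_inv_into_f_f)
  ultimately show ?thesis
    using assms(3) by (auto simp: mod_hom_def the_inv_into_f_f)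
qed

lemma mod_hom_submodule: "f \<in> mod_hom A M N \<Longrightarrow> H \<subseteq> carrier M \<Longrightarrow> f \<in> mod_hom A (M\<lparr>carrier := H\<rparr>) N"
  by (auto simp: mod_hom_def Pi_iff subset_iff)

text \<open>The finitely many elements involved in a relation generate a module that embeds into the type
  of the test modules.\<close>

lemma flat_tensor_inj:
  assumes fl: "flat_module A P" and N': "Module.module A N'" and N: "Module.module A N"
    and f: "f \<in> mod_hom A N' N" "inj_on f (carrier N')"
    and c: "c \<in> tfree N' P" "tensor_frag f (\<lambda>y. y) c \<in> tensor_rel A N P"
  shows "c \<in> tensor_rel A N' P"
proof -
  note P = flat_moduleD[OF fl]
  obtain S where S: "finite S" "S \<subseteq> carrier N" and
    SH: "\<And>H. submodule H A N \<Longrightarrow> S \<subseteq> H \<Longrightarrow> tensor_frag f (\<lambda>y. y) c \<in> tensor_rel A (N\<lparr>carrier := H\<rparr>) P"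
    using tensor_rel_finite_support[OF N P c(2)] by blast
  let ?S = "S \<union> f ` fst ` Poly_Mapping.keys c"
  have keys: "fst ` Poly_Mapping.keys c \<subseteq> carrier N'" using c(1) by (auto simp: tfree_def)
  have "finite ?S" "?S \<subseteq> carrier N" using S keys mod_homD(1)[OF f(1)] by auto
  then obtain H \<pi> where H: "submodule H A N" "?S \<subseteq> H" "H \<subseteq> range (\<pi> :: (nat \<Rightarrow> 'a) \<Rightarrow> _)"
    using finite_subset_submodule[OF N, of ?S] by blast
  \<comment> \<open>An element is named by the set of all coefficient sequences that produce it.
    Over \<open>H\<close> these fibres are nonempty and disjoint, so the naming is injective, and
    the names have the type of the test modules.\<close>
  define enc where "enc x = {u. \<pi> u = x}" for x
  have enc_inj: "inj_on enc H"
  proof (rule inj_onI)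
    fix x y assume "x \<in> H" "y \<in> H" "enc x = enc y"
    moreover from \<open>x \<in> H\<close> obtain u where "\<pi> u = x" using H(3) by auto
    ultimately show "x = y" by (auto simp: enc_def)
  qed
  \<comment> \<open>Flatness will be tested on the inclusion of \<open>K\<close> into
    \<open>H\<close>: \<open>H\<close> contains everything the relation mentions, and
    \<open>K\<close> is the part on which \<open>f\<close> can be inverted. The image of
    \<open>c\<close> has its entries in \<open>K\<close>.\<close>
  define K where "K = f ` carrier N' \<inter> H"
  have K: "submodule K A N"
    unfolding K_def by (rule submodule_inter[OF N submodule_image[OF N' N f(1) submodule_carrier[OF N']] H(1)])
  note mH = module_submodule[OF N H(1)] and mK = module_submodule[OF N K]
  have enc_inj': "inj_on enc K" using enc_inj by (rule inj_on_subset) (auto simp: K_def)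
  let ?NH = "transport enc (N\<lparr>carrier := H\<rparr>)" and ?NK = "transport enc (N\<lparr>carrier := K\<rparr>)"
  have tH: "Module.module A ?NH" and tK: "Module.module A ?NK"
    by (rule module_transport; use mH mK enc_inj enc_inj' in simp)+
  have incl: "(\<lambda>x. x) \<in> mod_hom A ?NK ?NH"
    using enc_inj enc_inj' transport_add[of enc "N\<lparr>carrier := H\<rparr>"] transport_add[of enc "N\<lparr>carrier := K\<rparr>"]
      transport_smult[of enc "N\<lparr>carrier := H\<rparr>"] transport_smult[of enc "N\<lparr>carrier := K\<rparr>"]
    by (auto simp: mod_hom_def K_def)
  let ?c = "tensor_frag f (\<lambda>y. y) c"
  \<comment> \<open>\<open>?N0\<close> is not meant as a module. It confines the support of
    \<open>c\<close> to first entries whose images are known to lie in \<open>H\<close>.\<close>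
  let ?N0 = "N'\<lparr>carrier := fst ` Poly_Mapping.keys c\<rparr>"
  have c0: "c \<in> tfree ?N0 P" using c(1) by (force simp: tfree_def)
  have cK: "?c \<in> tfree (N\<lparr>carrier := K\<rparr>) P"
    by (rule tensor_frag_tfree[OF c0]) (use keys H(2) in \<open>force simp: K_def\<close>)+
  have "?c \<in> tensor_rel A (N\<lparr>carrier := H\<rparr>) P" using SH[OF H(1)] H(2) by auto
  then have "tensor_frag enc (\<lambda>y. y) ?c \<in> tensor_rel A ?NH P"
    by (rule tensor_frag_rel[OF mH P tH transport_hom, rotated]) (use enc_inj in simp)
  then have "tensor_frag enc (\<lambda>y. y) ?c \<in> tensor_rel A ?NK P"
    by (intro flat_tensor_inj_test[OF fl tK tH incl])
      (auto simp: tensor_frag_id intro!: tensor_frag_tfree[OF cK])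
  then have "tensor_frag (the_inv_into K enc) (\<lambda>y. y) (tensor_frag enc (\<lambda>y. y) ?c) \<in> tensor_rel A (N\<lparr>carrier := K\<rparr>) P"
    using tensor_frag_rel[OF tK P mK inv_transport_hom[OF mK]] enc_inj' by simp
  also have "tensor_frag (the_inv_into K enc) (\<lambda>y. y) (tensor_frag enc (\<lambda>y. y) ?c) = ?c"
    unfolding tensor_frag_comp[of _ _ enc] using tensor_frag_cong[OF cK, of _ "\<lambda>x. x" _ "\<lambda>y. y"] enc_inj'
    by (simp add: the_inv_into_f_f tensor_frag_id)
  finally have "?c \<in> tensor_rel A (N\<lparr>carrier := K\<rparr>) P" .
  moreover have "the_inv_into (carrier N') f \<in> mod_hom A (N\<lparr>carrier := K\<rparr>) N'"
    using mod_hom_submodule[OF the_inv_into_hom[OF N' f], of K] by (simp add: K_def)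
  ultimately have "tensor_frag (the_inv_into (carrier N') f) (\<lambda>y. y) ?c \<in> tensor_rel A N' P"
    using tensor_frag_rel[OF mK P N'] by blast
  also have "tensor_frag (the_inv_into (carrier N') f) (\<lambda>y. y) ?c = c"
    unfolding tensor_frag_comp using tensor_frag_cong[OF c(1), of _ "\<lambda>x. x" _ "\<lambda>y. y"] f(2)
    by (simp add: the_inv_into_f_f tensor_frag_id)
  finally show ?thesis .
qed

section \<open>Exactness properties of the tensor product\<close>

text \<open>A set-theoretic section \<open>\<sigma>\<close> of \<open>\<pi>\<close> is not linear,
  but its defects lie in the kernel of \<open>\<pi>\<close>. Hence it sends relations of
  \<open>N\<close> into the group \<open>G\<close> of tensors congruent to kernel tensors, while
  \<open>c\<close> differs from its image under \<open>\<sigma>\<close> after \<open>\<pi>\<close>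
  by an element of \<open>G\<close>.\<close>

lemma tensor_right_exact:
  assumes M: "Module.module A M" and N: "Module.module A N" and P: "Module.module A P"
    and \<pi>: "\<pi> \<in> mod_hom A M N" "\<pi> ` carrier M = carrier N"
    and c: "c \<in> tfree M P" "tensor_frag \<pi> (\<lambda>y. y) c \<in> tensor_rel A N P"
  shows "\<exists>k\<in>tfree (M\<lparr>carrier := {x \<in> carrier M. \<pi> x = \<zero>\<^bsub>N\<^esub>}\<rparr>) P. c - k \<in> tensor_rel A M P"
proof -
  let ?K = "M\<lparr>carrier := {x \<in> carrier M. \<pi> x = \<zero>\<^bsub>N\<^esub>}\<rparr>"
  note sg = subgrp_tensor_rel[OF M P]
  define G where "G = {c. \<exists>k\<in>tfree ?K P. c - k \<in> tensor_rel A M P}"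
  have G: "subgrp G"
    unfolding subgrp_def
  proof (intro conjI ballI)
    show "0 \<in> G" unfolding G_def using subgrp_0[OF sg] subgrp_0[OF subgrp_tfree] by force
    fix x y assume "x \<in> G" "y \<in> G"
    then obtain k l where "k \<in> tfree ?K P" "l \<in> tfree ?K P" "x - k \<in> tensor_rel A M P" "y - l \<in> tensor_rel A M P"
      by (auto simp: G_def)
    then show "x - y \<in> G"
      unfolding G_def using subgrp_diff[OF sg, of "x - k" "y - l"] subgrp_diff[OF subgrp_tfree, of k ?K P l]
      by (auto simp: algebra_simps intro!: bexI[of _ "k - l"])
  qed
  have relG: "x \<in> G" if "x \<in> tensor_rel A M P" for x
    using that subgrp_0[OF subgrp_tfree] by (auto simp: G_def intro!: bexI[of _ 0])
  have kerG: "frag_of (x, y) \<in> G" if "x \<in> carrier M" "\<pi> x = \<zero>\<^bsub>N\<^esub>" "y \<in> carrier P" for x y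
    using that subgrp_0[OF sg] by (auto simp: G_def intro!: bexI[of _ "frag_of (x, y)"])
  have diffG: "frag_of (x, y) - frag_of (x', y) \<in> G"
    if "x \<in> carrier M" "x' \<in> carrier M" "\<pi> x = \<pi> x'" "y \<in> carrier P" for x x' y
  proof -
    have "frag_of (x \<ominus>\<^bsub>M\<^esub> x', y) \<in> G"
      using that mod_hom_minus[OF M N \<pi>(1)] module_minus_eq_zero_iff[OF N] mod_homD(1)[OF \<pi>(1)]
      by (intro kerG) (auto simp: module_minus_closed[OF M])
    moreover have "frag_of (x \<ominus>\<^bsub>M\<^esub> x', y) - (frag_of (x, y) - frag_of (x', y)) \<in> G"
      using that by (intro relG tensor_rel_minus_left[OF M P])
    ultimately show ?thesis using subgrp_cong[OF G] by blast
  qed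
  define \<sigma> where "\<sigma> = inv_into (carrier M) \<pi>"
  have \<sigma>: "\<sigma> n \<in> carrier M" "\<pi> (\<sigma> n) = n" if "n \<in> carrier N" for n
    using that \<pi>(2) by (auto simp: \<sigma>_def inv_into_into f_inv_into_f)
  have 1: "tensor_frag \<sigma> (\<lambda>y. y) r \<in> G" if "r \<in> tensor_rel A N P" for r
  proof -
    have "r \<in> {r. tensor_frag \<sigma> (\<lambda>y. y) r \<in> G}"
    proof (rule tensor_rel_induct[OF N P that])
      show "subgrp {r. tensor_frag \<sigma> (\<lambda>y. y) r \<in> G}"
        using G by (auto simp: subgrp_def tensor_frag_diff)
    next
      fix x x' y assume xy: "x \<in> carrier N" "x' \<in> carrier N" "y \<in> carrier P"
      have "frag_of (\<sigma> (x \<oplus>\<^bsub>N\<^esub> x'), y) - frag_of (\<sigma> x \<oplus>\<^bsub>M\<^esub> \<sigma> x', y) \<in> G"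
        using xy \<sigma> mod_homD(2)[OF \<pi>(1)] by (intro diffG) (auto simp: module_add_closed[OF N] module_add_closed[OF M])
      moreover have "frag_of (\<sigma> x \<oplus>\<^bsub>M\<^esub> \<sigma> x', y) - frag_of (\<sigma> x, y) - frag_of (\<sigma> x', y) \<in> G"
        using xy \<sigma> by (intro relG tensor_rel_add_left) auto
      ultimately show "frag_of (x \<oplus>\<^bsub>N\<^esub> x', y) - frag_of (x, y) - frag_of (x', y) \<in> {r. tensor_frag \<sigma> (\<lambda>y. y) r \<in> G}"
        by (drule_tac subgrp_add[OF G]) (auto simp: tensor_frag_diff tensor_frag_add algebra_simps)
    next
      fix x y y' assume xy: "x \<in> carrier N" "y \<in> carrier P" "y' \<in> carrier P"
      then show "frag_of (x, y \<oplus>\<^bsub>P\<^esub> y') - frag_of (x, y) - frag_of (x, y') \<in> {r. tensor_frag \<sigma> (\<lambda>y. y) r \<in> G}"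
        using \<sigma> by (simp add: tensor_frag_diff relG tensor_rel_add_right)
    next
      fix r x y assume xy: "r \<in> carrier A" "x \<in> carrier N" "y \<in> carrier P"
      have "frag_of (\<sigma> (r \<odot>\<^bsub>N\<^esub> x), y) - frag_of (r \<odot>\<^bsub>M\<^esub> \<sigma> x, y) \<in> G"
        using xy \<sigma> mod_homD(3)[OF \<pi>(1)] by (intro diffG) (auto simp: module_smult_closed[OF N] module_smult_closed[OF M])
      moreover have "frag_of (r \<odot>\<^bsub>M\<^esub> \<sigma> x, y) - frag_of (\<sigma> x, r \<odot>\<^bsub>P\<^esub> y) \<in> G"
        using xy \<sigma> by (intro relG tensor_rel_smult) auto
      ultimately show "frag_of (r \<odot>\<^bsub>N\<^esub> x, y) - frag_of (x, r \<odot>\<^bsub>P\<^esub> y) \<in> {r. tensor_frag \<sigma> (\<lambda>y. y) r \<in> G}"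
        by (drule_tac subgrp_add[OF G]) (auto simp: tensor_frag_diff tensor_frag_add algebra_simps)
    qed
    then show ?thesis by simp
  qed
  have 2: "c - tensor_frag \<sigma> (\<lambda>y. y) (tensor_frag \<pi> (\<lambda>y. y) c) \<in> G"
    using c(1)
  proof (induction c rule: tfree_induct)
    case (one x y)
    then show ?case using \<sigma> mod_homD(1)[OF \<pi>(1)] by (auto intro!: diffG)
  next
    case (diff a b)
    then show ?case using subgrp_diff[OF G] by (force simp: tensor_frag_diff algebra_simps)
  qed (simp add: subgrp_0[OF G])
  have "c \<in> G" using subgrp_cong[OF G 2] 1[OF c(2)] by simp
  then show ?thesis by (simp add: G_def)
qed

text \<open>Factor \<open>f\<close> through its image: right exactness handles the surjection onto
  the image, flatness the inclusion of the image into \<open>N\<close>.\<close>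

lemma flat_tensor_kernel:
  assumes fl: "flat_module A P" and M: "Module.module A M" and N: "Module.module A N"
    and f: "f \<in> mod_hom A M N" and c: "c \<in> tfree M P" "tensor_frag f (\<lambda>y. y) c \<in> tensor_rel A N P"
  shows "\<exists>k\<in>tfree (M\<lparr>carrier := {x \<in> carrier M. f x = \<zero>\<^bsub>N\<^esub>}\<rparr>) P. c - k \<in> tensor_rel A M P"
proof -
  note P = flat_moduleD[OF fl]
  let ?I = "N\<lparr>carrier := f ` carrier M\<rparr>"
  have I: "Module.module A ?I"
    by (rule module_submodule[OF N submodule_image[OF M N f submodule_carrier[OF M]]])
  have f': "f \<in> mod_hom A M ?I" using f by (auto simp: mod_hom_def)
  have "tensor_frag f (\<lambda>y. y) c \<in> tfree ?I P"
    by (rule tensor_frag_tfree[OF c(1)]) auto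
  moreover have "(\<lambda>x. x) \<in> mod_hom A ?I N" using mod_homD(1)[OF f] by (auto simp: mod_hom_def)
  ultimately have "tensor_frag f (\<lambda>y. y) c \<in> tensor_rel A ?I P"
    using flat_tensor_inj[OF fl I N, of "\<lambda>x. x"] c(2) by (auto simp: tensor_frag_id)
  from tensor_right_exact[OF M I P f' _ c(1) this] show ?thesis by simp
qed

text \<open>The lift is exact and not only up to relations: preimages are chosen separately for each
  element, and the free abelian group extends the choice.\<close>

lemma tensor_frag_lift:
  assumes "k \<in> tfree M P" "\<And>x. x \<in> carrier M \<Longrightarrow> \<exists>l\<in>carrier L. f l = x"
  shows "\<exists>l\<in>tfree L P. tensor_frag f (\<lambda>y. y) l = k"
proof -
  obtain s where s: "\<And>x. x \<in> carrier M \<Longrightarrow> s x \<in> carrier L \<and> f (s x) = x" using assms(2) by metis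
  have "tensor_frag s (\<lambda>y. y) k \<in> tfree L P" by (rule tensor_frag_tfree[OF assms(1)]) (use s in auto)
  moreover have "tensor_frag f (\<lambda>y. y) (tensor_frag s (\<lambda>y. y) k) = k"
    unfolding tensor_frag_comp using tensor_frag_cong[OF assms(1), of _ "\<lambda>x. x" _ "\<lambda>y. y"] s
    by (simp add: tensor_frag_id)
  ultimately show ?thesis by blast
qed

lemma flat_tensor_exact:
  assumes fl: "flat_module A P" and M: "Module.module A M" and N: "Module.module A N"
    and f: "f \<in> mod_hom A M N" and g: "\<And>x. x \<in> carrier M \<Longrightarrow> f x = \<zero>\<^bsub>N\<^esub> \<Longrightarrow> \<exists>l\<in>carrier L. g l = x"
    and c: "c \<in> tfree M P" "tensor_frag f (\<lambda>y. y) c \<in> tensor_rel A N P"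
  shows "\<exists>l\<in>tfree L P. c - tensor_frag g (\<lambda>y. y) l \<in> tensor_rel A M P"
proof -
  obtain k where k: "k \<in> tfree (M\<lparr>carrier := {x \<in> carrier M. f x = \<zero>\<^bsub>N\<^esub>}\<rparr>) P" "c - k \<in> tensor_rel A M P"
    using flat_tensor_kernel[OF fl M N f c] by blast
  then show ?thesis using tensor_frag_lift[OF k(1), of L g] g by auto
qed

text \<open>The gluing sequence from M to the sum of M1 and M2 to M12 stays exact after tensoring.
  No direct sum is formed: surjectivity of \<open>b1\<close> together with gluing makes
  \<open>a2\<close> surjective, so it suffices to compare the kernel of \<open>a2\<close> with the
  kernel of \<open>b1\<close>.\<close>

lemma
  assumes fl: "flat_module A P" and M: "Module.module A M" and M1: "Module.module A M1"
    and M2: "Module.module A M2" and M12: "Module.module A M12"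
    and a1: "a1 \<in> mod_hom A M M1" and a2: "a2 \<in> mod_hom A M M2"
    and b1: "b1 \<in> mod_hom A M1 M12" and b2: "b2 \<in> mod_hom A M2 M12"
    and comm: "\<And>x. x \<in> carrier M \<Longrightarrow> b1 (a1 x) = b2 (a2 x)"
    and unique: "\<And>x. x \<in> carrier M \<Longrightarrow> a1 x = \<zero>\<^bsub>M1\<^esub> \<Longrightarrow> a2 x = \<zero>\<^bsub>M2\<^esub> \<Longrightarrow> x = \<zero>\<^bsub>M\<^esub>"
    and glue: "\<And>x y. x \<in> carrier M1 \<Longrightarrow> y \<in> carrier M2 \<Longrightarrow> b1 x = b2 y \<Longrightarrow> \<exists>z\<in>carrier M. a1 z = x \<and> a2 z = y"
    and surj: "\<And>x. x \<in> carrier M12 \<Longrightarrow> \<exists>y\<in>carrier M1. b1 y = x"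
  shows tensor_patch_unique: "\<And>t. t \<in> tfree M P \<Longrightarrow> tensor_frag a1 (\<lambda>y. y) t \<in> tensor_rel A M1 P \<Longrightarrow>
      tensor_frag a2 (\<lambda>y. y) t \<in> tensor_rel A M2 P \<Longrightarrow> t \<in> tensor_rel A M P" (is "PROP ?U")
    and tensor_patch_glue: "\<And>t1 t2. t1 \<in> tfree M1 P \<Longrightarrow> t2 \<in> tfree M2 P \<Longrightarrow>
      tensor_frag b1 (\<lambda>y. y) t1 - tensor_frag b2 (\<lambda>y. y) t2 \<in> tensor_rel A M12 P \<Longrightarrow>
      \<exists>t\<in>tfree M P. tensor_frag a1 (\<lambda>y. y) t - t1 \<in> tensor_rel A M1 P \<and>
        tensor_frag a2 (\<lambda>y. y) t - t2 \<in> tensor_rel A M2 P" (is "PROP ?G")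
proof -
  note P = flat_moduleD[OF fl]
  have surj2: "\<exists>z\<in>carrier M. a2 z = y" if "y \<in> carrier M2" for y
    using surj[OF mod_homD(1)[OF b2 that]] glue[OF _ that] by blast
  show "PROP ?U"
  proof -
    fix t assume t: "t \<in> tfree M P" "tensor_frag a1 (\<lambda>y. y) t \<in> tensor_rel A M1 P"
      "tensor_frag a2 (\<lambda>y. y) t \<in> tensor_rel A M2 P"
    \<comment> \<open>\<open>t\<close> may be replaced by a tensor with entries in the kernel of
      \<open>a2\<close>. There \<open>a1\<close> is injective by \<open>unique\<close>, and flatness
      keeps it injective.\<close>
    let ?K = "{x \<in> carrier M. a2 x = \<zero>\<^bsub>M2\<^esub>}"
    note sK = submodule_kernel[OF M M2 a2]
    note mK = module_submodule[OF M sK]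
    obtain k where k: "k \<in> tfree (M\<lparr>carrier := ?K\<rparr>) P" "t - k \<in> tensor_rel A M P"
      using flat_tensor_kernel[OF fl M M2 a2 t(1,3)] by blast
    have "tensor_frag a1 (\<lambda>y. y) t - tensor_frag a1 (\<lambda>y. y) k \<in> tensor_rel A M1 P"
      using tensor_frag_rel[OF M P M1 a1 k(2)] by (simp add: tensor_frag_diff)
    then have *: "tensor_frag a1 (\<lambda>y. y) k \<in> tensor_rel A M1 P"
      using subgrp_cong[OF subgrp_tensor_rel[OF M1 P]] t(2) by blast
    have a1K: "a1 \<in> mod_hom A (M\<lparr>carrier := ?K\<rparr>) M1"
      using a1 by (rule mod_hom_submodule) auto
    have "k \<in> tensor_rel A (M\<lparr>carrier := ?K\<rparr>) P"
      by (rule flat_tensor_inj[OF fl mK M1 a1K _ k(1) *])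
        (use inj_on_mod_hom_iff[OF mK M1 a1K] unique in simp)
    then have "k \<in> tensor_rel A M P" by (rule tensor_rel_mono[OF M P sK])
    then show "t \<in> tensor_rel A M P" using subgrp_cong[OF subgrp_tensor_rel[OF M P] k(2)] by blast
  qed
  show "PROP ?G"
  proof -
    fix t1 t2 assume t: "t1 \<in> tfree M1 P" "t2 \<in> tfree M2 P"
      "tensor_frag b1 (\<lambda>y. y) t1 - tensor_frag b2 (\<lambda>y. y) t2 \<in> tensor_rel A M12 P"
    \<comment> \<open>\<open>s\<close> already has the right second component; \<open>?u\<close> is
      the error left in the first one, and it is killed by \<open>b1\<close> up to
      relations.\<close>
    obtain s where s: "s \<in> tfree M P" "tensor_frag a2 (\<lambda>y. y) s = t2"
      using tensor_frag_lift[OF t(2), of M a2] surj2 by blast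
    let ?u = "t1 - tensor_frag a1 (\<lambda>y. y) s"
    have u: "?u \<in> tfree M1 P"
      by (intro subgrp_diff[OF subgrp_tfree] t tensor_frag_tfree[OF s(1)]) (auto simp: mod_homD[OF a1])
    have "tensor_frag b1 (\<lambda>y. y) (tensor_frag a1 (\<lambda>y. y) s) = tensor_frag b2 (\<lambda>y. y) t2"
      unfolding s(2)[symmetric] tensor_frag_comp by (rule tensor_frag_cong[OF s(1)]) (auto simp: comm)
    then have "tensor_frag b1 (\<lambda>y. y) ?u \<in> tensor_rel A M12 P"
      using t(3) by (simp add: tensor_frag_diff)
    then obtain k where k: "k \<in> tfree (M1\<lparr>carrier := {x \<in> carrier M1. b1 x = \<zero>\<^bsub>M12\<^esub>}\<rparr>) P" "?u - k \<in> tensor_rel A M1 P"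
      using flat_tensor_kernel[OF fl M1 M12 b1 u] by blast
    \<comment> \<open>An element of the kernel of \<open>b1\<close> glues with 0 on the other side,
      so \<open>a1\<close> maps the kernel of \<open>a2\<close> onto it. The correction
      \<open>w\<close> therefore changes the second component only by relations.\<close>
    let ?K = "{x \<in> carrier M. a2 x = \<zero>\<^bsub>M2\<^esub>}"
    have "\<exists>z\<in>carrier (M\<lparr>carrier := ?K\<rparr>). a1 z = x" if "x \<in> carrier M1" "b1 x = \<zero>\<^bsub>M12\<^esub>" for x
      using glue[OF that(1) module_zero_closed[OF M2]] that(2) mod_hom_zero[OF M2 M12 b2] by auto
    then obtain w where w: "w \<in> tfree (M\<lparr>carrier := ?K\<rparr>) P" "tensor_frag a1 (\<lambda>y. y) w = k"
      using tensor_frag_lift[OF k(1), of "M\<lparr>carrier := ?K\<rparr>" a1] by auto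
    have wM: "w \<in> tfree M P" using w(1) tfree_mono[of "M\<lparr>carrier := ?K\<rparr>" M P P] by auto
    have "tensor_frag a1 (\<lambda>y. y) (s + w) - t1 = - (?u - k)" by (simp add: tensor_frag_add w(2))
    moreover have "tensor_frag a2 (\<lambda>y. y) w \<in> tensor_rel A M2 P"
      by (rule tensor_frag_zero_rel[OF M2 P w(1)]) simp
    then have "tensor_frag a2 (\<lambda>y. y) (s + w) - t2 \<in> tensor_rel A M2 P"
      by (simp add: tensor_frag_add s(2))
    ultimately show "\<exists>t\<in>tfree M P. tensor_frag a1 (\<lambda>y. y) t - t1 \<in> tensor_rel A M1 P \<and>
        tensor_frag a2 (\<lambda>y. y) t - t2 \<in> tensor_rel A M2 P"
      using subgrp_uminus[OF subgrp_tensor_rel[OF M1 P] k(2)] subgrp_add[OF subgrp_tfree s(1) wM]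
      by (metis (no_types, lifting))
  qed
qed

section \<open>Complexes of abelian groups modulo subgroups\<close>

text \<open>The groups meant are the quotients \<open>C n / N n\<close>. Nothing precedes degree 0,
  so exactness there is injectivity of the first differential.\<close>

definition acyclic_mod ::
  "(nat \<Rightarrow> 'x::ab_group_add set) \<Rightarrow> (nat \<Rightarrow> 'x set) \<Rightarrow> (nat \<Rightarrow> 'x \<Rightarrow> 'x) \<Rightarrow> bool" where
  "acyclic_mod C N D \<longleftrightarrow> (\<forall>x\<in>C 0. D 0 x \<in> N 1 \<longrightarrow> x \<in> N 0) \<and>
     (\<forall>n. \<forall>x\<in>C (Suc n). D (Suc n) x \<in> N (Suc (Suc n)) \<longrightarrow> (\<exists>y\<in>C n. x - D n y \<in> N (Suc n)))"

lemma acyclic_modD: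
  assumes "acyclic_mod C N D"
  shows "x \<in> C 0 \<Longrightarrow> D 0 x \<in> N 1 \<Longrightarrow> x \<in> N 0"
    and "x \<in> C (Suc n) \<Longrightarrow> D (Suc n) x \<in> N (Suc (Suc n)) \<Longrightarrow> \<exists>y\<in>C n. x - D n y \<in> N (Suc n)"
  using assms unfolding acyclic_mod_def by blast+

text \<open>For each \<open>U\<close> a complex \<open>C U / N U\<close>; the restrictions patch sections over \<open>V1\<close> and \<open>V2\<close> that agree
  over \<open>W\<close> to sections over \<open>V\<close>.\<close>

locale patching =
  fixes C N :: "'v \<Rightarrow> nat \<Rightarrow> 'x::ab_group_add set" and D :: "'v \<Rightarrow> nat \<Rightarrow> 'x \<Rightarrow> 'x"
    and \<rho> :: "'v \<Rightarrow> 'v \<Rightarrow> nat \<Rightarrow> 'x \<Rightarrow> 'x" and V V1 V2 W :: 'v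
  assumes subC: "U \<in> {V, V1, V2, W} \<Longrightarrow> subgrp (C U n)"
    and subN: "U \<in> {V, V1, V2, W} \<Longrightarrow> subgrp (N U n)"
    and Dd: "D U n (x - y) = D U n x - D U n y"
    and DC: "U \<in> {V, V1, V2, W} \<Longrightarrow> x \<in> C U n \<Longrightarrow> D U n x \<in> C U (Suc n)"
    and DN: "U \<in> {V, V1, V2, W} \<Longrightarrow> x \<in> N U n \<Longrightarrow> D U n x \<in> N U (Suc n)"
    and DD: "U \<in> {V, V1, V2, W} \<Longrightarrow> x \<in> C U n \<Longrightarrow> D U (Suc n) (D U n x) \<in> N U (Suc (Suc n))"
    and rd: "\<rho> U U' n (x - y) = \<rho> U U' n x - \<rho> U U' n y"
    and rC: "(U, U') \<in> {(V, V1), (V, V2), (V1, W), (V2, W)} \<Longrightarrow> x \<in> C U n \<Longrightarrow> \<rho> U U' n x \<in> C U' n"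
    and rN: "(U, U') \<in> {(V, V1), (V, V2), (V1, W), (V2, W)} \<Longrightarrow> x \<in> N U n \<Longrightarrow> \<rho> U U' n x \<in> N U' n"
    and rD: "(U, U') \<in> {(V, V1), (V, V2), (V1, W), (V2, W)} \<Longrightarrow> x \<in> C U n \<Longrightarrow>
      \<rho> U U' (Suc n) (D U n x) - D U' n (\<rho> U U' n x) \<in> N U' (Suc n)"
    and rr: "x \<in> C V n \<Longrightarrow> \<rho> V1 W n (\<rho> V V1 n x) - \<rho> V2 W n (\<rho> V V2 n x) \<in> N W n"
    and unique: "x \<in> C V n \<Longrightarrow> \<rho> V V1 n x \<in> N V1 n \<Longrightarrow> \<rho> V V2 n x \<in> N V2 n \<Longrightarrow> x \<in> N V n"
    and glue: "x1 \<in> C V1 n \<Longrightarrow> x2 \<in> C V2 n \<Longrightarrow> \<rho> V1 W n x1 - \<rho> V2 W n x2 \<in> N W n \<Longrightarrow>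
      \<exists>x\<in>C V n. \<rho> V V1 n x - x1 \<in> N V1 n \<and> \<rho> V V2 n x - x2 \<in> N V2 n"
    and surj: "x \<in> C W n \<Longrightarrow> \<exists>y\<in>C V1 n. \<rho> V1 W n y - x \<in> N W n"
begin

lemma cycle_restrict:
  assumes "(U, U') \<in> {(V, V1), (V, V2), (V1, W), (V2, W)}" "x \<in> C U n" "D U n x \<in> N U (Suc n)"
  shows "D U' n (\<rho> U U' n x) \<in> N U' (Suc n)"
proof -
  have "U' \<in> {V, V1, V2, W}" using assms(1) by auto
  from subgrp_cong[OF subN[OF this] rD[OF assms(1,2)]] show ?thesis using rN[OF assms(1,3)] by blast
qed

text \<open>Primitives of \<open>x\<close> over \<open>V1\<close> and \<open>V2\<close> differ over
  \<open>W\<close> by a cycle. A primitive of that cycle extends to \<open>V1\<close> by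
  \<open>surj\<close> and corrects the first choice, after which the two primitives agree over
  \<open>W\<close> and glue.\<close>

theorem mayer_vietoris:
  assumes a1: "acyclic_mod (C V1) (N V1) (D V1)" and a2: "acyclic_mod (C V2) (N V2) (D V2)"
    and a12: "acyclic_mod (C W) (N W) (D W)"
  shows "acyclic_mod (C V) (N V) (D V)"
  unfolding acyclic_mod_def
proof (intro conjI allI ballI impI)
  fix x assume x: "x \<in> C V 0" "D V 0 x \<in> N V 1"
  have "\<rho> V V1 0 x \<in> N V1 0" "\<rho> V V2 0 x \<in> N V2 0"
    using a1 a2 cycle_restrict[of V V1 x 0] cycle_restrict[of V V2 x 0] rC[of V V1 x 0] rC[of V V2 x 0] x
    by (auto simp: acyclic_mod_def)
  then show "x \<in> N V 0" using unique[OF x(1)] by blast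
next
  fix n x assume x: "x \<in> C V (Suc n)" "D V (Suc n) x \<in> N V (Suc (Suc n))"
  note s = subN[of V1] subN[of V2] subN[of W] subN[of V]
  let ?x1 = "\<rho> V V1 (Suc n) x" and ?x2 = "\<rho> V V2 (Suc n) x"
  obtain b1 where b1: "b1 \<in> C V1 n" "?x1 - D V1 n b1 \<in> N V1 (Suc n)"
    using acyclic_modD(2)[OF a1, of ?x1 n] cycle_restrict[of V V1 x "Suc n"] rC[of V V1 x "Suc n"] x by blast
  obtain b2 where b2: "b2 \<in> C V2 n" "?x2 - D V2 n b2 \<in> N V2 (Suc n)"
    using acyclic_modD(2)[OF a2, of ?x2 n] cycle_restrict[of V V2 x "Suc n"] rC[of V V2 x "Suc n"] x by blast
  define c where "c = \<rho> V1 W n b1 - \<rho> V2 W n b2"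
  have cC: "c \<in> C W n" unfolding c_def by (intro subgrp_diff[OF subC] rC) (use b1 b2 in auto)
  have Dc: "D W n c \<in> N W (Suc n)"
  proof -
    \<comment> \<open>By additivity the right-hand side collapses to the left. Its three groups of
      terms lie in \<open>N W (Suc n)\<close> by \<open>rr\<close>, by \<open>rN\<close> and by
      \<open>rD\<close>.\<close>
    have "D W n c = (\<rho> V1 W (Suc n) ?x1 - \<rho> V2 W (Suc n) ?x2)
        - (\<rho> V1 W (Suc n) (?x1 - D V1 n b1) - \<rho> V2 W (Suc n) (?x2 - D V2 n b2))
        - ((\<rho> V1 W (Suc n) (D V1 n b1) - D W n (\<rho> V1 W n b1))
           - (\<rho> V2 W (Suc n) (D V2 n b2) - D W n (\<rho> V2 W n b2)))"
      by (simp add: c_def Dd rd)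
    also have "\<dots> \<in> N W (Suc n)"
      by (intro subgrp_diff[OF s(3)] rr rN rD) (use x b1 b2 in auto)
    finally show ?thesis .
  qed
  have "\<exists>b\<in>C V1 n. ?x1 - D V1 n b \<in> N V1 (Suc n) \<and> \<rho> V1 W n b - \<rho> V2 W n b2 \<in> N W n"
  proof (cases n)
    case 0
    \<comment> \<open>In degree 0 a cycle over \<open>W\<close> is already trivial, so the
      primitives need no correction.\<close>
    then have "c \<in> N W n" using a12 cC Dc by (auto simp: acyclic_mod_def)
    then show ?thesis using b1 by (auto simp: c_def)
  next
    case (Suc m)
    then obtain c' where c': "c' \<in> C W m" "c - D W m c' \<in> N W n"
      using a12 cC Dc unfolding acyclic_mod_def by blast
    \<comment> \<open>\<open>c'\<close> lives over \<open>W\<close> only, so it is lifted to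
      \<open>V1\<close> up to \<open>N\<close>. Replacing \<open>b1\<close> by
      \<open>b1 - D V1 m c1\<close> leaves its coboundary unchanged modulo \<open>N\<close> and
      cancels the discrepancy \<open>c\<close>.\<close>
    obtain c1 where c1: "c1 \<in> C V1 m" "\<rho> V1 W m c1 - c' \<in> N W m" using surj[OF c'(1)] by blast
    let ?b = "b1 - D V1 m c1"
    have "D V1 m c1 \<in> C V1 n" using DC[of V1 c1 m] c1(1) Suc by simp
    then have "?b \<in> C V1 n" using subgrp_diff[OF subC b1(1)] by blast
    moreover have "D V1 n (D V1 m c1) \<in> N V1 (Suc n)" using DD[of V1 c1 m] c1(1) Suc by simp
    then have "?x1 - D V1 n ?b \<in> N V1 (Suc n)"
      using subgrp_add[OF s(1) b1(2), of "D V1 n (D V1 m c1)"] by (simp add: Dd algebra_simps)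
    moreover have "\<rho> V1 W n ?b - \<rho> V2 W n b2 = (c - D W m c') - (\<rho> V1 W n (D V1 m c1) - D W m (\<rho> V1 W m c1))
        - D W m (\<rho> V1 W m c1 - c')"
      by (simp add: c_def rd Dd)
    moreover have "\<dots> \<in> N W n"
      by (rule subgrp_diff[OF s(3) subgrp_diff[OF s(3) c'(2)]])
        (use rD[of V1 W c1 m] DN[of W _ m] c1 Suc in auto)
    ultimately show ?thesis by metis
  qed
  then obtain b where b: "b \<in> C V1 n" "?x1 - D V1 n b \<in> N V1 (Suc n)" "\<rho> V1 W n b - \<rho> V2 W n b2 \<in> N W n" by blast
  obtain y where y: "y \<in> C V n" "\<rho> V V1 n y - b \<in> N V1 n" "\<rho> V V2 n y - b2 \<in> N V2 n"
    using glue[OF b(1) b2(1) b(3)] by blast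
  have "x - D V n y \<in> N V (Suc n)"
  proof (rule unique)
    show "x - D V n y \<in> C V (Suc n)" by (intro subgrp_diff[OF subC] x DC y) auto
    have "\<rho> V V1 (Suc n) (x - D V n y) = (?x1 - D V1 n b) - (\<rho> V V1 (Suc n) (D V n y) - D V1 n (\<rho> V V1 n y))
        - D V1 n (\<rho> V V1 n y - b)" by (simp add: rd Dd)
    also have "\<dots> \<in> N V1 (Suc n)" by (intro subgrp_diff[OF s(1)] b rD DN y) (use y in auto)
    finally show "\<rho> V V1 (Suc n) (x - D V n y) \<in> N V1 (Suc n)" .
    have "\<rho> V V2 (Suc n) (x - D V n y) = (?x2 - D V2 n b2) - (\<rho> V V2 (Suc n) (D V n y) - D V2 n (\<rho> V V2 n y))
        - D V2 n (\<rho> V V2 n y - b2)" by (simp add: rd Dd)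
    also have "\<dots> \<in> N V2 (Suc n)" by (intro subgrp_diff[OF s(2)] b2 rD DN y) (use y in auto)
    finally show "\<rho> V V2 (Suc n) (x - D V n y) \<in> N V2 (Suc n)" .
  qed
  then show "\<exists>y\<in>C V n. x - D V n y \<in> N V (Suc n)" using y by blast
qed

end

section \<open>Mapping cones\<close>

definition shift_set :: "(nat \<Rightarrow> 'x::zero set) \<Rightarrow> nat \<Rightarrow> 'x set" where
  "shift_set F n = (case n of 0 \<Rightarrow> {0} | Suc m \<Rightarrow> F m)"

definition shift_map :: "(nat \<Rightarrow> 'x \<Rightarrow> 'x::zero) \<Rightarrow> nat \<Rightarrow> 'x \<Rightarrow> 'x" where
  "shift_map d n = (case n of 0 \<Rightarrow> (\<lambda>_. 0) | Suc m \<Rightarrow> d m)"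

lemma shift_simps [simp]: "shift_set F 0 = {0}" "shift_set F (Suc n) = F n"
  "shift_map d 0 x = 0" "shift_map d (Suc n) = d n"
  by (simp_all add: shift_set_def shift_map_def)

text \<open>Degree n holds F in degree n and G in degree n - 1, with 0 in place of G in degree -1.
  This is the usual cone moved by one degree, so that it begins with F in degree 0.\<close>

definition cone_set :: "(nat \<Rightarrow> 'x::zero set) \<Rightarrow> (nat \<Rightarrow> 'x set) \<Rightarrow> nat \<Rightarrow> ('x \<times> 'x) set" where
  "cone_set F G n = F n \<times> shift_set G n"

text \<open>The minus sign makes the square vanish modulo the denominators. A cycle is a cocycle
  \<open>t\<close> of the first complex together with a primitive of its image in the
  second.\<close>

definition cone_map ::
  "(nat \<Rightarrow> 'x \<Rightarrow> 'x::ab_group_add) \<Rightarrow> (nat \<Rightarrow> 'x \<Rightarrow> 'x) \<Rightarrow> (nat \<Rightarrow> 'x \<Rightarrow> 'x) \<Rightarrow> nat \<Rightarrow> 'x \<times> 'x \<Rightarrow> 'x \<times> 'x" where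
  "cone_map d d' \<phi> n = (\<lambda>(t, r). (d n t, \<phi> n t - shift_map d' n r))"

lemma subgrp_Times: "subgrp S \<Longrightarrow> subgrp T \<Longrightarrow> subgrp (S \<times> T)"
  by (auto simp: subgrp_def zero_prod_def)

lemma subgrp_shift: "(\<And>n. subgrp (F n)) \<Longrightarrow> subgrp (shift_set F n)"
  by (cases n) (auto simp: subgrp_def)

text \<open>The conditions of \<open>patching\<close> are checked componentwise. Only the
  differential mixes the components, and it does so through \<open>\<phi>\<close>; what has to be
  added is therefore that \<open>\<phi>\<close> commutes with differentials and with restrictions
  modulo \<open>NG\<close>.\<close>

lemma patching_cone:
  assumes F: "patching F NF d \<rho> V V1 V2 W" and G: "patching G NG d' \<rho>' V V1 V2 W"
    and NG: "\<And>U n. U \<in> {V, V1, V2, W} \<Longrightarrow> NG U n \<subseteq> G U n"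
    and \<phi>: "\<And>U n x y. \<phi> U n (x - y) = \<phi> U n x - \<phi> U n y"
    and \<phi>F: "\<And>U n x. U \<in> {V, V1, V2, W} \<Longrightarrow> x \<in> F U n \<Longrightarrow> \<phi> U n x \<in> G U n"
    and \<phi>N: "\<And>U n x. U \<in> {V, V1, V2, W} \<Longrightarrow> x \<in> NF U n \<Longrightarrow> \<phi> U n x \<in> NG U n"
    and \<phi>d: "\<And>U n x. U \<in> {V, V1, V2, W} \<Longrightarrow> x \<in> F U n \<Longrightarrow> \<phi> U (Suc n) (d U n x) - d' U n (\<phi> U n x) \<in> NG U (Suc n)"
    and \<phi>r: "\<And>U U' n x. (U, U') \<in> {(V, V1), (V, V2), (V1, W), (V2, W)} \<Longrightarrow> x \<in> F U n \<Longrightarrow>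
      \<rho>' U U' n (\<phi> U n x) - \<phi> U' n (\<rho> U U' n x) \<in> NG U' n"
  shows "patching (\<lambda>U. cone_set (F U) (G U)) (\<lambda>U. cone_set (NF U) (NG U)) (\<lambda>U. cone_map (d U) (d' U) (\<phi> U))
    (\<lambda>U U' n (t, r). (\<rho> U U' n t, shift_map (\<rho>' U U') n r)) V V1 V2 W"
proof -
  interpret F: patching F NF d \<rho> V V1 V2 W by fact
  interpret G: patching G NG d' \<rho>' V V1 V2 W by fact
  have z: "d' U n 0 = 0" "\<rho>' U U' n 0 = 0" "\<phi> U n 0 = 0" for U U' n
    using G.Dd[of U n 0 0] G.rd[of U U' n 0 0] \<phi>[of U n 0 0] by simp_all
  note defs = cone_set_def cone_map_def
  show ?thesis
  proof
    fix U n assume U: "U \<in> {V, V1, V2, W}"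
    show "subgrp (cone_set (F U) (G U) n)" "subgrp (cone_set (NF U) (NG U) n)"
      unfolding cone_set_def by (intro subgrp_Times subgrp_shift F.subC F.subN G.subC G.subN U)+
  next
    fix U n x y
    show "cone_map (d U) (d' U) (\<phi> U) n (x - y) = cone_map (d U) (d' U) (\<phi> U) n x - cone_map (d U) (d' U) (\<phi> U) n y"
      by (cases n; cases x; cases y) (simp_all add: cone_map_def F.Dd G.Dd \<phi>)
  next
    fix U x n assume U: "U \<in> {V, V1, V2, W}" and x: "x \<in> cone_set (F U) (G U) n"
    obtain t r where tr: "x = (t, r)" "t \<in> F U n" "r \<in> shift_set G' n" if "G' = G U" for G'
      using x by (auto simp: cone_set_def)
    have t: "t \<in> F U n" and r: "r \<in> shift_set (G U) n" using tr by auto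
    have r': "shift_map (d' U) n r \<in> G U n"
      using r U by (cases n) (auto simp: subgrp_0 G.subC G.DC)
    show "cone_map (d U) (d' U) (\<phi> U) n x \<in> cone_set (F U) (G U) (Suc n)"
      using t r' U by (simp add: defs tr F.DC subgrp_diff[OF G.subC] \<phi>F)
    have "\<phi> U (Suc n) (d U n t) - d' U n (\<phi> U n t - shift_map (d' U) n r) \<in> NG U (Suc n)"
    proof -
      have "d' U n (shift_map (d' U) n r) \<in> NG U (Suc n)"
        using r U by (cases n) (auto simp: z subgrp_0 G.subN G.DD)
      from subgrp_add[OF G.subN[OF U] \<phi>d[OF U t] this] show ?thesis by (simp add: G.Dd algebra_simps)
    qed
    then show "cone_map (d U) (d' U) (\<phi> U) (Suc n) (cone_map (d U) (d' U) (\<phi> U) n x) \<in> cone_set (NF U) (NG U) (Suc (Suc n))"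
      using t U by (simp add: defs tr F.DD)
  next
    fix U x n assume U: "U \<in> {V, V1, V2, W}" and x: "x \<in> cone_set (NF U) (NG U) n"
    then show "cone_map (d U) (d' U) (\<phi> U) n x \<in> cone_set (NF U) (NG U) (Suc n)"
      by (cases n) (auto simp: defs F.DN subgrp_diff[OF G.subN] \<phi>N G.DN)
  next
    fix U U' n and x y :: "'b \<times> 'b"
    show "(case x - y of (t, r) \<Rightarrow> (\<rho> U U' n t, shift_map (\<rho>' U U') n r)) =
       (case x of (t, r) \<Rightarrow> (\<rho> U U' n t, shift_map (\<rho>' U U') n r)) - (case y of (t, r) \<Rightarrow> (\<rho> U U' n t, shift_map (\<rho>' U U') n r))"
      by (cases n; cases x; cases y) (simp_all add: F.rd G.rd)
  next
    fix U U' x n assume UU: "(U, U') \<in> {(V, V1), (V, V2), (V1, W), (V2, W)}"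
    have U: "U \<in> {V, V1, V2, W}" "U' \<in> {V, V1, V2, W}" using UU by auto
    show "(case x of (t, r) \<Rightarrow> (\<rho> U U' n t, shift_map (\<rho>' U U') n r)) \<in> cone_set (F U') (G U') n"
      if "x \<in> cone_set (F U) (G U) n"
      using that F.rC[OF UU] G.rC[OF UU] by (cases n) (auto simp: cone_set_def)
    show "(case x of (t, r) \<Rightarrow> (\<rho> U U' n t, shift_map (\<rho>' U U') n r)) \<in> cone_set (NF U') (NG U') n"
      if "x \<in> cone_set (NF U) (NG U) n"
      using that F.rN[OF UU] G.rN[OF UU] by (cases n) (auto simp: cone_set_def)
    assume "x \<in> cone_set (F U) (G U) n"
    then obtain t r where tr: "x = (t, r)" "t \<in> F U n" "r \<in> shift_set (G U) n"
      by (auto simp: cone_set_def)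
    have "\<rho>' U U' n (\<phi> U n t - shift_map (d' U) n r) - (\<phi> U' n (\<rho> U U' n t) - shift_map (d' U') n (shift_map (\<rho>' U U') n r)) \<in> NG U' n"
    proof -
      have "\<rho>' U U' n (shift_map (d' U) n r) - shift_map (d' U') n (shift_map (\<rho>' U U') n r) \<in> NG U' n"
        using tr(3) U G.rD[OF UU] by (cases n) (auto simp: z subgrp_0 G.subN)
      from subgrp_diff[OF G.subN[OF U(2)] \<phi>r[OF UU tr(2)] this] show ?thesis by (simp add: G.rd algebra_simps)
    qed
    then show "(case cone_map (d U) (d' U) (\<phi> U) n x of (t, r) \<Rightarrow> (\<rho> U U' (Suc n) t, shift_map (\<rho>' U U') (Suc n) r)) -
       cone_map (d U') (d' U') (\<phi> U') n (case x of (t, r) \<Rightarrow> (\<rho> U U' n t, shift_map (\<rho>' U U') n r))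
       \<in> cone_set (NF U') (NG U') (Suc n)"
      using F.rD[OF UU tr(2)] by (simp add: defs tr(1))
  next
    fix x n assume "x \<in> cone_set (F V) (G V) n"
    then show "(case case x of (t, r) \<Rightarrow> (\<rho> V V1 n t, shift_map (\<rho>' V V1) n r) of (t, r) \<Rightarrow> (\<rho> V1 W n t, shift_map (\<rho>' V1 W) n r)) -
       (case case x of (t, r) \<Rightarrow> (\<rho> V V2 n t, shift_map (\<rho>' V V2) n r) of (t, r) \<Rightarrow> (\<rho> V2 W n t, shift_map (\<rho>' V2 W) n r))
       \<in> cone_set (NF W) (NG W) n"
      using F.rr G.rr by (cases n) (auto simp: cone_set_def)
  next
    fix x n assume "x \<in> cone_set (F V) (G V) n"
      "(case x of (t, r) \<Rightarrow> (\<rho> V V1 n t, shift_map (\<rho>' V V1) n r)) \<in> cone_set (NF V1) (NG V1) n"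
      "(case x of (t, r) \<Rightarrow> (\<rho> V V2 n t, shift_map (\<rho>' V V2) n r)) \<in> cone_set (NF V2) (NG V2) n"
    then show "x \<in> cone_set (NF V) (NG V) n"
      using F.unique G.unique by (cases n) (auto simp: cone_set_def)
  next
    fix x1 x2 n assume *: "x1 \<in> cone_set (F V1) (G V1) n" "x2 \<in> cone_set (F V2) (G V2) n"
      "(case x1 of (t, r) \<Rightarrow> (\<rho> V1 W n t, shift_map (\<rho>' V1 W) n r)) -
       (case x2 of (t, r) \<Rightarrow> (\<rho> V2 W n t, shift_map (\<rho>' V2 W) n r)) \<in> cone_set (NF W) (NG W) n"
    obtain t1 r1 t2 r2 where x: "x1 = (t1, r1)" "x2 = (t2, r2)" by (metis surj_pair)
    obtain t where t: "t \<in> F V n" "\<rho> V V1 n t - t1 \<in> NF V1 n" "\<rho> V V2 n t - t2 \<in> NF V2 n"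
      using F.glue[of t1 n t2] * x by (auto simp: cone_set_def)
    have "\<exists>r\<in>shift_set (G V) n. shift_map (\<rho>' V V1) n r - r1 \<in> shift_set (NG V1) n \<and>
        shift_map (\<rho>' V V2) n r - r2 \<in> shift_set (NG V2) n"
      using G.glue[of r1 _ r2] * x by (cases n) (auto simp: cone_set_def)
    then show "\<exists>x\<in>cone_set (F V) (G V) n.
       (case x of (t, r) \<Rightarrow> (\<rho> V V1 n t, shift_map (\<rho>' V V1) n r)) - x1 \<in> cone_set (NF V1) (NG V1) n \<and>
       (case x of (t, r) \<Rightarrow> (\<rho> V V2 n t, shift_map (\<rho>' V V2) n r)) - x2 \<in> cone_set (NF V2) (NG V2) n"
      using t by (auto simp: cone_set_def x)
  next
    fix x n assume *: "x \<in> cone_set (F W) (G W) n"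
    obtain t r where x: "x = (t, r)" by (metis surj_pair)
    obtain t' where t': "t' \<in> F V1 n" "\<rho> V1 W n t' - t \<in> NF W n"
      using F.surj[of t n] * x by (auto simp: cone_set_def)
    have "\<exists>r'\<in>shift_set (G V1) n. shift_map (\<rho>' V1 W) n r' - r \<in> shift_set (NG W) n"
      using G.surj[of r] * x by (cases n) (auto simp: cone_set_def)
    then show "\<exists>y\<in>cone_set (F V1) (G V1) n. (case y of (t, r) \<Rightarrow> (\<rho> V1 W n t, shift_map (\<rho>' V1 W) n r)) - x \<in> cone_set (NF W) (NG W) n"
      using t' by (auto simp: cone_set_def x)
  qed
qed

text \<open>A morphism between resolutions of \<open>A / NA\<close> and \<open>A' / NA'\<close> that lies over an isomorphism has an
  acyclic cone.\<close>

lemma acyclic_cone_resolution: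
  fixes F NF G NG :: "nat \<Rightarrow> 'x::ab_group_add set" and A NA A' NA' :: "'y::ab_group_add set"
  assumes sF: "\<And>n. subgrp (F n)" "\<And>n. subgrp (NF n)" and sG: "\<And>n. subgrp (G n)" "\<And>n. subgrp (NG n)"
    and sA': "subgrp NA'"
    and lin: "\<And>n x y. d n (x - y) = d n x - d n y" "\<And>n x y. d' n (x - y) = d' n x - d' n y"
      "\<And>n x y. \<phi> n (x - y) = \<phi> n x - \<phi> n y" "\<And>x y. e' (x - y) = e' x - e' y"
    and dF: "\<And>n x. x \<in> F n \<Longrightarrow> d n x \<in> F (Suc n)" and dG: "\<And>n x. x \<in> G n \<Longrightarrow> d' n x \<in> G (Suc n)"
    and dNF: "\<And>n x. x \<in> NF n \<Longrightarrow> d n x \<in> NF (Suc n)" and ddG: "\<And>n x. x \<in> G n \<Longrightarrow> d' (Suc n) (d' n x) \<in> NG (Suc (Suc n))"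
    and \<phi>F: "\<And>n x. x \<in> F n \<Longrightarrow> \<phi> n x \<in> G n" and \<phi>N: "\<And>n x. x \<in> NF n \<Longrightarrow> \<phi> n x \<in> NG n"
    and \<phi>d: "\<And>n x. x \<in> F n \<Longrightarrow> \<phi> (Suc n) (d n x) - d' n (\<phi> n x) \<in> NG (Suc n)"
    and exF: "\<And>n x. x \<in> F (Suc n) \<Longrightarrow> d (Suc n) x \<in> NF (Suc (Suc n)) \<Longrightarrow> \<exists>y\<in>F n. x - d n y \<in> NF (Suc n)"
    and exG: "\<And>n x. x \<in> G (Suc n) \<Longrightarrow> d' (Suc n) x \<in> NG (Suc (Suc n)) \<Longrightarrow> \<exists>y\<in>G n. x - d' n y \<in> NG (Suc n)"
    and ex0F: "\<And>x. x \<in> F 0 \<Longrightarrow> d 0 x \<in> NF 1 \<Longrightarrow> \<exists>m\<in>A. x - e m \<in> NF 0"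
    and ex0G: "\<And>x. x \<in> G 0 \<Longrightarrow> d' 0 x \<in> NG 1 \<Longrightarrow> \<exists>m\<in>A'. x - e' m \<in> NG 0"
    and eF: "\<And>m. m \<in> A \<Longrightarrow> e m \<in> F 0" and eN: "\<And>m. m \<in> NA \<Longrightarrow> e m \<in> NF 0"
    and eN': "\<And>m. m \<in> NA' \<Longrightarrow> e' m \<in> NG 0"
    and de: "\<And>m. m \<in> A \<Longrightarrow> d 0 (e m) \<in> NF 1"
    and inj': "\<And>m. m \<in> A' \<Longrightarrow> e' m \<in> NG 0 \<Longrightarrow> m \<in> NA'"
    and \<psi>A: "\<And>m. m \<in> A \<Longrightarrow> \<psi> m \<in> A'"
    and \<phi>e: "\<And>m. m \<in> A \<Longrightarrow> \<phi> 0 (e m) - e' (\<psi> m) \<in> NG 0"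
    and \<psi>inj: "\<And>m. m \<in> A \<Longrightarrow> \<psi> m \<in> NA' \<Longrightarrow> m \<in> NA"
    and \<psi>surj: "\<And>m. m \<in> A' \<Longrightarrow> \<exists>l\<in>A. \<psi> l - m \<in> NA'"
  shows "acyclic_mod (cone_set F G) (cone_set NF NG) (cone_map d d' \<phi>)"
  unfolding acyclic_mod_def
proof (intro conjI allI ballI impI)
  fix x assume x: "x \<in> cone_set F G 0" "cone_map d d' \<phi> 0 x \<in> cone_set NF NG 1"
  then obtain t where t: "x = (t, 0)" "t \<in> F 0" "d 0 t \<in> NF 1" "\<phi> 0 t \<in> NG 0"
    by (auto simp: cone_set_def cone_map_def)
  \<comment> \<open>In degree 0 the cycle \<open>t\<close> comes from some \<open>m\<close> of
    \<open>A\<close>. Since \<open>\<phi>\<close> kills \<open>t\<close> and \<open>e'\<close> is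
    injective modulo denominators, \<open>\<psi> m\<close> is trivial, and then so is
    \<open>m\<close>.\<close>
  obtain m where m: "m \<in> A" "t - e m \<in> NF 0" using ex0F[OF t(2,3)] by blast
  have "e' (\<psi> m) = \<phi> 0 t - \<phi> 0 (t - e m) - (\<phi> 0 (e m) - e' (\<psi> m))" by (simp add: lin)
  also have "\<dots> \<in> NG 0" by (intro subgrp_diff[OF sG(2)] t \<phi>N m \<phi>e)
  finally have "m \<in> NA" using inj'[OF \<psi>A] \<psi>inj m by blast
  then show "x \<in> cone_set NF NG 0"
    using subgrp_cong[OF sF(2) m(2)] eN by (simp add: t cone_set_def)
next
  fix n x assume x: "x \<in> cone_set F G (Suc n)" "cone_map d d' \<phi> (Suc n) x \<in> cone_set NF NG (Suc (Suc n))"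
  then obtain t r where t: "x = (t, r)" "t \<in> F (Suc n)" "r \<in> G n" "d (Suc n) t \<in> NF (Suc (Suc n))"
    "\<phi> (Suc n) t - d' n r \<in> NG (Suc n)"
    by (auto simp: cone_set_def cone_map_def)
  obtain t' where t': "t' \<in> F n" "t - d n t' \<in> NF (Suc n)" using exF[OF t(2,4)] by blast
  \<comment> \<open>Subtracting the coboundary of \<open>(t', 0)\<close> disposes of the first
    component. What is left in the second is, up to sign, the cycle \<open>?r\<close> of the second
    resolution.\<close>
  let ?r = "\<phi> n t' - r"
  have rG: "?r \<in> G n" by (intro subgrp_diff[OF sG(1)] \<phi>F t t')
  have "d' n ?r = (\<phi> (Suc n) t - d' n r) - \<phi> (Suc n) (t - d n t') - (\<phi> (Suc n) (d n t') - d' n (\<phi> n t'))"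
    by (simp add: lin)
  also have "\<dots> \<in> NG (Suc n)" by (intro subgrp_diff[OF sG(2)] t \<phi>N t' \<phi>d)
  finally have dr: "d' n ?r \<in> NG (Suc n)" .
  show "\<exists>y\<in>cone_set F G n. x - cone_map d d' \<phi> n y \<in> cone_set NF NG (Suc n)"
  proof (cases n)
    case 0
    \<comment> \<open>In degree 0 a cycle of \<open>G\<close> comes from \<open>A'\<close> instead
      of being a coboundary. It is lifted through \<open>\<psi>\<close> to \<open>m\<close>, and
      \<open>t'\<close> is changed by \<open>e m\<close>, which is itself a cycle, so that the first
      component is not disturbed.\<close>
    obtain m' where m': "m' \<in> A'" "?r - e' m' \<in> NG 0" using ex0G[of ?r] rG dr 0 by auto
    obtain m where m: "m \<in> A" "\<psi> m - m' \<in> NA'" using \<psi>surj[OF m'(1)] by blast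
    have 1: "t' - e m \<in> F n" using subgrp_diff[OF sF(1) t'(1)] eF[OF m(1)] 0 by simp
    have "t - d n (t' - e m) = (t - d n t') + d 0 (e m)" using 0 by (simp add: lin)
    also have "\<dots> \<in> NF (Suc n)" using 0 t'(2) de[OF m(1)] by (intro subgrp_add[OF sF(2)]) auto
    finally have 2: "t - d n (t' - e m) \<in> NF (Suc n)" .
    have "\<phi> n (t' - e m) - r = (?r - e' m') - (\<phi> 0 (e m) - e' (\<psi> m)) - e' (\<psi> m - m')" using 0 by (simp add: lin)
    also have "\<dots> \<in> NG n" unfolding 0 by (rule subgrp_diff[OF sG(2) subgrp_diff[OF sG(2) _ \<phi>e[OF m(1)]] eN'[OF m(2)]]) (use m'(2) 0 in simp)
    finally have "r - \<phi> n (t' - e m) \<in> NG n" by (rule subgrp_sym[OF sG(2)])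
    with 1 2 show ?thesis by (intro bexI[of _ "(t' - e m, 0)"]) (auto simp: cone_set_def cone_map_def t 0)
  next
    case (Suc k)
    \<comment> \<open>In positive degree \<open>?r\<close> is a coboundary of some \<open>s\<close>,
      and \<open>(t', s)\<close> is the primitive sought.\<close>
    obtain s where s: "s \<in> G k" "?r - d' k s \<in> NG (Suc k)" using exG[of ?r k] rG dr Suc by auto
    have "r - (\<phi> n t' - d' k s) = - (?r - d' k s)" by simp
    also have "\<dots> \<in> NG n" using s(2) Suc by (metis subgrp_uminus sG(2))
    finally show ?thesis using t' s Suc t
      by (intro bexI[of _ "(t', s)"]) (auto simp: cone_set_def cone_map_def)
  qed
qed

section \<open>Base change\<close>

lemma restrict_scalars_simps [simp]:
  "carrier (restrict_scalars f M) = carrier M" "\<zero>\<^bsub>restrict_scalars f M\<^esub> = \<zero>\<^bsub>M\<^esub>"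
  "x \<oplus>\<^bsub>restrict_scalars f M\<^esub> y = x \<oplus>\<^bsub>M\<^esub> y" "r \<odot>\<^bsub>restrict_scalars f M\<^esub> x = f r \<odot>\<^bsub>M\<^esub> x"
  by (simp_all add: restrict_scalars_def)

lemma alg_module_simps [simp]:
  "carrier (alg_module f B) = carrier B" "\<zero>\<^bsub>alg_module f B\<^esub> = \<zero>\<^bsub>B\<^esub>"
  "x \<oplus>\<^bsub>alg_module f B\<^esub> y = x \<oplus>\<^bsub>B\<^esub> y" "r \<odot>\<^bsub>alg_module f B\<^esub> x = f r \<otimes>\<^bsub>B\<^esub> x"
  by (simp_all add: alg_module_def)

lemma abelian_group_restrict:
  assumes "abelian_group M" "carrier N = carrier M" "\<zero>\<^bsub>N\<^esub> = \<zero>\<^bsub>M\<^esub>" "\<And>x y. x \<oplus>\<^bsub>N\<^esub> y = x \<oplus>\<^bsub>M\<^esub> y"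
  shows "abelian_group N"
proof -
  interpret M: abelian_group M by fact
  show ?thesis
  proof (rule abelian_groupI)
    fix x assume "x \<in> carrier N"
    then show "\<exists>y\<in>carrier N. y \<oplus>\<^bsub>N\<^esub> x = \<zero>\<^bsub>N\<^esub>" using M.l_neg by (auto simp: assms(2-4))
  qed (auto simp: assms(2-4) M.a_ac)
qed

lemma module_restrict_scalars:
  assumes "cring A" "f \<in> ring_hom A B" "Module.module B M"
  shows "Module.module A (restrict_scalars f M)"
proof -
  interpret Module.module B M by fact
  show ?thesis
    by (intro moduleI abelian_group_restrict[OF abelian_group_axioms] assms(1))
      (auto simp: ring_hom_closed[OF assms(2)] ring_hom_add[OF assms(2)] ring_hom_mult[OF assms(2)]
        ring_hom_one[OF assms(2)] smult_l_distr smult_r_distr smult_assoc1)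
qed

lemma module_alg_module:
  assumes "cring A" "f \<in> ring_hom A B" "cring B"
  shows "Module.module A (alg_module f B)"
proof -
  interpret cring B by fact
  show ?thesis
    by (intro moduleI abelian_group_restrict[OF is_abelian_group] assms(1))
      (auto simp: ring_hom_closed[OF assms(2)] ring_hom_add[OF assms(2)] ring_hom_mult[OF assms(2)]
        ring_hom_one[OF assms(2)] l_distr r_distr m_assoc)
qed

text \<open>The map \<open>M \<otimes>\<^sub>B B \<rightarrow> M\<close> on representatives.\<close>

definition tensor_eval :: "('b, 'x) ring_scheme \<Rightarrow> ('b, 'm) module \<Rightarrow> ('m \<times> 'b \<Rightarrow>\<^sub>0 int) \<Rightarrow> 'm" where
  "tensor_eval B M = (SOME h. h \<in> hom (free_Abelian_group (carrier M \<times> carrier B)) (add_monoid M) \<and>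
     (\<forall>x\<in>carrier M. \<forall>b\<in>carrier B. h (frag_of (x, b)) = b \<odot>\<^bsub>M\<^esub> x))"

context
  fixes B :: "'b ring" and M :: "('b, 'm) module"
  assumes M: "Module.module B M"
begin

interpretation Module.module B M by (rule M)

lemma tensor_eval_hom:
  "tensor_eval B M \<in> hom (free_Abelian_group (carrier M \<times> carrier B)) (add_monoid M)"
  "x \<in> carrier M \<Longrightarrow> b \<in> carrier B \<Longrightarrow> tensor_eval B M (frag_of (x, b)) = b \<odot>\<^bsub>M\<^esub> x"
proof -
  have im: "(\<lambda>(x, b). b \<odot>\<^bsub>M\<^esub> x) ` (carrier M \<times> carrier B) \<subseteq> carrier (add_monoid M)" by auto
  obtain h where "h \<in> hom (free_Abelian_group (carrier M \<times> carrier B)) (add_monoid M)"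
      "\<And>z. z \<in> carrier M \<times> carrier B \<Longrightarrow> h (frag_of z) = (\<lambda>(x, b). b \<odot>\<^bsub>M\<^esub> x) z"
    using comm_group.free_Abelian_group_universal[OF M.a_comm_group im] by metis
  then have "\<exists>h. h \<in> hom (free_Abelian_group (carrier M \<times> carrier B)) (add_monoid M) \<and>
     (\<forall>x\<in>carrier M. \<forall>b\<in>carrier B. h (frag_of (x, b)) = b \<odot>\<^bsub>M\<^esub> x)" by auto
  from someI_ex[OF this] show
    "tensor_eval B M \<in> hom (free_Abelian_group (carrier M \<times> carrier B)) (add_monoid M)"
    "x \<in> carrier M \<Longrightarrow> b \<in> carrier B \<Longrightarrow> tensor_eval B M (frag_of (x, b)) = b \<odot>\<^bsub>M\<^esub> x"
    unfolding tensor_eval_def by blast+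
qed

lemma tfree_alg_iff: "c \<in> tfree M (alg_module f B) \<longleftrightarrow> Poly_Mapping.keys c \<subseteq> carrier M \<times> carrier B"
  by (simp add: tfree_def)

lemma tensor_eval_closed: "c \<in> tfree M (alg_module f B) \<Longrightarrow> tensor_eval B M c \<in> carrier M"
  using hom_in_carrier[OF tensor_eval_hom(1), of c] by (simp add: tfree_alg_iff)

lemma tensor_eval_add:
  "c \<in> tfree M (alg_module f B) \<Longrightarrow> c' \<in> tfree M (alg_module f B) \<Longrightarrow>
    tensor_eval B M (c + c') = tensor_eval B M c \<oplus>\<^bsub>M\<^esub> tensor_eval B M c'"
  using hom_mult[OF tensor_eval_hom(1), of c c'] by (simp add: tfree_alg_iff)

lemma tensor_eval_0: "tensor_eval B M 0 = \<zero>\<^bsub>M\<^esub>"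
  using hom_one[OF tensor_eval_hom(1)] M.add.is_group by simp

lemma tensor_eval_diff:
  assumes "c \<in> tfree M (alg_module f B)" "c' \<in> tfree M (alg_module f B)"
  shows "tensor_eval B M (c - c') = tensor_eval B M c \<ominus>\<^bsub>M\<^esub> tensor_eval B M c'"
proof -
  have "tensor_eval B M (c - c') \<oplus>\<^bsub>M\<^esub> tensor_eval B M c' = tensor_eval B M c"
    using tensor_eval_add[of "c - c'" f c'] assms by (simp add: subgrp_diff[OF subgrp_tfree])
  moreover have "tensor_eval B M (c - c') \<in> carrier M" "tensor_eval B M c' \<in> carrier M" "tensor_eval B M c \<in> carrier M"
    using assms by (auto intro!: tensor_eval_closed[of _ f] subgrp_diff[OF subgrp_tfree])
  ultimately show ?thesis by (metis M.add.inv_solve_right M.minus_eq a_inv_def)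
qed

lemma module_alg_self:
  assumes "\<And>b. b \<in> carrier B \<Longrightarrow> g b = b" shows "Module.module B (alg_module g B)"
  by (rule module_alg_module) (auto simp: is_cring assms ring_hom_def)

text \<open>Every tensor is congruent to its value tensored with 1, so the relations are exactly the
  kernel of evaluation. The structure map \<open>g\<close> is required to be the identity on the
  carrier only, because the restriction from a stalk to itself is known to be the identity only
  there.\<close>

lemma tensor_eval_rel_iff:
  assumes g: "\<And>b. b \<in> carrier B \<Longrightarrow> g b = b" and c: "c \<in> tfree M (alg_module g B)"
  shows "c \<in> tensor_rel B M (alg_module g B) \<longleftrightarrow> tensor_eval B M c = \<zero>\<^bsub>M\<^esub>"
    and "c - frag_of (tensor_eval B M c, \<one>\<^bsub>B\<^esub>) \<in> tensor_rel B M (alg_module g B)"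
proof -
  let ?P = "alg_module g B"
  note P = module_alg_self[OF g]
  note sg = subgrp_tensor_rel[OF M P]
  have ker: "tensor_eval B M c = \<zero>\<^bsub>M\<^esub>" if "c \<in> tensor_rel B M ?P" for c
  proof -
    let ?S = "{c \<in> tfree M ?P. tensor_eval B M c = \<zero>\<^bsub>M\<^esub>}"
    have "c \<in> ?S"
    proof (rule tensor_rel_induct[OF M P that])
      show "subgrp ?S"
        by (auto simp: subgrp_def subgrp_0[OF subgrp_tfree] subgrp_diff[OF subgrp_tfree] tensor_eval_0 tensor_eval_diff M.r_neg M.minus_eq)
    next
      fix x x' y assume "x \<in> carrier M" "x' \<in> carrier M" "y \<in> carrier ?P"
      then show "frag_of (x \<oplus>\<^bsub>M\<^esub> x', y) - frag_of (x, y) - frag_of (x', y) \<in> ?S"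
        by (simp add: subgrp_diff[OF subgrp_tfree] tensor_eval_diff[of _ g] tensor_eval_hom(2) smult_r_distr M.minus_eq M.a_ac M.r_neg M.minus_add M.r_neg1 M.r_neg2)
    next
      fix x y y' assume "x \<in> carrier M" "y \<in> carrier ?P" "y' \<in> carrier ?P"
      then show "frag_of (x, y \<oplus>\<^bsub>?P\<^esub> y') - frag_of (x, y) - frag_of (x, y') \<in> ?S"
        by (simp add: subgrp_diff[OF subgrp_tfree] tensor_eval_diff[of _ g] tensor_eval_hom(2) smult_l_distr M.minus_eq M.a_ac M.r_neg M.minus_add M.r_neg1 M.r_neg2)
    next
      fix r x y assume "r \<in> carrier B" "x \<in> carrier M" "y \<in> carrier ?P"
      then show "frag_of (r \<odot>\<^bsub>M\<^esub> x, y) - frag_of (x, r \<odot>\<^bsub>?P\<^esub> y) \<in> ?S"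
        by (simp add: subgrp_diff[OF subgrp_tfree] tensor_eval_diff[of _ g] tensor_eval_hom(2) g smult_assoc1[symmetric] m_comm M.r_neg M.minus_eq)
    qed
    then show ?thesis by simp
  qed
  show *: "c - frag_of (tensor_eval B M c, \<one>\<^bsub>B\<^esub>) \<in> tensor_rel B M ?P"
    using c
  proof (induction c rule: tfree_induct)
    case zero
    have "frag_of (\<zero>\<^bsub>M\<^esub>, \<one>\<^bsub>B\<^esub>) \<in> tensor_rel B M ?P"
      by (rule tensor_rel_zero_left[OF M P]) auto
    then show ?case using subgrp_uminus[OF sg] by (force simp: tensor_eval_0)
  next
    case (one x y)
    then have "frag_of (y \<odot>\<^bsub>M\<^esub> x, \<one>\<^bsub>B\<^esub>) - frag_of (x, y \<odot>\<^bsub>?P\<^esub> \<one>\<^bsub>B\<^esub>) \<in> tensor_rel B M ?P"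
      by (intro tensor_rel_smult) auto
    then show ?case using one subgrp_sym[OF sg] by (simp add: tensor_eval_hom(2) g)
  next
    case (diff a b)
    let ?a = "tensor_eval B M a" and ?b = "tensor_eval B M b"
    have cl: "?a \<in> carrier M" "?b \<in> carrier M" using diff tensor_eval_closed by auto
    have "frag_of (?a \<ominus>\<^bsub>M\<^esub> ?b, \<one>\<^bsub>B\<^esub>) - (frag_of (?a, \<one>\<^bsub>B\<^esub>) - frag_of (?b, \<one>\<^bsub>B\<^esub>)) \<in> tensor_rel B M ?P"
      by (rule tensor_rel_minus_left[OF M P cl]) auto
    from subgrp_diff[OF sg subgrp_diff[OF sg diff(3,4)] this] show ?case
      using diff(1,2) by (simp add: tensor_eval_diff algebra_simps)
  qed
  show "c \<in> tensor_rel B M ?P \<longleftrightarrow> tensor_eval B M c = \<zero>\<^bsub>M\<^esub>"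
  proof
    assume "tensor_eval B M c = \<zero>\<^bsub>M\<^esub>"
    then have "frag_of (tensor_eval B M c, \<one>\<^bsub>B\<^esub>) \<in> tensor_rel B M ?P"
      using tensor_rel_zero_left[OF M P, of "\<one>\<^bsub>B\<^esub>"] by simp
    then show "c \<in> tensor_rel B M ?P" using subgrp_cong[OF sg *] by simp
  qed (rule ker)
qed

end

lemma tensor_eval_natural:
  assumes M: "Module.module B M" and N: "Module.module B N" and h: "h \<in> mod_hom B M N"
    and c: "c \<in> tfree M (alg_module f B)"
  shows "h (tensor_eval B M c) = tensor_eval B N (tensor_frag h (\<lambda>y. y) c)"
  using c
proof (induction c rule: tfree_induct)
  case zero
  show ?case using mod_hom_zero[OF assms(1-3)] by (simp add: tensor_eval_0 M N)
next
  case (one x y)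
  then show ?case using mod_homD[OF h] by (simp add: tensor_eval_hom(2) M N)
next
  case (diff a b)
  have "tensor_frag h (\<lambda>y. y) c \<in> tfree N (alg_module f B)" if "c \<in> tfree M (alg_module f B)" for c
    by (rule tensor_frag_tfree[OF that]) (use mod_homD(1)[OF h] in auto)
  then show ?case using diff
    by (simp add: tensor_frag_diff tensor_eval_diff[OF M, of _ f] tensor_eval_diff[OF N, of _ f] mod_hom_minus[OF M N h] tensor_eval_closed[OF M, of _ f])
qed

definition semilinear :: "('a, 'x) ring_scheme \<Rightarrow> ('a \<Rightarrow> 'b) \<Rightarrow> ('a, 'm) module \<Rightarrow> ('b, 'n) module \<Rightarrow> ('m \<Rightarrow> 'n) \<Rightarrow> bool" where
  "semilinear A f M N \<phi> \<longleftrightarrow> add_hom M N \<phi> \<and> (\<forall>r\<in>carrier A. \<forall>x\<in>carrier M. \<phi> (r \<odot>\<^bsub>M\<^esub> x) = f r \<odot>\<^bsub>N\<^esub> \<phi> x)"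

lemma semilinearD:
  assumes "semilinear A f M N \<phi>"
  shows "x \<in> carrier M \<Longrightarrow> \<phi> x \<in> carrier N"
    and "x \<in> carrier M \<Longrightarrow> y \<in> carrier M \<Longrightarrow> \<phi> (x \<oplus>\<^bsub>M\<^esub> y) = \<phi> x \<oplus>\<^bsub>N\<^esub> \<phi> y"
    and "r \<in> carrier A \<Longrightarrow> x \<in> carrier M \<Longrightarrow> \<phi> (r \<odot>\<^bsub>M\<^esub> x) = f r \<odot>\<^bsub>N\<^esub> \<phi> x"
  using assms by (auto simp: semilinear_def add_hom_def)

text \<open>\<open>\<phi>\<close> induces an isomorphism \<open>M \<otimes>\<^sub>A B \<rightarrow> N\<close>.\<close>

definition base_change ::
  "'a ring \<Rightarrow> 'b ring \<Rightarrow> ('a \<Rightarrow> 'b) \<Rightarrow> ('a, 'm) module \<Rightarrow> ('b, 'n) module \<Rightarrow> ('m \<Rightarrow> 'n) \<Rightarrow> bool" where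
  "base_change A B f M N \<phi> \<longleftrightarrow>
     (\<forall>y\<in>carrier N. \<exists>t\<in>tfree M (alg_module f B). tensor_eval B N (tensor_frag \<phi> (\<lambda>y. y) t) = y) \<and>
     (\<forall>t\<in>tfree M (alg_module f B). tensor_eval B N (tensor_frag \<phi> (\<lambda>y. y) t) = \<zero>\<^bsub>N\<^esub> \<longrightarrow>
       t \<in> tensor_rel A M (alg_module f B))"

lemma base_changeD:
  assumes "base_change A B f M N \<phi>"
  shows "y \<in> carrier N \<Longrightarrow> \<exists>t\<in>tfree M (alg_module f B). tensor_eval B N (tensor_frag \<phi> (\<lambda>y. y) t) = y"
    and "t \<in> tfree M (alg_module f B) \<Longrightarrow> tensor_eval B N (tensor_frag \<phi> (\<lambda>y. y) t) = \<zero>\<^bsub>N\<^esub> \<Longrightarrow>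
       t \<in> tensor_rel A M (alg_module f B)"
  using assms unfolding base_change_def by blast+

lemma tensor_frag_semilinear_tfree:
  assumes "semilinear A f M N \<phi>" "t \<in> tfree M (alg_module f B)"
  shows "tensor_frag \<phi> (\<lambda>y. y) t \<in> tfree N (alg_module f' B)"
  by (rule tensor_frag_tfree[OF assms(2)]) (use semilinearD(1)[OF assms(1)] in auto)

lemma tensor_frag_semilinear_rel:
  assumes A: "cring A" and B: "cring B" and f: "f \<in> ring_hom A B" and M: "Module.module A M"
    and N: "Module.module B N" and \<phi>: "semilinear A f M N \<phi>" and g: "\<And>b. b \<in> carrier B \<Longrightarrow> g b = b"
    and t: "t \<in> tensor_rel A M (alg_module f B)"
  shows "tensor_frag \<phi> (\<lambda>y. y) t \<in> tensor_rel B N (alg_module g B)"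
proof (rule tensor_frag_rel_gen[OF M module_alg_module[OF A f B] N module_alg_self[OF N g] _ _ _ t])
  show "add_hom M N \<phi>" using \<phi> by (simp add: semilinear_def)
  show "add_hom (alg_module f B) (alg_module g B) (\<lambda>y. y)" by (simp add: add_hom_def)
  show "\<exists>s\<in>carrier B. (\<forall>x\<in>carrier M. \<phi> (r \<odot>\<^bsub>M\<^esub> x) = s \<odot>\<^bsub>N\<^esub> \<phi> x) \<and>
        (\<forall>y\<in>carrier (alg_module f B). r \<odot>\<^bsub>alg_module f B\<^esub> y = s \<odot>\<^bsub>alg_module g B\<^esub> y)"
    if "r \<in> carrier A" for r
    using that semilinearD(3)[OF \<phi>] ring_hom_closed[OF f that] by (intro bexI[of _ "f r"]) (auto simp: g)
qed

text \<open>A diagram chase between two right exact rows. Values in \<open>M'\<close> are reached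
  through \<open>R0'\<close>; a tensor over \<open>M\<close> with value 0 is lifted to
  \<open>R0\<close> and corrected by the image of a tensor over \<open>R1\<close>.\<close>

lemma base_change_cokernel:
  assumes A: "cring A" and B: "cring B" and f: "f \<in> ring_hom A B"
    and mods: "Module.module A R1" "Module.module A R0" "Module.module A M"
      "Module.module B R1'" "Module.module B R0'" "Module.module B M'"
    and F: "F \<in> mod_hom A R1 R0" and g: "g \<in> mod_hom A R0 M"
    and F': "F' \<in> mod_hom B R1' R0'" and g': "g' \<in> mod_hom B R0' M'"
    and gF: "\<And>x. x \<in> carrier R1 \<Longrightarrow> g (F x) = \<zero>\<^bsub>M\<^esub>"
    and gsurj: "\<And>m. m \<in> carrier M \<Longrightarrow> \<exists>x\<in>carrier R0. g x = m"
    and ex': "\<And>x. x \<in> carrier R0' \<Longrightarrow> g' x = \<zero>\<^bsub>M'\<^esub> \<Longrightarrow> \<exists>y\<in>carrier R1'. F' y = x"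
    and gsurj': "\<And>m. m \<in> carrier M' \<Longrightarrow> \<exists>x\<in>carrier R0'. g' x = m"
    and i1: "semilinear A f R1 R1' i1" and i0: "semilinear A f R0 R0' i0" and \<phi>: "semilinear A f M M' \<phi>"
    and i0F: "\<And>x. x \<in> carrier R1 \<Longrightarrow> i0 (F x) = F' (i1 x)"
    and \<phi>g: "\<And>x. x \<in> carrier R0 \<Longrightarrow> \<phi> (g x) = g' (i0 x)"
    and bc1: "base_change A B f R1 R1' i1" and bc0: "base_change A B f R0 R0' i0"
  shows "base_change A B f M M' \<phi>"
  unfolding base_change_def
proof (intro conjI ballI impI)
  let ?P = "alg_module f B"
  note P = module_alg_module[OF A f B]
  have gi0: "tensor_eval B M' (tensor_frag \<phi> (\<lambda>y. y) (tensor_frag g (\<lambda>y. y) t)) =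
      g' (tensor_eval B R0' (tensor_frag i0 (\<lambda>y. y) t))" if t: "t \<in> tfree R0 ?P" for t
  proof -
    have "tensor_frag \<phi> (\<lambda>y. y) (tensor_frag g (\<lambda>y. y) t) = tensor_frag g' (\<lambda>y. y) (tensor_frag i0 (\<lambda>y. y) t)"
      unfolding tensor_frag_comp by (rule tensor_frag_cong[OF t]) (simp_all add: \<phi>g)
    then show ?thesis
      using tensor_eval_natural[OF mods(5,6) g' tensor_frag_semilinear_tfree[OF i0 t, where f'="\<lambda>b. b"]] by simp
  qed
  {
    fix m assume "m \<in> carrier M'"
    then obtain x where x: "x \<in> carrier R0'" "g' x = m" using gsurj' by blast
    obtain t where t: "t \<in> tfree R0 ?P" "tensor_eval B R0' (tensor_frag i0 (\<lambda>y. y) t) = x"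
      using base_changeD(1)[OF bc0 x(1)] by blast
    have "tensor_frag g (\<lambda>y. y) t \<in> tfree M ?P"
      by (rule tensor_frag_tfree[OF t(1)]) (auto simp: mod_homD(1)[OF g])
    then show "\<exists>t\<in>tfree M ?P. tensor_eval B M' (tensor_frag \<phi> (\<lambda>y. y) t) = m"
      using gi0[OF t(1)] t(2) x(2) by auto
  }
  fix t assume t: "t \<in> tfree M ?P" "tensor_eval B M' (tensor_frag \<phi> (\<lambda>y. y) t) = \<zero>\<^bsub>M'\<^esub>"
  \<comment> \<open>The value of the lift \<open>T\<close> in \<open>R0'\<close> is killed by
    \<open>g'\<close>, hence comes from \<open>R1'\<close> and so from a tensor \<open>T1\<close>
    over \<open>R1\<close>. Then \<open>T\<close> minus the image of \<open>T1\<close> has value 0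
    and is a relation, while \<open>g\<close> annihilates that image.\<close>
  obtain T where T: "T \<in> tfree R0 ?P" "tensor_frag g (\<lambda>y. y) T = t"
    using tensor_frag_lift[OF t(1), of R0 g] gsurj by blast
  let ?y = "tensor_eval B R0' (tensor_frag i0 (\<lambda>y. y) T)"
  have "?y \<in> carrier R0'" by (rule tensor_eval_closed[OF mods(5) tensor_frag_semilinear_tfree[OF i0 T(1), where f'="\<lambda>b. b"]])
  then obtain v where v: "v \<in> carrier R1'" "F' v = ?y"
    using ex' gi0[OF T(1)] T(2) t(2) by auto
  obtain T1 where T1: "T1 \<in> tfree R1 ?P" "tensor_eval B R1' (tensor_frag i1 (\<lambda>y. y) T1) = v"
    using base_changeD(1)[OF bc1 v(1)] by blast
  let ?F = "tensor_frag F (\<lambda>y. y) T1"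
  have FT: "?F \<in> tfree R0 ?P" by (rule tensor_frag_tfree[OF T1(1)]) (auto simp: mod_homD(1)[OF F])
  have "tensor_frag i0 (\<lambda>y. y) ?F = tensor_frag F' (\<lambda>y. y) (tensor_frag i1 (\<lambda>y. y) T1)"
    unfolding tensor_frag_comp by (rule tensor_frag_cong[OF T1(1)]) (simp_all add: i0F)
  then have evF: "tensor_eval B R0' (tensor_frag i0 (\<lambda>y. y) ?F) = ?y"
    using tensor_eval_natural[OF mods(4,5) F' tensor_frag_semilinear_tfree[OF i1 T1(1), where f'="\<lambda>b. b"]] T1(2) v(2) by simp
  have "tensor_eval B R0' (tensor_frag i0 (\<lambda>y. y) (T - ?F)) = \<zero>\<^bsub>R0'\<^esub>"
    using module_minus_eq_zero_iff[OF mods(5) \<open>?y \<in> carrier R0'\<close> \<open>?y \<in> carrier R0'\<close>] evF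
    by (simp add: tensor_frag_diff
        tensor_eval_diff[OF mods(5) tensor_frag_semilinear_tfree[OF i0 T(1)] tensor_frag_semilinear_tfree[OF i0 FT, where f'="\<lambda>b. b"]])
  then have "T - ?F \<in> tensor_rel A R0 ?P"
    by (intro base_changeD(2)[OF bc0] subgrp_diff[OF subgrp_tfree] T FT)
  then have "tensor_frag g (\<lambda>y. y) (T - ?F) \<in> tensor_rel A M ?P"
    by (rule tensor_frag_rel[OF mods(2) P mods(3) g])
  moreover have "tensor_frag g (\<lambda>y. y) ?F \<in> tensor_rel A M ?P"
    unfolding tensor_frag_comp by (rule tensor_frag_zero_rel[OF mods(3) P T1(1)]) (simp add: gF)
  ultimately show "t \<in> tensor_rel A M ?P"
    using subgrp_cong[OF subgrp_tensor_rel[OF mods(3) P], of t "tensor_frag g (\<lambda>y. y) ?F"]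
    by (simp add: tensor_frag_diff T(2))
qed

section \<open>Free modules\<close>

text \<open>The sections of \<open>free_sheaf\<close> over one open set, isolated so that they can
  be studied over any commutative ring.\<close>

definition free_module :: "'a ring \<Rightarrow> 'j set \<Rightarrow> ('a, 'j \<Rightarrow> 'a) module" where
  "free_module A J = mk_module {x \<in> J \<rightarrow>\<^sub>E carrier A. finite {j \<in> J. x j \<noteq> \<zero>\<^bsub>A\<^esub>}}
     (\<lambda>j\<in>J. \<zero>\<^bsub>A\<^esub>) (\<lambda>x y. \<lambda>j\<in>J. x j \<oplus>\<^bsub>A\<^esub> y j) (\<lambda>r x. \<lambda>j\<in>J. r \<otimes>\<^bsub>A\<^esub> x j)"

lemma free_module_simps:
  "x \<in> carrier (free_module A J) \<longleftrightarrow> x \<in> J \<rightarrow>\<^sub>E carrier A \<and> finite {j \<in> J. x j \<noteq> \<zero>\<^bsub>A\<^esub>}"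
  "\<zero>\<^bsub>free_module A J\<^esub> = (\<lambda>j\<in>J. \<zero>\<^bsub>A\<^esub>)"
  "x \<oplus>\<^bsub>free_module A J\<^esub> y = (\<lambda>j\<in>J. x j \<oplus>\<^bsub>A\<^esub> y j)"
  "r \<odot>\<^bsub>free_module A J\<^esub> x = (\<lambda>j\<in>J. r \<otimes>\<^bsub>A\<^esub> x j)"
  by (simp_all add: free_module_def)

lemma module_free_module:
  assumes "cring A" shows "Module.module A (free_module A J)"
proof -
  interpret cring A by fact
  have fin: "finite {j \<in> J. h (x j) (y j) \<noteq> \<zero>\<^bsub>A\<^esub>}"
    if "finite {j \<in> J. x j \<noteq> \<zero>\<^bsub>A\<^esub>}" "finite {j \<in> J. y j \<noteq> \<zero>\<^bsub>A\<^esub>}" "h \<zero>\<^bsub>A\<^esub> \<zero>\<^bsub>A\<^esub> = \<zero>\<^bsub>A\<^esub>" for h :: "'a \<Rightarrow> 'a \<Rightarrow> 'a" and x y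
    by (rule finite_subset[OF _ finite_UnI[OF that(1,2)]]) (use that(3) in force)
  have fin1: "finite {j \<in> J. h (x j) \<noteq> \<zero>\<^bsub>A\<^esub>}"
    if "finite {j \<in> J. x j \<noteq> \<zero>\<^bsub>A\<^esub>}" "h \<zero>\<^bsub>A\<^esub> = \<zero>\<^bsub>A\<^esub>" for h :: "'a \<Rightarrow> 'a" and x
    using fin[of x x "\<lambda>u v. h u"] that by simp
  have mem: "x j \<in> carrier A" if "x \<in> J \<rightarrow>\<^sub>E carrier A" "j \<in> J" for x j
    using that by auto
  have ext: "x \<in> extensional J" if "x \<in> J \<rightarrow>\<^sub>E carrier A" for x
    using that by (simp add: PiE_iff)
  have eqI: "x = y" if "\<And>j. j \<in> J \<Longrightarrow> x j = y j" "x \<in> extensional J" "y \<in> extensional J" for x y :: "_ \<Rightarrow> 'a"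
    using that by (metis extensionalityI)
  have cong: "{j \<in> J. (\<lambda>j\<in>J. g j) j \<noteq> \<zero>\<^bsub>A\<^esub>} = {j \<in> J. g j \<noteq> \<zero>\<^bsub>A\<^esub>}" for g :: "_ \<Rightarrow> 'a" by auto
  show ?thesis
  proof (intro moduleI abelian_groupI)
    fix x y assume "x \<in> carrier (free_module A J)" "y \<in> carrier (free_module A J)"
    then show "x \<oplus>\<^bsub>free_module A J\<^esub> y \<in> carrier (free_module A J)"
      using fin[of x y "\<lambda>u v. u \<oplus>\<^bsub>A\<^esub> v"] by (auto simp: free_module_simps cong simp del: restrict_apply)
  next
    fix x assume x: "x \<in> carrier (free_module A J)"
    show "\<exists>y\<in>carrier (free_module A J). y \<oplus>\<^bsub>free_module A J\<^esub> x = \<zero>\<^bsub>free_module A J\<^esub>"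
    proof
      show "(\<lambda>j\<in>J. \<ominus>\<^bsub>A\<^esub> x j) \<in> carrier (free_module A J)"
        using x fin1[of x "\<lambda>u. \<ominus>\<^bsub>A\<^esub> u"] by (auto simp: free_module_simps cong simp del: restrict_apply)
      show "(\<lambda>j\<in>J. \<ominus>\<^bsub>A\<^esub> x j) \<oplus>\<^bsub>free_module A J\<^esub> x = \<zero>\<^bsub>free_module A J\<^esub>"
        using x by (auto simp: free_module_simps l_neg mem intro!: restrict_ext)
    qed
  next
    fix r x assume "r \<in> carrier A" "x \<in> carrier (free_module A J)"
    then show "r \<odot>\<^bsub>free_module A J\<^esub> x \<in> carrier (free_module A J)"
      using fin1[of x "\<lambda>u. r \<otimes>\<^bsub>A\<^esub> u"] by (auto simp: free_module_simps cong simp del: restrict_apply)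
  next
    show "\<zero>\<^bsub>free_module A J\<^esub> \<in> carrier (free_module A J)"
      by (auto simp: free_module_simps cong simp del: restrict_apply)
  qed (auto simp: free_module_simps mem ext a_ac l_distr r_distr m_assoc intro!: eqI assms restrict_extensional)
qed

definition free_inj :: "'a ring \<Rightarrow> 'j set \<Rightarrow> 'j \<Rightarrow> 'a \<Rightarrow> 'j \<Rightarrow> 'a" where
  "free_inj A J j c = (\<lambda>i\<in>J. if i = j then c else \<zero>\<^bsub>A\<^esub>)"

lemma free_inj_closed: "cring A \<Longrightarrow> c \<in> carrier A \<Longrightarrow> free_inj A J j c \<in> carrier (free_module A J)"
proof -
  assume "cring A" "c \<in> carrier A"
  interpret cring A by fact
  have "finite {i \<in> J. free_inj A J j c i \<noteq> \<zero>\<^bsub>A\<^esub>}"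
    by (rule finite_subset[of _ "{j}"]) (auto simp: free_inj_def)
  then show ?thesis using \<open>c \<in> carrier A\<close> by (auto simp: free_module_simps free_inj_def)
qed

lemma free_inj_hom:
  assumes "cring A" "\<alpha> \<in> ring_hom R A"
  shows "free_inj A J j \<in> mod_hom R (alg_module \<alpha> A) (restrict_scalars \<alpha> (free_module A J))"
proof -
  interpret cring A by fact
  show ?thesis using assms free_inj_closed[OF assms(1)]
    by (auto simp: mod_hom_def free_module_simps(2-4)) (auto simp: free_inj_def ring_hom_closed[OF assms(2)])
qed

lemma free_proj_hom:
  "j \<in> J \<Longrightarrow> (\<lambda>x. x j) \<in> mod_hom R (restrict_scalars \<alpha> (free_module A J)) (alg_module \<alpha> A)"
  by (auto simp: mod_hom_def free_module_simps)

lemma free_module_split: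
  assumes "cring A" "x \<in> carrier (free_module A J)" "j \<in> J"
  shows "x(j := \<zero>\<^bsub>A\<^esub>) \<in> carrier (free_module A J)"
    and "x = x(j := \<zero>\<^bsub>A\<^esub>) \<oplus>\<^bsub>free_module A J\<^esub> free_inj A J j (x j)"
proof -
  interpret cring A by fact
  have "finite {i \<in> J. (x(j := \<zero>\<^bsub>A\<^esub>)) i \<noteq> \<zero>\<^bsub>A\<^esub>}"
    by (rule finite_subset[of _ "{i \<in> J. x i \<noteq> \<zero>\<^bsub>A\<^esub>}"]) (use assms(2) in \<open>auto simp: free_module_simps\<close>)
  then show "x(j := \<zero>\<^bsub>A\<^esub>) \<in> carrier (free_module A J)"
    using assms(2,3) by (auto simp: free_module_simps PiE_iff extensional_def)
  show "x = x(j := \<zero>\<^bsub>A\<^esub>) \<oplus>\<^bsub>free_module A J\<^esub> free_inj A J j (x j)"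
    using assms(2,3) by (auto simp: free_module_simps free_inj_def PiE_iff extensional_def fun_eq_iff)
qed

lemma semilinear_free:
  assumes "cring A" "cring B" "cring C" "cring C'" "f \<in> ring_hom A B" "\<alpha> \<in> ring_hom A C" "\<beta> \<in> ring_hom B C'" "h \<in> ring_hom C C'"
    and "\<And>a. a \<in> carrier A \<Longrightarrow> h (\<alpha> a) = \<beta> (f a)"
  shows "semilinear A f (restrict_scalars \<alpha> (free_module C J)) (restrict_scalars \<beta> (free_module C' J)) (\<lambda>x. \<lambda>j\<in>J. h (x j))"
proof -
  have h0: "h \<zero>\<^bsub>C\<^esub> = \<zero>\<^bsub>C'\<^esub>" using assms by (intro ring_hom_zero) (auto simp: cring_def)
  have "finite {j \<in> J. h (x j) \<noteq> \<zero>\<^bsub>C'\<^esub>}" if "finite {j \<in> J. x j \<noteq> \<zero>\<^bsub>C\<^esub>}" for x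
    by (rule finite_subset[OF _ that]) (auto simp: h0)
  moreover have "{j \<in> J. (\<lambda>j\<in>J. g j) j \<noteq> \<zero>\<^bsub>C'\<^esub>} = {j \<in> J. g j \<noteq> \<zero>\<^bsub>C'\<^esub>}" for g by auto
  moreover have mem: "x j \<in> carrier C" if "x \<in> J \<rightarrow>\<^sub>E carrier C" "j \<in> J" for x j
    using that by auto
  ultimately show ?thesis
    by (auto simp: semilinear_def add_hom_def free_module_simps ring_hom_closed[OF assms(8)] mem
        ring_hom_add[OF assms(8)] ring_hom_mult[OF assms(8)] ring_hom_closed[OF assms(6)] assms(9) simp del: restrict_apply)
     (auto simp: fun_eq_iff ring_hom_closed[OF assms(8)] mem
        ring_hom_add[OF assms(8)] ring_hom_mult[OF assms(8)] ring_hom_closed[OF assms(6)] assms(9))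
qed

text \<open>Tensor products commute with direct sums. Elements have finite support, so values are
  reached by induction on the support, and a tensor with value 0 is split into its coordinates, to
  each of which \<open>bc\<close> applies.\<close>

lemma base_change_free:
  assumes crings: "cring A" "cring B" "cring C" "cring C'"
    and f: "f \<in> ring_hom A B" and \<alpha>: "\<alpha> \<in> ring_hom A C" and \<beta>: "\<beta> \<in> ring_hom B C'" and h: "h \<in> ring_hom C C'"
    and h\<alpha>: "\<And>a. a \<in> carrier A \<Longrightarrow> h (\<alpha> a) = \<beta> (f a)"
    and bc: "base_change A B f (alg_module \<alpha> C) (alg_module \<beta> C') h"
  shows "base_change A B f (restrict_scalars \<alpha> (free_module C J)) (restrict_scalars \<beta> (free_module C' J)) (\<lambda>x. \<lambda>j\<in>J. h (x j))"
proof -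
  interpret C: cring C by fact
  interpret C': cring C' by fact
  let ?P = "alg_module f B" and ?R = "restrict_scalars \<alpha> (free_module C J)" and ?R' = "restrict_scalars \<beta> (free_module C' J)"
  let ?h = "\<lambda>x. \<lambda>j\<in>J. h (x j)" and ?C = "alg_module \<alpha> C" and ?C' = "alg_module \<beta> C'"
  have h0: "h \<zero>\<^bsub>C\<^esub> = \<zero>\<^bsub>C'\<^esub>" using crings h by (intro ring_hom_zero) (auto simp: cring_def)
  note P = module_alg_module[OF crings(1) f crings(2)]
  note R = module_restrict_scalars[OF crings(1) \<alpha> module_free_module[OF crings(3)], of J]
  note R' = module_restrict_scalars[OF crings(2) \<beta> module_free_module[OF crings(4)], of J]
  note C = module_alg_module[OF crings(1) \<alpha> crings(3)] and C' = module_alg_module[OF crings(2) \<beta> crings(4)]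
  note sh = semilinear_free[OF crings f \<alpha> \<beta> h h\<alpha>, of J]
  note sg = subgrp_tensor_rel[OF R P]
  have hc: "semilinear A f ?C ?C' h"
    using h h\<alpha> \<alpha> by (auto simp: semilinear_def add_hom_def ring_hom_closed ring_hom_add ring_hom_mult)
  have inj_tf: "tensor_frag (free_inj C J j) (\<lambda>y. y) t \<in> tfree ?R ?P" if "t \<in> tfree ?C ?P" for t j
    by (rule tensor_frag_tfree[OF that]) (auto intro: free_inj_closed crings)
  have gen: "\<exists>t\<in>tfree ?R ?P. tensor_eval B ?R' (tensor_frag ?h (\<lambda>y. y) t) = y"
    if "finite S" "S \<subseteq> J" "y \<in> carrier ?R'" "\<And>j. j \<in> J \<Longrightarrow> j \<notin> S \<Longrightarrow> y j = \<zero>\<^bsub>C'\<^esub>" for S y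
    using that
  proof (induction S arbitrary: y rule: finite_induct)
    case empty
    then have "y = \<zero>\<^bsub>?R'\<^esub>" by (auto simp: free_module_simps PiE_iff extensional_def fun_eq_iff)
    then show ?case using tensor_eval_0[OF R'] subgrp_0[OF subgrp_tfree] by (intro bexI[of _ 0]) auto
  next
    case (insert j S)
    let ?y = "y(j := \<zero>\<^bsub>C'\<^esub>)"
    have j: "j \<in> J" and y: "y \<in> carrier (free_module C' J)" using insert by auto
    note sp = free_module_split[OF crings(4) y j]
    have "\<exists>t\<in>tfree ?R ?P. tensor_eval B ?R' (tensor_frag ?h (\<lambda>y. y) t) = ?y"
    proof (rule insert.IH)
      show "?y \<in> carrier ?R'" using sp(1) by simp
      show "?y i = \<zero>\<^bsub>C'\<^esub>" if "i \<in> J" "i \<notin> S" for i using that insert.prems(3)[of i] by auto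
    qed (use insert.prems in auto)
    then obtain t where t: "t \<in> tfree ?R ?P" "tensor_eval B ?R' (tensor_frag ?h (\<lambda>y. y) t) = ?y" by blast
    have "y j \<in> carrier ?C'" using y j by (auto simp: free_module_simps)
    from base_changeD(1)[OF bc this] obtain u where u: "u \<in> tfree ?C ?P" "tensor_eval B ?C' (tensor_frag h (\<lambda>y. y) u) = y j" by blast
    let ?u = "tensor_frag (free_inj C J j) (\<lambda>y. y) u"
    have "tensor_frag ?h (\<lambda>y. y) ?u = tensor_frag (free_inj C' J j) (\<lambda>y. y) (tensor_frag h (\<lambda>y. y) u)"
      unfolding tensor_frag_comp by (rule tensor_frag_cong[OF u(1)]) (auto simp: free_inj_def h0)
    then have "tensor_eval B ?R' (tensor_frag ?h (\<lambda>y. y) ?u) = free_inj C' J j (y j)"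
      using tensor_eval_natural[OF C' R' free_inj_hom[OF crings(4) \<beta>] tensor_frag_semilinear_tfree[OF hc u(1), where f'="\<lambda>b. b"], of j] u(2) by simp
    then have "tensor_eval B ?R' (tensor_frag ?h (\<lambda>y. y) (t + ?u)) = y"
      using tensor_eval_add[OF R' tensor_frag_semilinear_tfree[OF sh t(1)] tensor_frag_semilinear_tfree[OF sh inj_tf[OF u(1)], where f'="\<lambda>b. b"]] t(2) sp(2)
      by (simp add: tensor_frag_add)
    moreover have "t + ?u \<in> tfree ?R ?P" by (intro subgrp_add[OF subgrp_tfree] t inj_tf u)
    ultimately show ?case by blast
  qed
  have split: "frag_of (x, b) - (\<Sum>j\<in>S. frag_of (free_inj C J j (x j), b)) \<in> tensor_rel A ?R ?P"
    if "finite S" "S \<subseteq> J" "x \<in> carrier ?R" "\<And>j. j \<in> J \<Longrightarrow> j \<notin> S \<Longrightarrow> x j = \<zero>\<^bsub>C\<^esub>" "b \<in> carrier B" for S x b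
    using that
  proof (induction S arbitrary: x rule: finite_induct)
    case empty
    then have "x = \<zero>\<^bsub>?R\<^esub>" by (auto simp: free_module_simps PiE_iff extensional_def fun_eq_iff)
    then show ?case using tensor_rel_zero_left[OF R P, of b] empty by simp
  next
    case (insert j S)
    let ?x = "x(j := \<zero>\<^bsub>C\<^esub>)"
    have j: "j \<in> J" and x: "x \<in> carrier (free_module C J)" using insert by auto
    note sp = free_module_split[OF crings(3) x j]
    have xj: "x j \<in> carrier C" using x j by (auto simp: free_module_simps)
    have "frag_of (?x \<oplus>\<^bsub>?R\<^esub> free_inj C J j (x j), b) - frag_of (?x, b) - frag_of (free_inj C J j (x j), b) \<in> tensor_rel A ?R ?P"
      by (rule tensor_rel_add_left) (use sp(1) free_inj_closed[OF crings(3) xj] insert.prems in auto)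
    then have "frag_of (x, b) - frag_of (?x, b) - frag_of (free_inj C J j (x j), b) \<in> tensor_rel A ?R ?P"
      using sp(2) by simp
    moreover have "frag_of (?x, b) - (\<Sum>i\<in>S. frag_of (free_inj C J i (?x i), b)) \<in> tensor_rel A ?R ?P"
    proof (rule insert.IH)
      show "?x \<in> carrier ?R" using sp(1) by simp
      show "?x i = \<zero>\<^bsub>C\<^esub>" if "i \<in> J" "i \<notin> S" for i using that insert.prems(3)[of i] by auto
      show "S \<subseteq> J" using insert.prems(1) by simp
      show "b \<in> carrier B" by (rule insert.prems(4))
    qed
    moreover have "(\<Sum>i\<in>S. frag_of (free_inj C J i (?x i), b)) = (\<Sum>i\<in>S. frag_of (free_inj C J i (x i), b))"
      using insert.hyps by (intro sum.cong) auto
    ultimately have "(frag_of (x, b) - frag_of (?x, b) - frag_of (free_inj C J j (x j), b)) +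
        (frag_of (?x, b) - (\<Sum>i\<in>S. frag_of (free_inj C J i (x i), b))) \<in> tensor_rel A ?R ?P"
      by (intro subgrp_add[OF sg]) auto
    then show ?case using insert.hyps by (simp add: algebra_simps)
  qed
  \<comment> \<open>The condition asks that every larger finite set works as well; this lets the
    sets belonging to two tensors be united in the induction.\<close>
  define Q where "Q t S \<longleftrightarrow> finite S \<and> S \<subseteq> J \<and> (\<forall>S'. finite S' \<longrightarrow> S \<subseteq> S' \<longrightarrow> S' \<subseteq> J \<longrightarrow>
      t - (\<Sum>j\<in>S'. tensor_frag (\<lambda>x. free_inj C J j (x j)) (\<lambda>y. y) t) \<in> tensor_rel A ?R ?P)" for t S
  have split': "\<exists>S. Q t S" if "t \<in> tfree ?R ?P" for t
    using that
  proof (induction t rule: tfree_induct)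
    case zero
    have "Q 0 {}" using subgrp_0[OF sg] by (simp add: Q_def)
    then show ?case by blast
  next
    case (one x y)
    have "Q (frag_of (x, y)) {j \<in> J. x j \<noteq> \<zero>\<^bsub>C\<^esub>}"
      unfolding Q_def
    proof (intro conjI allI impI)
      show "finite {j \<in> J. x j \<noteq> \<zero>\<^bsub>C\<^esub>}" using one(1) by (simp add: free_module_simps)
      fix S' assume S': "finite S'" "{j \<in> J. x j \<noteq> \<zero>\<^bsub>C\<^esub>} \<subseteq> S'" "S' \<subseteq> J"
      have "frag_of (x, y) - (\<Sum>j\<in>S'. frag_of (free_inj C J j (x j), y)) \<in> tensor_rel A ?R ?P"
        by (rule split) (use S' one in auto)
      then show "frag_of (x, y) - (\<Sum>j\<in>S'. tensor_frag (\<lambda>x. free_inj C J j (x j)) (\<lambda>y. y) (frag_of (x, y))) \<in> tensor_rel A ?R ?P"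
        by simp
    qed auto
    then show ?case by blast
  next
    case (diff a b)
    then obtain S T where ST: "Q a S" "Q b T" by blast
    have "Q (a - b) (S \<union> T)"
      unfolding Q_def
    proof (intro conjI allI impI)
      show "finite (S \<union> T)" "S \<union> T \<subseteq> J" using ST by (auto simp: Q_def)
      fix S' assume S': "finite S'" "S \<union> T \<subseteq> S'" "S' \<subseteq> J"
      have "a - (\<Sum>j\<in>S'. tensor_frag (\<lambda>x. free_inj C J j (x j)) (\<lambda>y. y) a) \<in> tensor_rel A ?R ?P"
        "b - (\<Sum>j\<in>S'. tensor_frag (\<lambda>x. free_inj C J j (x j)) (\<lambda>y. y) b) \<in> tensor_rel A ?R ?P"
        using ST S' by (auto simp: Q_def)
      from subgrp_diff[OF sg this]
      show "a - b - (\<Sum>j\<in>S'. tensor_frag (\<lambda>x. free_inj C J j (x j)) (\<lambda>y. y) (a - b)) \<in> tensor_rel A ?R ?P"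
        by (simp add: tensor_frag_diff sum_subtractf algebra_simps)
    qed
    then show ?case by blast
  qed
  show ?thesis
    unfolding base_change_def
  proof (intro conjI ballI impI)
    fix y assume y: "y \<in> carrier ?R'"
    show "\<exists>t\<in>tfree ?R ?P. tensor_eval B ?R' (tensor_frag ?h (\<lambda>y. y) t) = y"
      by (rule gen[of "{j \<in> J. y j \<noteq> \<zero>\<^bsub>C'\<^esub>}"]) (use y in \<open>auto simp: free_module_simps\<close>)
  next
    fix t assume t: "t \<in> tfree ?R ?P" "tensor_eval B ?R' (tensor_frag ?h (\<lambda>y. y) t) = \<zero>\<^bsub>?R'\<^esub>"
    obtain S where S: "finite S" "S \<subseteq> J"
      "t - (\<Sum>j\<in>S. tensor_frag (\<lambda>x. free_inj C J j (x j)) (\<lambda>y. y) t) \<in> tensor_rel A ?R ?P"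
      using split'[OF t(1)] unfolding Q_def by blast
    \<comment> \<open>The j-th coordinate of \<open>t\<close> is a tensor over \<open>C\<close>. Its
      value is the j-th coordinate of the value of \<open>t\<close>, hence 0, so it is a relation,
      and the inclusion of the j-th summand carries relations to relations.\<close>
    have "tensor_frag (\<lambda>x. free_inj C J j (x j)) (\<lambda>y. y) t \<in> tensor_rel A ?R ?P" if "j \<in> S" for j
    proof -
      have j: "j \<in> J" using that S by auto
      let ?t = "tensor_frag (\<lambda>x. x j) (\<lambda>y. y) t"
      have tj: "?t \<in> tfree ?C ?P"
        by (rule tensor_frag_tfree[OF t(1)]) (use j in \<open>auto simp: free_module_simps\<close>)
      have "tensor_frag h (\<lambda>y. y) ?t = tensor_frag (\<lambda>x. x j) (\<lambda>y. y) (tensor_frag ?h (\<lambda>y. y) t)"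
        unfolding tensor_frag_comp using j by simp
      then have "tensor_eval B ?C' (tensor_frag h (\<lambda>y. y) ?t) = \<zero>\<^bsub>?C'\<^esub>"
        using tensor_eval_natural[OF R' C' free_proj_hom[OF j] tensor_frag_semilinear_tfree[OF sh t(1), where f'="\<lambda>b. b"]] t(2) j
        by (simp add: free_module_simps)
      from base_changeD(2)[OF bc tj this] have "?t \<in> tensor_rel A ?C ?P" .
      from tensor_frag_rel[OF C P R free_inj_hom[OF crings(3) \<alpha>] this] show ?thesis
        unfolding tensor_frag_comp .
    qed
    then have "(\<Sum>j\<in>S. tensor_frag (\<lambda>x. free_inj C J j (x j)) (\<lambda>y. y) t) \<in> tensor_rel A ?R ?P"
      by (rule subgrp_sum[OF sg])
    then show "t \<in> tensor_rel A ?R ?P" using subgrp_cong[OF sg S(3)] by blast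
  qed
qed

section \<open>Finite topological spaces\<close>

lemma min_open_self: "p \<in> min_open T p"
  by (simp add: min_open_def)

lemma min_open_least: "openin T U \<Longrightarrow> p \<in> U \<Longrightarrow> min_open T p \<subseteq> U"
  by (auto simp: min_open_def)

lemma min_open_open:
  assumes "finite (topspace T)" "p \<in> topspace T" shows "openin T (min_open T p)"
  unfolding min_open_def
proof (rule openin_Inter)
  have "{U. openin T U \<and> p \<in> U} \<subseteq> Pow (topspace T)" by (auto dest: openin_subset)
  then show "finite {U. openin T U \<and> p \<in> U}" using assms(1) by (meson finite_Pow_iff finite_subset)
  show "{U. openin T U \<and> p \<in> U} \<noteq> {}" using assms(2) by blast
qed auto

lemma min_open_mono:
  assumes "finite (topspace T)" "p \<in> topspace T" "q \<in> min_open T p" shows "min_open T q \<subseteq> min_open T p"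
  using min_open_least[OF min_open_open[OF assms(1,2)] assms(3)] .

lemma min_open_topspace: "p \<in> topspace T \<Longrightarrow> min_open T p \<subseteq> topspace T"
  by (rule min_open_least) auto

lemma min_open_prod:
  assumes "finite (topspace T)" "finite (topspace T')" "p \<in> topspace T" "p' \<in> topspace T'"
  shows "min_open (prod_topology T T') (p, p') = min_open T p \<times> min_open T' p'"
proof
  show "min_open (prod_topology T T') (p, p') \<subseteq> min_open T p \<times> min_open T' p'"
    using assms by (intro min_open_least) (auto simp: openin_prod_Times_iff min_open_open min_open_self)
  show "min_open T p \<times> min_open T' p' \<subseteq> min_open (prod_topology T T') (p, p')"
  proof -
    have "min_open T p \<times> min_open T' p' \<subseteq> W" if W: "openin (prod_topology T T') W" "(p, p') \<in> W" for W
    proof -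
      obtain U V where UV: "openin T U" "openin T' V" "p \<in> U" "p' \<in> V" "U \<times> V \<subseteq> W"
        using W unfolding openin_prod_topology_alt by meson
      then show ?thesis using min_open_least[OF UV(1,3)] min_open_least[OF UV(2,4)] by blast
    qed
    then show ?thesis unfolding min_open_def[of "prod_topology T T'"] by blast
  qed
qed

lemma min_open_subtopology:
  assumes "finite (topspace T)" "openin T U" "p \<in> U"
  shows "min_open (subtopology T U) p = min_open T p"
proof -
  have p: "p \<in> topspace T" using assms openin_subset by blast
  have "openin (subtopology T U) (min_open T p)"
    using min_open_open[OF assms(1) p] min_open_least[OF assms(2,3)] assms(2) by (simp add: openin_open_subtopology)
  then show ?thesis
    using assms(2) by (auto simp: min_open_def openin_open_subtopology)
qed

lemma cring_one: "cring R \<Longrightarrow> \<one>\<^bsub>R\<^esub> \<in> carrier R" "cring R \<Longrightarrow> \<one>\<^bsub>R\<^esub> \<otimes>\<^bsub>R\<^esub> \<one>\<^bsub>R\<^esub> = \<one>\<^bsub>R\<^esub>"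
  by (simp_all add: cring.cring_simprules(6,12))

section \<open>Tensor products of algebras\<close>

definition tensor_mult :: "'a ring \<Rightarrow> 'b ring \<Rightarrow> ('a \<times> 'b \<Rightarrow>\<^sub>0 int) \<Rightarrow> ('a \<times> 'b \<Rightarrow>\<^sub>0 int) \<Rightarrow> ('a \<times> 'b \<Rightarrow>\<^sub>0 int)" where
  "tensor_mult A B c d = frag_extend (\<lambda>(x, y). frag_extend (\<lambda>(x', y'). frag_of (x \<otimes>\<^bsub>A\<^esub> x', y \<otimes>\<^bsub>B\<^esub> y')) d) c"

lemma tensor_mult_left: "tensor_mult A B c (frag_of (x', y')) = tensor_frag (\<lambda>x. x \<otimes>\<^bsub>A\<^esub> x') (\<lambda>y. y \<otimes>\<^bsub>B\<^esub> y') c"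
  by (simp add: tensor_mult_def tensor_frag_def)

lemma tensor_mult_right: "tensor_mult A B (frag_of (x, y)) d = tensor_frag (\<lambda>x'. x \<otimes>\<^bsub>A\<^esub> x') (\<lambda>y'. y \<otimes>\<^bsub>B\<^esub> y') d"
  by (simp add: tensor_mult_def tensor_frag_def)

lemma tensor_mult_diff_left: "tensor_mult A B (c - c') d = tensor_mult A B c d - tensor_mult A B c' d"
  by (simp add: tensor_mult_def frag_extend_diff)

lemma tensor_mult_diff_right: "tensor_mult A B c (d - d') = tensor_mult A B c d - tensor_mult A B c d'"
proof -
  have "Poly_Mapping.keys c \<subseteq> UNIV" by simp
  then show ?thesis
    by (induction c rule: frag_induction) (auto simp: tensor_mult_def frag_extend_diff)
qed

lemma tensor_mult_0: "tensor_mult A B 0 d = 0" "tensor_mult A B c 0 = 0"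
  using tensor_mult_diff_left[of A B 0 0 d] tensor_mult_diff_right[of A B c 0 0] by simp_all

locale tensor_algebras =
  fixes k :: "'k ring" and A :: "'a ring" and f :: "'k \<Rightarrow> 'a" and B :: "'b ring" and g :: "'k \<Rightarrow> 'b"
  assumes k: "cring k" and A: "cring A" and B: "cring B"
    and f: "f \<in> ring_hom k A" and g: "g \<in> ring_hom k B"
begin

abbreviation "M \<equiv> alg_module f A"
abbreviation "N \<equiv> alg_module g B"
abbreviation "R \<equiv> tensor_ring k A f B g"
abbreviation "tcos \<equiv> \<lambda>c. tensor_rel k M N #>\<^bsub>tensor_free M N\<^esub> c"

lemma M: "Module.module k M" and N: "Module.module k N"
  using module_alg_module k A B f g by blast+

lemmas sg = subgrp_tensor_rel[OF M N] and rel_tfree = tensor_rel_tfree[OF M N]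

lemma cos_eq_iff: "tcos c = tcos c' \<longleftrightarrow> c - c' \<in> tensor_rel k M N"
  by (rule r_coset_tensor_rel_eq_iff[OF M N])

lemma mem_cos: "x \<in> tcos c \<longleftrightarrow> x - c \<in> tensor_rel k M N"
  by (simp add: tensor_coset_eq)

lemma frag_mult_rel:
  assumes "c \<in> tensor_rel k M N" "x \<in> carrier A" "y \<in> carrier B"
  shows "tensor_frag (\<lambda>z. z \<otimes>\<^bsub>A\<^esub> x) (\<lambda>z. z \<otimes>\<^bsub>B\<^esub> y) c \<in> tensor_rel k M N"
    "tensor_frag (\<lambda>z. x \<otimes>\<^bsub>A\<^esub> z) (\<lambda>z. y \<otimes>\<^bsub>B\<^esub> z) c \<in> tensor_rel k M N"
proof -
  interpret A: cring A by (rule A)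
  interpret B: cring B by (rule B)
  have fk: "f r \<in> carrier A" "g r \<in> carrier B" if "r \<in> carrier k" for r
    using that ring_hom_closed f g by metis+
  have l: "add_hom M M (\<lambda>z. z \<otimes>\<^bsub>A\<^esub> x)" "add_hom N N (\<lambda>z. z \<otimes>\<^bsub>B\<^esub> y)"
    "add_hom M M (\<lambda>z. x \<otimes>\<^bsub>A\<^esub> z)" "add_hom N N (\<lambda>z. y \<otimes>\<^bsub>B\<^esub> z)"
    using assms by (auto simp: add_hom_def A.l_distr B.l_distr A.r_distr B.r_distr)
  show "tensor_frag (\<lambda>z. z \<otimes>\<^bsub>A\<^esub> x) (\<lambda>z. z \<otimes>\<^bsub>B\<^esub> y) c \<in> tensor_rel k M N"
    by (rule tensor_frag_rel_gen[OF M N M N l(1,2) _ assms(1)])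
      (use assms fk in \<open>auto simp: A.m_assoc B.m_assoc\<close>)
  show "tensor_frag (\<lambda>z. x \<otimes>\<^bsub>A\<^esub> z) (\<lambda>z. y \<otimes>\<^bsub>B\<^esub> z) c \<in> tensor_rel k M N"
    by (rule tensor_frag_rel_gen[OF M N M N l(3,4) _ assms(1)])
      (use assms fk in \<open>auto simp: A.m_lcomm B.m_lcomm\<close>)
qed

text \<open>Multiplication by a pure tensor is a tensor product of two linear maps and so preserves
  relations; additivity extends this to all tensors.\<close>

lemma tensor_mult_rel:
  shows "c \<in> tensor_rel k M N \<Longrightarrow> d \<in> tfree M N \<Longrightarrow> tensor_mult A B c d \<in> tensor_rel k M N"
    and "c \<in> tfree M N \<Longrightarrow> d \<in> tensor_rel k M N \<Longrightarrow> tensor_mult A B c d \<in> tensor_rel k M N"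
proof -
  show "tensor_mult A B c d \<in> tensor_rel k M N" if "c \<in> tensor_rel k M N" "d \<in> tfree M N"
    using that(2,1) by (induction d rule: tfree_induct)
      (auto simp: tensor_mult_0 tensor_mult_left tensor_mult_diff_right frag_mult_rel subgrp_0[OF sg] subgrp_diff[OF sg])
  show "tensor_mult A B c d \<in> tensor_rel k M N" if "c \<in> tfree M N" "d \<in> tensor_rel k M N"
    using that by (induction c rule: tfree_induct)
      (auto simp: tensor_mult_0 tensor_mult_right tensor_mult_diff_left frag_mult_rel subgrp_0[OF sg] subgrp_diff[OF sg])
qed

lemma mult_cos:
  assumes "c \<in> tfree M N" "d \<in> tfree M N"
  shows "tcos c \<otimes>\<^bsub>R\<^esub> tcos d = tcos (tensor_mult A B c d)"
proof -
  have "tcos (tensor_mult A B c' d') = tcos (tensor_mult A B c d)" if "c' \<in> tcos c" "d' \<in> tcos d" for c' d'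
  proof -
    have rels: "c' - c \<in> tensor_rel k M N" "d' - d \<in> tensor_rel k M N" using that by (auto simp: mem_cos)
    have "d' \<in> tfree M N" using subgrp_cong[OF subgrp_tfree, of d' d] rels(2) rel_tfree assms(2) by blast
    \<comment> \<open>One factor is changed at a time: c' d' - c d = (c' - c) d' + c (d' -
      d).\<close>
    then have "tensor_mult A B (c' - c) d' + tensor_mult A B c (d' - d) \<in> tensor_rel k M N"
      by (intro subgrp_add[OF sg] tensor_mult_rel assms rels)
    then show ?thesis by (simp add: cos_eq_iff tensor_mult_diff_left tensor_mult_diff_right)
  qed
  moreover have "c \<in> tcos c" "d \<in> tcos d" using subgrp_0[OF sg] by (auto simp: mem_cos)
  moreover have "tcos c \<otimes>\<^bsub>R\<^esub> tcos d = (\<Union>c'\<in>tcos c. \<Union>d'\<in>tcos d. tcos (tensor_mult A B c' d'))"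
    by (simp add: tensor_ring_def Let_def tensor_mult_def)
  ultimately show ?thesis by blast
qed

lemma mult_pure:
  assumes "x \<in> carrier A" "x' \<in> carrier A" "y \<in> carrier B" "y' \<in> carrier B"
  shows "tcos (frag_of (x, y)) \<otimes>\<^bsub>R\<^esub> tcos (frag_of (x', y')) = tcos (frag_of (x \<otimes>\<^bsub>A\<^esub> x', y \<otimes>\<^bsub>B\<^esub> y'))"
  using assms by (subst mult_cos) (auto simp: tensor_mult_left)

lemma add_cos: "tcos c \<oplus>\<^bsub>R\<^esub> tcos d = tcos (c + d)"
proof -
  have "tcos c \<oplus>\<^bsub>R\<^esub> tcos d = {x + y | x y. x \<in> tcos c \<and> y \<in> tcos d}"
    by (auto simp: tensor_ring_def Let_def tensor_def FactGroup_def set_mult_def tensor_free_def)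
  also have "\<dots> = tcos (c + d)"
  proof (intro equalityI subsetI)
    fix z assume "z \<in> {x + y | x y. x \<in> tcos c \<and> y \<in> tcos d}"
    then obtain x y where "z = x + y" "x - c \<in> tensor_rel k M N" "y - d \<in> tensor_rel k M N" by (auto simp: mem_cos)
    then show "z \<in> tcos (c + d)" using subgrp_add[OF sg, of "x - c" "y - d"] by (simp add: mem_cos algebra_simps)
  next
    fix z assume "z \<in> tcos (c + d)"
    then have "z = (z - d) + d" "z - d \<in> tcos c" "d \<in> tcos d"
      using subgrp_0[OF sg] by (auto simp: mem_cos algebra_simps)
    then show "z \<in> {x + y | x y. x \<in> tcos c \<and> y \<in> tcos d}" by blast
  qed
  finally show ?thesis .
qed

lemma one_cos: "\<one>\<^bsub>R\<^esub> = tcos (frag_of (\<one>\<^bsub>A\<^esub>, \<one>\<^bsub>B\<^esub>))"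
  by (simp add: tensor_ring_def Let_def pure_tensor_def)

lemma zero_cos: "\<zero>\<^bsub>R\<^esub> = tcos 0"
  using tensor_coset_eq[where A=k and M=M and N=N and c=0] by (simp add: tensor_ring_def Let_def tensor_def FactGroup_def)

lemma carrier_cos: "carrier R = tcos ` tfree M N"
  by (simp add: tensor_ring_def Let_def carrier_tensor)

end

section \<open>The product of ringed finite spaces\<close>

locale ringed_finite_space_over = ringed_finite_space X for X :: "('p, 'r) ringed_space" +
  fixes k :: "'k ring" and a :: "'p set \<Rightarrow> 'k \<Rightarrow> 'r"
  assumes cring_k: "cring k" and over: "over_base k X a"
begin

abbreviation "T \<equiv> topo X"
abbreviation "mo \<equiv> min_open (topo X)"
abbreviation "alg p \<equiv> alg_module (stalk_struct X a p) (stalk X p)"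

lemmas mo_open = min_open_open[OF finite_topspace] and mo_mono = min_open_mono[OF finite_topspace]

lemma mo_top: "p \<in> topspace T \<Longrightarrow> q \<in> mo p \<Longrightarrow> q \<in> topspace T"
  by (rule subsetD[OF min_open_topspace])

lemma cring_stalk: "p \<in> topspace T \<Longrightarrow> cring (stalk X p)"
  by (simp add: stalk_def cring_sec mo_open)

lemma presheaf_sec: "presheaf_on T (\<lambda>U. carrier (sec X U)) (res X)"
  using sheaf_sec by (simp add: sheaf_on_def)

lemma res_id: "openin T U \<Longrightarrow> s \<in> carrier (sec X U) \<Longrightarrow> res X U U s = s"
  using presheaf_sec by (simp add: presheaf_on_def)

lemma res_res: "openin T U \<Longrightarrow> openin T V \<Longrightarrow> openin T W \<Longrightarrow> W \<subseteq> V \<Longrightarrow> V \<subseteq> U \<Longrightarrow> s \<in> carrier (sec X U) \<Longrightarrow>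
    res X V W (res X U V s) = res X U W s"
  using presheaf_sec unfolding presheaf_on_def by blast

lemma stalk_res_hom: "p \<in> topspace T \<Longrightarrow> q \<in> mo p \<Longrightarrow> stalk_res X p q \<in> ring_hom (stalk X p) (stalk X q)"
  unfolding stalk_res_def stalk_def using mo_top[of p q] by (intro res_hom mo_open mo_mono)

lemma stalk_res_id: "p \<in> topspace T \<Longrightarrow> x \<in> carrier (stalk X p) \<Longrightarrow> stalk_res X p p x = x"
  by (simp add: stalk_res_def stalk_def res_id mo_open)

lemma stalk_res_comp:
  "p \<in> topspace T \<Longrightarrow> q \<in> mo p \<Longrightarrow> r \<in> mo q \<Longrightarrow> x \<in> carrier (stalk X p) \<Longrightarrow>
    stalk_res X q r (stalk_res X p q x) = stalk_res X p r x"
  unfolding stalk_res_def stalk_def using mo_top[of p q] mo_top[of q r]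
  by (intro res_res mo_open mo_mono) auto

lemma stalk_struct_hom: "p \<in> topspace T \<Longrightarrow> stalk_struct X a p \<in> ring_hom k (stalk X p)"
  using over mo_open by (simp add: over_base_def stalk_struct_def stalk_def)

lemma stalk_struct_res:
  "p \<in> topspace T \<Longrightarrow> q \<in> mo p \<Longrightarrow> c \<in> carrier k \<Longrightarrow> stalk_res X p q (stalk_struct X a p c) = stalk_struct X a q c"
  using over mo_open[of p] mo_open[of q] mo_mono[of p q] mo_top[of p q]
  by (simp add: over_base_def stalk_res_def stalk_struct_def)

lemma module_alg: "p \<in> topspace T \<Longrightarrow> Module.module k (alg p)"
  by (rule module_alg_module[OF cring_k stalk_struct_hom cring_stalk])

lemma stalk_res_mod_hom:
  assumes "p \<in> topspace T" "q \<in> mo p" shows "stalk_res X p q \<in> mod_hom k (alg p) (alg q)"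
  using stalk_res_hom[OF assms] stalk_struct_res[OF assms] ring_hom_closed[OF stalk_struct_hom[OF assms(1)]]
  by (auto simp: mod_hom_def ring_hom_closed ring_hom_add ring_hom_mult)

end

text \<open>That the sections of the product form commutative rings enters as the assumption
  \<open>cring_Y\<close>. A module presupposes a commutative ring of scalars, so any sheaf of
  modules on the product supplies it.\<close>

locale product_setup = X: ringed_finite_space_over X k a + X': ringed_finite_space_over X' k a'
  for X :: "('p, 'r) ringed_space" and k :: "'k ring" and a :: "'p set \<Rightarrow> 'k \<Rightarrow> 'r"
    and X' :: "('q, 's) ringed_space" and a' :: "'q set \<Rightarrow> 'k \<Rightarrow> 's" +
  fixes Y :: "('p \<times> 'q, 'p \<times> 'q \<Rightarrow> ('r \<times> 's \<Rightarrow>\<^sub>0 int) set) ringed_space"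
  defines "Y \<equiv> product_space k X a X' a'"
  assumes cring_Y: "openin (topo Y) W \<Longrightarrow> cring (sec Y W)"
begin

abbreviation "TY \<equiv> topo Y"
abbreviation "moY \<equiv> min_open (topo Y)"

lemma topo_Y: "topo Y = prod_topology (topo X) (topo X')"
  by (simp add: Y_def product_space_def Let_def)

lemma topspace_Y: "topspace TY = topspace (topo X) \<times> topspace (topo X')"
  by (simp add: topo_Y)

lemma finite_Y: "finite (topspace TY)"
  by (simp add: topspace_Y X.finite_topspace X'.finite_topspace)

lemmas moY_open = min_open_open[OF finite_Y] and moY_mono = min_open_mono[OF finite_Y]

lemma moY_top: "z \<in> topspace TY \<Longrightarrow> w \<in> moY z \<Longrightarrow> w \<in> topspace TY"
  by (rule subsetD[OF min_open_topspace])

lemma moY_eq: "z \<in> topspace TY \<Longrightarrow> moY z = X.mo (fst z) \<times> X'.mo (snd z)"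
  using min_open_prod[OF X.finite_topspace X'.finite_topspace, of "fst z" "snd z"]
  by (auto simp: topo_Y)

lemma moY_pair: "p \<in> topspace X.T \<Longrightarrow> x \<in> topspace X'.T \<Longrightarrow> moY (p, x) = X.mo p \<times> X'.mo x"
  by (simp add: moY_eq topspace_Y)

lemma moY_D:
  assumes "z \<in> topspace TY" "w \<in> moY z"
  shows "fst z \<in> topspace X.T" "snd z \<in> topspace X'.T" "fst w \<in> X.mo (fst z)" "snd w \<in> X'.mo (snd z)"
    "fst w \<in> topspace X.T" "snd w \<in> topspace X'.T"
  using assms(1) assms(2)[unfolded moY_eq[OF assms(1)]] moY_top[OF assms]
  by (simp_all add: topspace_Y mem_Times_iff)

abbreviation "K z \<equiv> X.alg (fst z)"
abbreviation "K' z \<equiv> X'.alg (snd z)"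
abbreviation "Rel z \<equiv> tensor_rel k (K z) (K' z)"
abbreviation "rfrag z w \<equiv> tensor_frag (stalk_res X (fst z) (fst w)) (stalk_res X' (snd z) (snd w))"

definition cosz :: "'p \<times> 'q \<Rightarrow> ('r \<times> 's \<Rightarrow>\<^sub>0 int) \<Rightarrow> ('r \<times> 's \<Rightarrow>\<^sub>0 int) set" where
  "cosz z c = Rel z #>\<^bsub>tensor_free (K z) (K' z)\<^esub> c"

abbreviation "PS z \<equiv> product_stalk k X a X' a' z"
abbreviation "PR z w \<equiv> product_stalk_res k X a X' a' z w"

lemma tensor_algebras:
  "z \<in> topspace TY \<Longrightarrow> tensor_algebras k (stalk X (fst z)) (stalk_struct X a (fst z)) (stalk X' (snd z)) (stalk_struct X' a' (snd z))"
  by (intro tensor_algebras.intro X.cring_k X.cring_stalk X'.cring_stalk X.stalk_struct_hom X'.stalk_struct_hom)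
    (auto simp: topspace_Y)

lemma PS_simps:
  assumes "z \<in> topspace TY"
  shows "carrier (PS z) = cosz z ` tfree (K z) (K' z)" "\<zero>\<^bsub>PS z\<^esub> = cosz z 0"
    "\<one>\<^bsub>PS z\<^esub> = cosz z (frag_of (\<one>\<^bsub>stalk X (fst z)\<^esub>, \<one>\<^bsub>stalk X' (snd z)\<^esub>))"
    "cosz z c \<oplus>\<^bsub>PS z\<^esub> cosz z d = cosz z (c + d)"
    "x \<in> carrier (stalk X (fst z)) \<Longrightarrow> x' \<in> carrier (stalk X (fst z)) \<Longrightarrow>
      y \<in> carrier (stalk X' (snd z)) \<Longrightarrow> y' \<in> carrier (stalk X' (snd z)) \<Longrightarrow>
     cosz z (frag_of (x, y)) \<otimes>\<^bsub>PS z\<^esub> cosz z (frag_of (x', y')) =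
     cosz z (frag_of (x \<otimes>\<^bsub>stalk X (fst z)\<^esub> x', y \<otimes>\<^bsub>stalk X' (snd z)\<^esub> y'))"
    "cosz z c = cosz z c' \<longleftrightarrow> c - c' \<in> Rel z"
    "subgrp (Rel z)"
proof -
  note ta = tensor_algebras[OF assms]
  have c: "cosz z = (\<lambda>c. Rel z #>\<^bsub>tensor_free (K z) (K' z)\<^esub> c)" by (rule ext) (simp add: cosz_def)
  show "carrier (PS z) = cosz z ` tfree (K z) (K' z)" unfolding product_stalk_def c by (rule tensor_algebras.carrier_cos[OF ta])
  show "\<zero>\<^bsub>PS z\<^esub> = cosz z 0" unfolding product_stalk_def c by (rule tensor_algebras.zero_cos[OF ta])
  show "\<one>\<^bsub>PS z\<^esub> = cosz z (frag_of (\<one>\<^bsub>stalk X (fst z)\<^esub>, \<one>\<^bsub>stalk X' (snd z)\<^esub>))"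
    unfolding product_stalk_def c by (rule tensor_algebras.one_cos[OF ta])
  show "cosz z c \<oplus>\<^bsub>PS z\<^esub> cosz z d = cosz z (c + d)" unfolding product_stalk_def c by (rule tensor_algebras.add_cos[OF ta])
  show "cosz z (frag_of (x, y)) \<otimes>\<^bsub>PS z\<^esub> cosz z (frag_of (x', y')) =
     cosz z (frag_of (x \<otimes>\<^bsub>stalk X (fst z)\<^esub> x', y \<otimes>\<^bsub>stalk X' (snd z)\<^esub> y'))"
    if "x \<in> carrier (stalk X (fst z))" "x' \<in> carrier (stalk X (fst z))"
      "y \<in> carrier (stalk X' (snd z))" "y' \<in> carrier (stalk X' (snd z))"
    unfolding product_stalk_def c by (rule tensor_algebras.mult_pure[OF ta that])
  show "cosz z c = cosz z c' \<longleftrightarrow> c - c' \<in> Rel z" unfolding c by (rule tensor_algebras.cos_eq_iff[OF ta])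
  show "subgrp (Rel z)" by (rule tensor_algebras.sg[OF ta])
qed

lemma rfrag_rel:
  assumes "z \<in> topspace TY" "w \<in> moY z" "c \<in> Rel z" shows "rfrag z w c \<in> Rel w"
proof -
  note D = moY_D[OF assms(1,2)]
  note h = X.stalk_res_mod_hom[OF D(1,3)] and h' = X'.stalk_res_mod_hom[OF D(2,4)]
  show ?thesis
  proof (rule tensor_frag_rel_gen[OF X.module_alg[OF D(1)] X'.module_alg[OF D(2)] X.module_alg[OF D(5)] X'.module_alg[OF D(6)]
        mod_hom_add_hom[OF h] mod_hom_add_hom[OF h'] _ assms(3)])
    fix r assume "r \<in> carrier k"
    then show "\<exists>s\<in>carrier k. (\<forall>x\<in>carrier (K z). stalk_res X (fst z) (fst w) (r \<odot>\<^bsub>K z\<^esub> x) = s \<odot>\<^bsub>K w\<^esub> stalk_res X (fst z) (fst w) x) \<and>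
       (\<forall>y\<in>carrier (K' z). stalk_res X' (snd z) (snd w) (r \<odot>\<^bsub>K' z\<^esub> y) = s \<odot>\<^bsub>K' w\<^esub> stalk_res X' (snd z) (snd w) y)"
      using mod_homD(3)[OF h] mod_homD(3)[OF h'] by blast
  qed
qed

lemma rfrag_tfree:
  assumes "z \<in> topspace TY" "w \<in> moY z" "c \<in> tfree (K z) (K' z)" shows "rfrag z w c \<in> tfree (K w) (K' w)"
proof -
  note D = moY_D[OF assms(1,2)]
  show ?thesis
    by (rule tensor_frag_tfree[OF assms(3)])
      (use mod_homD(1)[OF X.stalk_res_mod_hom[OF D(1,3)]] mod_homD(1)[OF X'.stalk_res_mod_hom[OF D(2,4)]] in auto)
qed

lemma rfrag_id:
  assumes "z \<in> topspace TY" "c \<in> tfree (K z) (K' z)" shows "rfrag z z c = c"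
  using tensor_frag_cong[OF assms(2), of _ "\<lambda>x. x" _ "\<lambda>x. x"] assms(1)
  by (auto simp: tensor_frag_id X.stalk_res_id X'.stalk_res_id topspace_Y)

lemma rfrag_comp:
  assumes "z \<in> topspace TY" "w \<in> moY z" "v \<in> moY w" "c \<in> tfree (K z) (K' z)"
  shows "rfrag w v (rfrag z w c) = rfrag z v c"
proof -
  note D = moY_D[OF assms(1,2)] and D' = moY_D[OF moY_top[OF assms(1,2)] assms(3)]
  show ?thesis
    unfolding tensor_frag_comp by (rule tensor_frag_cong[OF assms(4)])
      (simp_all add: X.stalk_res_comp[OF D(1,3) D'(3)] X'.stalk_res_comp[OF D(2,4) D'(4)])
qed

lemma PR_cosz:
  assumes "z \<in> topspace TY" "w \<in> moY z" shows "PR z w (cosz z c) = cosz w (rfrag z w c)"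
  unfolding product_stalk_res_def cosz_def
  using assms
  by (intro tensor_map_coset[OF X.module_alg[OF moY_D(5)[OF assms]] X'.module_alg[OF moY_D(6)[OF assms]]] PS_simps(7) rfrag_rel)

lemma sec_Y: "sec Y = stalks_sec TY (product_stalk k X a X' a') (product_stalk_res k X a X' a')"
  and res_Y: "res Y W W' s = restrict s W'"
  by (simp_all add: Y_def product_space_def Let_def)

lemma sec_Y_simps:
  "s \<in> carrier (sec Y W) \<longleftrightarrow> s \<in> (\<Pi>\<^sub>E z\<in>W. carrier (PS z)) \<and> (\<forall>z\<in>W. \<forall>w\<in>moY z. PR z w (s z) = s w)"
  "s \<otimes>\<^bsub>sec Y W\<^esub> t = (\<lambda>z\<in>W. s z \<otimes>\<^bsub>PS z\<^esub> t z)" "s \<oplus>\<^bsub>sec Y W\<^esub> t = (\<lambda>z\<in>W. s z \<oplus>\<^bsub>PS z\<^esub> t z)"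
  "\<one>\<^bsub>sec Y W\<^esub> = (\<lambda>z\<in>W. \<one>\<^bsub>PS z\<^esub>)" "\<zero>\<^bsub>sec Y W\<^esub> = (\<lambda>z\<in>W. \<zero>\<^bsub>PS z\<^esub>)"
  by (simp_all add: sec_Y stalks_sec_def)

lemma open_moY: "openin TY W \<Longrightarrow> z \<in> W \<Longrightarrow> moY z \<subseteq> W" "openin TY W \<Longrightarrow> z \<in> W \<Longrightarrow> z \<in> topspace TY"
  by (rule min_open_least) (use openin_subset in auto)

lemma res_Y_hom:
  assumes "openin TY W" "openin TY W'" "W' \<subseteq> W"
  shows "(\<lambda>s. restrict s W') \<in> ring_hom (sec Y W) (sec Y W')"
proof -
  have "restrict s W' \<in> carrier (sec Y W')" if "s \<in> carrier (sec Y W)" for s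
    using that assms(3) open_moY(1)[OF assms(2)] by (auto simp: sec_Y_simps subset_iff)
  then show ?thesis
    using assms(3) by (auto simp: ring_hom_def sec_Y_simps(2-5) fun_eq_iff subset_iff)
qed

text \<open>Over a minimal open set a section is determined by its germ at the least point. This is
  the section whose germ at \<open>z\<close> is represented by \<open>c\<close>; it turns
  computations with sections into computations with tensors.\<close>

definition tsec :: "'p \<times> 'q \<Rightarrow> ('r \<times> 's \<Rightarrow>\<^sub>0 int) \<Rightarrow> 'p \<times> 'q \<Rightarrow> ('r \<times> 's \<Rightarrow>\<^sub>0 int) set" where
  "tsec z c = (\<lambda>w\<in>moY z. cosz w (rfrag z w c))"

lemma tsec_closed:
  assumes z: "z \<in> topspace TY" and c: "c \<in> tfree (K z) (K' z)"
  shows "tsec z c \<in> carrier (sec Y (moY z))"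
proof -
  have "cosz w (rfrag z w c) \<in> carrier (PS w)" if "w \<in> moY z" for w
    using that rfrag_tfree[OF z that c] by (auto simp: PS_simps(1)[OF moY_top[OF z that]])
  moreover have "PR w v (tsec z c w) = tsec z c v" if "w \<in> moY z" "v \<in> moY w" for w v
    using that moY_mono[OF z that(1)] rfrag_comp[OF z that c] PR_cosz[OF moY_top[OF z that(1)] that(2)]
    by (auto simp: tsec_def)
  ultimately show ?thesis by (auto simp: sec_Y_simps tsec_def)
qed

lemma tsec_surj:
  assumes z: "z \<in> topspace TY" and s: "s \<in> carrier (sec Y (moY z))"
  shows "\<exists>c\<in>tfree (K z) (K' z). s = tsec z c"
proof -
  have "s z \<in> carrier (PS z)" using s min_open_self[of z TY] by (auto simp: sec_Y_simps)
  then obtain c where c: "c \<in> tfree (K z) (K' z)" "s z = cosz z c" by (auto simp: PS_simps(1)[OF z])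
  have "s w = tsec z c w" for w
  proof (cases "w \<in> moY z")
    case True
    then have "s w = PR z w (s z)" using s min_open_self[of z TY] by (auto simp: sec_Y_simps)
    then show ?thesis using True PR_cosz[OF z True] c(2) by (simp add: tsec_def)
  next
    case False
    moreover have "s \<in> extensional (moY z)" using s by (simp add: sec_Y_simps PiE_iff)
    ultimately show ?thesis by (simp add: tsec_def extensional_arb[of s "moY z" w])
  qed
  then show ?thesis using c(1) by blast
qed

lemma tsec_restrict:
  assumes "z \<in> topspace TY" "w \<in> moY z" "c \<in> tfree (K z) (K' z)"
  shows "restrict (tsec z c) (moY w) = tsec w (rfrag z w c)"
  using moY_mono[OF assms(1,2)] rfrag_comp[OF assms(1,2) _ assms(3)]
  by (auto simp: tsec_def fun_eq_iff subset_iff)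

lemma tsec_eq_iff:
  assumes z: "z \<in> topspace TY" and c: "c \<in> tfree (K z) (K' z)" "c' \<in> tfree (K z) (K' z)"
  shows "tsec z c = tsec z c' \<longleftrightarrow> c - c' \<in> Rel z"
proof
  assume "tsec z c = tsec z c'"
  then have "tsec z c z = tsec z c' z" by simp
  then show "c - c' \<in> Rel z"
    using min_open_self[of z TY] PS_simps(6)[OF z] rfrag_id[OF z] c by (simp add: tsec_def)
next
  assume "c - c' \<in> Rel z"
  then have "cosz w (rfrag z w c) = cosz w (rfrag z w c')" if "w \<in> moY z" for w
    using rfrag_rel[OF z that, of "c - c'"] by (simp add: PS_simps(6)[OF moY_top[OF z that]] tensor_frag_diff)
  then show "tsec z c = tsec z c'" unfolding tsec_def by (rule restrict_ext)
qed

lemma tsec_add: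
  assumes "z \<in> topspace TY" shows "tsec z c \<oplus>\<^bsub>sec Y (moY z)\<^esub> tsec z c' = tsec z (c + c')"
  using moY_top[OF assms] by (auto simp: tsec_def sec_Y_simps PS_simps(4) tensor_frag_add intro!: restrict_ext)

lemma tsec_zero:
  assumes "z \<in> topspace TY" shows "\<zero>\<^bsub>sec Y (moY z)\<^esub> = tsec z 0"
  using moY_top[OF assms] by (auto simp: tsec_def sec_Y_simps PS_simps(2) intro!: restrict_ext)

lemma tsec_mult:
  assumes z: "z \<in> topspace TY" and "x \<in> carrier (stalk X (fst z))" "x' \<in> carrier (stalk X (fst z))"
    "y \<in> carrier (stalk X' (snd z))" "y' \<in> carrier (stalk X' (snd z))"
  shows "tsec z (frag_of (x, y)) \<otimes>\<^bsub>sec Y (moY z)\<^esub> tsec z (frag_of (x', y')) =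
    tsec z (frag_of (x \<otimes>\<^bsub>stalk X (fst z)\<^esub> x', y \<otimes>\<^bsub>stalk X' (snd z)\<^esub> y'))"
  unfolding tsec_def sec_Y_simps
proof (rule restrict_ext)
  fix w assume w: "w \<in> moY z"
  note D = moY_D[OF z w]
  note h = X.stalk_res_hom[OF D(1,3)] and h' = X'.stalk_res_hom[OF D(2,4)]
  show "(\<lambda>w\<in>moY z. cosz w (rfrag z w (frag_of (x, y)))) w \<otimes>\<^bsub>PS w\<^esub> (\<lambda>w\<in>moY z. cosz w (rfrag z w (frag_of (x', y')))) w =
    cosz w (rfrag z w (frag_of (x \<otimes>\<^bsub>stalk X (fst z)\<^esub> x', y \<otimes>\<^bsub>stalk X' (snd z)\<^esub> y')))"
    using w assms(2-5) PS_simps(5)[OF moY_top[OF z w]]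
    by (simp add: ring_hom_closed[OF h] ring_hom_closed[OF h'] ring_hom_mult[OF h] ring_hom_mult[OF h'])
qed

section \<open>The ring map of the projection\<close>

abbreviation "ps U \<equiv> proj_sharp k X a X' a' U"

lemma ps_apply:
  assumes "z \<in> U \<times> topspace X'.T"
  shows "ps U s z = cosz z (frag_of (res X U (X.mo (fst z)) s, \<one>\<^bsub>stalk X' (snd z)\<^esub>))"
  using assms by (auto simp: proj_sharp_def cosz_def pure_tensor_def)

lemma open_times: "openin X.T U \<Longrightarrow> openin X'.T V \<Longrightarrow> openin TY (U \<times> V)"
  by (simp add: topo_Y openin_prod_Times_iff)

lemma ps_ext: "ps U s \<in> extensional (U \<times> topspace X'.T)"
  by (auto simp: proj_sharp_def)

text \<open>Over a minimal open set the map sends s to s \<otimes> 1. The compatibility of values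
  required in \<open>ps_closed\<close> is then inherited from \<open>tsec\<close>.\<close>

lemma ps_restrict_moY:
  assumes U: "openin X.T U" and z: "z \<in> U \<times> topspace X'.T" and s: "s \<in> carrier (sec X U)"
  shows "restrict (ps U s) (moY z) = tsec z (frag_of (res X U (X.mo (fst z)) s, \<one>\<^bsub>stalk X' (snd z)\<^esub>))"
proof -
  have zY: "z \<in> topspace TY" using z openin_subset[OF U] by (auto simp: topspace_Y)
  show ?thesis
    unfolding tsec_def
  proof (rule restrict_ext)
    fix w assume w: "w \<in> moY z"
    note D = moY_D[OF zY w]
    have mo: "X.mo (fst z) \<subseteq> U" using min_open_least[OF U, of "fst z"] z by auto
    then have wU: "w \<in> U \<times> topspace X'.T" using D by (auto simp: mem_Times_iff)
    have "stalk_res X (fst z) (fst w) (res X U (X.mo (fst z)) s) = res X U (X.mo (fst w)) s"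
      unfolding stalk_res_def by (rule X.res_res[OF U X.mo_open[OF D(1)] X.mo_open[OF D(5)] X.mo_mono[OF D(1,3)] mo s])
    then show "ps U s w = cosz w (rfrag z w (frag_of (res X U (X.mo (fst z)) s, \<one>\<^bsub>stalk X' (snd z)\<^esub>)))"
      using ring_hom_one[OF X'.stalk_res_hom[OF D(2,4)]] by (simp add: ps_apply[OF wU])
  qed
qed

lemma ps_closed:
  assumes U: "openin X.T U" and s: "s \<in> carrier (sec X U)"
  shows "ps U s \<in> carrier (sec Y (U \<times> topspace X'.T))"
proof -
  have *: "z \<in> topspace TY" "moY z \<subseteq> U \<times> topspace X'.T" "tsec z (frag_of (res X U (X.mo (fst z)) s, \<one>\<^bsub>stalk X' (snd z)\<^esub>)) \<in> carrier (sec Y (moY z))"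
    if z: "z \<in> U \<times> topspace X'.T" for z
  proof -
    show zY: "z \<in> topspace TY" using z openin_subset[OF U] by (auto simp: topspace_Y)
    show "moY z \<subseteq> U \<times> topspace X'.T" by (rule open_moY(1)[OF open_times[OF U] z]) simp
    have p: "fst z \<in> topspace X.T" "snd z \<in> topspace X'.T" "fst z \<in> U" using zY z by (auto simp: topspace_Y)
    have "res X U (X.mo (fst z)) s \<in> carrier (stalk X (fst z))"
      unfolding stalk_def by (rule ring_hom_closed[OF X.res_hom[OF U X.mo_open[OF p(1)] min_open_least[OF U p(3)]] s])
    then show "tsec z (frag_of (res X U (X.mo (fst z)) s, \<one>\<^bsub>stalk X' (snd z)\<^esub>)) \<in> carrier (sec Y (moY z))"
      using X'.cring_stalk[OF p(2)] by (intro tsec_closed zY) (simp add: cring_one)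
  qed
  have "ps U s z \<in> carrier (PS z)" "\<forall>w\<in>moY z. PR z w (ps U s z) = ps U s w" if z: "z \<in> U \<times> topspace X'.T" for z
  proof -
    have "restrict (ps U s) (moY z) \<in> carrier (sec Y (moY z))"
      using *(3)[OF z] unfolding ps_restrict_moY[OF U z s] .
    then have "\<forall>v\<in>moY z. restrict (ps U s) (moY z) v \<in> carrier (PS v)"
      and B: "\<forall>v\<in>moY z. \<forall>w\<in>moY v. PR v w (restrict (ps U s) (moY z) v) = restrict (ps U s) (moY z) w"
      unfolding sec_Y_simps(1) PiE_iff by blast+
    then show "ps U s z \<in> carrier (PS z)" using min_open_self[of z TY] by fastforce
    show "\<forall>w\<in>moY z. PR z w (ps U s z) = ps U s w"
      using bspec[OF B min_open_self[of z TY]] min_open_self[of z TY] by simp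
  qed
  then show ?thesis using ps_ext[of U s] by (auto simp: sec_Y_simps PiE_iff)
qed

lemma ps_hom:
  assumes U: "openin X.T U"
  shows "ps U \<in> ring_hom (sec X U) (sec Y (U \<times> topspace X'.T))"
proof (rule ring_hom_memI)
  have r: "res X U (X.mo (fst z)) \<in> ring_hom (sec X U) (stalk X (fst z))" "cring (stalk X' (snd z))" "z \<in> topspace TY"
    if z: "z \<in> U \<times> topspace X'.T" for z
  proof -
    have p: "fst z \<in> topspace X.T" "snd z \<in> topspace X'.T" "fst z \<in> U" using openin_subset[OF U] z by auto
    show "res X U (X.mo (fst z)) \<in> ring_hom (sec X U) (stalk X (fst z))"
      unfolding stalk_def by (rule X.res_hom[OF U X.mo_open[OF p(1)] min_open_least[OF U p(3)]])
    show "cring (stalk X' (snd z))" using X'.cring_stalk p by blast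
    show "z \<in> topspace TY" using p by (auto simp: topspace_Y mem_Times_iff)
  qed
  show "ps U x \<in> carrier (sec Y (U \<times> topspace X'.T))" if "x \<in> carrier (sec X U)" for x
    by (rule ps_closed[OF U that])
  have eqI: "u = v" if "\<And>z. z \<in> U \<times> topspace X'.T \<Longrightarrow> u z = v z" "u \<in> extensional (U \<times> topspace X'.T)" "v \<in> extensional (U \<times> topspace X'.T)"
    for u v :: "'p \<times> 'q \<Rightarrow> ('r \<times> 's \<Rightarrow>\<^sub>0 int) set"
    using that by (metis extensionalityI)
  show "ps U \<one>\<^bsub>sec X U\<^esub> = \<one>\<^bsub>sec Y (U \<times> topspace X'.T)\<^esub>"
  proof (rule eqI)
    fix z assume z: "z \<in> U \<times> topspace X'.T"
    note rz = r[OF z]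
    show "ps U \<one>\<^bsub>sec X U\<^esub> z = \<one>\<^bsub>sec Y (U \<times> topspace X'.T)\<^esub> z"
      using z by (simp add: sec_Y_simps ps_apply PS_simps(3)[OF rz(3)] ring_hom_one[OF rz(1)])
  qed (auto simp: ps_ext sec_Y_simps)
  fix x y assume xy: "x \<in> carrier (sec X U)" "y \<in> carrier (sec X U)"
  show "ps U (x \<otimes>\<^bsub>sec X U\<^esub> y) = ps U x \<otimes>\<^bsub>sec Y (U \<times> topspace X'.T)\<^esub> ps U y"
  proof (rule eqI)
    fix z assume z: "z \<in> U \<times> topspace X'.T"
    note rz = r[OF z]
    show "ps U (x \<otimes>\<^bsub>sec X U\<^esub> y) z = (ps U x \<otimes>\<^bsub>sec Y (U \<times> topspace X'.T)\<^esub> ps U y) z"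
      using z PS_simps(5)[OF rz(3)] ring_hom_closed[OF rz(1)] ring_hom_mult[OF rz(1)] xy rz(2)
      by (simp add: sec_Y_simps ps_apply cring_one)
  qed (auto simp: ps_ext sec_Y_simps)
  show "ps U (x \<oplus>\<^bsub>sec X U\<^esub> y) = ps U x \<oplus>\<^bsub>sec Y (U \<times> topspace X'.T)\<^esub> ps U y"
  proof (rule eqI)
    fix z assume z: "z \<in> U \<times> topspace X'.T"
    note rz = r[OF z]
    have p: "fst z \<in> topspace X.T" "snd z \<in> topspace X'.T" using rz(3) by (auto simp: topspace_Y)
    have "frag_of (res X U (X.mo (fst z)) (x \<oplus>\<^bsub>sec X U\<^esub> y), \<one>\<^bsub>stalk X' (snd z)\<^esub>)
        - frag_of (res X U (X.mo (fst z)) x, \<one>\<^bsub>stalk X' (snd z)\<^esub>) - frag_of (res X U (X.mo (fst z)) y, \<one>\<^bsub>stalk X' (snd z)\<^esub>) \<in> Rel z"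
      using tensor_rel_add_left[of "res X U (X.mo (fst z)) x" "K z" "res X U (X.mo (fst z)) y" "\<one>\<^bsub>stalk X' (snd z)\<^esub>" "K' z" k]
        ring_hom_closed[OF rz(1)] xy rz(2) by (simp add: ring_hom_add[OF rz(1)] cring_one)
    then show "ps U (x \<oplus>\<^bsub>sec X U\<^esub> y) z = (ps U x \<oplus>\<^bsub>sec Y (U \<times> topspace X'.T)\<^esub> ps U y) z"
      using z by (simp add: sec_Y_simps ps_apply PS_simps(4,6)[OF rz(3)] algebra_simps)
  qed (auto simp: ps_ext sec_Y_simps)
qed

lemma ps_res:
  assumes "openin X.T U" "openin X.T U'" "U' \<subseteq> U" "s \<in> carrier (sec X U)"
  shows "restrict (ps U s) (U' \<times> topspace X'.T) = ps U' (res X U U' s)"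
proof (rule extensionalityI[of _ "U' \<times> topspace X'.T"])
  fix z assume z: "z \<in> U' \<times> topspace X'.T"
  then have "z \<in> U \<times> topspace X'.T" "fst z \<in> topspace X.T" "fst z \<in> U'" using assms(3) openin_subset[OF assms(1)] by auto
  moreover from this have "res X U' (X.mo (fst z)) (res X U U' s) = res X U (X.mo (fst z)) s"
    by (intro X.res_res assms X.mo_open min_open_least)
  ultimately show "restrict (ps U s) (U' \<times> topspace X'.T) z = ps U' (res X U U' s) z"
    using z by (simp add: ps_apply)
qed (auto simp: ps_ext)

end

section \<open>Restriction of scalars, free sheaves and open subspaces\<close>

lemma mod_hom_restrict_scalars:
  assumes "F \<in> mod_hom C M N" "\<alpha> \<in> ring_hom A C"
  shows "F \<in> mod_hom A (restrict_scalars \<alpha> M) (restrict_scalars \<alpha> N)"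
  using assms by (auto simp: mod_hom_def ring_hom_closed)

lemma msec_free_sheaf: "msec (free_sheaf X J) U = free_module (sec X U) J"
  and mres_free_sheaf: "mres (free_sheaf X J) U V x = (\<lambda>j\<in>J. res X U V (x j))"
  by (simp_all add: free_sheaf_def free_module_def Let_def)

lemma open_sub_simps [simp]: "sec (open_sub X U) = sec X" "res (open_sub X U) = res X"
  "topo (open_sub X U) = subtopology (topo X) U"
  by (simp_all add: open_sub_def)

lemma sheaf_of_modulesD:
  assumes "sheaf_of_modules X M"
  shows "openin (topo X) U \<Longrightarrow> Module.module (sec X U) (msec M U)"
    and "openin (topo X) U \<Longrightarrow> openin (topo X) V \<Longrightarrow> V \<subseteq> U \<Longrightarrow>
        mres M U V \<in> mod_hom (sec X U) (msec M U) (restrict_scalars (res X U V) (msec M V))"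
    and "sheaf_on (topo X) (\<lambda>U. carrier (msec M U)) (mres M)"
    and "openin (topo X) U \<Longrightarrow> s \<in> carrier (msec M U) \<Longrightarrow> mres M U U s = s"
    and "openin (topo X) U \<Longrightarrow> openin (topo X) V \<Longrightarrow> openin (topo X) W \<Longrightarrow> W \<subseteq> V \<Longrightarrow> V \<subseteq> U \<Longrightarrow>
        s \<in> carrier (msec M U) \<Longrightarrow> mres M V W (mres M U V s) = mres M U W s"
proof -
  show "openin (topo X) U \<Longrightarrow> Module.module (sec X U) (msec M U)"
    and "openin (topo X) U \<Longrightarrow> openin (topo X) V \<Longrightarrow> V \<subseteq> U \<Longrightarrow>
        mres M U V \<in> mod_hom (sec X U) (msec M U) (restrict_scalars (res X U V) (msec M V))"
    and sh: "sheaf_on (topo X) (\<lambda>U. carrier (msec M U)) (mres M)"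
    using assms by (simp_all add: sheaf_of_modules_def)
  have pre: "presheaf_on (topo X) (\<lambda>U. carrier (msec M U)) (mres M)"
    using sh by (simp add: sheaf_on_def)
  show "openin (topo X) U \<Longrightarrow> s \<in> carrier (msec M U) \<Longrightarrow> mres M U U s = s"
    using pre by (simp add: presheaf_on_def)
  show "openin (topo X) U \<Longrightarrow> openin (topo X) V \<Longrightarrow> openin (topo X) W \<Longrightarrow> W \<subseteq> V \<Longrightarrow> V \<subseteq> U \<Longrightarrow>
        s \<in> carrier (msec M U) \<Longrightarrow> mres M V W (mres M U V s) = mres M U W s"
    using pre by (simp add: presheaf_on_def)
qed

lemma sheaf_homD:
  assumes "f \<in> sheaf_hom X M N"
  shows "openin (topo X) U \<Longrightarrow> f U \<in> mod_hom (sec X U) (msec M U) (msec N U)"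
    and "openin (topo X) U \<Longrightarrow> openin (topo X) V \<Longrightarrow> V \<subseteq> U \<Longrightarrow> s \<in> carrier (msec M U) \<Longrightarrow>
        f V (mres M U V s) = mres N U V (f U s)"
  using assms by (simp_all add: sheaf_hom_def)

section \<open>Base change of the structure sheaf and of quasi-coherent modules over products of
  minimal open sets\<close>

context product_setup
begin

text \<open>The ring map through which sections over U_p x V become a module over the stalk at
  \<open>p\<close>. For V = X' it is the map of the projection itself.\<close>

definition psr :: "'p \<Rightarrow> 'q set \<Rightarrow> 'r \<Rightarrow> 'p \<times> 'q \<Rightarrow> ('r \<times> 's \<Rightarrow>\<^sub>0 int) set" where
  "psr p V s = restrict (ps (X.mo p) s) (X.mo p \<times> V)"

lemma open_mo_times: "p \<in> topspace X.T \<Longrightarrow> openin X'.T V \<Longrightarrow> openin TY (X.mo p \<times> V)"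
  by (intro open_times X.mo_open)

lemma psr_hom:
  assumes "p \<in> topspace X.T" "openin X'.T V"
  shows "psr p V \<in> ring_hom (stalk X p) (sec Y (X.mo p \<times> V))"
proof -
  have "(\<lambda>s. restrict s (X.mo p \<times> V)) \<circ> ps (X.mo p) \<in> ring_hom (stalk X p) (sec Y (X.mo p \<times> V))"
    unfolding stalk_def
    by (rule ring_hom_trans[OF ps_hom[OF X.mo_open[OF assms(1)]] res_Y_hom])
      (use assms openin_subset[OF assms(2)] in \<open>auto intro: open_mo_times\<close>)
  then show ?thesis by (simp add: psr_def[abs_def] comp_def)
qed

lemma psr_restrict: "V' \<subseteq> V \<Longrightarrow> restrict (psr p V s) (X.mo p \<times> V') = psr p V' s"
  by (auto simp: psr_def fun_eq_iff)

lemma psr_stalk_res: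
  assumes "p \<in> topspace X.T" "q \<in> X.mo p" "openin X'.T V" "s \<in> carrier (stalk X p)"
  shows "restrict (psr p V s) (X.mo q \<times> V) = psr q V (stalk_res X p q s)"
proof -
  have V: "V \<subseteq> topspace X'.T" using openin_subset[OF assms(3)] .
  have "restrict (ps (X.mo p) s) (X.mo q \<times> topspace X'.T) = ps (X.mo q) (stalk_res X p q s)"
    unfolding stalk_res_def
    by (rule ps_res[OF X.mo_open[OF assms(1)] X.mo_open[OF X.mo_top[OF assms(1,2)]] X.mo_mono[OF assms(1,2)]])
      (use assms(4) in \<open>simp add: stalk_def\<close>)
  then have "psr q V (stalk_res X p q s) = restrict (restrict (ps (X.mo p) s) (X.mo q \<times> topspace X'.T)) (X.mo q \<times> V)"
    by (simp add: psr_def)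
  also have "\<dots> = restrict (psr p V s) (X.mo q \<times> V)"
    unfolding psr_def using V X.mo_mono[OF assms(1,2)] by (intro ext) (auto simp: restrict_def)
  finally show ?thesis by simp
qed

lemma psr_top: "psr p (topspace X'.T) s = ps (X.mo p) s"
  using ps_ext[of "X.mo p" s] by (simp add: psr_def extensional_restrict)

lemma psr_tsec:
  assumes "p \<in> topspace X.T" "x \<in> topspace X'.T" "s \<in> carrier (stalk X p)"
  shows "psr p (X'.mo x) s = tsec (p, x) (frag_of (s, \<one>\<^bsub>stalk X' x\<^esub>))"
  using ps_restrict_moY[OF X.mo_open[OF assms(1)], of "(p, x)" s] assms min_open_self[of p X.T]
    X.res_id[OF X.mo_open[OF assms(1)], of s]
  by (simp add: psr_def moY_pair stalk_def)

lemma tsec_diff: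
  assumes z: "z \<in> topspace TY" and c: "c \<in> tfree (K z) (K' z)" "c' \<in> tfree (K z) (K' z)"
  shows "tsec z (c - c') = tsec z c \<ominus>\<^bsub>sec Y (moY z)\<^esub> tsec z c'"
proof -
  interpret C: cring "sec Y (moY z)" by (rule cring_Y[OF moY_open[OF z]])
  have "tsec z (c - c') \<oplus>\<^bsub>sec Y (moY z)\<^esub> tsec z c' = tsec z c" by (simp add: tsec_add[OF z])
  moreover have "tsec z (c - c') \<in> carrier (sec Y (moY z))" "tsec z c' \<in> carrier (sec Y (moY z))" "tsec z c \<in> carrier (sec Y (moY z))"
    by (intro tsec_closed z c subgrp_diff[OF subgrp_tfree])+
  ultimately show ?thesis by (metis C.add.inv_solve_right C.minus_eq a_inv_def)
qed

text \<open>The isomorphism \<open>(O\<^sub>p \<otimes>\<^sub>k O'\<^sub>x) \<otimes>\<^bsub>O\<^sub>p\<^esub> O\<^sub>q = O\<^sub>q \<otimes>\<^sub>k O'\<^sub>x\<close>: the frag \<open>(b, d)\<close> corresponds to \<open>((1 \<otimes> d), b)\<close>.\<close>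

lemma base_change_stalk:
  assumes p: "p \<in> topspace X.T" and q: "q \<in> X.mo p" and x: "x \<in> topspace X'.T"
  shows "base_change (stalk X p) (stalk X q) (stalk_res X p q)
    (alg_module (psr p (X'.mo x)) (sec Y (X.mo p \<times> X'.mo x))) (alg_module (psr q (X'.mo x)) (sec Y (X.mo q \<times> X'.mo x)))
    (\<lambda>s. restrict s (X.mo q \<times> X'.mo x))"
proof -
  define A B D f where "A = stalk X p" and "B = stalk X q" and "D = stalk X' x" and "f = stalk_res X p q"
  define z w where "z = (p, x)" and "w = (q, x)"
  have qt: "q \<in> topspace X.T" using X.mo_top[OF p q] .
  have z: "z \<in> topspace TY" and w: "w \<in> topspace TY" using p x qt by (auto simp: topspace_Y z_def w_def)
  have moz: "X.mo p \<times> X'.mo x = moY z" and mow: "X.mo q \<times> X'.mo x = moY w"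
    using moY_pair p qt x by (auto simp: z_def w_def)
  have wz: "w \<in> moY z" using q min_open_self[of x X'.T] moz by (auto simp: w_def)
  define C C' where "C = sec Y (moY z)" and "C' = sec Y (moY w)"
  define \<alpha> \<beta> where "\<alpha> = psr p (X'.mo x)" and "\<beta> = psr q (X'.mo x)"
  define h where "h = (\<lambda>s :: 'p \<times> 'q \<Rightarrow> ('r \<times> 's \<Rightarrow>\<^sub>0 int) set. restrict s (moY w))"
  \<comment> \<open>This is 1 \<otimes> d as a section. Sections over the minimal open set are
    generated by these over the stalk at \<open>p\<close>.\<close>
  define \<delta> where "\<delta> d = tsec z (frag_of (\<one>\<^bsub>A\<^esub>, d))" for d
  interpret A: cring A unfolding A_def by (rule X.cring_stalk[OF p])
  interpret B: cring B unfolding B_def by (rule X.cring_stalk[OF qt])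
  interpret D: cring D unfolding D_def by (rule X'.cring_stalk[OF x])
  interpret C: cring C unfolding C_def by (rule cring_Y[OF moY_open[OF z]])
  interpret C': cring C' unfolding C'_def by (rule cring_Y[OF moY_open[OF w]])
  have f: "f \<in> ring_hom A B" unfolding f_def A_def B_def by (rule X.stalk_res_hom[OF p q])
  have ox: "openin X'.T (X'.mo x)" by (rule X'.mo_open[OF x])
  have \<alpha>: "\<alpha> \<in> ring_hom A C" and \<beta>: "\<beta> \<in> ring_hom B C'"
    using psr_hom[OF p ox] psr_hom[OF qt ox] by (simp_all add: \<alpha>_def \<beta>_def A_def B_def C_def C'_def moz mow)
  have \<alpha>t: "\<alpha> s = tsec z (frag_of (s, \<one>\<^bsub>D\<^esub>))" if "s \<in> carrier A" for s
    using psr_tsec[OF p x] that by (simp add: \<alpha>_def A_def D_def z_def)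
  have \<beta>t: "\<beta> s = tsec w (frag_of (s, \<one>\<^bsub>D\<^esub>))" if "s \<in> carrier B" for s
    using psr_tsec[OF qt x] that by (simp add: \<beta>_def B_def D_def w_def)
  have h: "h \<in> ring_hom C C'" unfolding h_def C_def C'_def
    by (rule res_Y_hom[OF moY_open[OF z] moY_open[OF w] moY_mono[OF z wz]])
  have tfz: "frag_of (s, d) \<in> tfree (K z) (K' z)" if "s \<in> carrier A" "d \<in> carrier D" for s d
    using that by (simp add: z_def A_def D_def)
  have \<delta>_cl: "\<delta> d \<in> carrier C" if "d \<in> carrier D" for d
    unfolding \<delta>_def C_def by (intro tsec_closed z tfz that) simp
  have \<alpha>\<delta>: "\<alpha> s \<otimes>\<^bsub>C\<^esub> \<delta> d = tsec z (frag_of (s, d))" if "s \<in> carrier A" "d \<in> carrier D" for s d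
    using tsec_mult[OF z, of s "\<one>\<^bsub>A\<^esub>" "\<one>\<^bsub>D\<^esub>" d] that
    by (simp add: \<alpha>t \<delta>_def C_def z_def A_def[symmetric] D_def[symmetric])
  have h\<delta>: "\<beta> b \<otimes>\<^bsub>C'\<^esub> h (\<delta> d) = tsec w (frag_of (b, d))" if "b \<in> carrier B" "d \<in> carrier D" for b d
  proof -
    have "h (\<delta> d) = tsec w (frag_of (f \<one>\<^bsub>A\<^esub>, d))"
      unfolding h_def \<delta>_def tsec_restrict[OF z wz tfz[OF A.one_closed that(2)]]
      using X'.stalk_res_id[OF x] that(2) by (simp add: z_def w_def f_def D_def)
    then show ?thesis
      using tsec_mult[OF w, of b "\<one>\<^bsub>B\<^esub>" "\<one>\<^bsub>D\<^esub>" d] that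
      by (simp add: \<beta>t ring_hom_one[OF f] C'_def w_def B_def[symmetric] D_def[symmetric])
  qed
  let ?P = "alg_module f B" and ?C = "alg_module \<alpha> C" and ?C' = "alg_module \<beta> C'"
  note mP = module_alg_module[OF A.is_cring f B.is_cring]
  note mC = module_alg_module[OF A.is_cring \<alpha> C.is_cring] and mC' = module_alg_module[OF B.is_cring \<beta> C'.is_cring]
  note sg = subgrp_tensor_rel[OF mC mP]
  define \<theta> where "\<theta> = frag_extend (\<lambda>(b, d). frag_of (\<delta> d, b :: 'r))"
  have \<theta>_of [simp]: "\<theta> (frag_of (b, d)) = frag_of (\<delta> d, b)" for b d by (simp add: \<theta>_def)
  have \<theta>_diff: "\<theta> (u - v) = \<theta> u - \<theta> v" for u v by (simp add: \<theta>_def frag_extend_diff)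
  have \<theta>_0 [simp]: "\<theta> 0 = 0" by (simp add: \<theta>_def)
  have Kz: "carrier (stalk X (fst z)) = carrier A" "carrier (stalk X' (snd z)) = carrier D"
    by (simp_all add: z_def A_def D_def)
  have Kw: "carrier (stalk X (fst w)) = carrier B" "carrier (stalk X' (snd w)) = carrier D" by (simp_all add: w_def B_def D_def)
  have \<theta>_tf: "\<theta> u \<in> tfree ?C ?P" if "u \<in> tfree (K w) (K' w)" for u
    using that by (induction u rule: tfree_induct)
      (auto simp: subgrp_0[OF subgrp_tfree] subgrp_diff[OF subgrp_tfree] \<theta>_diff \<delta>_cl Kw)
  have \<theta>_rel: "\<theta> u \<in> tensor_rel A ?C ?P" if u: "u \<in> Rel w" for u
  proof -
    have "u \<in> {u. \<theta> u \<in> tensor_rel A ?C ?P}"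
    proof (rule tensor_rel_induct[OF X.module_alg X'.module_alg u])
      show "fst w \<in> topspace X.T" "snd w \<in> topspace X'.T" using qt x by (simp_all add: w_def)
      show "subgrp {u. \<theta> u \<in> tensor_rel A ?C ?P}"
        by (auto simp: subgrp_def \<theta>_diff subgrp_0[OF sg] subgrp_diff[OF sg])
    next
      fix b b' d assume "b \<in> carrier (K w)" "b' \<in> carrier (K w)" "d \<in> carrier (K' w)"
      then show "frag_of (b \<oplus>\<^bsub>K w\<^esub> b', d) - frag_of (b, d) - frag_of (b', d) \<in> {u. \<theta> u \<in> tensor_rel A ?C ?P}"
        using tensor_rel_add_right[of "\<delta> d" ?C b ?P b' A] \<delta>_cl by (simp add: \<theta>_diff w_def B_def D_def)
    next
      fix b d d' assume *: "b \<in> carrier (K w)" "d \<in> carrier (K' w)" "d' \<in> carrier (K' w)"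
      then have d: "b \<in> carrier B" "d \<in> carrier D" "d' \<in> carrier D" by (simp_all add: Kw)
      have "\<delta> (d \<oplus>\<^bsub>D\<^esub> d') = \<delta> d \<oplus>\<^bsub>C\<^esub> \<delta> d'"
        unfolding \<delta>_def C_def tsec_add[OF z]
      proof (subst tsec_eq_iff[OF z])
        show "frag_of (\<one>\<^bsub>A\<^esub>, d \<oplus>\<^bsub>D\<^esub> d') \<in> tfree (K z) (K' z)" using d by (intro tfz) auto
        show "frag_of (\<one>\<^bsub>A\<^esub>, d) + frag_of (\<one>\<^bsub>A\<^esub>, d') \<in> tfree (K z) (K' z)"
          using d by (intro subgrp_add[OF subgrp_tfree] tfz) auto
        show "frag_of (\<one>\<^bsub>A\<^esub>, d \<oplus>\<^bsub>D\<^esub> d') - (frag_of (\<one>\<^bsub>A\<^esub>, d) + frag_of (\<one>\<^bsub>A\<^esub>, d')) \<in> Rel z"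
          using tensor_rel_add_right[of "\<one>\<^bsub>A\<^esub>" "K z" d "K' z" d' k] d A.one_closed by (simp add: z_def A_def D_def diff_diff_eq)
      qed
      then show "frag_of (b, d \<oplus>\<^bsub>K' w\<^esub> d') - frag_of (b, d) - frag_of (b, d') \<in> {u. \<theta> u \<in> tensor_rel A ?C ?P}"
        using tensor_rel_add_left[of "\<delta> d" ?C "\<delta> d'" b ?P A] \<delta>_cl d by (simp add: \<theta>_diff w_def D_def)
    next
      fix r b d assume *: "r \<in> carrier k" "b \<in> carrier (K w)" "d \<in> carrier (K' w)"
      then have d: "b \<in> carrier B" "d \<in> carrier D" by (simp_all add: Kw)
      let ?s = "stalk_struct X a p r" and ?s' = "stalk_struct X' a' x r"
      have s: "?s \<in> carrier A" "?s' \<in> carrier D" "f ?s = stalk_struct X a q r"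
        using ring_hom_closed[OF X.stalk_struct_hom[OF p] *(1)] ring_hom_closed[OF X'.stalk_struct_hom[OF x] *(1)]
          X.stalk_struct_res[OF p q *(1)] by (simp_all add: A_def D_def f_def)
      \<comment> \<open>An element of \<open>k\<close> acts on 1 \<otimes> d through either factor,
        because the stalk of the product is a tensor product over \<open>k\<close>.\<close>
      have "\<alpha> ?s \<otimes>\<^bsub>C\<^esub> \<delta> d = \<delta> (?s' \<otimes>\<^bsub>D\<^esub> d)"
        unfolding \<alpha>\<delta>[OF s(1) d(2)] unfolding \<delta>_def
      proof (subst tsec_eq_iff[OF z])
        show "frag_of (?s, d) \<in> tfree (K z) (K' z)" "frag_of (\<one>\<^bsub>A\<^esub>, ?s' \<otimes>\<^bsub>D\<^esub> d) \<in> tfree (K z) (K' z)"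
          using d s by (simp_all add: Kz)
        show "frag_of (?s, d) - frag_of (\<one>\<^bsub>A\<^esub>, ?s' \<otimes>\<^bsub>D\<^esub> d) \<in> Rel z"
          using tensor_rel_smult[of r k "\<one>\<^bsub>A\<^esub>" "K z" d "K' z"] *(1) d s
          by (simp add: z_def A_def[symmetric] D_def[symmetric])
      qed
      moreover have "frag_of (?s \<odot>\<^bsub>?C\<^esub> \<delta> d, b) - frag_of (\<delta> d, ?s \<odot>\<^bsub>?P\<^esub> b) \<in> tensor_rel A ?C ?P"
        using s d \<delta>_cl by (intro tensor_rel_smult) auto
      ultimately have "frag_of (\<delta> d, f ?s \<otimes>\<^bsub>B\<^esub> b) - frag_of (\<delta> (?s' \<otimes>\<^bsub>D\<^esub> d), b) \<in> tensor_rel A ?C ?P"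
        using subgrp_sym[OF sg] by simp
      then show "frag_of (r \<odot>\<^bsub>K w\<^esub> b, d) - frag_of (b, r \<odot>\<^bsub>K' w\<^esub> d) \<in> {u. \<theta> u \<in> tensor_rel A ?C ?P}"
        by (simp add: \<theta>_diff w_def s(3) B_def D_def)
    qed
    then show ?thesis by simp
  qed
  have h_tf: "tensor_frag h (\<lambda>y. y) t \<in> tfree ?C' (alg_module (\<lambda>b. b) B)" if "t \<in> tfree ?C ?P" for t
    by (rule tensor_frag_tfree[OF that]) (auto simp: ring_hom_closed[OF h])
  have ev: "tensor_eval B ?C' (tensor_frag h (\<lambda>y. y) (\<theta> u)) = tsec w u" if "u \<in> tfree (K w) (K' w)" for u
    using that
  proof (induction u rule: tfree_induct)
    case zero
    show ?case using tensor_eval_0[OF mC'] tsec_zero[OF w] by (simp add: C'_def)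
  next
    case (one b d)
    then show ?case using tensor_eval_hom(2)[OF mC'] h\<delta> \<delta>_cl by (simp add: Kw ring_hom_closed[OF h])
  next
    case (diff u v)
    \<comment> \<open>Subtraction goes through the additive inverse of the particular structure, so
      the two structures on the same carrier have to be compared.\<close>
    have "x \<ominus>\<^bsub>?C'\<^esub> y = x \<ominus>\<^bsub>C'\<^esub> y" if "x \<in> carrier C'" "y \<in> carrier C'" for x y
    proof -
      have "(x \<ominus>\<^bsub>?C'\<^esub> y) \<oplus>\<^bsub>?C'\<^esub> y = x" "x \<ominus>\<^bsub>?C'\<^esub> y \<in> carrier ?C'"
        using that abelian_group.minus_closed[OF module_abelian_group[OF mC'], of x y]
          abelian_group.r_neg[OF module_abelian_group[OF mC']] module_uminus_closed[OF mC']
        by (auto simp: a_minus_def C'.a_assoc abelian_group.l_neg[OF module_abelian_group[OF mC'], simplified] simp del: C'.add.m_comm)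
      then show ?thesis using that by (metis C'.add.inv_solve_right C'.minus_eq a_inv_def alg_module_simps(1,3))
    qed
    then show ?case
      using diff tensor_eval_diff[OF mC' h_tf[OF \<theta>_tf[OF diff(1)]] h_tf[OF \<theta>_tf[OF diff(2)]]]
        tsec_diff[OF w diff(1,2)] tsec_closed[OF w diff(1)] tsec_closed[OF w diff(2)]
      by (simp add: tensor_frag_diff \<theta>_diff C'_def)
  qed
  \<comment> \<open>A scalar s from O_p crosses the tensor sign: (s \<otimes> d) \<otimes> b is
    congruent to (1 \<otimes> d) \<otimes> f(s) b. Hence every tensor is congruent to a value of
    \<open>\<theta>\<close>.\<close>
  have red1: "\<exists>u\<in>tfree (K w) (K' w). frag_of (tsec z c, b) - \<theta> u \<in> tensor_rel A ?C ?P"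
    if "c \<in> tfree (K z) (K' z)" and b: "b \<in> carrier B" for c b
    using that(1)
  proof (induction c rule: tfree_induct)
    case zero
    have "frag_of (\<zero>\<^bsub>?C\<^esub>, b) \<in> tensor_rel A ?C ?P" by (rule tensor_rel_zero_left[OF mC mP]) (simp add: b)
    then show ?case using tsec_zero[OF z] subgrp_0[OF subgrp_tfree] by (intro bexI[of _ 0]) (simp_all add: C_def)
  next
    case (one s d)
    then have sd: "s \<in> carrier A" "d \<in> carrier D" by (simp_all add: z_def A_def D_def)
    have "frag_of (s \<odot>\<^bsub>?C\<^esub> \<delta> d, b) - frag_of (\<delta> d, s \<odot>\<^bsub>?P\<^esub> b) \<in> tensor_rel A ?C ?P"
      using sd b \<delta>_cl by (intro tensor_rel_smult) auto
    then have "frag_of (tsec z (frag_of (s, d)), b) - \<theta> (frag_of (f s \<otimes>\<^bsub>B\<^esub> b, d)) \<in> tensor_rel A ?C ?P"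
      by (simp add: \<alpha>\<delta>[OF sd])
    moreover have "frag_of (f s \<otimes>\<^bsub>B\<^esub> b, d) \<in> tfree (K w) (K' w)"
      using sd b ring_hom_closed[OF f] by (simp add: w_def B_def[symmetric] D_def[symmetric])
    ultimately show ?case by blast
  next
    case (diff c c')
    then obtain u v where uv: "u \<in> tfree (K w) (K' w)" "v \<in> tfree (K w) (K' w)"
      "frag_of (tsec z c, b) - \<theta> u \<in> tensor_rel A ?C ?P" "frag_of (tsec z c', b) - \<theta> v \<in> tensor_rel A ?C ?P" by blast
    have cl: "tsec z c \<in> carrier C" "tsec z c' \<in> carrier C" "tsec z (c - c') \<in> carrier C"
      using tsec_closed[OF z] diff(1,2) subgrp_diff[OF subgrp_tfree diff(1,2)] by (simp_all add: C_def)
    have "tsec z c = tsec z (c - c') \<oplus>\<^bsub>?C\<^esub> tsec z c'" using tsec_add[OF z, of "c - c'" c'] by (simp add: C_def)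
    then have "frag_of (tsec z c, b) - frag_of (tsec z (c - c'), b) - frag_of (tsec z c', b) \<in> tensor_rel A ?C ?P"
      using tensor_rel_add_left[of "tsec z (c - c')" ?C "tsec z c'" b ?P A] cl b by simp
    from subgrp_diff[OF sg subgrp_diff[OF sg uv(3,4)] this]
    have "frag_of (tsec z (c - c'), b) - \<theta> (u - v) \<in> tensor_rel A ?C ?P"
      by (simp add: \<theta>_diff algebra_simps)
    then show ?case using subgrp_diff[OF subgrp_tfree uv(1,2)] by blast
  qed
  have red: "\<exists>u\<in>tfree (K w) (K' w). t - \<theta> u \<in> tensor_rel A ?C ?P" if "t \<in> tfree ?C ?P" for t
    using that
  proof (induction t rule: tfree_induct)
    case zero show ?case using subgrp_0[OF sg] subgrp_0[OF subgrp_tfree] by (intro bexI[of _ 0]) simp_all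
  next
    case (one c b)
    then show ?case using tsec_surj[OF z, of c] red1[of _ b] by (auto simp: C_def)
  next
    case (diff s t)
    then obtain u v where uv: "u \<in> tfree (K w) (K' w)" "v \<in> tfree (K w) (K' w)"
      "s - \<theta> u \<in> tensor_rel A ?C ?P" "t - \<theta> v \<in> tensor_rel A ?C ?P" by blast
    from subgrp_diff[OF sg uv(3,4)] have "s - t - \<theta> (u - v) \<in> tensor_rel A ?C ?P"
      by (simp add: \<theta>_diff algebra_simps)
    then show ?case using subgrp_diff[OF subgrp_tfree uv(1,2)] by blast
  qed
  have hc: "semilinear A f ?C ?C' h"
    using h ring_hom_closed[OF \<alpha>] psr_stalk_res[OF p q ox]
    by (auto simp: semilinear_def add_hom_def ring_hom_closed ring_hom_add ring_hom_mult)
      (simp add: h_def \<alpha>_def \<beta>_def f_def A_def mow)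
  have "base_change A B f ?C ?C' h"
    unfolding base_change_def
  proof (intro conjI ballI impI)
    fix y assume "y \<in> carrier ?C'"
    then obtain u where u: "u \<in> tfree (K w) (K' w)" "y = tsec w u" using tsec_surj[OF w, of y] by (auto simp: C'_def)
    then show "\<exists>t\<in>tfree ?C ?P. tensor_eval B ?C' (tensor_frag h (\<lambda>y. y) t) = y"
      using \<theta>_tf[OF u(1)] ev[OF u(1)] by auto
  next
    fix t assume t: "t \<in> tfree ?C ?P" "tensor_eval B ?C' (tensor_frag h (\<lambda>y. y) t) = \<zero>\<^bsub>?C'\<^esub>"
    \<comment> \<open>\<open>\<theta>\<close> reaches every tensor modulo relations and is inverted
      by evaluation. So \<open>u\<close> has value 0, hence is a relation over \<open>k\<close>, and
      \<open>\<theta>\<close> preserves relations.\<close>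
    obtain u where u: "u \<in> tfree (K w) (K' w)" "t - \<theta> u \<in> tensor_rel A ?C ?P" using red[OF t(1)] by blast
    have id: "\<And>b. b \<in> carrier B \<Longrightarrow> (\<lambda>b. b) b = b" by simp
    have "tensor_frag h (\<lambda>y. y) (t - \<theta> u) \<in> tensor_rel B ?C' (alg_module (\<lambda>b. b) B)"
      by (rule tensor_frag_semilinear_rel[OF A.is_cring B.is_cring f mC mC' hc id u(2)])
    moreover have "tensor_frag h (\<lambda>y. y) t \<in> tensor_rel B ?C' (alg_module (\<lambda>b. b) B)"
      using tensor_eval_rel_iff(1)[OF mC' id h_tf[OF t(1)]] t(2) by blast
    ultimately have "tensor_frag h (\<lambda>y. y) (\<theta> u) \<in> tensor_rel B ?C' (alg_module (\<lambda>b. b) B)"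
      using subgrp_cong[OF subgrp_tensor_rel[OF mC' module_alg_self[OF mC' id]], of "tensor_frag h (\<lambda>y. y) t" "tensor_frag h (\<lambda>y. y) (\<theta> u)"]
      by (simp add: tensor_frag_diff)
    then have "tsec w u = tsec w 0"
      using tensor_eval_rel_iff(1)[OF mC' id h_tf[OF \<theta>_tf[OF u(1)]]] ev[OF u(1)] tsec_zero[OF w] by (simp add: C'_def)
    then have "u \<in> Rel w" using tsec_eq_iff[OF w u(1) subgrp_0[OF subgrp_tfree]] by simp
    then show "t \<in> tensor_rel A ?C ?P" using \<theta>_rel subgrp_cong[OF sg u(2)] by blast
  qed
  then show ?thesis
    unfolding A_def B_def f_def \<alpha>_def \<beta>_def C_def C'_def h_def moz mow .
qed

text \<open>A presentation of \<open>M\<close> near (p, x) restricts to presentations over U_p x U_x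
  and U_q x U_x. Both are minimal open sets, so stalkwise exactness is exactness of sections. Free
  modules have the base change property by \<open>base_change_stalk\<close> and
  \<open>base_change_free\<close>, and cokernels inherit it.\<close>

lemma quasi_coherent_base_change:
  fixes M :: "('p \<times> 'q, 'p \<times> 'q \<Rightarrow> ('r \<times> 's \<Rightarrow>\<^sub>0 int) set, 'm) module_sheaf"
  assumes qc: "quasi_coherent Y M" and p: "p \<in> topspace X.T" and q: "q \<in> X.mo p" and x: "x \<in> topspace X'.T"
  shows "base_change (stalk X p) (stalk X q) (stalk_res X p q)
    (restrict_scalars (psr p (X'.mo x)) (msec M (X.mo p \<times> X'.mo x)))
    (restrict_scalars (psr q (X'.mo x)) (msec M (X.mo q \<times> X'.mo x)))
    (mres M (X.mo p \<times> X'.mo x) (X.mo q \<times> X'.mo x))"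
proof -
  let ?z = "(p, x)" and ?w = "(q, x)"
  have qt: "q \<in> topspace X.T" using X.mo_top[OF p q] .
  have z: "?z \<in> topspace TY" and w: "?w \<in> topspace TY" using p x qt by (auto simp: topspace_Y)
  have moz: "X.mo p \<times> X'.mo x = moY ?z" and mow: "X.mo q \<times> X'.mo x = moY ?w"
    using moY_pair p qt x by auto
  have wz: "?w \<in> moY ?z" using q min_open_self[of x X'.T] moz by auto
  have sh: "sheaf_of_modules Y M" using qc by (simp add: quasi_coherent_def)
  have "\<exists>U. openin TY U \<and> ?z \<in> U \<and>
      (\<exists>(I :: ('m \<Rightarrow> 'p \<times> 'q \<Rightarrow> ('r \<times> 's \<Rightarrow>\<^sub>0 int) set) set) (J :: 'm set). free_cokernel (open_sub Y U) I J M)"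
    using conjunct2[OF qc[unfolded quasi_coherent_def]] z by (rule bspec)
  then obtain U and I :: "('m \<Rightarrow> 'p \<times> 'q \<Rightarrow> ('r \<times> 's \<Rightarrow>\<^sub>0 int) set) set" and J :: "'m set"
    where U: "openin TY U" "?z \<in> U" and fc: "free_cokernel (open_sub Y U) I J M"
    by (elim exE conjE)
  let ?Y = "open_sub Y U"
  obtain F g where F: "F \<in> sheaf_hom ?Y (free_sheaf ?Y I) (free_sheaf ?Y J)" and g: "g \<in> sheaf_hom ?Y (free_sheaf ?Y J) M"
    and ex: "exact_at ?Y (free_sheaf ?Y I) F (free_sheaf ?Y J) g M" and ep: "sheaf_epi ?Y (free_sheaf ?Y J) g M"
    using fc unfolding free_cokernel_def by blast
  \<comment> \<open>The neighbourhood contains the minimal open set of (p, x) and therefore (q, x):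
    one presentation serves both points.\<close>
  have wU: "?w \<in> U" using open_moY(1)[OF U] wz by blast
  have mo: "min_open (subtopology TY U) v = moY v" if "v \<in> U" for v
    using min_open_subtopology[OF finite_Y U(1) that] by simp
  have top: "v \<in> topspace (subtopology TY U)" if "v \<in> U" for v
    using that open_moY(2)[OF U(1) that] by simp
  have opn: "openin (topo ?Y) (moY v)" if "v \<in> U" for v
    using open_moY[OF U(1) that] moY_open U(1) by (simp add: openin_open_subtopology)
  let ?C = "sec Y (moY ?z)" and ?C' = "sec Y (moY ?w)"
  define H where "H = (\<lambda>s :: 'p \<times> 'q \<Rightarrow> ('r \<times> 's \<Rightarrow>\<^sub>0 int) set. restrict s (moY ?w))"
  let ?\<alpha> = "psr p (X'.mo x)" and ?\<beta> = "psr q (X'.mo x)"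
  have ox: "openin X'.T (X'.mo x)" by (rule X'.mo_open[OF x])
  have \<alpha>: "?\<alpha> \<in> ring_hom (stalk X p) ?C" and \<beta>: "?\<beta> \<in> ring_hom (stalk X q) ?C'"
    using psr_hom[OF p ox] psr_hom[OF qt ox] by (simp_all add: moz mow)
  note cA = X.cring_stalk[OF p] and cB = X.cring_stalk[OF qt]
  note cC = cring_Y[OF moY_open[OF z]] and cC' = cring_Y[OF moY_open[OF w]]
  note f = X.stalk_res_hom[OF p q]
  note mon = moY_mono[OF z wz]
  have h: "H \<in> ring_hom ?C ?C'" unfolding H_def by (rule res_Y_hom[OF moY_open[OF z] moY_open[OF w] mon])
  have h\<alpha>: "H (?\<alpha> s) = ?\<beta> (stalk_res X p q s)" if "s \<in> carrier (stalk X p)" for s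
    using psr_stalk_res[OF p q ox that] by (simp add: mow H_def)
  have bc: "base_change (stalk X p) (stalk X q) (stalk_res X p q) (alg_module ?\<alpha> ?C) (alg_module ?\<beta> ?C') H"
    using base_change_stalk[OF p q x] by (simp add: moz mow H_def)
  note mM = module_restrict_scalars[OF cA \<alpha> sheaf_of_modulesD(1)[OF sh moY_open[OF z]]]
    and mM' = module_restrict_scalars[OF cB \<beta> sheaf_of_modulesD(1)[OF sh moY_open[OF w]]]
  note mfree = module_restrict_scalars[OF cA \<alpha> module_free_module[OF cC]]
    and mfree' = module_restrict_scalars[OF cB \<beta> module_free_module[OF cC']]
  note F1 = sheaf_homD(1)[OF F opn, unfolded msec_free_sheaf open_sub_simps]
  note g1 = sheaf_homD(1)[OF g opn, unfolded msec_free_sheaf open_sub_simps]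
  note rM = sheaf_of_modulesD(2)[OF sh moY_open[OF z] moY_open[OF w] mon]
  have ex': "F (moY v) ` carrier (free_module (sec Y (moY v)) I) =
      {y \<in> carrier (free_module (sec Y (moY v)) J). g (moY v) y = \<zero>\<^bsub>msec M (moY v)\<^esub>}" if "v \<in> U" for v
    using bspec[OF ex[unfolded exact_at_def mstalk_def msec_free_sheaf open_sub_simps] top[OF that]] unfolding mo[OF that] .
  have ep': "g (moY v) ` carrier (free_module (sec Y (moY v)) J) = carrier (msec M (moY v))" if "v \<in> U" for v
    using bspec[OF ep[unfolded sheaf_epi_def mstalk_def msec_free_sheaf open_sub_simps] top[OF that]] unfolding mo[OF that] .
  have natF: "(\<lambda>j\<in>J. H (F (moY ?z) y j)) = F (moY ?w) (\<lambda>j\<in>I. H (y j))" if "y \<in> carrier (free_module ?C I)" for y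
    using sheaf_homD(2)[OF F opn[OF U(2)] opn[OF wU] mon, unfolded msec_free_sheaf mres_free_sheaf open_sub_simps res_Y, OF that] by (simp add: H_def)
  have natg: "mres M (moY ?z) (moY ?w) (g (moY ?z) y) = g (moY ?w) (\<lambda>j\<in>J. H (y j))" if "y \<in> carrier (free_module ?C J)" for y
    using sheaf_homD(2)[OF g opn[OF U(2)] opn[OF wU] mon, unfolded msec_free_sheaf mres_free_sheaf open_sub_simps res_Y, OF that] by (simp add: H_def)
  have semi: "semilinear (stalk X p) (stalk_res X p q) (restrict_scalars ?\<alpha> (msec M (moY ?z)))
      (restrict_scalars ?\<beta> (msec M (moY ?w))) (mres M (moY ?z) (moY ?w))"
    using mod_homD[OF rM] h\<alpha> ring_hom_closed[OF \<alpha>]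
    by (auto simp: semilinear_def add_hom_def res_Y H_def)
  show ?thesis
    unfolding moz mow
  proof (rule base_change_cokernel[OF cA cB f mfree mfree mM mfree' mfree' mM'
        mod_hom_restrict_scalars[OF F1[OF U(2)] \<alpha>] mod_hom_restrict_scalars[OF g1[OF U(2)] \<alpha>]
        mod_hom_restrict_scalars[OF F1[OF wU] \<beta>] mod_hom_restrict_scalars[OF g1[OF wU] \<beta>]
        _ _ _ _ semilinear_free[OF cA cB cC cC' f \<alpha> \<beta> h, OF h\<alpha>] semilinear_free[OF cA cB cC cC' f \<alpha> \<beta> h, OF h\<alpha>] semi _ _
        base_change_free[OF cA cB cC cC' f \<alpha> \<beta> h, OF h\<alpha> bc] base_change_free[OF cA cB cC cC' f \<alpha> \<beta> h, OF h\<alpha> bc]])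
    show "g (moY ?z) (F (moY ?z) y) = \<zero>\<^bsub>restrict_scalars ?\<alpha> (msec M (moY ?z))\<^esub>"
      if "y \<in> carrier (restrict_scalars ?\<alpha> (free_module ?C I))" for y
      using ex'[OF U(2)] that by auto
    show "\<exists>y\<in>carrier (restrict_scalars ?\<alpha> (free_module ?C J)). g (moY ?z) y = m"
      if "m \<in> carrier (restrict_scalars ?\<alpha> (msec M (moY ?z)))" for m
    proof -
      have "m \<in> g (moY ?z) ` carrier (free_module ?C J)" unfolding ep'[OF U(2)] using that by simp
      then show ?thesis by auto
    qed
    show "\<exists>y\<in>carrier (restrict_scalars ?\<beta> (free_module ?C' I)). F (moY ?w) y = v"
      if "v \<in> carrier (restrict_scalars ?\<beta> (free_module ?C' J))" "g (moY ?w) v = \<zero>\<^bsub>restrict_scalars ?\<beta> (msec M (moY ?w))\<^esub>" for v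
    proof -
      have "v \<in> F (moY ?w) ` carrier (free_module ?C' I)" unfolding ex'[OF wU] using that by simp
      then show ?thesis by auto
    qed
    show "\<exists>y\<in>carrier (restrict_scalars ?\<beta> (free_module ?C' J)). g (moY ?w) y = m"
      if "m \<in> carrier (restrict_scalars ?\<beta> (msec M (moY ?w)))" for m
    proof -
      have "m \<in> g (moY ?w) ` carrier (free_module ?C' J)" unfolding ep'[OF wU] using that by simp
      then show ?thesis by auto
    qed
  qed (use natF natg in auto)
qed

end

section \<open>Sheaves of modules on ringed finite spaces\<close>

lemma sheaf_on_glue:
  assumes "sheaf_on T S r" "\<And>V. V \<in> \<U> \<Longrightarrow> openin T V" "\<And>V. V \<in> \<U> \<Longrightarrow> s V \<in> S V"
    "\<And>V W. V \<in> \<U> \<Longrightarrow> W \<in> \<U> \<Longrightarrow> r V (V \<inter> W) (s V) = r W (V \<inter> W) (s W)"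
  shows "\<exists>!t. t \<in> S (\<Union>\<U>) \<and> (\<forall>V\<in>\<U>. r (\<Union>\<U>) V t = s V)"
proof -
  have "(\<forall>V\<in>\<U>. openin T V \<and> s V \<in> S V) \<longrightarrow>
        (\<forall>V\<in>\<U>. \<forall>W\<in>\<U>. r V (V \<inter> W) (s V) = r W (V \<inter> W) (s W)) \<longrightarrow>
        (\<exists>!t. t \<in> S (\<Union>\<U>) \<and> (\<forall>V\<in>\<U>. r (\<Union>\<U>) V t = s V))"
    using assms(1) unfolding sheaf_on_def by (elim conjE allE)
  then show ?thesis using assms(2-4) by blast
qed

lemma sheaf_on_pre:
  assumes "sheaf_on T S r"
  shows "openin T U \<Longrightarrow> openin T V \<Longrightarrow> V \<subseteq> U \<Longrightarrow> x \<in> S U \<Longrightarrow> r U V x \<in> S V"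
    and "openin T U \<Longrightarrow> x \<in> S U \<Longrightarrow> r U U x = x"
    and "openin T U \<Longrightarrow> openin T V \<Longrightarrow> openin T W \<Longrightarrow> W \<subseteq> V \<Longrightarrow> V \<subseteq> U \<Longrightarrow> x \<in> S U \<Longrightarrow>
      r V W (r U V x) = r U W x"
proof -
  have pre: "presheaf_on T S r" using assms by (simp add: sheaf_on_def)
  show "openin T U \<Longrightarrow> openin T V \<Longrightarrow> V \<subseteq> U \<Longrightarrow> x \<in> S U \<Longrightarrow> r U V x \<in> S V"
    using pre by (simp add: presheaf_on_def Pi_iff)
  show "openin T U \<Longrightarrow> x \<in> S U \<Longrightarrow> r U U x = x" using pre by (simp add: presheaf_on_def)
  show "openin T U \<Longrightarrow> openin T V \<Longrightarrow> openin T W \<Longrightarrow> W \<subseteq> V \<Longrightarrow> V \<subseteq> U \<Longrightarrow> x \<in> S U \<Longrightarrow>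
      r V W (r U V x) = r U W x" using pre by (simp add: presheaf_on_def)
qed

lemma sheaf_on_eqI:
  assumes sh: "sheaf_on T S r" and op: "\<And>V. V \<in> \<U> \<Longrightarrow> openin T V" and t: "t \<in> S (\<Union>\<U>)" "t' \<in> S (\<Union>\<U>)"
    and eq: "\<And>V. V \<in> \<U> \<Longrightarrow> r (\<Union>\<U>) V t = r (\<Union>\<U>) V t'"
  shows "t = t'"
proof -
  have opU: "openin T (\<Union>\<U>)" using op by blast
  note p = sheaf_on_pre[OF sh]
  have "\<exists>!u. u \<in> S (\<Union>\<U>) \<and> (\<forall>V\<in>\<U>. r (\<Union>\<U>) V u = r (\<Union>\<U>) V t)"
  proof (rule sheaf_on_glue[OF sh op])
    show "r (\<Union>\<U>) V t \<in> S V" if "V \<in> \<U>" for V by (rule p(1)[OF opU op[OF that] _ t(1)]) (use that in auto)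
    show "r V (V \<inter> W) (r (\<Union>\<U>) V t) = r W (V \<inter> W) (r (\<Union>\<U>) W t)" if "V \<in> \<U>" "W \<in> \<U>" for V W
    proof -
      have "openin T (V \<inter> W)" using op that by auto
      then show ?thesis
        using p(3)[OF opU op[OF that(1)] _ _ Union_upper[OF that(1)] t(1), of "V \<inter> W"] p(3)[OF opU op[OF that(2)] _ _ Union_upper[OF that(2)] t(1), of "V \<inter> W"]
        by simp
    qed
  qed
  then show ?thesis using t eq by metis
qed

lemma sheaf_on_glue2:
  assumes sh: "sheaf_on T S r" and op: "openin T V1" "openin T V2" and x: "x1 \<in> S V1" "x2 \<in> S V2"
    and eq: "r V1 (V1 \<inter> V2) x1 = r V2 (V1 \<inter> V2) x2"
  shows "\<exists>x\<in>S (V1 \<union> V2). r (V1 \<union> V2) V1 x = x1 \<and> r (V1 \<union> V2) V2 x = x2"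
proof -
  \<comment> \<open>If \<open>V1\<close> and \<open>V2\<close> coincide, then \<open>eq\<close>
    forces x1 = x2, so assigning a section to each set is consistent.\<close>
  define s where "s V = (if V = V1 then x1 else x2)" for V
  have s: "s V1 = x1" "s V2 = x2"
    using eq sheaf_on_pre(2)[OF sh] op x by (auto simp: s_def)
  have "\<exists>!t. t \<in> S (\<Union>{V1, V2}) \<and> (\<forall>V\<in>{V1, V2}. r (\<Union>{V1, V2}) V t = s V)"
    by (rule sheaf_on_glue[OF sh]) (use op x s eq in \<open>auto simp: Int_commute\<close>)
  then show ?thesis using s by (metis insertI1 insertI2 Union_insert Union_empty Un_empty_right)
qed

context ringed_finite_space
begin

abbreviation "umin \<equiv> min_open (topo X)"

lemmas umin_open = min_open_open[OF finite_topspace]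

lemma open_pt: "openin (topo X) U \<Longrightarrow> u \<in> U \<Longrightarrow> u \<in> topspace (topo X)"
  using openin_subset by blast

lemma Union_umin:
  assumes "openin (topo X) U" shows "\<Union>(umin ` U) = U"
proof
  show "\<Union>(umin ` U) \<subseteq> U" using min_open_least[OF assms] by blast
  show "U \<subseteq> \<Union>(umin ` U)" using min_open_self[of _ "topo X"] by blast
qed

lemma sheaf_eqI:
  assumes sh: "sheaf_on (topo X) S r" and U: "openin (topo X) U" and t: "t \<in> S U" "t' \<in> S U"
    and eq: "\<And>u. u \<in> U \<Longrightarrow> r U (umin u) t = r U (umin u) t'"
  shows "t = t'"
proof (rule sheaf_on_eqI[OF sh, of "umin ` U"])
  show "openin (topo X) V" if "V \<in> umin ` U" for V using that umin_open open_pt[OF U] by auto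
qed (use t eq in \<open>auto simp: Union_umin[OF U]\<close>)

lemma res_zero: "openin (topo X) U \<Longrightarrow> openin (topo X) V \<Longrightarrow> V \<subseteq> U \<Longrightarrow> res X U V \<zero>\<^bsub>sec X U\<^esub> = \<zero>\<^bsub>sec X V\<^esub>"
  using cring_sec by (intro ring_hom_zero[OF res_hom]) (auto simp: cring_def)

text \<open>The structure sheaf of \<open>W\<close> extended by zero, as an ideal sheaf.\<close>

definition ext_zero :: "'p set \<Rightarrow> ('p, 'r, 'r) module_sheaf" where
  "ext_zero W = \<lparr>msec = (\<lambda>U. (alg_module (\<lambda>x. x) (sec X U))
      \<lparr>carrier := {x \<in> carrier (sec X U). \<forall>u\<in>U - W. res X U (umin u) x = \<zero>\<^bsub>sec X (umin u)\<^esub>}\<rparr>),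
     mres = res X\<rparr>"

lemma ext_zero_simps:
  "x \<in> carrier (msec (ext_zero W) U) \<longleftrightarrow>
    x \<in> carrier (sec X U) \<and> (\<forall>u\<in>U - W. res X U (umin u) x = \<zero>\<^bsub>sec X (umin u)\<^esub>)"
  "x \<oplus>\<^bsub>msec (ext_zero W) U\<^esub> y = x \<oplus>\<^bsub>sec X U\<^esub> y" "r \<odot>\<^bsub>msec (ext_zero W) U\<^esub> x = r \<otimes>\<^bsub>sec X U\<^esub> x"
  "mres (ext_zero W) = res X" "\<zero>\<^bsub>msec (ext_zero W) U\<^esub> = \<zero>\<^bsub>sec X U\<^esub>"
  by (simp_all add: ext_zero_def)

text \<open>Vanishing of germs outside \<open>W\<close> is a local condition and is stable under
  multiplication, so gluing in the structure sheaf does not leave the ideal.\<close>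

lemma sheaf_ext_zero: "sheaf_of_modules X (ext_zero W)"
  unfolding sheaf_of_modules_def
proof (intro conjI allI impI)
  note p = sheaf_on_pre[OF sheaf_sec]
  have um: "openin (topo X) (umin u)" "umin u \<subseteq> U" if "openin (topo X) U" "u \<in> U" for u U
    using umin_open[OF open_pt[OF that]] min_open_least[OF that] .
  {
    fix U assume U: "openin (topo X) U"
    interpret R: cring "sec X U" by (rule cring_sec[OF U])
    have m: "Module.module (sec X U) (alg_module (\<lambda>x. x) (sec X U))"
      by (rule module_alg_module) (auto simp: ring_hom_def R.is_cring)
    have "submodule {x \<in> carrier (sec X U). \<forall>u\<in>U - W. res X U (umin u) x = \<zero>\<^bsub>sec X (umin u)\<^esub>} (sec X U) (alg_module (\<lambda>x. x) (sec X U))"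
    proof (rule submoduleI2[OF m])
      have hom: "res X U (umin u) \<in> ring_hom (sec X U) (sec X (umin u))" "cring (sec X (umin u))" if "u \<in> U" for u
        using res_hom[OF U] um[OF U that] cring_sec by auto
      have z: "z \<oplus>\<^bsub>sec X (umin u)\<^esub> z = z" if "u \<in> U" "z = \<zero>\<^bsub>sec X (umin u)\<^esub>" for u z
        using cring.cring_simprules(8)[OF hom(2)[OF that(1)], of z] cring.cring_simprules(2)[OF hom(2)[OF that(1)]] that(2) by simp
      show "\<zero>\<^bsub>alg_module (\<lambda>x. x) (sec X U)\<^esub> \<in> {x \<in> carrier (sec X U). \<forall>u\<in>U - W. res X U (umin u) x = \<zero>\<^bsub>sec X (umin u)\<^esub>}"
        using res_zero[OF U um(1)[OF U] um(2)[OF U]] by auto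
      show "x \<oplus>\<^bsub>alg_module (\<lambda>x. x) (sec X U)\<^esub> y \<in> {x \<in> carrier (sec X U). \<forall>u\<in>U - W. res X U (umin u) x = \<zero>\<^bsub>sec X (umin u)\<^esub>}"
        if "x \<in> {x \<in> carrier (sec X U). \<forall>u\<in>U - W. res X U (umin u) x = \<zero>\<^bsub>sec X (umin u)\<^esub>}"
          "y \<in> {x \<in> carrier (sec X U). \<forall>u\<in>U - W. res X U (umin u) x = \<zero>\<^bsub>sec X (umin u)\<^esub>}" for x y
        using that ring_hom_add[OF hom(1)] z by auto
      show "r \<odot>\<^bsub>alg_module (\<lambda>x. x) (sec X U)\<^esub> x \<in> {x \<in> carrier (sec X U). \<forall>u\<in>U - W. res X U (umin u) x = \<zero>\<^bsub>sec X (umin u)\<^esub>}"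
        if "r \<in> carrier (sec X U)" "x \<in> {x \<in> carrier (sec X U). \<forall>u\<in>U - W. res X U (umin u) x = \<zero>\<^bsub>sec X (umin u)\<^esub>}" for r x
        using that ring_hom_mult[OF hom(1)] ring_hom_closed[OF hom(1)] cring.cring_simprules(27)[OF hom(2)] by auto
    qed auto
    from module_submodule[OF m this] show "Module.module (sec X U) (msec (ext_zero W) U)" by (simp add: ext_zero_def)
  }
  have resW: "res X U V x \<in> carrier (msec (ext_zero W) V)"
    if "openin (topo X) U" "openin (topo X) V" "V \<subseteq> U" "x \<in> carrier (msec (ext_zero W) U)" for U V x
    using that p(1)[OF that(1-3)] p(3)[OF that(1,2) um(1)[OF that(2)] um(2)[OF that(2)] that(3)]
    by (auto simp: ext_zero_simps)
  show "mres (ext_zero W) U V \<in> mod_hom (sec X U) (msec (ext_zero W) U) (restrict_scalars (res X U V) (msec (ext_zero W) V))"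
    if "openin (topo X) U" "openin (topo X) V" "V \<subseteq> U" for U V
    using resW[OF that] ring_hom_add[OF res_hom[OF that]] ring_hom_mult[OF res_hom[OF that]]
    by (auto simp: mod_hom_def ext_zero_simps(2-4)) (auto simp: ext_zero_simps(1))
  show "sheaf_on (topo X) (\<lambda>U. carrier (msec (ext_zero W) U)) (mres (ext_zero W))"
    unfolding sheaf_on_def
  proof (intro conjI allI impI)
    show "presheaf_on (topo X) (\<lambda>U. carrier (msec (ext_zero W) U)) (mres (ext_zero W))"
      unfolding presheaf_on_def
    proof (intro conjI allI impI ballI)
      show "mres (ext_zero W) U V \<in> carrier (msec (ext_zero W) U) \<rightarrow> carrier (msec (ext_zero W) V)"
        if "openin (topo X) U" "openin (topo X) V" "V \<subseteq> U" for U V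
        using resW[OF that] by (auto simp: ext_zero_simps(4))
      show "mres (ext_zero W) U U s = s" if "openin (topo X) U" "s \<in> carrier (msec (ext_zero W) U)" for U s
        using p(2) that by (auto simp: ext_zero_simps)
      show "mres (ext_zero W) V E (mres (ext_zero W) U V s) = mres (ext_zero W) U E s"
        if "openin (topo X) U" "openin (topo X) V" "openin (topo X) E" "E \<subseteq> V" "V \<subseteq> U" "s \<in> carrier (msec (ext_zero W) U)" for U V E s
        using p(3)[OF that(1-5)] that(6) by (auto simp: ext_zero_simps)
    qed
  next
    fix \<U> s assume s: "\<forall>V\<in>\<U>. openin (topo X) V \<and> s V \<in> carrier (msec (ext_zero W) V)"
      and c: "\<forall>V\<in>\<U>. \<forall>E\<in>\<U>. mres (ext_zero W) V (V \<inter> E) (s V) = mres (ext_zero W) E (V \<inter> E) (s E)"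
    have opU: "openin (topo X) (\<Union>\<U>)" using s by blast
    have ex: "\<exists>!t. t \<in> carrier (sec X (\<Union>\<U>)) \<and> (\<forall>V\<in>\<U>. res X (\<Union>\<U>) V t = s V)"
      by (rule sheaf_on_glue[OF sheaf_sec]) (use s c in \<open>auto simp: ext_zero_simps\<close>)
    have "t \<in> carrier (msec (ext_zero W) (\<Union>\<U>))"
      if t: "t \<in> carrier (sec X (\<Union>\<U>))" "\<forall>V\<in>\<U>. res X (\<Union>\<U>) V t = s V" for t
      unfolding ext_zero_simps(1)
    proof (intro conjI ballI t)
      fix u assume u: "u \<in> \<Union>\<U> - W"
      then obtain V where V: "V \<in> \<U>" "u \<in> V" by blast
      then have oV: "openin (topo X) V" using s by blast
      have "res X (\<Union>\<U>) (umin u) t = res X V (umin u) (res X (\<Union>\<U>) V t)"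
        by (rule p(3)[OF opU oV um(1)[OF oV V(2)] um(2)[OF oV V(2)] _ t(1), symmetric]) (use V in blast)
      also have "\<dots> = \<zero>\<^bsub>sec X (umin u)\<^esub>" using t(2) V s u by (auto simp: ext_zero_simps)
      finally show "res X (\<Union>\<U>) (umin u) t = \<zero>\<^bsub>sec X (umin u)\<^esub>" .
    qed
    then show "\<exists>!t. t \<in> carrier (msec (ext_zero W) (\<Union>\<U>)) \<and> (\<forall>V\<in>\<U>. mres (ext_zero W) (\<Union>\<U>) V t = s V)"
      using ex unfolding ext_zero_simps(1,4) by blast
  qed
qed

text \<open>A section \<open>s\<close> of \<open>Q\<close> over \<open>W\<close> is a morphism to \<open>Q\<close> from the structure sheaf of \<open>W\<close> extended by zero.\<close>

lemma ext_zero_hom: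
  assumes Q: "sheaf_of_modules X Q" and W: "openin (topo X) W" and s: "s \<in> carrier (msec Q W)"
  shows "\<exists>f\<in>sheaf_hom X (ext_zero W) Q. f W \<one>\<^bsub>sec X W\<^esub> = s"
proof -
  note D = sheaf_of_modulesD[OF Q] and p = sheaf_on_pre[OF sheaf_sec]
  note q = sheaf_on_pre[OF D(3)]
  have um: "openin (topo X) (umin u)" "umin u \<subseteq> U" if "openin (topo X) U" "u \<in> U" for u U
    using umin_open[OF open_pt[OF that]] min_open_least[OF that] .
  \<comment> \<open>The local formula for the morphism: multiply the restriction of \<open>s\<close>
    by \<open>x\<close> where that makes sense, and take 0 elsewhere. On a minimal open set not
    inside \<open>W\<close> the restriction of \<open>x\<close> is 0, so on smaller sets, even those
    inside \<open>W\<close>, both branches agree; this is \<open>Gres\<close>.\<close>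
  define G where "G U x V = (if V \<subseteq> W then res X U V x \<odot>\<^bsub>msec Q V\<^esub> mres Q W V s else \<zero>\<^bsub>msec Q V\<^esub>)" for U x V
  have Gcl: "G U x V \<in> carrier (msec Q V)"
    if "openin (topo X) U" "openin (topo X) V" "V \<subseteq> U" "x \<in> carrier (sec X U)" for U V x
    using q(1)[OF W that(2) _ s] p(1)[OF that(1,2,3,4)] module_smult_closed[OF D(1)[OF that(2)]] module_zero_closed[OF D(1)[OF that(2)]]
    by (auto simp: G_def)
  have Gres: "mres Q V V' (G U x V) = G U x V'"
    if "openin (topo X) U" "openin (topo X) V" "openin (topo X) V'" "V' \<subseteq> V" "V \<subseteq> U" "x \<in> carrier (sec X U)"
      "V \<subseteq> W \<or> res X U V x = \<zero>\<^bsub>sec X V\<^esub>" for U V V' x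
  proof (cases "V \<subseteq> W")
    case True
    then show ?thesis
      using mod_homD(3)[OF D(2)[OF that(2-4)], of "res X U V x" "mres Q W V s"] q(1)[OF W that(2) True s] p(1)[OF that(1,2,5,6)]
        p(3)[OF that(1,2,3,4,5,6)] q(3)[OF W that(2,3,4) True s] subset_trans[OF that(4) True]
      by (simp add: G_def)
  next
    case False
    then have z: "res X U V x = \<zero>\<^bsub>sec X V\<^esub>" using that(7) by blast
    have "res X U V' x = \<zero>\<^bsub>sec X V'\<^esub>"
      using p(3)[OF that(1,2,3,4,5,6)] z res_zero[OF that(2-4)] by simp
    moreover have "\<zero>\<^bsub>sec X V'\<^esub> \<odot>\<^bsub>msec Q V'\<^esub> mres Q W V' s = \<zero>\<^bsub>msec Q V'\<^esub>" if "V' \<subseteq> W"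
      using Module.module.smult_l_null[OF D(1)[OF \<open>openin (topo X) V'\<close>]] q(1)[OF W \<open>openin (topo X) V'\<close> that s] by blast
    moreover have "mres Q V V' \<zero>\<^bsub>msec Q V\<^esub> = \<zero>\<^bsub>msec Q V'\<^esub>"
      using add_hom_zero[OF module_abelian_group[OF D(1)[OF that(2)]]
          abelian_group_restrict[OF module_abelian_group[OF D(1)[OF that(3)]]] mod_hom_add_hom[OF D(2)[OF that(2-4)]]]
      by simp
    ultimately show ?thesis using False by (auto simp: G_def)
  qed
  have Gz: "umin u \<subseteq> W \<or> res X U (umin u) x = \<zero>\<^bsub>sec X (umin u)\<^esub>" if "u \<in> U" "x \<in> carrier (msec (ext_zero W) U)" for U u x
    using that um(2)[OF W, of u] by (auto simp: ext_zero_simps)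
  have ex: "\<exists>t. t \<in> carrier (msec Q U) \<and> (\<forall>u\<in>U. mres Q U (umin u) t = G U x (umin u))"
    if U: "openin (topo X) U" and x: "x \<in> carrier (msec (ext_zero W) U)" for U x
  proof -
    have xs: "x \<in> carrier (sec X U)" using x by (simp add: ext_zero_simps)
    have "\<exists>!t. t \<in> carrier (msec Q (\<Union>(umin ` U))) \<and> (\<forall>V\<in>umin ` U. mres Q (\<Union>(umin ` U)) V t = G U x V)"
    proof (rule sheaf_on_glue[OF D(3)])
      show "openin (topo X) V" "G U x V \<in> carrier (msec Q V)" if "V \<in> umin ` U" for V
        using that um[OF U] Gcl[OF U _ _ xs] by auto
      show "mres Q V (V \<inter> V') (G U x V) = mres Q V' (V \<inter> V') (G U x V')" if "V \<in> umin ` U" "V' \<in> umin ` U" for V V'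
      proof -
        from that obtain u u' where u: "u \<in> U" "V = umin u" "u' \<in> U" "V' = umin u'" by blast
        then have o: "openin (topo X) V" "openin (topo X) V'" "V \<subseteq> U" "V' \<subseteq> U" using um[OF U] by auto
        then have oi: "openin (topo X) (V \<inter> V')" by auto
        have "mres Q V (V \<inter> V') (G U x V) = G U x (V \<inter> V')"
          by (rule Gres[OF U o(1) oi _ o(3) xs]) (use Gz[OF u(1) x] u in auto)
        moreover have "mres Q V' (V \<inter> V') (G U x V') = G U x (V \<inter> V')"
          by (rule Gres[OF U o(2) oi _ o(4) xs]) (use Gz[OF u(3) x] u in auto)
        ultimately show ?thesis by simp
      qed
    qed
    from ex1_implies_ex[OF this] show ?thesis unfolding Union_umin[OF U] by simp
  qed
  define f where "f U x = (SOME t. t \<in> carrier (msec Q U) \<and> (\<forall>u\<in>U. mres Q U (umin u) t = G U x (umin u)))" for U x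
  have f: "f U x \<in> carrier (msec Q U)" "u \<in> U \<Longrightarrow> mres Q U (umin u) (f U x) = G U x (umin u)"
    if "openin (topo X) U" "x \<in> carrier (msec (ext_zero W) U)" for U x u
    using someI_ex[OF ex[OF that]] unfolding f_def by blast+
  have eqI: "t = t'" if "openin (topo X) U" "t \<in> carrier (msec Q U)" "t' \<in> carrier (msec Q U)"
    "\<And>u. u \<in> U \<Longrightarrow> mres Q U (umin u) t = mres Q U (umin u) t'" for U t t'
    using sheaf_eqI[OF D(3) that] .
  have "f \<in> sheaf_hom X (ext_zero W) Q"
    unfolding sheaf_hom_def mod_hom_def
  proof (intro CollectI conjI allI impI ballI)
    fix U assume U: "openin (topo X) U"
    note mE = sheaf_of_modulesD(1)[OF sheaf_ext_zero U, of W]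
    show "f U \<in> carrier (msec (ext_zero W) U) \<rightarrow> carrier (msec Q U)" using f(1)[OF U] by blast
    show "f U (x \<oplus>\<^bsub>msec (ext_zero W) U\<^esub> y) = f U x \<oplus>\<^bsub>msec Q U\<^esub> f U y"
      if xy: "x \<in> carrier (msec (ext_zero W) U)" "y \<in> carrier (msec (ext_zero W) U)" for x y
    proof (rule eqI[OF U f(1)[OF U module_add_closed[OF mE xy]] module_add_closed[OF D(1)[OF U] f(1)[OF U xy(1)] f(1)[OF U xy(2)]]])
      fix u assume u: "u \<in> U"
      note o = um[OF U u]
      have c: "x \<in> carrier (sec X U)" "y \<in> carrier (sec X U)" using xy by (simp_all add: ext_zero_simps)
      have "mres Q U (umin u) (f U (x \<oplus>\<^bsub>msec (ext_zero W) U\<^esub> y)) = G U (x \<oplus>\<^bsub>sec X U\<^esub> y) (umin u)"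
        using f(2)[OF U module_add_closed[OF mE xy] u] by (simp add: ext_zero_simps)
      also have "\<dots> = G U x (umin u) \<oplus>\<^bsub>msec Q (umin u)\<^esub> G U y (umin u)"
      proof (cases "umin u \<subseteq> W")
        case True
        then show ?thesis
          using ring_hom_add[OF res_hom[OF U o] c] Module.module.smult_l_distr[OF D(1)[OF o(1)] p(1)[OF U o c(1)] p(1)[OF U o c(2)] q(1)[OF W o(1) True s]]
          by (simp add: G_def)
      next
        case False
        then show ?thesis
          using abelian_monoid.l_zero[OF abelian_group.axioms(1)[OF module_abelian_group[OF D(1)[OF o(1)]]] module_zero_closed[OF D(1)[OF o(1)]]]
          by (simp add: G_def)
      qed
      also have "\<dots> = mres Q U (umin u) (f U x \<oplus>\<^bsub>msec Q U\<^esub> f U y)"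
        using mod_homD(2)[OF D(2)[OF U o] f(1)[OF U xy(1)] f(1)[OF U xy(2)]] f(2)[OF U xy(1) u] f(2)[OF U xy(2) u] by simp
      finally show "mres Q U (umin u) (f U (x \<oplus>\<^bsub>msec (ext_zero W) U\<^esub> y)) = mres Q U (umin u) (f U x \<oplus>\<^bsub>msec Q U\<^esub> f U y)" .
    qed
    show "f U (r \<odot>\<^bsub>msec (ext_zero W) U\<^esub> x) = r \<odot>\<^bsub>msec Q U\<^esub> f U x"
      if r: "r \<in> carrier (sec X U)" and x: "x \<in> carrier (msec (ext_zero W) U)" for r x
    proof (rule eqI[OF U f(1)[OF U module_smult_closed[OF mE r x]] module_smult_closed[OF D(1)[OF U] r f(1)[OF U x]]])
      fix u assume u: "u \<in> U"
      note o = um[OF U u]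
      have c: "x \<in> carrier (sec X U)" using x by (simp add: ext_zero_simps)
      have "mres Q U (umin u) (f U (r \<odot>\<^bsub>msec (ext_zero W) U\<^esub> x)) = G U (r \<otimes>\<^bsub>sec X U\<^esub> x) (umin u)"
        using f(2)[OF U module_smult_closed[OF mE r x] u] by (simp add: ext_zero_simps)
      also have "\<dots> = res X U (umin u) r \<odot>\<^bsub>msec Q (umin u)\<^esub> G U x (umin u)"
      proof (cases "umin u \<subseteq> W")
        case True
        then show ?thesis
          using ring_hom_mult[OF res_hom[OF U o] r c] Module.module.smult_assoc1[OF D(1)[OF o(1)] p(1)[OF U o r] p(1)[OF U o c] q(1)[OF W o(1) True s]]
          by (simp add: G_def)
      next
        case False
        then show ?thesis
          using Module.module.smult_r_null[OF D(1)[OF o(1)] p(1)[OF U o r]] by (simp add: G_def)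
      qed
      also have "\<dots> = mres Q U (umin u) (r \<odot>\<^bsub>msec Q U\<^esub> f U x)"
        using mod_homD(3)[OF D(2)[OF U o] r f(1)[OF U x]] f(2)[OF U x u] by simp
      finally show "mres Q U (umin u) (f U (r \<odot>\<^bsub>msec (ext_zero W) U\<^esub> x)) = mres Q U (umin u) (r \<odot>\<^bsub>msec Q U\<^esub> f U x)" .
    qed
  next
    fix U V x assume U: "openin (topo X) U" and V: "openin (topo X) V" and VU: "V \<subseteq> U" and x: "x \<in> carrier (msec (ext_zero W) U)"
    have c: "x \<in> carrier (sec X U)" using x by (simp add: ext_zero_simps)
    have x': "mres (ext_zero W) U V x \<in> carrier (msec (ext_zero W) V)"
      using sheaf_on_pre(1)[OF sheaf_of_modulesD(3)[OF sheaf_ext_zero] U V VU x] .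
    show "f V (mres (ext_zero W) U V x) = mres Q U V (f U x)"
    proof (rule eqI[OF V f(1)[OF V x'] q(1)[OF U V VU f(1)[OF U x]]])
      fix u assume u: "u \<in> V"
      note o = um[OF V u]
      have "mres Q V (umin u) (f V (mres (ext_zero W) U V x)) = G V (res X U V x) (umin u)"
        using f(2)[OF V x' u] by (simp add: ext_zero_simps)
      also have "\<dots> = G U x (umin u)" using p(3)[OF U V o VU c] by (simp add: G_def)
      also have "\<dots> = mres Q V (umin u) (mres Q U V (f U x))"
        using q(3)[OF U V o VU f(1)[OF U x]] f(2)[OF U x, of u] u VU by auto
      finally show "mres Q V (umin u) (f V (mres (ext_zero W) U V x)) = mres Q V (umin u) (mres Q U V (f U x))" .
    qed
  qed
  moreover have "f W \<one>\<^bsub>sec X W\<^esub> = s"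
  proof -
    have 1: "\<one>\<^bsub>sec X W\<^esub> \<in> carrier (msec (ext_zero W) W)" using cring_one(1)[OF cring_sec[OF W]] by (simp add: ext_zero_simps)
    show ?thesis
    proof (rule eqI[OF W f(1)[OF W 1] s])
      fix u assume u: "u \<in> W"
      note o = um[OF W u]
      show "mres Q W (umin u) (f W \<one>\<^bsub>sec X W\<^esub>) = mres Q W (umin u) s"
        using f(2)[OF W 1 u] o ring_hom_one[OF res_hom[OF W o]] Module.module.smult_one[OF D(1)[OF o(1)] q(1)[OF W o s]]
        by (simp add: G_def)
    qed
  qed
  ultimately show ?thesis by blast
qed

text \<open>The section \<open>s\<close> is a morphism to \<open>Q\<close> from the structure sheaf
  of \<open>W\<close> extended by zero. Injectivity extends it to the structure sheaf of
  \<open>V\<close> extended by zero, and the image of 1 over \<open>V\<close> extends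
  \<open>s\<close>. Both sheaves are ideal sheaves, hence of the type on which injectivity is
  tested.\<close>

lemma injective_sheaf_flasque:
  assumes inj: "injective_sheaf X Q" and W: "openin (topo X) W" and V: "openin (topo X) V" and WV: "W \<subseteq> V"
    and s: "s \<in> carrier (msec Q W)"
  shows "\<exists>t\<in>carrier (msec Q V). mres Q V W t = s"
proof -
  have Q: "sheaf_of_modules X Q" using inj by (simp add: injective_sheaf_def)
  obtain f where f: "f \<in> sheaf_hom X (ext_zero W) Q" "f W \<one>\<^bsub>sec X W\<^esub> = s" using ext_zero_hom[OF Q W s] by blast
  have sub: "x \<in> carrier (msec (ext_zero V) U)" if "x \<in> carrier (msec (ext_zero W) U)" for x U
    using that WV by (auto simp: ext_zero_simps)
  have j: "(\<lambda>U x. x) \<in> sheaf_hom X (ext_zero W) (ext_zero V)"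
    using sub by (simp add: sheaf_hom_def mod_hom_def ext_zero_simps(2-4))
  have mono: "sheaf_mono X (ext_zero W) (\<lambda>U x. x)" by (simp add: sheaf_mono_def)
  have ex: "\<exists>g\<in>sheaf_hom X (ext_zero V) Q. \<forall>U. openin (topo X) U \<longrightarrow> (\<forall>s\<in>carrier (msec (ext_zero W) U). g U ((\<lambda>U x. x) U s) = f U s)"
    using conjunct2[OF inj[unfolded injective_sheaf_def]] sheaf_ext_zero[of W] sheaf_ext_zero[of V] j mono f(1) by metis
  then obtain g where g: "g \<in> sheaf_hom X (ext_zero V) Q"
    "\<And>U s. openin (topo X) U \<Longrightarrow> s \<in> carrier (msec (ext_zero W) U) \<Longrightarrow> g U s = f U s" by auto
  have 1: "\<one>\<^bsub>sec X V\<^esub> \<in> carrier (msec (ext_zero V) V)" "\<one>\<^bsub>sec X W\<^esub> \<in> carrier (msec (ext_zero W) W)"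
    using cring_one(1)[OF cring_sec[OF V]] cring_one(1)[OF cring_sec[OF W]] by (simp_all add: ext_zero_simps)
  have "mres Q V W (g V \<one>\<^bsub>sec X V\<^esub>) = g W (res X V W \<one>\<^bsub>sec X V\<^esub>)"
    using sheaf_homD(2)[OF g(1) V W WV 1(1)] by (simp add: ext_zero_simps(4))
  also have "\<dots> = s" using ring_hom_one[OF res_hom[OF V W WV]] g(2)[OF W 1(2)] f(2) by simp
  finally show ?thesis using mod_homD(1)[OF sheaf_homD(1)[OF g(1) V] 1(1)] by blast
qed

end

text \<open>Compatible families of germs glue pointwise, whatever the stalks and the maps between
  them are. This yields both the structure sheaf of the product and the sheaf property of
  \<open>sheafify\<close>.\<close>

lemma sheaf_on_stalkwise:
  "sheaf_on T (\<lambda>U. {s \<in> \<Pi>\<^sub>E z\<in>U. C z. \<forall>z\<in>U. \<forall>w\<in>min_open T z. R z w (s z) = s w}) (\<lambda>U V s. restrict s V)"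
  unfolding sheaf_on_def
proof (intro conjI allI impI)
  let ?S = "\<lambda>U. {s \<in> \<Pi>\<^sub>E z\<in>U. C z. \<forall>z\<in>U. \<forall>w\<in>min_open T z. R z w (s z) = s w}"
  show "presheaf_on T ?S (\<lambda>U V s. restrict s V)"
    unfolding presheaf_on_def
  proof (intro conjI allI impI ballI)
    show "(\<lambda>s. restrict s V) \<in> ?S U \<rightarrow> ?S V" if "openin T U" "openin T V" "V \<subseteq> U" for U V
      using that(3) min_open_least[OF that(2)] by (auto simp: subset_iff)
    show "restrict s U = s" if "s \<in> ?S U" for U s using that by (simp add: PiE_iff extensional_restrict)
    show "restrict (restrict s V) W = restrict s W" if "W \<subseteq> V" for V W and s :: "'a \<Rightarrow> 'b"
      using that by (auto simp: fun_eq_iff)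
  qed
next
  let ?S = "\<lambda>U. {s \<in> \<Pi>\<^sub>E z\<in>U. C z. \<forall>z\<in>U. \<forall>w\<in>min_open T z. R z w (s z) = s w}"
  fix \<U> s assume s: "\<forall>V\<in>\<U>. openin T V \<and> s V \<in> ?S V"
    and c: "\<forall>V\<in>\<U>. \<forall>W\<in>\<U>. restrict (s V) (V \<inter> W) = restrict (s W) (V \<inter> W)"
  \<comment> \<open>By \<open>c\<close> any member of the cover that contains \<open>z\<close> gives
    the same value, so the choice is harmless.\<close>
  define t where "t = (\<lambda>z\<in>\<Union>\<U>. s (SOME V. V \<in> \<U> \<and> z \<in> V) z)"
  have tz: "t z = s V z" if "V \<in> \<U>" "z \<in> V" for z V
  proof -
    let ?W = "SOME V. V \<in> \<U> \<and> z \<in> V"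
    have W: "?W \<in> \<U> \<and> z \<in> ?W" by (rule someI[of _ V]) (use that in blast)
    then have "restrict (s ?W) (?W \<inter> V) = restrict (s V) (?W \<inter> V)" using c that(1) by simp
    from fun_cong[OF this, of z] have "s ?W z = s V z" using W that(2) by simp
    then show ?thesis using that by (auto simp: t_def)
  qed
  have tV: "restrict t V = s V" if "V \<in> \<U>" for V
  proof
    fix z show "restrict t V z = s V z"
      using tz[OF that] s that by (cases "z \<in> V") (auto simp: PiE_iff extensional_arb[of "s V" V z])
  qed
  have t: "t \<in> ?S (\<Union>\<U>)"
    unfolding mem_Collect_eq
  proof (intro conjI ballI)
    have "t z \<in> C z" if "V \<in> \<U>" "z \<in> V" for z V
      using tz[OF that] s that by auto
    moreover have "t \<in> extensional (\<Union>\<U>)" by (simp add: t_def)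
    ultimately show "t \<in> (\<Pi>\<^sub>E z\<in>\<Union>\<U>. C z)" by (auto simp: PiE_iff)
    fix z w assume "z \<in> \<Union>\<U>" and w: "w \<in> min_open T z"
    then obtain V where V: "V \<in> \<U>" "z \<in> V" by blast
    then have "openin T V" "s V \<in> ?S V" using s by auto
    then have "w \<in> V" "R z w (s V z) = s V w" using min_open_least[of T V z] V w by auto
    then show "R z w (t z) = t w" using tz[OF V] tz[OF V(1)] by simp
  qed
  have uniq: "t' = t" if "t' \<in> ?S (\<Union>\<U>)" "\<forall>V\<in>\<U>. restrict t' V = s V" for t'
  proof
    fix z show "t' z = t z"
    proof (cases "z \<in> \<Union>\<U>")
      case True
      then obtain V where V: "V \<in> \<U>" "z \<in> V" by blast
      then have "restrict t' V z = s V z" using that(2) by simp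
      then show ?thesis using V tz[OF V] by simp
    next
      case False
      then show ?thesis using that(1) by (simp add: t_def PiE_iff extensional_arb[of t' "\<Union>\<U>" z])
    qed
  qed
  show "\<exists>!t. t \<in> ?S (\<Union>\<U>) \<and> (\<forall>V\<in>\<U>. restrict t V = s V)"
  proof (rule ex1I[of _ t])
    show "t \<in> ?S (\<Union>\<U>) \<and> (\<forall>V\<in>\<U>. restrict t V = s V)" using t tV by blast
  qed (elim conjE, rule uniq)
qed

lemma sheaf_on_cong:
  assumes "sheaf_on T S r" "\<And>U. openin T U \<Longrightarrow> S' U = S U" shows "sheaf_on T S' r"
proof -
  have "presheaf_on T S' r" using assms by (simp add: sheaf_on_def presheaf_on_def)
  moreover have "\<exists>!t. t \<in> S' (\<Union>\<U>) \<and> (\<forall>V\<in>\<U>. r (\<Union>\<U>) V t = s V)"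
    if s: "\<forall>V\<in>\<U>. openin T V \<and> s V \<in> S' V" "\<forall>V\<in>\<U>. \<forall>W\<in>\<U>. r V (V \<inter> W) (s V) = r W (V \<inter> W) (s W)" for \<U> s
  proof -
    have "openin T (\<Union>\<U>)" using s(1) by blast
    moreover have "\<exists>!t. t \<in> S (\<Union>\<U>) \<and> (\<forall>V\<in>\<U>. r (\<Union>\<U>) V t = s V)"
      by (rule sheaf_on_glue[OF assms(1)]) (use s assms(2) in auto)
    ultimately show ?thesis using assms(2) by simp
  qed
  ultimately show ?thesis by (simp add: sheaf_on_def)
qed

context product_setup
begin

lemma ringed_finite_space_Y: "ringed_finite_space Y"
proof (intro ringed_finite_space.intro ringed_space.intro ringed_finite_space_axioms.intro)
  show "cring (sec Y U)" if "openin TY U" for U by (rule cring_Y[OF that])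
  show "res Y U V \<in> ring_hom (sec Y U) (sec Y V)" if "openin TY U" "openin TY V" "V \<subseteq> U" for U V
    using res_Y_hom[OF that] by (simp add: res_Y[abs_def])
  show "finite (topspace TY)" by (rule finite_Y)
  show "sheaf_on TY (\<lambda>U. carrier (sec Y U)) (res Y)"
    unfolding res_Y[abs_def] by (rule sheaf_on_cong[OF sheaf_on_stalkwise[of TY "\<lambda>z. carrier (PS z)" PR]]) (simp add: sec_Y stalks_sec_def)
qed

end

section \<open>The Mayer--Vietoris induction\<close>

locale resolution_setup = product_setup X k a X' a' Y
  for X :: "('p, 'r) ringed_space" and k :: "'k ring" and a :: "'p set \<Rightarrow> 'k \<Rightarrow> 'r"
    and X' :: "('q, 's) ringed_space" and a' :: "'q set \<Rightarrow> 'k \<Rightarrow> 's"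
    and Y :: "('p \<times> 'q, 'p \<times> 'q \<Rightarrow> ('r \<times> 's \<Rightarrow>\<^sub>0 int) set) ringed_space" +
  fixes M :: "('p \<times> 'q, 'p \<times> 'q \<Rightarrow> ('r \<times> 's \<Rightarrow>\<^sub>0 int) set, 'm) module_sheaf"
    and e :: "('p \<times> 'q) set \<Rightarrow> 'm \<Rightarrow> 'i"
    and Q :: "nat \<Rightarrow> ('p \<times> 'q, 'p \<times> 'q \<Rightarrow> ('r \<times> 's \<Rightarrow>\<^sub>0 int) set, 'i) module_sheaf"
    and d :: "nat \<Rightarrow> ('p \<times> 'q) set \<Rightarrow> 'i \<Rightarrow> 'i"
  assumes qc: "quasi_coherent Y M" and resolution: "injective_resolution Y M e Q d"
    and flat: "p \<in> topspace (topo X) \<Longrightarrow> q \<in> min_open (topo X) p \<Longrightarrow>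
      flat_ring_hom (stalk X p) (stalk X q) (stalk_res X p q)"
begin

interpretation YS: ringed_finite_space Y by (rule ringed_finite_space_Y)

lemma sheaf_M: "sheaf_of_modules Y M" using qc by (simp add: quasi_coherent_def)

lemma sheaf_Q: "sheaf_of_modules Y (Q n)"
  using resolution by (simp add: injective_resolution_def injective_sheaf_def)

lemma injective_Q: "injective_sheaf Y (Q n)" using resolution by (simp add: injective_resolution_def)

lemma e_hom: "e \<in> sheaf_hom Y M (Q 0)" and d_hom: "d n \<in> sheaf_hom Y (Q n) (Q (Suc n))"
  and e_mono: "sheaf_mono Y M e" and exact0: "exact_at Y M e (Q 0) (d 0) (Q 1)"
  and exact: "exact_at Y (Q n) (d n) (Q (Suc n)) (d (Suc n)) (Q (Suc (Suc n)))"
  using resolution by (simp_all add: injective_resolution_def)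

text \<open>Exactness of the resolution is stated on stalks. Over other open sets the composite
  vanishes because a section is determined by its restrictions to minimal open sets.\<close>

lemma d_d:
  assumes U: "openin TY U" and x: "x \<in> carrier (msec (Q n) U)"
  shows "d (Suc n) U (d n U x) = \<zero>\<^bsub>msec (Q (Suc (Suc n))) U\<^esub>"
proof -
  note D = sheaf_of_modulesD[OF sheaf_Q]
  note h = sheaf_homD[OF d_hom]
  have dx: "d n U x \<in> carrier (msec (Q (Suc n)) U)" by (rule mod_homD(1)[OF h(1)[OF U] x])
  show ?thesis
  proof (rule YS.sheaf_eqI[OF D(3) U])
    show "d (Suc n) U (d n U x) \<in> carrier (msec (Q (Suc (Suc n))) U)" by (rule mod_homD(1)[OF h(1)[OF U] dx])
    show "\<zero>\<^bsub>msec (Q (Suc (Suc n))) U\<^esub> \<in> carrier (msec (Q (Suc (Suc n))) U)" by (rule module_zero_closed[OF D(1)[OF U]])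
    fix u assume u: "u \<in> U"
    have o: "openin TY (moY u)" "moY u \<subseteq> U" "u \<in> topspace TY" using moY_open open_moY[OF U u] by auto
    have rx: "mres (Q n) U (moY u) x \<in> carrier (msec (Q n) (moY u))"
      using mod_homD(1)[OF D(2)[OF U o(1,2)] x] by simp
    have "mres (Q (Suc (Suc n))) U (moY u) (d (Suc n) U (d n U x)) = d (Suc n) (moY u) (d n (moY u) (mres (Q n) U (moY u) x))"
      using h(2)[OF U o(1,2) x] h(2)[OF U o(1,2) dx] by simp
    also have "\<dots> = \<zero>\<^bsub>msec (Q (Suc (Suc n))) (moY u)\<^esub>"
      using bspec[OF exact[of n, unfolded exact_at_def mstalk_def] o(3)] rx by blast
    also have "\<dots> = mres (Q (Suc (Suc n))) U (moY u) \<zero>\<^bsub>msec (Q (Suc (Suc n))) U\<^esub>"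
      using add_hom_zero[OF module_abelian_group[OF D(1)[OF U]]
          abelian_group_restrict[OF module_abelian_group[OF D(1)[OF o(1)]]] mod_hom_add_hom[OF D(2)[OF U o(1,2)]]] by simp
    finally show "mres (Q (Suc (Suc n))) U (moY u) (d (Suc n) U (d n U x)) = mres (Q (Suc (Suc n))) U (moY u) \<zero>\<^bsub>msec (Q (Suc (Suc n))) U\<^esub>" .
  qed
qed

text \<open>Sections over \<open>U\<^sub>p \<times> V\<close> as a module over the stalk at \<open>p\<close>.\<close>

definition strip :: "('p \<times> 'q, 'p \<times> 'q \<Rightarrow> ('r \<times> 's \<Rightarrow>\<^sub>0 int) set, 'n) module_sheaf \<Rightarrow> 'p \<Rightarrow> 'q set \<Rightarrow> ('r, 'n) module" where
  "strip N p V = restrict_scalars (psr p V) (msec N (X.mo p \<times> V))"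

lemma strip_simps [simp]:
  "carrier (strip N p V) = carrier (msec N (X.mo p \<times> V))" "\<zero>\<^bsub>strip N p V\<^esub> = \<zero>\<^bsub>msec N (X.mo p \<times> V)\<^esub>"
  "x \<oplus>\<^bsub>strip N p V\<^esub> y = x \<oplus>\<^bsub>msec N (X.mo p \<times> V)\<^esub> y"
  "r \<odot>\<^bsub>strip N p V\<^esub> x = psr p V r \<odot>\<^bsub>msec N (X.mo p \<times> V)\<^esub> x"
  by (simp_all add: strip_def)

lemma module_strip:
  assumes "sheaf_of_modules Y N" "p \<in> topspace X.T" "openin X'.T V"
  shows "Module.module (stalk X p) (strip N p V)"
  unfolding strip_def
  by (rule module_restrict_scalars[OF X.cring_stalk[OF assms(2)] psr_hom[OF assms(2,3)] sheaf_of_modulesD(1)[OF assms(1) open_mo_times[OF assms(2,3)]]])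

lemma strip_mres:
  assumes N: "sheaf_of_modules Y N" and p: "p \<in> topspace X.T" and V: "openin X'.T V" "openin X'.T V'" "V' \<subseteq> V"
  shows "mres N (X.mo p \<times> V) (X.mo p \<times> V') \<in> mod_hom (stalk X p) (strip N p V) (strip N p V')"
proof -
  note h = sheaf_of_modulesD(2)[OF N open_mo_times[OF p V(1)] open_mo_times[OF p V(2)]]
  have "X.mo p \<times> V' \<subseteq> X.mo p \<times> V" using V(3) by auto
  from mod_homD[OF h[OF this]] show ?thesis
    using ring_hom_closed[OF psr_hom[OF p V(1)]] psr_restrict[OF V(3)] by (auto simp: mod_hom_def res_Y)
qed

lemma strip_semilinear:
  assumes N: "sheaf_of_modules Y N" and p: "p \<in> topspace X.T" and q: "q \<in> X.mo p" and V: "openin X'.T V"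
  shows "semilinear (stalk X p) (stalk_res X p q) (strip N p V) (strip N q V) (mres N (X.mo p \<times> V) (X.mo q \<times> V))"
proof -
  have qt: "q \<in> topspace X.T" using X.mo_top[OF p q] .
  note h = sheaf_of_modulesD(2)[OF N open_mo_times[OF p V] open_mo_times[OF qt V]]
  have "X.mo q \<times> V \<subseteq> X.mo p \<times> V" using X.mo_mono[OF p q] by auto
  from mod_homD[OF h[OF this]] show ?thesis
    using ring_hom_closed[OF psr_hom[OF p V]] psr_stalk_res[OF p q V] by (auto simp: semilinear_def add_hom_def res_Y)
qed

lemma strip_hom:
  assumes f: "f \<in> sheaf_hom Y N N'" and p: "p \<in> topspace X.T" and V: "openin X'.T V"
  shows "f (X.mo p \<times> V) \<in> mod_hom (stalk X p) (strip N p V) (strip N' p V)"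
  unfolding strip_def by (rule mod_hom_restrict_scalars[OF sheaf_homD(1)[OF f open_mo_times[OF p V]] psr_hom[OF p V]])

section \<open>Sections of the resolution tensored with a stalk\<close>

abbreviation "P q p \<equiv> alg_module (stalk_res X p q) (stalk X q)"

text \<open>The second index is the point whose sections are taken, the first the point whose stalk
  is tensored with. Hence \<open>FF q p\<close> modulo \<open>NF q p\<close> is the base change of
  the complex at \<open>p\<close>, and \<open>FF q q\<close> modulo \<open>NF q q\<close> is the
  complex at \<open>q\<close> itself.\<close>

definition FF where "FF q p V n = tfree (strip (Q n) p V) (P q p)"
definition NF where "NF q p V n = tensor_rel (stalk X p) (strip (Q n) p V) (P q p)"
definition dF :: "'p \<Rightarrow> 'q set \<Rightarrow> nat \<Rightarrow> ('i \<times> 'r \<Rightarrow>\<^sub>0 int) \<Rightarrow> ('i \<times> 'r \<Rightarrow>\<^sub>0 int)"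
  where "dF p V n = tensor_frag (d n (X.mo p \<times> V)) (\<lambda>y. y)"
definition rF :: "'p \<Rightarrow> 'q set \<Rightarrow> 'q set \<Rightarrow> nat \<Rightarrow> ('i \<times> 'r \<Rightarrow>\<^sub>0 int) \<Rightarrow> ('i \<times> 'r \<Rightarrow>\<^sub>0 int)"
  where "rF p V V' n = tensor_frag (mres (Q n) (X.mo p \<times> V) (X.mo p \<times> V')) (\<lambda>y. y)"
definition fF :: "'p \<Rightarrow> 'p \<Rightarrow> 'q set \<Rightarrow> nat \<Rightarrow> ('i \<times> 'r \<Rightarrow>\<^sub>0 int) \<Rightarrow> ('i \<times> 'r \<Rightarrow>\<^sub>0 int)"
  where "fF q p V n = tensor_frag (mres (Q n) (X.mo p \<times> V) (X.mo q \<times> V)) (\<lambda>y. y)"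

lemma flat_P: "p \<in> topspace X.T \<Longrightarrow> q \<in> X.mo p \<Longrightarrow> flat_module (stalk X p) (P q p)"
  using flat by (simp add: flat_ring_hom_def)

lemmas module_P = flat_moduleD[OF flat_P]

lemma mo_self: "p \<in> X.mo p" by (rule min_open_self)

context
  fixes q p assumes p: "p \<in> topspace X.T" and q: "q \<in> X.mo p"
begin

lemma qt: "q \<in> topspace X.T" using X.mo_top[OF p q] .

lemma subgrp_FF: "subgrp (FF q p V n)" unfolding FF_def by (rule subgrp_tfree)

lemma subgrp_NF: "openin X'.T V \<Longrightarrow> subgrp (NF q p V n)"
  unfolding NF_def by (rule subgrp_tensor_rel[OF module_strip[OF sheaf_Q p] module_P[OF p q]])

lemma NF_FF: "openin X'.T V \<Longrightarrow> NF q p V n \<subseteq> FF q p V n"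
  unfolding NF_def FF_def by (rule tensor_rel_tfree[OF module_strip[OF sheaf_Q p] module_P[OF p q]])

lemma dF_FF: "openin X'.T V \<Longrightarrow> x \<in> FF q p V n \<Longrightarrow> dF p V n x \<in> FF q p V (Suc n)"
  unfolding FF_def dF_def by (erule tensor_frag_tfree) (auto simp del: strip_simps intro: mod_homD(1)[OF strip_hom[OF d_hom p]])

lemma dF_NF: "openin X'.T V \<Longrightarrow> x \<in> NF q p V n \<Longrightarrow> dF p V n x \<in> NF q p V (Suc n)"
  unfolding NF_def dF_def
  by (rule tensor_frag_rel[OF module_strip[OF sheaf_Q p] module_P[OF p q] module_strip[OF sheaf_Q p] strip_hom[OF d_hom p]])

lemma dF_dF:
  assumes V: "openin X'.T V" and x: "x \<in> FF q p V n"
  shows "dF p V (Suc n) (dF p V n x) \<in> NF q p V (Suc (Suc n))"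
  unfolding NF_def dF_def tensor_frag_comp
proof (rule tensor_frag_zero_rel[OF module_strip[OF sheaf_Q p V] module_P[OF p q] x[unfolded FF_def]])
  fix y assume "y \<in> carrier (strip (Q n) p V)"
  then show "d (Suc n) (X.mo p \<times> V) (d n (X.mo p \<times> V) y) = \<zero>\<^bsub>strip (Q (Suc (Suc n))) p V\<^esub>"
    using d_d[OF open_mo_times[OF p V]] by simp
qed

lemma rF_FF: "openin X'.T V \<Longrightarrow> openin X'.T V' \<Longrightarrow> V' \<subseteq> V \<Longrightarrow> x \<in> FF q p V n \<Longrightarrow> rF p V V' n x \<in> FF q p V' n"
  unfolding FF_def rF_def by (erule tensor_frag_tfree) (auto simp del: strip_simps intro: mod_homD(1)[OF strip_mres[OF sheaf_Q p]])

lemma rF_NF: "openin X'.T V \<Longrightarrow> openin X'.T V' \<Longrightarrow> V' \<subseteq> V \<Longrightarrow> x \<in> NF q p V n \<Longrightarrow> rF p V V' n x \<in> NF q p V' n"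
  unfolding NF_def rF_def
  by (rule tensor_frag_rel[OF module_strip[OF sheaf_Q p] module_P[OF p q] module_strip[OF sheaf_Q p] strip_mres[OF sheaf_Q p]])

lemma rF_dF:
  assumes "openin X'.T V" "openin X'.T V'" "V' \<subseteq> V" "x \<in> FF q p V n"
  shows "rF p V V' (Suc n) (dF p V n x) = dF p V' n (rF p V V' n x)"
proof -
  have "X.mo p \<times> V' \<subseteq> X.mo p \<times> V" using assms(3) by auto
  from sheaf_homD(2)[OF d_hom open_mo_times[OF p assms(1)] open_mo_times[OF p assms(2)] this]
  show ?thesis
    unfolding rF_def dF_def tensor_frag_comp
    by (intro tensor_frag_cong[OF assms(4)[unfolded FF_def]]) simp_all
qed

lemma rF_rF:
  assumes "openin X'.T V" "openin X'.T V'" "openin X'.T V''" "V'' \<subseteq> V'" "V' \<subseteq> V" "x \<in> FF q p V n"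
  shows "rF p V' V'' n (rF p V V' n x) = rF p V V'' n x"
proof -
  have "X.mo p \<times> V'' \<subseteq> X.mo p \<times> V'" "X.mo p \<times> V' \<subseteq> X.mo p \<times> V" using assms(4,5) by auto
  from sheaf_of_modulesD(5)[OF sheaf_Q open_mo_times[OF p assms(1)] open_mo_times[OF p assms(2)] open_mo_times[OF p assms(3)] this]
  show ?thesis
    unfolding rF_def tensor_frag_comp
    by (intro tensor_frag_cong[OF assms(6)[unfolded FF_def]]) simp_all
qed

text \<open>Uniqueness and gluing are the sheaf axioms of \<open>Q n\<close> on U_p x V1 and U_p x
  V2, and surjectivity holds since injective sheaves are flasque. With flat coefficients these
  properties survive the tensor product.\<close>

lemma patching_F:
  assumes V1: "openin X'.T V1" and V2: "openin X'.T V2"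
  shows "patching (FF q p) (NF q p) (dF p) (rF p) (V1 \<union> V2) V1 V2 (V1 \<inter> V2)"
proof -
  let ?V = "V1 \<union> V2" and ?W = "V1 \<inter> V2"
  have V: "openin X'.T ?V" and W: "openin X'.T ?W" using V1 V2 by auto
  have op: "openin X'.T U" if "U \<in> {?V, V1, V2, ?W}" for U using that V1 V2 V W by auto
  have opr: "openin X'.T U" "openin X'.T U'" "U' \<subseteq> U" if "(U, U') \<in> {(?V, V1), (?V, V2), (V1, ?W), (V2, ?W)}" for U U'
    using that V1 V2 V W by auto
  note Pf = flat_P[OF p q] and mP = module_P[OF p q]
  note ms = module_strip[OF sheaf_Q p] and sm = strip_mres[OF sheaf_Q p]
  note oY = open_mo_times[OF p]
  have setU: "X.mo p \<times> V1 \<union> X.mo p \<times> V2 = X.mo p \<times> ?V" and setI: "(X.mo p \<times> V1) \<inter> (X.mo p \<times> V2) = X.mo p \<times> ?W" by auto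
  have sub: "X.mo p \<times> V1 \<subseteq> X.mo p \<times> ?V" "X.mo p \<times> V2 \<subseteq> X.mo p \<times> ?V" "X.mo p \<times> ?W \<subseteq> X.mo p \<times> V1" "X.mo p \<times> ?W \<subseteq> X.mo p \<times> V2"
    by auto
  have comm: "mres (Q n) (X.mo p \<times> V1) (X.mo p \<times> ?W) (mres (Q n) (X.mo p \<times> ?V) (X.mo p \<times> V1) x) =
      mres (Q n) (X.mo p \<times> V2) (X.mo p \<times> ?W) (mres (Q n) (X.mo p \<times> ?V) (X.mo p \<times> V2) x)"
    if "x \<in> carrier (strip (Q n) p ?V)" for n x
    using sheaf_of_modulesD(5)[OF sheaf_Q oY[OF V] oY[OF V1] oY[OF W] sub(3,1)]
      sheaf_of_modulesD(5)[OF sheaf_Q oY[OF V] oY[OF V2] oY[OF W] sub(4,2)] that by simp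
  have uni: "x = \<zero>\<^bsub>strip (Q n) p ?V\<^esub>"
    if x: "x \<in> carrier (strip (Q n) p ?V)" "mres (Q n) (X.mo p \<times> ?V) (X.mo p \<times> V1) x = \<zero>\<^bsub>strip (Q n) p V1\<^esub>"
      "mres (Q n) (X.mo p \<times> ?V) (X.mo p \<times> V2) x = \<zero>\<^bsub>strip (Q n) p V2\<^esub>" for n x
  proof (rule sheaf_on_eqI[OF sheaf_of_modulesD(3)[OF sheaf_Q], of "{X.mo p \<times> V1, X.mo p \<times> V2}" x n])
    show "openin TY U" if "U \<in> {X.mo p \<times> V1, X.mo p \<times> V2}" for U using that oY[OF V1] oY[OF V2] by auto
    show "x \<in> carrier (msec (Q n) (\<Union>{X.mo p \<times> V1, X.mo p \<times> V2}))" using x(1) by (simp add: setU)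
    show "\<zero>\<^bsub>strip (Q n) p ?V\<^esub> \<in> carrier (msec (Q n) (\<Union>{X.mo p \<times> V1, X.mo p \<times> V2}))"
      using module_zero_closed[OF ms[OF V]] by (simp add: setU)
    show "mres (Q n) (\<Union>{X.mo p \<times> V1, X.mo p \<times> V2}) U x = mres (Q n) (\<Union>{X.mo p \<times> V1, X.mo p \<times> V2}) U \<zero>\<^bsub>strip (Q n) p ?V\<^esub>"
      if "U \<in> {X.mo p \<times> V1, X.mo p \<times> V2}" for U
      using that x(2,3) mod_hom_zero[OF ms[OF V] ms[OF V1] sm[OF V V1]] mod_hom_zero[OF ms[OF V] ms[OF V2] sm[OF V V2]]
      by (auto simp: setU)
  qed
  have glu: "\<exists>z\<in>carrier (strip (Q n) p ?V). mres (Q n) (X.mo p \<times> ?V) (X.mo p \<times> V1) z = x \<and> mres (Q n) (X.mo p \<times> ?V) (X.mo p \<times> V2) z = y"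
    if "x \<in> carrier (strip (Q n) p V1)" "y \<in> carrier (strip (Q n) p V2)"
      "mres (Q n) (X.mo p \<times> V1) (X.mo p \<times> ?W) x = mres (Q n) (X.mo p \<times> V2) (X.mo p \<times> ?W) y" for n x y
    using sheaf_on_glue2[OF sheaf_of_modulesD(3)[OF sheaf_Q] oY[OF V1] oY[OF V2], of x n y] that by (simp add: setU setI)
  have sur: "\<exists>y\<in>carrier (strip (Q n) p V1). mres (Q n) (X.mo p \<times> V1) (X.mo p \<times> ?W) y = x"
    if "x \<in> carrier (strip (Q n) p ?W)" for n x
    using YS.injective_sheaf_flasque[OF injective_Q oY[OF W] oY[OF V1] sub(3)] that by simp
  note pt = Pf ms[OF V] ms[OF V1] ms[OF V2] ms[OF W] sm[OF V V1 Un_upper1] sm[OF V V2 Un_upper2] sm[OF V1 W Int_lower1] sm[OF V2 W Int_lower2]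
  show ?thesis
  proof
    fix U n assume U: "U \<in> {?V, V1, V2, ?W}"
    show "subgrp (FF q p U n)" by (rule subgrp_FF)
    show "subgrp (NF q p U n)" by (rule subgrp_NF[OF op[OF U]])
    show "dF p U n x \<in> FF q p U (Suc n)" if "x \<in> FF q p U n" for x by (rule dF_FF[OF op[OF U] that])
    show "dF p U n x \<in> NF q p U (Suc n)" if "x \<in> NF q p U n" for x by (rule dF_NF[OF op[OF U] that])
    show "dF p U (Suc n) (dF p U n x) \<in> NF q p U (Suc (Suc n))" if "x \<in> FF q p U n" for x by (rule dF_dF[OF op[OF U] that])
  next
    show "dF p U n (x - y) = dF p U n x - dF p U n y" for U n x y by (simp add: dF_def tensor_frag_diff)
    show "rF p U U' n (x - y) = rF p U U' n x - rF p U U' n y" for U U' n x y by (simp add: rF_def tensor_frag_diff)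
  next
    fix U U' n x assume U: "(U, U') \<in> {(?V, V1), (?V, V2), (V1, ?W), (V2, ?W)}"
    show "rF p U U' n x \<in> FF q p U' n" if "x \<in> FF q p U n" by (rule rF_FF[OF opr[OF U] that])
    show "rF p U U' n x \<in> NF q p U' n" if "x \<in> NF q p U n" by (rule rF_NF[OF opr[OF U] that])
    show "rF p U U' (Suc n) (dF p U n x) - dF p U' n (rF p U U' n x) \<in> NF q p U' (Suc n)" if "x \<in> FF q p U n"
      using rF_dF[OF opr[OF U] that] subgrp_0[OF subgrp_NF[OF opr(2)[OF U]]] by simp
  next
    fix x n assume x: "x \<in> FF q p ?V n"
    show "rF p V1 ?W n (rF p ?V V1 n x) - rF p V2 ?W n (rF p ?V V2 n x) \<in> NF q p ?W n"
      using rF_rF[OF V V1 W _ _ x] rF_rF[OF V V2 W _ _ x] subgrp_0[OF subgrp_NF[OF W]] by simp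
    show "x \<in> NF q p ?V n" if "rF p ?V V1 n x \<in> NF q p V1 n" "rF p ?V V2 n x \<in> NF q p V2 n"
      using tensor_patch_unique[OF pt comm uni glu sur, of n x] x that unfolding FF_def NF_def rF_def by blast
  next
    fix x1 x2 n assume "x1 \<in> FF q p V1 n" "x2 \<in> FF q p V2 n" "rF p V1 ?W n x1 - rF p V2 ?W n x2 \<in> NF q p ?W n"
    then show "\<exists>x\<in>FF q p ?V n. rF p ?V V1 n x - x1 \<in> NF q p V1 n \<and> rF p ?V V2 n x - x2 \<in> NF q p V2 n"
      using tensor_patch_glue[OF pt comm uni glu sur, of n x1 x2] unfolding FF_def NF_def rF_def by blast
  next
    fix x n assume "x \<in> FF q p ?W n"
    then have "\<exists>y\<in>FF q p V1 n. rF p V1 ?W n y = x"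
      unfolding FF_def rF_def using tensor_frag_lift[OF _ sur] by blast
    then show "\<exists>y\<in>FF q p V1 n. rF p V1 ?W n y - x \<in> NF q p ?W n"
      using subgrp_0[OF subgrp_NF[OF W]] by force
  qed
qed

text \<open>U_p x U_x is the minimal open set of (p, x), so exactness at the stalk is exactness of
  sections over it, and flatness carries this to the tensored complex.\<close>

lemma exact_F:
  assumes x: "x \<in> topspace X'.T" and t: "t \<in> FF q p (X'.mo x) (Suc n)" "dF p (X'.mo x) (Suc n) t \<in> NF q p (X'.mo x) (Suc (Suc n))"
  shows "\<exists>s\<in>FF q p (X'.mo x) n. t - dF p (X'.mo x) n s \<in> NF q p (X'.mo x) (Suc n)"
proof -
  have o: "openin X'.T (X'.mo x)" by (rule X'.mo_open[OF x])
  have z: "(p, x) \<in> topspace TY" using p x by (simp add: topspace_Y)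
  have "\<exists>l\<in>carrier (strip (Q n) p (X'.mo x)). d n (X.mo p \<times> X'.mo x) l = m"
    if "m \<in> carrier (strip (Q (Suc n)) p (X'.mo x))" "d (Suc n) (X.mo p \<times> X'.mo x) m = \<zero>\<^bsub>strip (Q (Suc (Suc n))) p (X'.mo x)\<^esub>" for m
  proof -
    have "m \<in> d n (moY (p, x)) ` carrier (msec (Q n) (moY (p, x)))"
      using bspec[OF exact[of n, unfolded exact_at_def mstalk_def] z] that by (simp add: moY_pair[OF p x])
    then show ?thesis by (auto simp: moY_pair[OF p x])
  qed
  from flat_tensor_exact[OF flat_P[OF p q] module_strip[OF sheaf_Q p o] module_strip[OF sheaf_Q p o] strip_hom[OF d_hom p o] this]
  show ?thesis using t unfolding FF_def NF_def dF_def by blast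
qed

lemma exact0_F:
  assumes x: "x \<in> topspace X'.T" and t: "t \<in> FF q p (X'.mo x) 0" "dF p (X'.mo x) 0 t \<in> NF q p (X'.mo x) 1"
  shows "\<exists>s\<in>tfree (strip M p (X'.mo x)) (P q p). t - tensor_frag (e (X.mo p \<times> X'.mo x)) (\<lambda>y. y) s \<in> NF q p (X'.mo x) 0"
proof -
  have o: "openin X'.T (X'.mo x)" by (rule X'.mo_open[OF x])
  have z: "(p, x) \<in> topspace TY" using p x by (simp add: topspace_Y)
  have "\<exists>l\<in>carrier (strip M p (X'.mo x)). e (X.mo p \<times> X'.mo x) l = m"
    if "m \<in> carrier (strip (Q 0) p (X'.mo x))" "d 0 (X.mo p \<times> X'.mo x) m = \<zero>\<^bsub>strip (Q (Suc 0)) p (X'.mo x)\<^esub>" for m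
  proof -
    have "m \<in> e (moY (p, x)) ` carrier (msec M (moY (p, x)))"
      using bspec[OF exact0[unfolded exact_at_def mstalk_def] z] that by (simp add: moY_pair[OF p x])
    then show ?thesis by (auto simp: moY_pair[OF p x])
  qed
  from flat_tensor_exact[OF flat_P[OF p q] module_strip[OF sheaf_Q p o] module_strip[OF sheaf_Q p o] strip_hom[OF d_hom p o] this]
  show ?thesis using t unfolding FF_def NF_def dF_def by simp
qed

text \<open>By the empty cover a sheaf has a single section over the empty set, so all entries of
  the tensor are 0.\<close>

lemma trivial_F:
  assumes "x \<in> FF q p {} n" shows "x \<in> NF q p {} n"
proof -
  have o: "openin X'.T {}" by simp
  have "y = \<zero>\<^bsub>strip (Q n) p {}\<^esub>" if "y \<in> carrier (strip (Q n) p {})" for y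
    using that module_zero_closed[OF module_strip[OF sheaf_Q p o]]
    by (intro sheaf_on_eqI[OF sheaf_of_modulesD(3)[OF sheaf_Q], of "{}" y n]) auto
  then show ?thesis
    using tensor_frag_zero_rel[OF module_strip[OF sheaf_Q p o] module_P[OF p q] assms[unfolded FF_def], of "\<lambda>y. y"]
    by (simp add: NF_def tensor_frag_id del: strip_simps)
qed

lemma fF_FF: "openin X'.T V \<Longrightarrow> x \<in> FF q p V n \<Longrightarrow> fF q p V n x \<in> FF q q V n"
  unfolding FF_def fF_def by (rule tensor_frag_semilinear_tfree[OF strip_semilinear[OF sheaf_Q p q]])

lemma fF_NF: "openin X'.T V \<Longrightarrow> x \<in> NF q p V n \<Longrightarrow> fF q p V n x \<in> NF q q V n"
  unfolding NF_def fF_def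
  by (rule tensor_frag_semilinear_rel[OF X.cring_stalk[OF p] X.cring_stalk[OF qt] X.stalk_res_hom[OF p q] module_strip[OF sheaf_Q p]
        module_strip[OF sheaf_Q qt] strip_semilinear[OF sheaf_Q p q] X.stalk_res_id[OF qt]])

lemma fF_dF:
  assumes "openin X'.T V" "x \<in> FF q p V n"
  shows "fF q p V (Suc n) (dF p V n x) = dF q V n (fF q p V n x)"
proof -
  have "X.mo q \<times> V \<subseteq> X.mo p \<times> V" using X.mo_mono[OF p q] by auto
  from sheaf_homD(2)[OF d_hom open_mo_times[OF p assms(1)] open_mo_times[OF qt assms(1)] this]
  show ?thesis
    unfolding fF_def dF_def tensor_frag_comp
    by (intro tensor_frag_cong[OF assms(2)[unfolded FF_def]]) simp_all
qed

lemma fF_rF: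
  assumes "openin X'.T V" "openin X'.T V'" "V' \<subseteq> V" "x \<in> FF q p V n"
  shows "rF q V V' n (fF q p V n x) = fF q p V' n (rF p V V' n x)"
proof -
  have "X.mo q \<times> V' \<subseteq> X.mo q \<times> V" "X.mo q \<times> V \<subseteq> X.mo p \<times> V" "X.mo q \<times> V' \<subseteq> X.mo p \<times> V'" "X.mo p \<times> V' \<subseteq> X.mo p \<times> V"
    using assms(3) X.mo_mono[OF p q] by auto
  note s = this and o = open_mo_times[OF p assms(1)] open_mo_times[OF p assms(2)] open_mo_times[OF qt assms(1)] open_mo_times[OF qt assms(2)]
  show ?thesis
    unfolding fF_def rF_def tensor_frag_comp
    using sheaf_of_modulesD(5)[OF sheaf_Q o(1,3,4) s(1,2)] sheaf_of_modulesD(5)[OF sheaf_Q o(1,2,4) s(3,4)]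
    by (intro tensor_frag_cong[OF assms(4)[unfolded FF_def]]) simp_all
qed

end

section \<open>Acyclicity of the cones\<close>

abbreviation "cone_acyclic q p V \<equiv> acyclic_mod (cone_set (FF q p V) (FF q q V)) (cone_set (NF q p V) (NF q q V))
    (cone_map (dF p V) (dF q V) (fF q p V))"

context
  fixes q p assumes p: "p \<in> topspace X.T" and q: "q \<in> X.mo p"
begin

text \<open>The two tensored resolutions have as augmentations the sections of \<open>M\<close> over
  U_p x U_x and U_q x U_x, each tensored with O_q. Evaluation identifies the second with the
  sections themselves, so base change of \<open>M\<close> says that \<open>?\<psi>\<close> is an
  isomorphism modulo relations.\<close>

lemma cone_acyclic_min_open:
  assumes x: "x \<in> topspace X'.T"
  shows "cone_acyclic q p (X'.mo x)"
proof -
  let ?V = "X'.mo x"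
  have qt: "q \<in> topspace X.T" using X.mo_top[OF p q] .
  have o: "openin X'.T ?V" by (rule X'.mo_open[OF x])
  note qs = mo_self[of q]
  note bc = quasi_coherent_base_change[OF qc p q x, folded strip_def]
  let ?A = "tfree (strip M p ?V) (P q p)" and ?NA = "tensor_rel (stalk X p) (strip M p ?V) (P q p)"
  let ?A' = "tfree (strip M q ?V) (P q q)" and ?NA' = "tensor_rel (stalk X q) (strip M q ?V) (P q q)"
  let ?e = "tensor_frag (e (X.mo p \<times> ?V)) (\<lambda>y. y :: 'r)" and ?e' = "tensor_frag (e (X.mo q \<times> ?V)) (\<lambda>y. y :: 'r)"
  let ?\<psi> = "tensor_frag (mres M (X.mo p \<times> ?V) (X.mo q \<times> ?V)) (\<lambda>y. y :: 'r)"
  have z: "(p, x) \<in> topspace TY" "(q, x) \<in> topspace TY" using p qt x by (simp_all add: topspace_Y)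
  note mM = module_strip[OF sheaf_M p o] and mM' = module_strip[OF sheaf_M qt o]
  note mQ = module_strip[OF sheaf_Q p o] and mQ' = module_strip[OF sheaf_Q qt o]
  note sl = strip_semilinear[OF sheaf_M p q o]
  have id: "\<And>b. b \<in> carrier (stalk X q) \<Longrightarrow> stalk_res X q q b = b" by (rule X.stalk_res_id[OF qt])
  have ev: "c \<in> ?NA' \<longleftrightarrow> tensor_eval (stalk X q) (strip M q ?V) c = \<zero>\<^bsub>strip M q ?V\<^esub>" if "c \<in> ?A'" for c
    by (rule tensor_eval_rel_iff(1)[OF mM' _ that]) (rule id)
  have sub: "X.mo q \<times> ?V \<subseteq> X.mo p \<times> ?V" using X.mo_mono[OF p q] by auto
  show ?thesis
  proof (rule acyclic_cone_resolution[where A = ?A and NA = ?NA and A' = ?A' and NA' = ?NA' and e = ?e and e' = ?e' and \<psi> = ?\<psi>])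
    show "subgrp (FF q p ?V n)" "subgrp (FF q q ?V n)" for n by (simp_all add: FF_def subgrp_tfree)
    show "subgrp (NF q p ?V n)" "subgrp (NF q q ?V n)" for n by (rule subgrp_NF[OF p q o] subgrp_NF[OF qt qs o])+
    show "subgrp ?NA'" by (rule subgrp_tensor_rel[OF mM' module_P[OF qt qs]])
    show "dF p ?V n (s - t) = dF p ?V n s - dF p ?V n t" "dF q ?V n (s - t) = dF q ?V n s - dF q ?V n t"
      "fF q p ?V n (s - t) = fF q p ?V n s - fF q p ?V n t" for n s t by (simp_all add: dF_def fF_def tensor_frag_diff)
    show "?e' (s - t) = ?e' s - ?e' t" for s t by (rule tensor_frag_diff)
    show "dF p ?V n t \<in> FF q p ?V (Suc n)" if "t \<in> FF q p ?V n" for n t by (rule dF_FF[OF p q o that])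
    show "dF q ?V n t \<in> FF q q ?V (Suc n)" if "t \<in> FF q q ?V n" for n t by (rule dF_FF[OF qt qs o that])
    show "dF p ?V n t \<in> NF q p ?V (Suc n)" if "t \<in> NF q p ?V n" for n t by (rule dF_NF[OF p q o that])
    show "dF q ?V (Suc n) (dF q ?V n t) \<in> NF q q ?V (Suc (Suc n))" if "t \<in> FF q q ?V n" for n t by (rule dF_dF[OF qt qs o that])
    show "fF q p ?V n t \<in> FF q q ?V n" if "t \<in> FF q p ?V n" for n t by (rule fF_FF[OF p q o that])
    show "fF q p ?V n t \<in> NF q q ?V n" if "t \<in> NF q p ?V n" for n t by (rule fF_NF[OF p q o that])
    show "fF q p ?V (Suc n) (dF p ?V n t) - dF q ?V n (fF q p ?V n t) \<in> NF q q ?V (Suc n)" if "t \<in> FF q p ?V n" for n t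
      using fF_dF[OF p q o that] subgrp_0[OF subgrp_NF[OF qt qs o]] by simp
    show "\<exists>s\<in>FF q p ?V n. t - dF p ?V n s \<in> NF q p ?V (Suc n)"
      if "t \<in> FF q p ?V (Suc n)" "dF p ?V (Suc n) t \<in> NF q p ?V (Suc (Suc n))" for n t by (rule exact_F[OF p q x that])
    show "\<exists>s\<in>FF q q ?V n. t - dF q ?V n s \<in> NF q q ?V (Suc n)"
      if "t \<in> FF q q ?V (Suc n)" "dF q ?V (Suc n) t \<in> NF q q ?V (Suc (Suc n))" for n t by (rule exact_F[OF qt qs x that])
    show "\<exists>m\<in>?A. t - ?e m \<in> NF q p ?V 0" if "t \<in> FF q p ?V 0" "dF p ?V 0 t \<in> NF q p ?V 1" for t by (rule exact0_F[OF p q x that])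
    show "\<exists>m\<in>?A'. t - ?e' m \<in> NF q q ?V 0" if "t \<in> FF q q ?V 0" "dF q ?V 0 t \<in> NF q q ?V 1" for t by (rule exact0_F[OF qt qs x that])
    show "?e m \<in> FF q p ?V 0" if "m \<in> ?A" for m
      unfolding FF_def by (rule tensor_frag_tfree[OF that]) (rule mod_homD(1)[OF strip_hom[OF e_hom p o]])
    show "?e m \<in> NF q p ?V 0" if "m \<in> ?NA" for m
      unfolding NF_def by (rule tensor_frag_rel[OF mM module_P[OF p q] mQ strip_hom[OF e_hom p o] that])
    show "?e' m \<in> NF q q ?V 0" if "m \<in> ?NA'" for m
      unfolding NF_def by (rule tensor_frag_rel[OF mM' module_P[OF qt qs] mQ' strip_hom[OF e_hom qt o] that])
    show "dF p ?V 0 (?e m) \<in> NF q p ?V 1" if "m \<in> ?A" for m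
      unfolding NF_def dF_def tensor_frag_comp
    proof (rule tensor_frag_zero_rel[OF mQ module_P[OF p q] that])
      fix l assume "l \<in> carrier (strip M p ?V)"
      then show "d 0 (X.mo p \<times> ?V) (e (X.mo p \<times> ?V) l) = \<zero>\<^bsub>strip (Q 1) p ?V\<^esub>"
        using bspec[OF exact0[unfolded exact_at_def mstalk_def] z(1)] by (auto simp: moY_pair[OF p x])
    qed
    show "m \<in> ?NA'" if "m \<in> ?A'" "?e' m \<in> NF q q ?V 0" for m
    proof (rule flat_tensor_inj[OF flat_P[OF qt qs] mM' mQ' strip_hom[OF e_hom qt o] _ that(1) that(2)[unfolded NF_def]])
      show "inj_on (e (X.mo q \<times> ?V)) (carrier (strip M q ?V))"
        using bspec[OF e_mono[unfolded sheaf_mono_def mstalk_def] z(2)] by (simp add: moY_pair[OF qt x])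
    qed
    show "?\<psi> m \<in> ?A'" if "m \<in> ?A" for m by (rule tensor_frag_semilinear_tfree[OF sl that])
    show "fF q p ?V 0 (?e m) - ?e' (?\<psi> m) \<in> NF q q ?V 0" if "m \<in> ?A" for m
    proof -
      have "fF q p ?V 0 (?e m) = ?e' (?\<psi> m)"
        unfolding fF_def tensor_frag_comp
        using sheaf_homD(2)[OF e_hom open_mo_times[OF p o] open_mo_times[OF qt o] sub]
        by (intro tensor_frag_cong[OF that]) simp_all
      then show ?thesis using subgrp_0[OF subgrp_NF[OF qt qs o]] by simp
    qed
    show "m \<in> ?NA" if m: "m \<in> ?A" "?\<psi> m \<in> ?NA'" for m
      using base_changeD(2)[OF bc m(1)] ev[OF tensor_frag_semilinear_tfree[OF sl m(1)]] m(2) by simp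
    show "\<exists>l\<in>?A. ?\<psi> l - m \<in> ?NA'" if m: "m \<in> ?A'" for m
    proof -
      \<comment> \<open>Modulo relations a tensor over O_q is determined by its value, so it is
        enough to find a source tensor with the same value as \<open>m\<close>.\<close>
      let ?y = "tensor_eval (stalk X q) (strip M q ?V) m"
      have y: "?y \<in> carrier (strip M q ?V)" by (rule tensor_eval_closed[OF mM' m])
      then obtain l where l: "l \<in> ?A" "tensor_eval (stalk X q) (strip M q ?V) (?\<psi> l) = ?y" using base_changeD(1)[OF bc] by blast
      have lA: "?\<psi> l \<in> ?A'" by (rule tensor_frag_semilinear_tfree[OF sl l(1)])
      have "tensor_eval (stalk X q) (strip M q ?V) (?\<psi> l - m) = \<zero>\<^bsub>strip M q ?V\<^esub>"
        using tensor_eval_diff[OF mM' lA m] l(2) module_minus_eq_zero_iff[OF mM' y y] by simp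
      then show ?thesis using ev[OF subgrp_diff[OF subgrp_tfree lA m]] l(1) by blast
    qed
  qed
qed

theorem cone_acyclic:
  assumes "openin X'.T V" shows "cone_acyclic q p V"
  using assms
proof (induction "card V" arbitrary: V rule: less_induct)
  case less
  have fin: "finite V" using openin_subset[OF less.prems] X'.finite_topspace finite_subset by blast
  have qt: "q \<in> topspace X.T" using X.mo_top[OF p q] .
  note qs = mo_self[of q]
  consider "V = {}" | x where "x \<in> V" "V = X'.mo x" | "V \<noteq> {}" "\<And>x. x \<in> V \<Longrightarrow> V \<noteq> X'.mo x" by blast
  then show ?case
  proof cases
    case 1
    \<comment> \<open>Over the empty set every element of the cone represents 0, so 0 can serve as
      primitive in each degree.\<close>
    have sub: "cone_set (FF q p V) (FF q q V) n \<subseteq> cone_set (NF q p V) (NF q q V) n" for n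
      using trivial_F[OF p q] trivial_F[OF qt qs] 1 by (cases n) (auto simp: cone_set_def)
    have z: "cone_map (dF p V) (dF q V) (fF q p V) n 0 = 0" for n
      by (cases n) (simp_all add: cone_map_def dF_def fF_def zero_prod_def)
    have zC: "0 \<in> cone_set (FF q p V) (FF q q V) n" for n
      using subgrp_0[OF subgrp_tfree] by (cases n) (auto simp: cone_set_def FF_def zero_prod_def)
    show ?thesis
      unfolding acyclic_mod_def
    proof (intro conjI allI ballI impI)
      fix x n assume "x \<in> cone_set (FF q p V) (FF q q V) (Suc n)"
      then show "\<exists>y\<in>cone_set (FF q p V) (FF q q V) n. x - cone_map (dF p V) (dF q V) (fF q p V) n y \<in> cone_set (NF q p V) (NF q q V) (Suc n)"
        using sub[of "Suc n"] zC[of n] z[of n] by (intro bexI[of _ 0]) auto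
    qed (use sub[of 0] in auto)
  next
    case (2 x)
    then have "x \<in> topspace X'.T" using openin_subset[OF less.prems] by blast
    then show ?thesis using cone_acyclic_min_open 2 by simp
  next
    case 3
    \<comment> \<open>The empty set belongs to this finite family, so it has a maximal member
      \<open>V2\<close>.\<close>
    let ?S = "{U. openin X'.T U \<and> U \<subset> V}"
    have "finite ?S" using fin by (intro finite_subset[of ?S "Pow V"]) auto
    moreover have "{} \<in> ?S" using 3(1) by auto
    ultimately obtain V2 where V2S: "V2 \<in> ?S" "\<forall>U\<in>?S. V2 \<subseteq> U \<longrightarrow> V2 = U"
      using finite_has_maximal[of ?S] by blast
    have V2: "V2 \<in> ?S" "\<And>U. U \<in> ?S \<Longrightarrow> V2 \<subseteq> U \<Longrightarrow> U = V2" using V2S by auto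
    from V2(1) obtain x where x: "x \<in> V" "x \<notin> V2" by blast
    then have xt: "x \<in> topspace X'.T" using openin_subset[OF less.prems] by blast
    let ?V1 = "X'.mo x"
    have V1: "openin X'.T ?V1" "?V1 \<subseteq> V" "?V1 \<noteq> V" "x \<in> ?V1"
      using X'.mo_open[OF xt] min_open_least[OF less.prems x(1)] 3(2)[OF x(1)] min_open_self[of x X'.T] by auto
    \<comment> \<open>Otherwise the union would be a proper open subset of \<open>V\<close> strictly
      larger than \<open>V2\<close>, since it contains \<open>x\<close>.\<close>
    have un: "V = ?V1 \<union> V2"
    proof (rule ccontr)
      assume "V \<noteq> ?V1 \<union> V2"
      then have "?V1 \<union> V2 \<in> ?S" using V1 V2(1) by auto
      from V2(2)[OF this] show False using x(2) V1(4) by auto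
    qed
    have oV2: "openin X'.T V2" using V2(1) by simp
    \<comment> \<open>\<open>V\<close> is not the minimal open set of any of its points, so all
      three pieces are strictly smaller than \<open>V\<close> and the induction hypothesis covers
      them.\<close>
    have lt: "card V2 < card V" "card (?V1 \<inter> V2) < card V" "card ?V1 < card V"
      using V1 V2(1) by (auto intro!: psubset_card_mono[OF fin])
    have oI: "openin X'.T (?V1 \<inter> V2)" using V1(1) oV2 by auto
    have op: "openin X'.T U" if "U \<in> {?V1 \<union> V2, ?V1, V2, ?V1 \<inter> V2}" for U using that V1(1) oV2 by auto
    have opr: "openin X'.T U" "openin X'.T U'" "U' \<subseteq> U"
      if "(U, U') \<in> {(?V1 \<union> V2, ?V1), (?V1 \<union> V2, V2), (?V1, ?V1 \<inter> V2), (V2, ?V1 \<inter> V2)}" for U U' using that V1(1) oV2 by auto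
    have "patching (\<lambda>U. cone_set (FF q p U) (FF q q U)) (\<lambda>U. cone_set (NF q p U) (NF q q U))
       (\<lambda>U. cone_map (dF p U) (dF q U) (fF q p U)) (\<lambda>U U' n (t, r). (rF p U U' n t, shift_map (rF q U U') n r))
       (?V1 \<union> V2) ?V1 V2 (?V1 \<inter> V2)"
    proof (rule patching_cone[OF patching_F[OF p q V1(1) oV2] patching_F[OF qt qs V1(1) oV2]])
      fix U n x assume U: "U \<in> {?V1 \<union> V2, ?V1, V2, ?V1 \<inter> V2}"
      show "NF q q U n \<subseteq> FF q q U n" by (rule NF_FF[OF qt qs op[OF U]])
      show "fF q p U n x \<in> FF q q U n" if "x \<in> FF q p U n" by (rule fF_FF[OF p q op[OF U] that])
      show "fF q p U n x \<in> NF q q U n" if "x \<in> NF q p U n" by (rule fF_NF[OF p q op[OF U] that])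
      show "fF q p U (Suc n) (dF p U n x) - dF q U n (fF q p U n x) \<in> NF q q U (Suc n)" if "x \<in> FF q p U n"
        using fF_dF[OF p q op[OF U] that] subgrp_0[OF subgrp_NF[OF qt qs op[OF U]]] by simp
    next
      show "fF q p U n (x - y) = fF q p U n x - fF q p U n y" for U n x y by (simp add: fF_def tensor_frag_diff)
    next
      fix U U' n x assume U: "(U, U') \<in> {(?V1 \<union> V2, ?V1), (?V1 \<union> V2, V2), (?V1, ?V1 \<inter> V2), (V2, ?V1 \<inter> V2)}" and x: "x \<in> FF q p U n"
      show "rF q U U' n (fF q p U n x) - fF q p U' n (rF p U U' n x) \<in> NF q q U' n"
        using fF_rF[OF p q opr[OF U] x] subgrp_0[OF subgrp_NF[OF qt qs opr(2)[OF U]]] by simp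
    qed
    from patching.mayer_vietoris[OF this] show ?thesis
      using less.hyps[OF lt(3) V1(1)] less.hyps[OF lt(1) oV2] less.hyps[OF lt(2) oI] un by simp
  qed
qed

end

end

section \<open>Quotient modules\<close>

context
  fixes A :: "'a ring" and M :: "('a, 'm) module" and Z H :: "'m set"
  assumes M: "Module.module A M" and Z: "submodule Z A M" and H: "submodule H A M" and HZ: "H \<subseteq> Z"
begin

interpretation Module.module A M by (rule M)

lemma abelian_subgroup_H: "abelian_subgroup H M"
  using H by (intro abelian_subgroupI3 additive_subgroupI) (auto simp: submodule_def M.abelian_group_axioms)

interpretation abelian_subgroup H M by (rule abelian_subgroup_H)

lemma coset_mem: "y \<in> H +>\<^bsub>M\<^esub> x \<longleftrightarrow> (\<exists>h\<in>H. y = h \<oplus>\<^bsub>M\<^esub> x)"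
  by (auto simp: a_r_coset_def')

lemma H_sub: "H \<subseteq> carrier M" by (rule submodule_subset[OF H])

lemma Z_sub: "Z \<subseteq> carrier M" by (rule submodule_subset[OF Z])

lemma coset_eq_iff:
  assumes "x \<in> carrier M" "y \<in> carrier M"
  shows "H +>\<^bsub>M\<^esub> x = H +>\<^bsub>M\<^esub> y \<longleftrightarrow> x \<ominus>\<^bsub>M\<^esub> y \<in> H"
proof
  assume "H +>\<^bsub>M\<^esub> x = H +>\<^bsub>M\<^esub> y"
  then obtain h where h: "h \<in> H" "x = h \<oplus>\<^bsub>M\<^esub> y" using a_rcos_self[OF assms(1)] coset_mem by auto
  then have "x \<ominus>\<^bsub>M\<^esub> y = h" using H_sub assms by (auto simp: M.minus_eq M.a_assoc M.r_neg)
  then show "x \<ominus>\<^bsub>M\<^esub> y \<in> H" using h by simp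
next
  assume h: "x \<ominus>\<^bsub>M\<^esub> y \<in> H"
  have "x = (x \<ominus>\<^bsub>M\<^esub> y) \<oplus>\<^bsub>M\<^esub> y" using assms by (simp add: M.minus_eq M.a_assoc M.l_neg)
  then have "x \<in> H +>\<^bsub>M\<^esub> y" using h coset_mem by blast
  then show "H +>\<^bsub>M\<^esub> x = H +>\<^bsub>M\<^esub> y"
    using M.a_repr_independence[OF _ assms(2) a_subgroup] by simp
qed

lemma coset_zero_iff: "x \<in> carrier M \<Longrightarrow> H +>\<^bsub>M\<^esub> x = H \<longleftrightarrow> x \<in> H"
proof -
  assume x: "x \<in> carrier M"
  have "\<ominus>\<^bsub>M\<^esub> \<zero>\<^bsub>M\<^esub> = \<zero>\<^bsub>M\<^esub>" by (rule M.minus_equality) simp_all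
  then have "x \<ominus>\<^bsub>M\<^esub> \<zero>\<^bsub>M\<^esub> = x" using x unfolding M.minus_eq by (metis M.r_zero)
  then show ?thesis using x coset_eq_iff[of x "\<zero>\<^bsub>M\<^esub>"] M.a_coset_add_zero[OF H_sub] by simp
qed

lemma coset_smult:
  assumes r: "r \<in> carrier A" and x: "x \<in> carrier M"
  shows "(\<Union>z\<in>H +>\<^bsub>M\<^esub> x. H +>\<^bsub>M\<^esub> (r \<odot>\<^bsub>M\<^esub> z)) = H +>\<^bsub>M\<^esub> (r \<odot>\<^bsub>M\<^esub> x)"
proof -
  have "H +>\<^bsub>M\<^esub> (r \<odot>\<^bsub>M\<^esub> z) = H +>\<^bsub>M\<^esub> (r \<odot>\<^bsub>M\<^esub> x)" if z: "z \<in> H +>\<^bsub>M\<^esub> x" for z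
  proof -
    obtain h where h: "h \<in> H" "z = h \<oplus>\<^bsub>M\<^esub> x" using z coset_mem by auto
    have hM: "h \<in> carrier M" using h H_sub by auto
    have "r \<odot>\<^bsub>M\<^esub> z \<ominus>\<^bsub>M\<^esub> r \<odot>\<^bsub>M\<^esub> x = r \<odot>\<^bsub>M\<^esub> h"
      using r x hM h(2) by (simp add: smult_r_distr M.minus_eq M.a_assoc M.r_neg)
    then show ?thesis using coset_eq_iff[of "r \<odot>\<^bsub>M\<^esub> z" "r \<odot>\<^bsub>M\<^esub> x"] submoduleD(3)[OF H r h(1)] r x hM h(2) by simp
  qed
  moreover have "x \<in> H +>\<^bsub>M\<^esub> x" using a_rcos_self[OF x] .
  ultimately show ?thesis by blast
qed

lemma quot_module_simps:
  "carrier (quot_module M Z H) = (\<lambda>x. H +>\<^bsub>M\<^esub> x) ` Z" "\<zero>\<^bsub>quot_module M Z H\<^esub> = H"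
  "x \<in> carrier M \<Longrightarrow> y \<in> carrier M \<Longrightarrow> (H +>\<^bsub>M\<^esub> x) \<oplus>\<^bsub>quot_module M Z H\<^esub> (H +>\<^bsub>M\<^esub> y) = H +>\<^bsub>M\<^esub> (x \<oplus>\<^bsub>M\<^esub> y)"
  "r \<in> carrier A \<Longrightarrow> x \<in> carrier M \<Longrightarrow> r \<odot>\<^bsub>quot_module M Z H\<^esub> (H +>\<^bsub>M\<^esub> x) = H +>\<^bsub>M\<^esub> (r \<odot>\<^bsub>M\<^esub> x)"
  by (simp_all add: quot_module_def a_rcos_sum coset_smult)

lemma module_quot: "Module.module A (quot_module M Z H)"
proof (rule module_image[OF module_submodule[OF M Z], of _ "\<lambda>x. H +>\<^bsub>M\<^esub> x"])
  show "\<zero>\<^bsub>quot_module M Z H\<^esub> = H +>\<^bsub>M\<^esub> \<zero>\<^bsub>M\<lparr>carrier := Z\<rparr>\<^esub>"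
    using M.a_coset_add_zero[OF H_sub] by (simp add: quot_module_simps)
qed (use Z_sub in \<open>auto simp: quot_module_simps subset_iff\<close>)

lemma quot_proj_hom: "(\<lambda>x. H +>\<^bsub>M\<^esub> x) \<in> mod_hom A (M\<lparr>carrier := Z\<rparr>) (quot_module M Z H)"
  using Z_sub by (auto simp: mod_hom_def quot_module_simps subset_iff)

end

text \<open>All members of a coset have images in one coset, so the union that defines an induced
  map collapses. An additive \<open>\<phi>\<close> is enough, which allows different scalar rings,
  as for restriction maps.\<close>

lemma quot_induced:
  fixes A :: "'a ring" and M :: "('a, 'm) module" and B :: "'b ring" and N :: "('b, 'n) module"
  assumes M: "Module.module A M" and H: "submodule H A M" and N: "Module.module B N" and L: "submodule L B N"
    and \<phi>: "add_hom M N \<phi>" and \<phi>H: "\<And>h. h \<in> H \<Longrightarrow> \<phi> h \<in> L" and x: "x \<in> carrier M"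
  shows "(\<Union>y\<in>H +>\<^bsub>M\<^esub> x. L +>\<^bsub>N\<^esub> \<phi> y) = L +>\<^bsub>N\<^esub> \<phi> x"
proof -
  interpret M: Module.module A M by fact
  interpret N: Module.module B N by fact
  note c = coset_mem[OF M H H order_refl] coset_eq_iff[OF N L L order_refl]
  have "L +>\<^bsub>N\<^esub> \<phi> y = L +>\<^bsub>N\<^esub> \<phi> x" if y: "y \<in> H +>\<^bsub>M\<^esub> x" for y
  proof -
    obtain h where h: "h \<in> H" "y = h \<oplus>\<^bsub>M\<^esub> x" using y c(1) by auto
    have hM: "h \<in> carrier M" using h submodule_subset[OF H] by auto
    have cl: "\<phi> h \<in> carrier N" "\<phi> x \<in> carrier N" using add_hom_closed[OF \<phi>] hM x by auto
    have "\<phi> y \<ominus>\<^bsub>N\<^esub> \<phi> x = \<phi> h"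
      using add_hom_add[OF \<phi> hM x] h(2) cl by (simp add: N.M.minus_eq N.M.a_assoc N.M.r_neg)
    then show ?thesis using c(2)[of "\<phi> y" "\<phi> x"] \<phi>H[OF h(1)] cl add_hom_closed[OF \<phi>] hM x h(2) by simp
  qed
  moreover have "x \<in> H +>\<^bsub>M\<^esub> x"
    using c(1)[of x x] submoduleD(1)[OF H] x by force
  ultimately show ?thesis by blast
qed

section \<open>Base change of cohomology\<close>

context resolution_setup
begin

abbreviation "KQ \<equiv> \<lambda>n. direct_image Y fst (proj_sharp k X a X' a') (Q n)"
abbreviation "KD \<equiv> \<lambda>n U. d n (preimage Y fst U)"
abbreviation "Zc n U \<equiv> cocycles KQ KD n U"
abbreviation "Bc n U \<equiv> coboundaries KQ KD n U"
abbreviation "PH n \<equiv> cohomology_presheaf KQ KD n"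
abbreviation "S' \<equiv> topspace X'.T"

lemma preimage_fst: "openin X.T U \<Longrightarrow> preimage Y fst U = U \<times> S'"
  using openin_subset[of X.T U] by (auto simp: preimage_def topspace_Y)

lemma msec_KQ: "openin X.T U \<Longrightarrow> msec (KQ n) U = restrict_scalars (ps U) (msec (Q n) (U \<times> S'))"
  and mres_KQ: "openin X.T U \<Longrightarrow> openin X.T V \<Longrightarrow> mres (KQ n) U V = mres (Q n) (U \<times> S') (V \<times> S')"
  by (simp_all add: direct_image_def preimage_fst)

lemma open_strip: "openin X.T U \<Longrightarrow> openin TY (U \<times> S')"
  by (rule open_times) simp_all

lemma module_KQ: "openin X.T U \<Longrightarrow> Module.module (sec X U) (msec (KQ n) U)"
  using module_restrict_scalars[OF X.cring_sec ps_hom sheaf_of_modulesD(1)[OF sheaf_Q open_strip]]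
  by (simp add: msec_KQ)

lemma KD_hom: "openin X.T U \<Longrightarrow> KD n U \<in> mod_hom (sec X U) (msec (KQ n) U) (msec (KQ (Suc n)) U)"
  using mod_hom_restrict_scalars[OF sheaf_homD(1)[OF d_hom open_strip] ps_hom] by (simp add: msec_KQ preimage_fst)

lemma mres_KQ_hom:
  assumes "openin X.T U" "openin X.T V" "V \<subseteq> U"
  shows "mres (KQ n) U V \<in> mod_hom (sec X U) (msec (KQ n) U) (restrict_scalars (res X U V) (msec (KQ n) V))"
proof -
  have "V \<times> S' \<subseteq> U \<times> S'" using assms(3) by auto
  note h = mod_homD[OF sheaf_of_modulesD(2)[OF sheaf_Q open_strip[OF assms(1)] open_strip[OF assms(2)] this]]
  show ?thesis
    unfolding mres_KQ[OF assms(1,2)] msec_KQ[OF assms(1)] msec_KQ[OF assms(2)]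
    using h ring_hom_closed[OF ps_hom[OF assms(1)]] ps_res[OF assms] by (auto simp: mod_hom_def res_Y)
qed

lemma KD_KD: "openin X.T U \<Longrightarrow> x \<in> carrier (msec (KQ n) U) \<Longrightarrow> KD (Suc n) U (KD n U x) = \<zero>\<^bsub>msec (KQ (Suc (Suc n))) U\<^esub>"
  using d_d[OF open_strip, of U x n] by (simp add: msec_KQ preimage_fst)

lemma KD_mres:
  assumes "openin X.T U" "openin X.T V" "V \<subseteq> U" "x \<in> carrier (msec (KQ n) U)"
  shows "KD n V (mres (KQ n) U V x) = mres (KQ (Suc n)) U V (KD n U x)"
proof -
  have "V \<times> S' \<subseteq> U \<times> S'" using assms(3) by auto
  from sheaf_homD(2)[OF d_hom open_strip[OF assms(1)] open_strip[OF assms(2)] this] show ?thesis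
    using assms by (simp add: msec_KQ mres_KQ preimage_fst)
qed

lemma submodule_Zc: "openin X.T U \<Longrightarrow> submodule (Zc n U) (sec X U) (msec (KQ n) U)"
  unfolding cocycles_def by (rule submodule_kernel[OF module_KQ module_KQ KD_hom])

lemma submodule_Bc:
  assumes U: "openin X.T U" shows "submodule (Bc n U) (sec X U) (msec (KQ n) U)"
proof (cases n)
  case 0
  interpret Module.module "sec X U" "msec (KQ 0) U" by (rule module_KQ[OF U])
  have "submodule {\<zero>\<^bsub>msec (KQ 0) U\<^esub>} (sec X U) (msec (KQ 0) U)"
    by (rule submoduleI2[OF module_KQ[OF U]]) auto
  then show ?thesis using 0 by (simp add: coboundaries_def)
next
  case (Suc m)
  then show ?thesis
    using submodule_image[OF module_KQ[OF U] module_KQ[OF U] KD_hom[OF U] submodule_carrier[OF module_KQ[OF U]], of m]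
    by (simp add: coboundaries_def)
qed

lemma Bc_Zc: "openin X.T U \<Longrightarrow> Bc n U \<subseteq> Zc n U"
proof (cases n)
  case 0
  assume U: "openin X.T U"
  show ?thesis
    using 0 submoduleD(1)[OF submodule_Zc[OF U, of 0]] by (simp add: coboundaries_def)
next
  case (Suc m)
  assume U: "openin X.T U"
  show ?thesis
    using Suc KD_KD[OF U] mod_homD(1)[OF KD_hom[OF U]] by (auto simp: coboundaries_def cocycles_def)
qed

lemma mres_Zc: "openin X.T U \<Longrightarrow> openin X.T V \<Longrightarrow> V \<subseteq> U \<Longrightarrow> x \<in> Zc n U \<Longrightarrow> mres (KQ n) U V x \<in> Zc n V"
  using mod_homD(1)[OF mres_KQ_hom, of U V x n] KD_mres[of U V x n]
    add_hom_zero[OF module_abelian_group[OF module_KQ] abelian_group_restrict[OF module_abelian_group[OF module_KQ]]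
      mod_hom_add_hom[OF mres_KQ_hom], of U V V "Suc n"]
  by (simp add: cocycles_def)

lemma mres_Bc:
  assumes "openin X.T U" "openin X.T V" "V \<subseteq> U" "x \<in> Bc n U" shows "mres (KQ n) U V x \<in> Bc n V"
proof (cases n)
  case 0
  then show ?thesis
    using assms(4) add_hom_zero[OF module_abelian_group[OF module_KQ[OF assms(1)]]
        abelian_group_restrict[OF module_abelian_group[OF module_KQ[OF assms(2)]]] mod_hom_add_hom[OF mres_KQ_hom[OF assms(1-3)]], of 0]
    by (simp add: coboundaries_def)
next
  case (Suc m)
  then obtain y where y: "y \<in> carrier (msec (KQ m) U)" "x = KD m U y" using assms(4) by (auto simp: coboundaries_def)
  then have "mres (KQ n) U V x = KD m V (mres (KQ m) U V y)" using KD_mres[OF assms(1-3) y(1)] Suc by simp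
  moreover have "mres (KQ m) U V y \<in> carrier (msec (KQ m) V)"
    using mod_homD(1)[OF mres_KQ_hom[OF assms(1-3)] y(1)] by simp
  ultimately show ?thesis using Suc by (simp add: coboundaries_def)
qed

lemma msec_PH: "msec (PH n) U = quot_module (msec (KQ n) U) (Zc n U) (Bc n U)"
  by (simp add: cohomology_presheaf_def)

lemma mres_PH:
  assumes "openin X.T U" "openin X.T V" "V \<subseteq> U" "x \<in> carrier (msec (KQ n) U)"
  shows "mres (PH n) U V (Bc n U +>\<^bsub>msec (KQ n) U\<^esub> x) = Bc n V +>\<^bsub>msec (KQ n) V\<^esub> mres (KQ n) U V x"
proof -
  have "add_hom (msec (KQ n) U) (msec (KQ n) V) (mres (KQ n) U V)"
    using mod_hom_add_hom[OF mres_KQ_hom[OF assms(1-3), of n]] by (simp add: add_hom_def)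
  from quot_induced[OF module_KQ[OF assms(1)] submodule_Bc[OF assms(1)] module_KQ[OF assms(2)] submodule_Bc[OF assms(2)] this
      mres_Bc[OF assms(1-3)] assms(4)]
  show ?thesis by (simp add: cohomology_presheaf_def)
qed

text \<open>Links the direct image with the strips used for the cones: the stalk of the direct image
  at \<open>p\<close> is the case V = X'.\<close>

lemma msec_KQ_strip: "p \<in> topspace X.T \<Longrightarrow> msec (KQ n) (X.mo p) = strip (Q n) p S'"
proof -
  assume p: "p \<in> topspace X.T"
  have "psr p S' = ps (X.mo p)" by (rule ext) (rule psr_top)
  then show ?thesis using msec_KQ[OF X.mo_open[OF p], of n] by (simp add: strip_def)
qed

text \<open>Modulo relations, coboundaries of the tensored complex are the tensors whose entries are
  coboundaries. In degree 0 both are trivial: the shifted group is {0}, and tensors with first entry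
  0 are relations.\<close>

lemma shift_coboundary:
  assumes q: "q' \<in> X.mo p'" and p: "p' \<in> topspace X.T"
  shows "r \<in> shift_set (FF q' p' S') i \<Longrightarrow> shift_map (dF p' S') i r \<in> tfree (strip (Q i) p' S'\<lparr>carrier := Bc i (X.mo p')\<rparr>) (P q' p')" (is "_ \<Longrightarrow> ?t r")
    and "t \<in> tfree (strip (Q i) p' S'\<lparr>carrier := Bc i (X.mo p')\<rparr>) (P q' p') \<Longrightarrow>
      \<exists>r\<in>shift_set (FF q' p' S') i. t - shift_map (dF p' S') i r \<in> NF q' p' S' i"
proof -
  have oS: "openin X'.T S'" by simp
  have o: "openin X.T (X.mo p')" by (rule X.mo_open[OF p])
  show "?t r" if "r \<in> shift_set (FF q' p' S') i"
  proof (cases i)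
    case 0
    then show ?thesis using subgrp_0[OF subgrp_tfree] by simp
  next
    case (Suc j)
    then have r: "r \<in> tfree (strip (Q j) p' S') (P q' p')" using that by (simp add: FF_def)
    have "tensor_frag (d j (X.mo p' \<times> S')) (\<lambda>y. y) r \<in> tfree (strip (Q i) p' S'\<lparr>carrier := Bc i (X.mo p')\<rparr>) (P q' p')"
      by (rule tensor_frag_tfree[OF r]) (simp_all add: Suc coboundaries_def msec_KQ_strip[OF p] preimage_fst[OF o])
    then show ?thesis using Suc by (simp add: dF_def)
  qed
  show "\<exists>r\<in>shift_set (FF q' p' S') i. t - shift_map (dF p' S') i r \<in> NF q' p' S' i"
    if t: "t \<in> tfree (strip (Q i) p' S'\<lparr>carrier := Bc i (X.mo p')\<rparr>) (P q' p')"
  proof (cases i)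
    case 0
    have "tensor_frag (\<lambda>x. x) (\<lambda>y. y) t \<in> tensor_rel (stalk X p') (strip (Q i) p' S') (P q' p')"
      by (rule tensor_frag_zero_rel[OF module_strip[OF sheaf_Q p oS] module_P[OF p q] t])
        (simp add: 0 coboundaries_def msec_KQ_strip[OF p])
    then show ?thesis using 0 by (simp add: tensor_frag_id NF_def)
  next
    case (Suc j)
    have "\<exists>l\<in>carrier (strip (Q j) p' S'). d j (X.mo p' \<times> S') l = x" if "x \<in> carrier (strip (Q i) p' S'\<lparr>carrier := Bc i (X.mo p')\<rparr>)" for x
      using that by (auto simp: Suc coboundaries_def msec_KQ_strip[OF p] preimage_fst[OF o])
    from tensor_frag_lift[OF t this] obtain r where "r \<in> tfree (strip (Q j) p' S') (P q' p')" "tensor_frag (d j (X.mo p' \<times> S')) (\<lambda>y. y) r = t" by blast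
    then show ?thesis
      using Suc subgrp_0[OF subgrp_NF[OF p q oS]] by (auto simp: FF_def dF_def intro!: bexI[of _ r])
  qed
qed

context
  fixes q p and i :: nat assumes p: "p \<in> topspace X.T" and q: "q \<in> X.mo p"
begin

text \<open>The acyclic cone over V = X' compares the cohomology of the tensored complex at
  \<open>p\<close> with the cohomology at \<open>q\<close>. Flatness lets cocycles of the tensored
  complex be taken with entries in the cocycles, so the former is the tensored cohomology. Reaching
  a class uses the cone in degree i + 1, the kernel uses degree i.\<close>

lemma cohomology_base_change:
  "base_change (stalk X p) (stalk X q) (stalk_res X p q) (msec (PH i) (X.mo p)) (msec (PH i) (X.mo q))
    (mres (PH i) (X.mo p) (X.mo q))"
proof -
  have qt: "q \<in> topspace X.T" using X.mo_top[OF p q] .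
  note qs = mo_self[of q]
  have oS: "openin X'.T S'" by simp
  note op = X.mo_open[OF p] and oq = X.mo_open[OF qt] and mon = X.mo_mono[OF p q]
  let ?A = "stalk X p" and ?B = "stalk X q"
  let ?Mp = "strip (Q i) p S'" and ?Mq = "strip (Q i) q S'"
  let ?Zp = "Zc i (X.mo p)" and ?Zq = "Zc i (X.mo q)" and ?Bp = "Bc i (X.mo p)" and ?Bq = "Bc i (X.mo q)"
  let ?Hp = "msec (PH i) (X.mo p)" and ?Hq = "msec (PH i) (X.mo q)"
  let ?\<phi> = "mres (Q i) (X.mo p \<times> S') (X.mo q \<times> S')" and ?\<phi>H = "mres (PH i) (X.mo p) (X.mo q)"
  let ?\<pi>p = "\<lambda>x. ?Bp +>\<^bsub>?Mp\<^esub> x" and ?\<pi>q = "\<lambda>x. ?Bq +>\<^bsub>?Mq\<^esub> x"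
  note Pp = flat_P[OF p q] and Pq = flat_P[OF qt qs]
  note mPp = module_P[OF p q] and mPq = module_P[OF qt qs]
  have mMp: "Module.module ?A ?Mp" and mMq: "Module.module ?B ?Mq"
    by (rule module_strip[OF sheaf_Q p oS] module_strip[OF sheaf_Q qt oS])+
  have sZp: "submodule ?Zp ?A ?Mp" and sBp: "submodule ?Bp ?A ?Mp" and sZq: "submodule ?Zq ?B ?Mq" and sBq: "submodule ?Bq ?B ?Mq"
    using submodule_Zc[OF op, of i] submodule_Bc[OF op, of i] submodule_Zc[OF oq, of i] submodule_Bc[OF oq, of i]
    by (simp_all add: msec_KQ_strip p qt stalk_def)
  note BZp = Bc_Zc[OF op, of i] and BZq = Bc_Zc[OF oq, of i]
  have Hp: "?Hp = quot_module ?Mp ?Zp ?Bp" and Hq: "?Hq = quot_module ?Mq ?Zq ?Bq"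
    by (simp_all add: msec_PH msec_KQ_strip p qt)
  note mZp = module_submodule[OF mMp sZp] and mZq = module_submodule[OF mMq sZq]
  have mHp: "Module.module ?A ?Hp" and mHq: "Module.module ?B ?Hq"
    unfolding Hp Hq by (rule module_quot[OF mMp sZp sBp BZp] module_quot[OF mMq sZq sBq BZq])+
  have \<pi>p: "?\<pi>p \<in> mod_hom ?A (?Mp\<lparr>carrier := ?Zp\<rparr>) ?Hp" and \<pi>q: "?\<pi>q \<in> mod_hom ?B (?Mq\<lparr>carrier := ?Zq\<rparr>) ?Hq"
    unfolding Hp Hq by (rule quot_proj_hom[OF mMp sZp sBp BZp] quot_proj_hom[OF mMq sZq sBq BZq])+
  have surjp: "?\<pi>p ` ?Zp = carrier ?Hp" and surjq: "?\<pi>q ` ?Zq = carrier ?Hq"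
    unfolding Hp Hq by (simp_all add: quot_module_simps(1)[OF mMp sZp sBp BZp] quot_module_simps(1)[OF mMq sZq sBq BZq])
  have kerp: "?\<pi>p x = \<zero>\<^bsub>?Hp\<^esub>" if "x \<in> ?Bp" for x
    unfolding Hp using that coset_zero_iff[OF mMp sZp sBp BZp, of x] submodule_subset[OF sBp]
    by (auto simp: quot_module_simps(2)[OF mMp sZp sBp BZp])
  have kerq: "?\<pi>q x = \<zero>\<^bsub>?Hq\<^esub> \<longleftrightarrow> x \<in> ?Bq" if "x \<in> carrier ?Mq" for x
    unfolding Hq using coset_zero_iff[OF mMq sZq sBq BZq that] by (simp add: quot_module_simps(2)[OF mMq sZq sBq BZq])
  have mresK: "mres (KQ i) (X.mo p) (X.mo q) = ?\<phi>" by (rule mres_KQ[OF op oq])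
  have \<phi>Z: "?\<phi> x \<in> ?Zq" if "x \<in> ?Zp" for x using mres_Zc[OF op oq mon that] by (simp add: mresK)
  have \<phi>H: "?\<phi>H (?\<pi>p x) = ?\<pi>q (?\<phi> x)" if "x \<in> ?Zp" for x
    using mres_PH[OF op oq mon, of x i] that submodule_subset[OF sZp]
    by (auto simp: msec_KQ_strip p qt mresK)
  have slH: "semilinear ?A (stalk_res X p q) ?Hp ?Hq ?\<phi>H"
  proof -
    note sl = semilinearD[OF strip_semilinear[OF sheaf_Q p q oS, of i]]
    have cl: "x \<in> carrier ?Mp" if "x \<in> ?Zp" for x using that submodule_subset[OF sZp] by auto
    have ex: "\<exists>x\<in>?Zp. y = ?\<pi>p x" if "y \<in> carrier ?Hp" for y using that surjp by blast
    note hp = mod_homD[OF \<pi>p] and hq = mod_homD[OF \<pi>q]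
    show ?thesis
      unfolding semilinear_def add_hom_def
    proof (intro conjI ballI)
      show "?\<phi>H \<in> carrier ?Hp \<rightarrow> carrier ?Hq"
        using ex \<phi>H \<phi>Z hq(1) by fastforce
      fix y y' assume "y \<in> carrier ?Hp" "y' \<in> carrier ?Hp"
      then obtain x x' where x: "x \<in> ?Zp" "y = ?\<pi>p x" "x' \<in> ?Zp" "y' = ?\<pi>p x'" using ex by blast
      have "y \<oplus>\<^bsub>?Hp\<^esub> y' = ?\<pi>p (x \<oplus>\<^bsub>?Mp\<^esub> x')" using hp(2)[of x x'] x by simp
      then have "?\<phi>H (y \<oplus>\<^bsub>?Hp\<^esub> y') = ?\<pi>q (?\<phi> (x \<oplus>\<^bsub>?Mp\<^esub> x'))"
        using \<phi>H[of "x \<oplus>\<^bsub>?Mp\<^esub> x'"] submoduleD(2)[OF sZp x(1,3)] by simp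
      also have "\<dots> = ?\<pi>q (?\<phi> x \<oplus>\<^bsub>?Mq\<^esub> ?\<phi> x')" using sl(2)[OF cl[OF x(1)] cl[OF x(3)]] by simp
      also have "\<dots> = ?\<phi>H y \<oplus>\<^bsub>?Hq\<^esub> ?\<phi>H y'" using hq(2)[of "?\<phi> x" "?\<phi> x'"] x \<phi>H \<phi>Z by simp
      finally show "?\<phi>H (y \<oplus>\<^bsub>?Hp\<^esub> y') = ?\<phi>H y \<oplus>\<^bsub>?Hq\<^esub> ?\<phi>H y'" .
    next
      fix r y assume r: "r \<in> carrier ?A" and "y \<in> carrier ?Hp"
      then obtain x where x: "x \<in> ?Zp" "y = ?\<pi>p x" using ex by blast
      have "r \<odot>\<^bsub>?Hp\<^esub> y = ?\<pi>p (r \<odot>\<^bsub>?Mp\<^esub> x)" using hp(3)[OF r, of x] x by simp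
      then have "?\<phi>H (r \<odot>\<^bsub>?Hp\<^esub> y) = ?\<pi>q (?\<phi> (r \<odot>\<^bsub>?Mp\<^esub> x))"
        using \<phi>H[of "r \<odot>\<^bsub>?Mp\<^esub> x"] submoduleD(3)[OF sZp r x(1)] by simp
      also have "\<dots> = ?\<pi>q (stalk_res X p q r \<odot>\<^bsub>?Mq\<^esub> ?\<phi> x)" using sl(3)[OF r cl[OF x(1)]] by simp
      also have "\<dots> = stalk_res X p q r \<odot>\<^bsub>?Hq\<^esub> ?\<phi>H y"
        using hq(3)[OF ring_hom_closed[OF X.stalk_res_hom[OF p q] r], of "?\<phi> x"] x \<phi>H \<phi>Z by simp
      finally show "?\<phi>H (r \<odot>\<^bsub>?Hp\<^esub> y) = stalk_res X p q r \<odot>\<^bsub>?Hq\<^esub> ?\<phi>H y" .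
    qed
  qed
  have evq: "c \<in> tensor_rel ?B ?Hq (P q q) \<longleftrightarrow> tensor_eval ?B ?Hq c = \<zero>\<^bsub>?Hq\<^esub>" if "c \<in> tfree ?Hq (P q q)" for c
    by (rule tensor_eval_rel_iff(1)[OF mHq _ that]) (rule X.stalk_res_id[OF qt])
  note sgq = subgrp_NF[OF qt qs oS, of i] and sgp = subgrp_NF[OF p q oS, of i]
  note sHq = subgrp_tensor_rel[OF mHq mPq] and sHp = subgrp_tensor_rel[OF mHp mPp]
  have subZp: "?Zp \<subseteq> carrier ?Mp" and subZq: "?Zq \<subseteq> carrier ?Mq" by (rule submodule_subset[OF sZp] submodule_subset[OF sZq])+
  have Zp_FF: "tfree (?Mp\<lparr>carrier := ?Zp\<rparr>) (P q p) \<subseteq> FF q p S' i"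
    unfolding FF_def by (rule tfree_mono) (use subZp in auto)
  have inclp: "(\<lambda>x. x) \<in> mod_hom ?A (?Mp\<lparr>carrier := ?Zp\<rparr>) ?Mp" using subZp by (auto simp: mod_hom_def)
  have inclq: "(\<lambda>x. x) \<in> mod_hom ?B (?Mq\<lparr>carrier := ?Zq\<rparr>) ?Mq" using subZq by (auto simp: mod_hom_def)
  \<comment> \<open>By flatness, tensors of cocycles embed into the tensored complex, so a relation
    found there already holds among cocycles.\<close>
  have flp: "t \<in> tensor_rel ?A (?Mp\<lparr>carrier := ?Zp\<rparr>) (P q p)" if "t \<in> tfree (?Mp\<lparr>carrier := ?Zp\<rparr>) (P q p)" "t \<in> NF q p S' i" for t
    using flat_tensor_inj[OF Pp mZp mMp inclp _ that(1)] that(2) by (simp add: tensor_frag_id NF_def)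
  have flq: "t \<in> tensor_rel ?B (?Mq\<lparr>carrier := ?Zq\<rparr>) (P q q)" if "t \<in> tfree (?Mq\<lparr>carrier := ?Zq\<rparr>) (P q q)" "t \<in> NF q q S' i" for t
    using flat_tensor_inj[OF Pq mZq mMq inclq _ that(1)] that(2) by (simp add: tensor_frag_id NF_def)
  have dZp: "d i (X.mo p \<times> S') x = \<zero>\<^bsub>strip (Q (Suc i)) p S'\<^esub>" if "x \<in> ?Zp" for x
    using that by (simp add: cocycles_def msec_KQ_strip p preimage_fst[OF op] del: strip_simps)
  have dZq: "d i (X.mo q \<times> S') x = \<zero>\<^bsub>strip (Q (Suc i)) q S'\<^esub>" if "x \<in> ?Zq" for x
    using that by (simp add: cocycles_def msec_KQ_strip qt preimage_fst[OF oq] del: strip_simps)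
  note ca = acyclic_modD[OF cone_acyclic[OF p q oS]]
  show ?thesis
    unfolding base_change_def
  proof (intro conjI ballI impI)
    fix y assume "y \<in> carrier ?Hq"
    then obtain z where z: "z \<in> ?Zq" "y = ?\<pi>q z" using surjq by blast
    let ?u1 = "\<one>\<^bsub>?B\<^esub>"
    have one: "?u1 \<in> carrier ?B" by (rule cring_one(1)[OF X.cring_stalk[OF qt]])
    have zF: "frag_of (z, ?u1) \<in> FF q q S' i" using z(1) subZq one by (auto simp: FF_def)
    \<comment> \<open>The second component of the cone is shifted, so a cocycle of degree i at
      \<open>q\<close> is a cycle of degree i + 1. A primitive (t, r) expresses z \<otimes> 1 as the
      image of the cocycle \<open>t\<close> up to the coboundary of \<open>r\<close>.\<close>
    have x: "(0, frag_of (z, ?u1)) \<in> cone_set (FF q p S') (FF q q S') (Suc i)"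
      using zF subgrp_0[OF subgrp_tfree] by (simp add: cone_set_def FF_def)
    have "dF q S' i (frag_of (z, ?u1)) \<in> NF q q S' (Suc i)"
      using tensor_rel_zero_left[OF module_strip[OF sheaf_Q qt oS] mPq, of ?u1 "Suc i"] one dZq[OF z(1)] by (simp add: dF_def NF_def)
    then have "cone_map (dF p S') (dF q S') (fF q p S') (Suc i) (0, frag_of (z, ?u1)) \<in> cone_set (NF q p S') (NF q q S') (Suc (Suc i))"
      using subgrp_0[OF subgrp_NF[OF p q oS]] subgrp_uminus[OF subgrp_NF[OF qt qs oS]]
      by (simp add: cone_map_def cone_set_def dF_def fF_def)
    from ca(2)[OF x this] obtain t r where tr: "t \<in> FF q p S' i" "r \<in> shift_set (FF q q S') i"
      "- dF p S' i t \<in> NF q p S' (Suc i)" "frag_of (z, ?u1) - (fF q p S' i t - shift_map (dF q S') i r) \<in> NF q q S' i"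
      by (auto simp: cone_set_def cone_map_def)
    have "dF p S' i t \<in> NF q p S' (Suc i)" using subgrp_uminus[OF subgrp_NF[OF p q oS] tr(3)] by simp
    \<comment> \<open>\<open>t\<close> is a cocycle of the tensored complex only. Flatness replaces
      it by a congruent tensor \<open>k\<close> whose entries are cocycles, and these have classes
      in cohomology.\<close>
    then obtain k where k: "k \<in> tfree (?Mp\<lparr>carrier := {x \<in> carrier ?Mp. d i (X.mo p \<times> S') x = \<zero>\<^bsub>strip (Q (Suc i)) p S'\<^esub>}\<rparr>) (P q p)"
      "t - k \<in> tensor_rel ?A ?Mp (P q p)"
      using flat_tensor_kernel[OF Pp mMp module_strip[OF sheaf_Q p oS] strip_hom[OF d_hom p oS] tr(1)[unfolded FF_def]]
      unfolding dF_def NF_def by blast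
    have "{x \<in> carrier ?Mp. d i (X.mo p \<times> S') x = \<zero>\<^bsub>strip (Q (Suc i)) p S'\<^esub>} = ?Zp"
      by (simp add: cocycles_def msec_KQ_strip p preimage_fst[OF op] del: strip_simps)
    with k have kZ: "k \<in> tfree (?Mp\<lparr>carrier := ?Zp\<rparr>) (P q p)" by simp
    let ?sr = "shift_map (dF q S') i r"
    have srB: "?sr \<in> tfree (?Mq\<lparr>carrier := ?Bq\<rparr>) (P q q)" by (rule shift_coboundary(1)[OF qs qt tr(2)])
    have srZ: "?sr \<in> tfree (?Mq\<lparr>carrier := ?Zq\<rparr>) (P q q)"
      using srB tfree_mono[of "?Mq\<lparr>carrier := ?Bq\<rparr>" "?Mq\<lparr>carrier := ?Zq\<rparr>" "P q q" "P q q"] BZq by auto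
    have \<phi>k: "fF q p S' i k \<in> tfree (?Mq\<lparr>carrier := ?Zq\<rparr>) (P q q)"
      unfolding fF_def by (rule tensor_frag_tfree[OF kZ]) (use \<phi>Z in auto)
    \<comment> \<open>All three terms have cocycle entries and their sum is a relation in the full
      complex, hence also a relation among cocycles, so it may be mapped to cohomology. There the
      coboundary term disappears.\<close>
    let ?u = "frag_of (z, ?u1) - fF q p S' i k + ?sr"
    have uZ: "?u \<in> tfree (?Mq\<lparr>carrier := ?Zq\<rparr>) (P q q)"
      by (intro subgrp_add[OF subgrp_tfree] subgrp_diff[OF subgrp_tfree] srZ \<phi>k) (use z one in simp)
    have "fF q p S' i (t - k) \<in> NF q q S' i" using fF_NF[OF p q oS, of "t - k" i] k(2) by (simp add: NF_def)
    from subgrp_add[OF sgq tr(4) this] have "?u \<in> NF q q S' i" by (simp add: fF_def tensor_frag_diff algebra_simps)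
    from flq[OF uZ this] have "tensor_frag ?\<pi>q (\<lambda>y. y) ?u \<in> tensor_rel ?B ?Hq (P q q)"
      by (rule tensor_frag_rel[OF mZq mPq mHq \<pi>q])
    moreover have "tensor_frag ?\<pi>q (\<lambda>y. y) ?sr \<in> tensor_rel ?B ?Hq (P q q)"
      by (rule tensor_frag_zero_rel[OF mHq mPq srB]) (use kerq submodule_subset[OF sBq] in auto)
    ultimately have "tensor_frag ?\<pi>q (\<lambda>y. y) ?u - tensor_frag ?\<pi>q (\<lambda>y. y) ?sr \<in> tensor_rel ?B ?Hq (P q q)"
      by (rule subgrp_diff[OF sHq])
    moreover have "tensor_frag ?\<pi>q (\<lambda>y. y) (fF q p S' i k) = tensor_frag ?\<phi>H (\<lambda>y. y) (tensor_frag ?\<pi>p (\<lambda>y. y) k)"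
      unfolding fF_def tensor_frag_comp by (rule tensor_frag_cong[OF kZ]) (simp_all add: \<phi>H)
    ultimately have rel: "frag_of (y, ?u1) - tensor_frag ?\<phi>H (\<lambda>y. y) (tensor_frag ?\<pi>p (\<lambda>y. y) k) \<in> tensor_rel ?B ?Hq (P q q)"
      by (simp add: tensor_frag_diff tensor_frag_add z(2))
    have kH: "tensor_frag ?\<pi>p (\<lambda>y. y) k \<in> tfree ?Hp (P q p)"
      by (rule tensor_frag_tfree[OF kZ]) (use surjp in auto)
    have kHq: "tensor_frag ?\<phi>H (\<lambda>y. y) (tensor_frag ?\<pi>p (\<lambda>y. y) k) \<in> tfree ?Hq (P q q)"
      by (rule tensor_frag_semilinear_tfree[OF slH kH])
    have yH: "frag_of (y, ?u1) \<in> tfree ?Hq (P q q)" using one z surjq by auto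
    have "y \<ominus>\<^bsub>?Hq\<^esub> tensor_eval ?B ?Hq (tensor_frag ?\<phi>H (\<lambda>y. y) (tensor_frag ?\<pi>p (\<lambda>y. y) k)) = \<zero>\<^bsub>?Hq\<^esub>"
      using rel evq[OF subgrp_diff[OF subgrp_tfree yH kHq]] tensor_eval_diff[OF mHq yH kHq] tensor_eval_hom(2)[OF mHq, of y ?u1]
        Module.module.smult_one[OF mHq, of y] yH one by simp
    then have "tensor_eval ?B ?Hq (tensor_frag ?\<phi>H (\<lambda>y. y) (tensor_frag ?\<pi>p (\<lambda>y. y) k)) = y"
      using module_minus_eq_zero_iff[OF mHq, of y] tensor_eval_closed[OF mHq kHq] yH by simp
    then show "\<exists>t\<in>tfree ?Hp (P q p). tensor_eval ?B ?Hq (tensor_frag ?\<phi>H (\<lambda>y. y) t) = y" using kH by blast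
  next
    fix c assume c: "c \<in> tfree ?Hp (P q p)" "tensor_eval ?B ?Hq (tensor_frag ?\<phi>H (\<lambda>y. y) c) = \<zero>\<^bsub>?Hq\<^esub>"
    have "\<exists>l\<in>carrier (?Mp\<lparr>carrier := ?Zp\<rparr>). ?\<pi>p l = x" if "x \<in> carrier ?Hp" for x using that surjp[symmetric] by auto
    from tensor_frag_lift[OF c(1) this] obtain t where t: "t \<in> tfree (?Mp\<lparr>carrier := ?Zp\<rparr>) (P q p)" "tensor_frag ?\<pi>p (\<lambda>y. y) t = c" by blast
    have \<phi>t: "fF q p S' i t \<in> tfree (?Mq\<lparr>carrier := ?Zq\<rparr>) (P q q)"
      unfolding fF_def by (rule tensor_frag_tfree[OF t(1)]) (use \<phi>Z in auto)
    have "tensor_frag ?\<pi>q (\<lambda>y. y) (fF q p S' i t) = tensor_frag ?\<phi>H (\<lambda>y. y) c"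
      unfolding fF_def t(2)[symmetric] tensor_frag_comp by (rule tensor_frag_cong[OF t(1)]) (simp_all add: \<phi>H)
    then have "tensor_frag ?\<pi>q (\<lambda>y. y) (fF q p S' i t) \<in> tensor_rel ?B ?Hq (P q q)"
      using evq[OF tensor_frag_semilinear_tfree[OF slH c(1)]] c(2) by simp
    \<comment> \<open>By right exactness a tensor of cocycles that vanishes in cohomology is
      congruent to one with coboundary entries. With a primitive \<open>r\<close> of the latter, (t,
      r) becomes a cycle of the cone.\<close>
    from tensor_right_exact[OF mZq mHq mPq \<pi>q _ \<phi>t this] surjq
    obtain k where k: "k \<in> tfree (?Mq\<lparr>carrier := ?Zq, carrier := {x \<in> carrier (?Mq\<lparr>carrier := ?Zq\<rparr>). ?\<pi>q x = \<zero>\<^bsub>?Hq\<^esub>}\<rparr>) (P q q)"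
      "fF q p S' i t - k \<in> tensor_rel ?B (?Mq\<lparr>carrier := ?Zq\<rparr>) (P q q)" by auto
    have "{x \<in> carrier (?Mq\<lparr>carrier := ?Zq\<rparr>). ?\<pi>q x = \<zero>\<^bsub>?Hq\<^esub>} = ?Bq" using kerq subZq BZq by auto
    with k(1) have kB: "k \<in> tfree (?Mq\<lparr>carrier := ?Bq\<rparr>) (P q q)" by simp
    have k2: "fF q p S' i t - k \<in> NF q q S' i" unfolding NF_def by (rule tensor_rel_mono[OF mMq mPq sZq k(2)])
    obtain r where r: "r \<in> shift_set (FF q q S') i" "k - shift_map (dF q S') i r \<in> NF q q S' i"
      using shift_coboundary(2)[OF qs qt kB] by blast
    have x: "(t, r) \<in> cone_set (FF q p S') (FF q q S') i" using t(1) Zp_FF r(1) by (auto simp: cone_set_def)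
    have "dF p S' i t \<in> NF q p S' (Suc i)"
      unfolding dF_def NF_def by (rule tensor_frag_zero_rel[OF module_strip[OF sheaf_Q p oS] mPp t(1)]) (use dZp in simp)
    then have Dx: "cone_map (dF p S') (dF q S') (fF q p S') i (t, r) \<in> cone_set (NF q p S') (NF q q S') (Suc i)"
      using subgrp_add[OF sgq k2 r(2)] by (simp add: cone_map_def cone_set_def)
    \<comment> \<open>Acyclicity makes \<open>t\<close> a coboundary of the tensored complex at
      \<open>p\<close>; in degree 0 this says that \<open>t\<close> itself is a relation.\<close>
    have "\<exists>s\<in>shift_set (FF q p S') i. t - shift_map (dF p S') i s \<in> NF q p S' i"
    proof (cases i)
      case 0
      then show ?thesis using ca(1)[of "(t, r)"] x Dx by (simp add: cone_set_def)
    next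
      case (Suc j)
      then obtain v where "v \<in> cone_set (FF q p S') (FF q q S') j" "(t, r) - cone_map (dF p S') (dF q S') (fF q p S') j v \<in> cone_set (NF q p S') (NF q q S') (Suc j)"
        using ca(2)[of "(t, r)" j] x Dx by blast
      then show ?thesis using Suc by (auto simp: cone_set_def cone_map_def)
    qed
    then obtain s where s: "s \<in> shift_set (FF q p S') i" "t - shift_map (dF p S') i s \<in> NF q p S' i" by blast
    let ?k = "shift_map (dF p S') i s"
    have kB: "?k \<in> tfree (?Mp\<lparr>carrier := ?Bp\<rparr>) (P q p)" by (rule shift_coboundary(1)[OF q p s(1)])
    then have kZ: "?k \<in> tfree (?Mp\<lparr>carrier := ?Zp\<rparr>) (P q p)"
      using tfree_mono[of "?Mp\<lparr>carrier := ?Bp\<rparr>" "?Mp\<lparr>carrier := ?Zp\<rparr>" "P q p" "P q p"] BZp by auto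
    have "t - ?k \<in> tensor_rel ?A (?Mp\<lparr>carrier := ?Zp\<rparr>) (P q p)"
      by (rule flp[OF subgrp_diff[OF subgrp_tfree t(1) kZ] s(2)])
    then have "tensor_frag ?\<pi>p (\<lambda>y. y) (t - ?k) \<in> tensor_rel ?A ?Hp (P q p)"
      by (rule tensor_frag_rel[OF mZp mPp mHp \<pi>p])
    moreover have "tensor_frag ?\<pi>p (\<lambda>y. y) ?k \<in> tensor_rel ?A ?Hp (P q p)"
      by (rule tensor_frag_zero_rel[OF mHp mPp kB]) (simp add: kerp)
    ultimately show "c \<in> tensor_rel ?A ?Hp (P q p)"
      using subgrp_cong[OF sHp, of c "tensor_frag ?\<pi>p (\<lambda>y. y) ?k"] by (simp add: tensor_frag_diff t(2))
  qed
qed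

end

end

section \<open>Presentations from base change\<close>

lemma free_module_induct [consumes 2, case_names zero add]:
  assumes "cring A" "x \<in> carrier (free_module A J)" "P \<zero>\<^bsub>free_module A J\<^esub>"
    and step: "\<And>x j c. x \<in> carrier (free_module A J) \<Longrightarrow> j \<in> J \<Longrightarrow> c \<in> carrier A \<Longrightarrow> P x \<Longrightarrow>
      P (x \<oplus>\<^bsub>free_module A J\<^esub> free_inj A J j c)"
  shows "P x"
proof -
  have "P x" if "finite S" "S \<subseteq> J" "x \<in> carrier (free_module A J)" "\<And>j. j \<in> J \<Longrightarrow> j \<notin> S \<Longrightarrow> x j = \<zero>\<^bsub>A\<^esub>" for S x
    using that
  proof (induction S arbitrary: x rule: finite_induct)
    case empty
    then have "x = \<zero>\<^bsub>free_module A J\<^esub>" by (auto simp: free_module_simps PiE_iff extensional_def fun_eq_iff)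
    then show ?case using assms(3) by simp
  next
    case (insert j S)
    have j: "j \<in> J" using insert.prems by auto
    note sp = free_module_split[OF assms(1) insert.prems(2) j]
    have "P (x(j := \<zero>\<^bsub>A\<^esub>))"
    proof (rule insert.IH[OF _ sp(1)])
      show "(x(j := \<zero>\<^bsub>A\<^esub>)) i = \<zero>\<^bsub>A\<^esub>" if "i \<in> J" "i \<notin> S" for i using that insert.prems(3)[of i] by auto
    qed (use insert.prems in auto)
    moreover have "x j \<in> carrier A" using insert.prems(2) j by (auto simp: free_module_simps)
    ultimately have "P (x(j := \<zero>\<^bsub>A\<^esub>) \<oplus>\<^bsub>free_module A J\<^esub> free_inj A J j (x j))" by (intro step sp(1) j)
    then show ?case using sp(2) by simp
  qed
  from this[of "{j \<in> J. x j \<noteq> \<zero>\<^bsub>A\<^esub>}" x] show ?thesis using assms(2) by (auto simp: free_module_simps)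
qed

text \<open>Scalar multiples of basis vectors generate the free module additively, so additive maps
  suffice and the target may be a module over another ring.\<close>

lemma free_module_hom_eqI:
  fixes A :: "'a ring" and N :: "('b, 'n) module" and J :: "'j set"
  assumes A: "cring A" and N: "abelian_group N" and h: "add_hom (free_module A J) N h" "add_hom (free_module A J) N h'"
    and eq: "\<And>j c. j \<in> J \<Longrightarrow> c \<in> carrier A \<Longrightarrow> h (free_inj A J j c) = h' (free_inj A J j c)"
    and x: "x \<in> carrier (free_module A J)"
  shows "h x = h' x"
  using A x
proof (induction x rule: free_module_induct)
  case zero
  note F = module_abelian_group[OF module_free_module[OF A]]
  show ?case using add_hom_zero[OF F N h(1)] add_hom_zero[OF F N h(2)] by simp
next
  case (add x j c)
  note i = free_inj_closed[OF A add(3), of J j]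
  show ?case using add_hom_add[OF h(1) add(1) i] add_hom_add[OF h(2) add(1) i] eq[OF add(2,3)] add(4) by simp
qed

text \<open>The linear extension of the assignment \<open>m\<close> of basis vectors. The sum ranges
  over the support, because over an infinite index set \<open>finsum\<close> is a default
  value.\<close>

definition free_lift :: "'a ring \<Rightarrow> ('a, 'm) module \<Rightarrow> 'j set \<Rightarrow> ('j \<Rightarrow> 'm) \<Rightarrow> ('j \<Rightarrow> 'a) \<Rightarrow> 'm" where
  "free_lift A N J m x = finsum N (\<lambda>j. x j \<odot>\<^bsub>N\<^esub> m j) {j \<in> J. x j \<noteq> \<zero>\<^bsub>A\<^esub>}"

context
  fixes A :: "'a ring" and N :: "('a, 'm) module" and J :: "'j set" and m :: "'j \<Rightarrow> 'm"
  assumes N: "Module.module A N" and m: "\<And>j. j \<in> J \<Longrightarrow> m j \<in> carrier N"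
begin

interpretation N: Module.module A N by (rule N)

lemma free_lift_eq:
  assumes "finite S" "S \<subseteq> J" "x \<in> J \<rightarrow> carrier A" "\<And>j. j \<in> J \<Longrightarrow> j \<notin> S \<Longrightarrow> x j = \<zero>\<^bsub>A\<^esub>"
  shows "free_lift A N J m x = finsum N (\<lambda>j. x j \<odot>\<^bsub>N\<^esub> m j) S"
proof -
  have "finite {j \<in> J. x j \<noteq> \<zero>\<^bsub>A\<^esub>}" by (rule finite_subset[OF _ assms(1)]) (use assms(4) in auto)
  then show ?thesis
    unfolding free_lift_def by (intro N.M.add.finprod_mono_neutral_cong assms(1)) (use assms m in \<open>auto simp: subset_iff Pi_iff\<close>)
qed

lemma free_lift_free_inj:
  assumes "j \<in> J" "c \<in> carrier A" shows "free_lift A N J m (free_inj A J j c) = c \<odot>\<^bsub>N\<^esub> m j"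
proof -
  have "free_lift A N J m (free_inj A J j c) = finsum N (\<lambda>i. free_inj A J j c i \<odot>\<^bsub>N\<^esub> m i) {j}"
    by (rule free_lift_eq) (use assms in \<open>auto simp: free_inj_def\<close>)
  also have "\<dots> = c \<odot>\<^bsub>N\<^esub> m j"
    using N.M.add.finprod_insert[of "{}" j "\<lambda>i. free_inj A J j c i \<odot>\<^bsub>N\<^esub> m i"] assms m by (simp add: free_inj_def)
  finally show ?thesis .
qed

lemma free_lift_hom: "free_lift A N J m \<in> mod_hom A (free_module A J) N"
proof -
  have mem: "x \<in> J \<rightarrow> carrier A" "finite {j \<in> J. x j \<noteq> \<zero>\<^bsub>A\<^esub>}" if "x \<in> carrier (free_module A J)" for x
    using that by (auto simp: free_module_simps)
  have cl: "free_lift A N J m x \<in> carrier N" if "x \<in> carrier (free_module A J)" for x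
    unfolding free_lift_def by (rule N.M.finsum_closed) (use mem[OF that] m in auto)
  moreover have "free_lift A N J m (x \<oplus>\<^bsub>free_module A J\<^esub> y) = free_lift A N J m x \<oplus>\<^bsub>N\<^esub> free_lift A N J m y"
    if xy: "x \<in> carrier (free_module A J)" "y \<in> carrier (free_module A J)" for x y
  proof -
    let ?S = "{j \<in> J. x j \<noteq> \<zero>\<^bsub>A\<^esub>} \<union> {j \<in> J. y j \<noteq> \<zero>\<^bsub>A\<^esub>}" and ?z = "x \<oplus>\<^bsub>free_module A J\<^esub> y"
    note mx = mem[OF xy(1)] and my = mem[OF xy(2)]
    have mz: "?z \<in> J \<rightarrow> carrier A" using mx my by (auto simp: free_module_simps)
    have "free_lift A N J m ?z = finsum N (\<lambda>j. ?z j \<odot>\<^bsub>N\<^esub> m j) ?S"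
      by (rule free_lift_eq) (use mx my mz in \<open>auto simp: free_module_simps\<close>)
    also have "\<dots> = finsum N (\<lambda>j. x j \<odot>\<^bsub>N\<^esub> m j \<oplus>\<^bsub>N\<^esub> y j \<odot>\<^bsub>N\<^esub> m j) ?S"
      by (rule N.M.finsum_cong') (use mx my m in \<open>auto simp: free_module_simps N.smult_l_distr Pi_iff\<close>)
    also have "\<dots> = finsum N (\<lambda>j. x j \<odot>\<^bsub>N\<^esub> m j) ?S \<oplus>\<^bsub>N\<^esub> finsum N (\<lambda>j. y j \<odot>\<^bsub>N\<^esub> m j) ?S"
      by (rule N.M.finsum_addf) (use mx my m in \<open>auto simp: Pi_iff\<close>)
    also have "finsum N (\<lambda>j. x j \<odot>\<^bsub>N\<^esub> m j) ?S = free_lift A N J m x" by (rule free_lift_eq[symmetric]) (use mx my in auto)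
    also have "finsum N (\<lambda>j. y j \<odot>\<^bsub>N\<^esub> m j) ?S = free_lift A N J m y" by (rule free_lift_eq[symmetric]) (use mx my in auto)
    finally show ?thesis .
  qed
  moreover have "free_lift A N J m (r \<odot>\<^bsub>free_module A J\<^esub> x) = r \<odot>\<^bsub>N\<^esub> free_lift A N J m x"
    if r: "r \<in> carrier A" and x: "x \<in> carrier (free_module A J)" for r x
  proof -
    let ?S = "{j \<in> J. x j \<noteq> \<zero>\<^bsub>A\<^esub>}" and ?z = "r \<odot>\<^bsub>free_module A J\<^esub> x"
    note mx = mem[OF x]
    have mz: "?z \<in> J \<rightarrow> carrier A" using mx r by (auto simp: free_module_simps)
    have "free_lift A N J m ?z = finsum N (\<lambda>j. ?z j \<odot>\<^bsub>N\<^esub> m j) ?S"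
      by (rule free_lift_eq) (use mx r mz in \<open>auto simp: free_module_simps\<close>)
    also have "\<dots> = finsum N (\<lambda>j. r \<odot>\<^bsub>N\<^esub> (x j \<odot>\<^bsub>N\<^esub> m j)) ?S"
      by (rule N.M.finsum_cong') (use mx r m in \<open>auto simp: free_module_simps N.smult_assoc1 Pi_iff\<close>)
    also have "\<dots> = r \<odot>\<^bsub>N\<^esub> free_lift A N J m x"
      unfolding free_lift_def by (rule N.finsum_smult_ldistr[symmetric]) (use mx r m in \<open>auto simp: Pi_iff\<close>)
    finally show ?thesis .
  qed
  ultimately show ?thesis by (auto simp: mod_hom_def)
qed

end

lemma semilinear_free_map:
  assumes "cring A" "cring B" "f \<in> ring_hom A B"
  shows "semilinear A f (free_module A J) (free_module B J) (\<lambda>x. \<lambda>j\<in>J. f (x j))"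
proof -
  have "(\<lambda>a. a) \<in> ring_hom A A" "(\<lambda>a. a) \<in> ring_hom B B" by (auto simp: ring_hom_def)
  from semilinear_free[OF assms(1,2,1,2,3) this assms(3), of J] show ?thesis
    by (simp add: semilinear_def add_hom_def)
qed

lemma free_inj_map:
  assumes "cring A" "cring B" "f \<in> ring_hom A B"
  shows "(\<lambda>i\<in>J. f (free_inj A J j c i)) = free_inj B J j (f c)"
  using ring_hom_zero[OF assms(3)] assms(1,2) by (auto simp: free_inj_def cring_def)

lemma free_lift_natural:
  assumes A: "cring A" and B: "cring B" and f: "f \<in> ring_hom A B"
    and M: "Module.module A M" and N: "Module.module B N" and \<phi>: "semilinear A f M N \<phi>"
    and m: "\<And>j. j \<in> J \<Longrightarrow> m j \<in> carrier M" and m': "\<And>j. j \<in> J \<Longrightarrow> m' j = \<phi> (m j)"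
    and x: "x \<in> carrier (free_module A J)"
  shows "\<phi> (free_lift A M J m x) = free_lift B N J m' (\<lambda>j\<in>J. f (x j))"
proof -
  have m'N: "m' j \<in> carrier N" if "j \<in> J" for j using m' semilinearD(1)[OF \<phi>] m that by simp
  note lM = free_lift_hom[of A M J m, OF M m] and lN = free_lift_hom[of B N J m', OF N m'N]
  note sf = semilinear_free_map[OF A B f, of J]
  show ?thesis
  proof (rule free_module_hom_eqI[OF A module_abelian_group[OF N] _ _ _ x])
    show "add_hom (free_module A J) N (\<lambda>x. \<phi> (free_lift A M J m x))"
      using mod_homD[OF lM] semilinearD[OF \<phi>] by (simp add: add_hom_def)
    show "add_hom (free_module A J) N (\<lambda>x. free_lift B N J m' (\<lambda>j\<in>J. f (x j)))"
      using mod_homD[OF lN] semilinearD[OF sf] by (simp add: add_hom_def)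
    show "\<phi> (free_lift A M J m (free_inj A J j c)) = free_lift B N J m' (\<lambda>i\<in>J. f (free_inj A J j c i))"
      if "j \<in> J" "c \<in> carrier A" for j c
      using that ring_hom_closed[OF f] m semilinearD(3)[OF \<phi>]
      by (simp add: free_inj_map[OF A B f] free_lift_free_inj[OF M m] free_lift_free_inj[OF N m'N] m')
  qed
qed

lemma free_inj_arith:
  fixes A :: "'a ring"
  assumes A: "cring A" and c: "c \<in> carrier A" "c' \<in> carrier A"
  shows "free_inj A J j (c \<oplus>\<^bsub>A\<^esub> c') = free_inj A J j c \<oplus>\<^bsub>free_module A J\<^esub> free_inj A J j c'"
    and "free_inj A J j (c \<otimes>\<^bsub>A\<^esub> c') = c \<odot>\<^bsub>free_module A J\<^esub> free_inj A J j c'"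
proof -
  interpret cring A by fact
  show "free_inj A J j (c \<oplus>\<^bsub>A\<^esub> c') = free_inj A J j c \<oplus>\<^bsub>free_module A J\<^esub> free_inj A J j c'"
    "free_inj A J j (c \<otimes>\<^bsub>A\<^esub> c') = c \<odot>\<^bsub>free_module A J\<^esub> free_inj A J j c'"
    using c by (auto simp: free_inj_def free_module_simps)
qed

section \<open>The standard presentation of a module after base change\<close>

context
  fixes A :: "'a ring" and B :: "'b ring" and f :: "'a \<Rightarrow> 'b" and M :: "('a, 'm) module" and N :: "('b, 'n) module" and \<phi> :: "'m \<Rightarrow> 'n"
  assumes A: "cring A" and B: "cring B" and f: "f \<in> ring_hom A B"
    and M: "Module.module A M" and N: "Module.module B N" and \<phi>: "semilinear A f M N \<phi>"
    and bc: "base_change A B f M N \<phi>"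
begin

interpretation A: cring A by (rule A)
interpretation B: cring B by (rule B)

private abbreviation "J \<equiv> carrier M"
private abbreviation "I \<equiv> {y \<in> carrier (free_module A J). free_lift A M J (\<lambda>m. m) y = \<zero>\<^bsub>M\<^esub>}"
private abbreviation "fmap \<equiv> \<lambda>x. \<lambda>j\<in>J. f (x j)"
private abbreviation "g \<equiv> free_lift B N J \<phi>"
private abbreviation "F \<equiv> free_lift B (free_module B J) I fmap"
text \<open>Sends the pair (m, b) to b times the basis vector of m. It is defined on representatives
  only, since it is not additive in m; its failure to respect the relations of the tensor product is
  exactly what the relations in \<open>I\<close> account for.\<close>

private abbreviation "\<Psi> \<equiv> \<lambda>t. tensor_eval B (free_module B J) (tensor_frag (\<lambda>m. free_inj B J m \<one>\<^bsub>B\<^esub>) (\<lambda>y. y) t)"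
private abbreviation "P \<equiv> alg_module f B"

private lemma MA: "Module.module A (free_module A J)" and MB: "Module.module B (free_module B J)"
  by (rule module_free_module[OF A] module_free_module[OF B])+

interpretation MB: Module.module B "free_module B J" by (rule MB)
interpretation MM: Module.module A M by (rule M)

private lemma fmap: "semilinear A f (free_module A J) (free_module B J) fmap"
  by (rule semilinear_free_map[OF A B f])

private lemma gh: "g \<in> mod_hom B (free_module B J) N"
  by (rule free_lift_hom[OF N]) (use semilinearD(1)[OF \<phi>] in auto)

private lemma g_inj: "m \<in> J \<Longrightarrow> c \<in> carrier B \<Longrightarrow> g (free_inj B J m c) = c \<odot>\<^bsub>N\<^esub> \<phi> m"
  by (rule free_lift_free_inj[OF N]) (use semilinearD(1)[OF \<phi>] in auto)

private lemma Fh: "F \<in> mod_hom B (free_module B I) (free_module B J)"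
  by (rule free_lift_hom[OF MB]) (use semilinearD(1)[OF fmap] in auto)

private lemma F_inj: "i \<in> I \<Longrightarrow> c \<in> carrier B \<Longrightarrow> F (free_inj B I i c) = c \<odot>\<^bsub>free_module B J\<^esub> fmap i"
  by (rule free_lift_free_inj[OF MB]) (use semilinearD(1)[OF fmap] in auto)

private lemma inj_tfree:
  "t \<in> tfree M P \<Longrightarrow> tensor_frag (\<lambda>m. free_inj B J m \<one>\<^bsub>B\<^esub>) (\<lambda>y. y) t \<in> tfree (free_module B J) (alg_module (\<lambda>b. b) B)"
  by (rule tensor_frag_tfree) (auto intro: free_inj_closed[OF B])

private lemma Psi_closed: "t \<in> tfree M P \<Longrightarrow> \<Psi> t \<in> carrier (free_module B J)"
  by (rule tensor_eval_closed[OF MB inj_tfree])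

private lemma Psi_diff: "t \<in> tfree M P \<Longrightarrow> t' \<in> tfree M P \<Longrightarrow> \<Psi> (t - t') = \<Psi> t \<ominus>\<^bsub>free_module B J\<^esub> \<Psi> t'"
  by (simp add: tensor_frag_diff tensor_eval_diff[OF MB inj_tfree inj_tfree])

private lemma Psi_add: "t \<in> tfree M P \<Longrightarrow> t' \<in> tfree M P \<Longrightarrow> \<Psi> (t + t') = \<Psi> t \<oplus>\<^bsub>free_module B J\<^esub> \<Psi> t'"
  by (simp add: tensor_frag_add tensor_eval_add[OF MB inj_tfree inj_tfree])

private lemma Psi_of: "m \<in> J \<Longrightarrow> c \<in> carrier B \<Longrightarrow> tensor_eval B (free_module B J) (frag_of (free_inj B J m \<one>\<^bsub>B\<^esub>, c)) = free_inj B J m c"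
  using free_inj_arith(2)[OF B, of c "\<one>\<^bsub>B\<^esub>" J m] by (simp add: tensor_eval_hom(2)[OF MB] free_inj_closed[OF B])

private lemma Psi_surj: "x \<in> carrier (free_module B J) \<Longrightarrow> \<exists>t\<in>tfree M P. \<Psi> t = x"
  using B
proof (induction x rule: free_module_induct[consumes 2])
  case zero
  show ?case using subgrp_0[OF subgrp_tfree] by (intro bexI[of _ 0]) (simp_all add: tensor_eval_0[OF MB])
next
  case (add x j c)
  then obtain t where t: "t \<in> tfree M P" "\<Psi> t = x" by blast
  have j: "frag_of (j, c) \<in> tfree M P" using add by simp
  have "\<Psi> (t + frag_of (j, c)) = x \<oplus>\<^bsub>free_module B J\<^esub> free_inj B J j c"
    using Psi_add[OF t(1) j] Psi_of[OF add(2,3)] t(2) by simp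
  then show ?case using subgrp_add[OF subgrp_tfree t(1) j] by blast
qed

private lemma g_Psi: "t \<in> tfree M P \<Longrightarrow> g (\<Psi> t) = tensor_eval B N (tensor_frag \<phi> (\<lambda>y. y) t)"
proof -
  assume t: "t \<in> tfree M P"
  have "tensor_frag g (\<lambda>y. y) (tensor_frag (\<lambda>m. free_inj B J m \<one>\<^bsub>B\<^esub>) (\<lambda>y. y) t) = tensor_frag \<phi> (\<lambda>y. y) t"
    unfolding tensor_frag_comp
    by (rule tensor_frag_cong[OF t]) (use g_inj semilinearD(1)[OF \<phi>] Module.module.smult_one[OF N] in auto)
  then show ?thesis using tensor_eval_natural[OF MB N gh inj_tfree[OF t]] by simp
qed

text \<open>The elements of \<open>M\<close> generate \<open>M\<close>, so their images generate
  \<open>N\<close> over \<open>B\<close>.\<close>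

lemma base_change_surj: "n \<in> carrier N \<Longrightarrow> \<exists>x\<in>carrier (free_module B (carrier M)). free_lift B N (carrier M) \<phi> x = n"
  using base_changeD(1)[OF bc] g_Psi Psi_closed by metis

private lemma relation: "y \<in> carrier B \<Longrightarrow> i \<in> I \<Longrightarrow> y \<odot>\<^bsub>free_module B J\<^esub> fmap i \<in> F ` carrier (free_module B I)"
  by (subst F_inj[symmetric]) (auto intro!: imageI free_inj_closed[OF B])

private lemma fmap_inj: "fmap (free_inj A J j c) = free_inj B J j (f c)"
  by (rule free_inj_map[OF A B f])

private lemma fmap_minus:
  "x \<in> carrier (free_module A J) \<Longrightarrow> y \<in> carrier (free_module A J) \<Longrightarrow> fmap (x \<ominus>\<^bsub>free_module A J\<^esub> y) = fmap x \<ominus>\<^bsub>free_module B J\<^esub> fmap y"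
  by (rule add_hom_minus[OF module_abelian_group[OF MA] module_abelian_group[OF MB] conjunct1[OF fmap[unfolded semilinear_def]]])

private lemma free_lift_minus:
  "x \<in> carrier (free_module A J) \<Longrightarrow> y \<in> carrier (free_module A J) \<Longrightarrow>
    free_lift A M J (\<lambda>m. m) (x \<ominus>\<^bsub>free_module A J\<^esub> y) = free_lift A M J (\<lambda>m. m) x \<ominus>\<^bsub>M\<^esub> free_lift A M J (\<lambda>m. m) y"
  by (rule mod_hom_minus[OF MA M free_lift_hom[OF M]])

private lemma free_lift_inj: "m \<in> J \<Longrightarrow> c \<in> carrier A \<Longrightarrow> free_lift A M J (\<lambda>m. m) (free_inj A J m c) = c \<odot>\<^bsub>M\<^esub> m"
  by (rule free_lift_free_inj[OF M])

private lemma smult_minus: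
  "c \<in> carrier B \<Longrightarrow> x \<in> carrier (free_module B J) \<Longrightarrow> y \<in> carrier (free_module B J) \<Longrightarrow>
    c \<odot>\<^bsub>free_module B J\<^esub> (x \<ominus>\<^bsub>free_module B J\<^esub> y) = c \<odot>\<^bsub>free_module B J\<^esub> x \<ominus>\<^bsub>free_module B J\<^esub> c \<odot>\<^bsub>free_module B J\<^esub> y"
  by (simp add: MB.M.minus_eq MB.smult_r_distr MB.smult_r_minus)

text \<open>Write \<open>x\<close> as the image of a tensor \<open>t\<close> under
  \<open>\<Psi>\<close>. The value of \<open>t\<close> in \<open>N\<close> is the image of
  \<open>x\<close>, hence 0, so by base change \<open>t\<close> is a relation of the tensor product;
  and \<open>\<Psi>\<close> turns each generating relation into a multiple of a relation already
  present over \<open>A\<close>.\<close>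

lemma base_change_relations:
  assumes x: "x \<in> carrier (free_module B (carrier M))" and gx: "free_lift B N (carrier M) \<phi> x = \<zero>\<^bsub>N\<^esub>"
  shows "x \<in> free_lift B (free_module B (carrier M)) {y \<in> carrier (free_module A (carrier M)). free_lift A M (carrier M) (\<lambda>m. m) y = \<zero>\<^bsub>M\<^esub>}
      (\<lambda>i. \<lambda>j\<in>carrier M. f (i j)) ` carrier (free_module B {y \<in> carrier (free_module A (carrier M)). free_lift A M (carrier M) (\<lambda>m. m) y = \<zero>\<^bsub>M\<^esub>})"
proof -
  obtain t where t: "t \<in> tfree M P" "\<Psi> t = x" using Psi_surj[OF x] by blast
  have rel: "t \<in> tensor_rel A M P" using base_changeD(2)[OF bc t(1)] g_Psi[OF t(1)] gx t(2) by simp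
  let ?im = "F ` carrier (free_module B I)" and ?S = "{t \<in> tfree M P. \<Psi> t \<in> F ` carrier (free_module B I)}"
  note MI = module_free_module[OF B, of I]
  have cl: "free_inj B J j c \<in> carrier (free_module B J)" if "c \<in> carrier B" for j c by (rule free_inj_closed[OF B that])
  have clA: "free_inj A J j c \<in> carrier (free_module A J)" if "c \<in> carrier A" for j c by (rule free_inj_closed[OF A that])
  have mA: "u \<ominus>\<^bsub>free_module A J\<^esub> v \<in> carrier (free_module A J)" if "u \<in> carrier (free_module A J)" "v \<in> carrier (free_module A J)" for u v
    by (rule module_minus_closed[OF MA that])
  have zero: "\<zero>\<^bsub>free_module B J\<^esub> \<in> ?im"
    unfolding mod_hom_zero[OF MI MB Fh, symmetric] by (rule imageI[OF module_zero_closed[OF MI]])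
  have "t \<in> ?S"
  proof (rule tensor_rel_induct[OF M module_alg_module[OF A f B] rel])
    show "subgrp ?S"
    proof -
      have "a \<ominus>\<^bsub>free_module B J\<^esub> b \<in> ?im" if ab: "a \<in> ?im" "b \<in> ?im" for a b
      proof -
        obtain u v where uv: "u \<in> carrier (free_module B I)" "a = F u" "v \<in> carrier (free_module B I)" "b = F v"
          using ab by (elim imageE)
        show ?thesis
          unfolding uv(2,4) mod_hom_minus[OF MI MB Fh uv(1,3), symmetric] by (rule imageI[OF module_minus_closed[OF MI uv(1,3)]])
      qed
      with zero show ?thesis
        by (simp add: subgrp_def subgrp_0[OF subgrp_tfree] subgrp_diff[OF subgrp_tfree] Psi_diff tensor_eval_0[OF MB])
    qed
  next
    fix x x' y assume xy: "x \<in> J" "x' \<in> J" "y \<in> carrier P"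
    \<comment> \<open>The basis vector of x + x' minus those of x and x': the relation over
      \<open>A\<close> that records additivity in the first argument.\<close>
    let ?i = "free_inj A J (x \<oplus>\<^bsub>M\<^esub> x') \<one>\<^bsub>A\<^esub> \<ominus>\<^bsub>free_module A J\<^esub> free_inj A J x \<one>\<^bsub>A\<^esub> \<ominus>\<^bsub>free_module A J\<^esub> free_inj A J x' \<one>\<^bsub>A\<^esub>"
    have "?i \<in> I"
      using xy by (simp add: free_lift_minus free_lift_inj clA mA MM.M.minus_eq MM.M.a_ac MM.M.r_neg MM.M.r_neg1 MM.M.r_neg2)
    from relation[OF _ this, of y] xy
    have "free_inj B J (x \<oplus>\<^bsub>M\<^esub> x') y \<ominus>\<^bsub>free_module B J\<^esub> free_inj B J x y \<ominus>\<^bsub>free_module B J\<^esub> free_inj B J x' y \<in> ?im"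
      by (simp add: fmap_minus clA mA fmap_inj smult_minus cl free_inj_arith(2)[OF B, symmetric] ring_hom_one[OF f])
    then show "frag_of (x \<oplus>\<^bsub>M\<^esub> x', y) - frag_of (x, y) - frag_of (x', y) \<in> ?S"
      using xy by (simp add: subgrp_diff[OF subgrp_tfree] Psi_diff Psi_of)
  next
    fix x y y' assume xy: "x \<in> J" "y \<in> carrier P" "y' \<in> carrier P"
    \<comment> \<open>Additivity in the second argument holds already in the free module, so 0 of
      the image is enough.\<close>
    have "\<Psi> (frag_of (x, y \<oplus>\<^bsub>P\<^esub> y') - frag_of (x, y) - frag_of (x, y')) = \<zero>\<^bsub>free_module B J\<^esub>"
      using xy by (simp add: subgrp_diff[OF subgrp_tfree] Psi_diff Psi_of free_inj_arith(1)[OF B] cl MB.M.minus_eq MB.M.a_ac MB.M.r_neg MB.M.r_neg1 MB.M.r_neg2)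
    then show "frag_of (x, y \<oplus>\<^bsub>P\<^esub> y') - frag_of (x, y) - frag_of (x, y') \<in> ?S"
      using xy zero by (simp add: subgrp_diff[OF subgrp_tfree])
  next
    fix r x y assume xy: "r \<in> carrier A" "x \<in> J" "y \<in> carrier P"
    \<comment> \<open>The basis vector of the multiple of x by r, minus r times the basis vector of
      x. Base change turns the coefficient r into f r, which is how it acts on
      \<open>P\<close>.\<close>
    let ?i = "free_inj A J (r \<odot>\<^bsub>M\<^esub> x) \<one>\<^bsub>A\<^esub> \<ominus>\<^bsub>free_module A J\<^esub> free_inj A J x r"
    have "?i \<in> I" using xy by (simp add: free_lift_minus free_lift_inj clA mA MM.M.minus_eq MM.M.r_neg)
    from relation[OF _ this, of y] xy
    have "free_inj B J (r \<odot>\<^bsub>M\<^esub> x) y \<ominus>\<^bsub>free_module B J\<^esub> free_inj B J x (f r \<otimes>\<^bsub>B\<^esub> y) \<in> ?im"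
      by (simp add: fmap_minus clA mA fmap_inj smult_minus cl free_inj_arith(2)[OF B, symmetric] ring_hom_one[OF f] ring_hom_closed[OF f] B.m_comm)
    then show "frag_of (r \<odot>\<^bsub>M\<^esub> x, y) - frag_of (x, r \<odot>\<^bsub>P\<^esub> y) \<in> ?S"
      using xy ring_hom_closed[OF f] by (simp add: subgrp_diff[OF subgrp_tfree] Psi_diff Psi_of)
  qed
  then show ?thesis using t(2) by simp
qed

text \<open>By additivity it is enough to look at multiples of basis vectors. Such a vector stands
  for a relation over \<open>A\<close>, and its image in \<open>N\<close> is \<open>\<phi>\<close>
  of the value of that relation, namely \<open>\<phi>\<close> of 0.\<close>

lemma base_change_relations_zero:
  assumes u: "u \<in> carrier (free_module B {y \<in> carrier (free_module A (carrier M)). free_lift A M (carrier M) (\<lambda>m. m) y = \<zero>\<^bsub>M\<^esub>})"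
  shows "free_lift B N (carrier M) \<phi> (free_lift B (free_module B (carrier M)) {y \<in> carrier (free_module A (carrier M)). free_lift A M (carrier M) (\<lambda>m. m) y = \<zero>\<^bsub>M\<^esub>}
      (\<lambda>i. \<lambda>j\<in>carrier M. f (i j)) u) = \<zero>\<^bsub>N\<^esub>"
proof -
  note Nz = module_zero_closed[OF N]
  interpret MN: Module.module B N by (rule N)
  have "(\<lambda>u. g (F u)) u = (\<lambda>_. \<zero>\<^bsub>N\<^esub>) u"
  proof (rule free_module_hom_eqI[OF B module_abelian_group[OF N] _ _ _ u])
    show "add_hom (free_module B I) N (\<lambda>u. g (F u))" using mod_homD[OF Fh] mod_homD[OF gh] by (simp add: add_hom_def)
    show "add_hom (free_module B I) N (\<lambda>_. \<zero>\<^bsub>N\<^esub>)" by (simp add: add_hom_def)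
    show "g (F (free_inj B I i c)) = \<zero>\<^bsub>N\<^esub>" if i: "i \<in> I" and c: "c \<in> carrier B" for i c
    proof -
      have "g (fmap i) = \<phi> (free_lift A M J (\<lambda>m. m) i)"
        by (rule free_lift_natural[OF A B f M N \<phi>, symmetric]) (use i in auto)
      also have "\<dots> = \<phi> \<zero>\<^bsub>M\<^esub>" using i by simp
      also have "\<dots> = \<zero>\<^bsub>N\<^esub>"
        by (rule add_hom_zero[OF module_abelian_group[OF M] module_abelian_group[OF N] conjunct1[OF \<phi>[unfolded semilinear_def]]])
      finally have "g (fmap i) = \<zero>\<^bsub>N\<^esub>" .
      moreover have "fmap i \<in> carrier (free_module B J)" using semilinearD(1)[OF fmap] i by simp
      ultimately show ?thesis using F_inj[OF i c] mod_homD(3)[OF gh c] c by simp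
    qed
  qed
  then show ?thesis .
qed

end

section \<open>From base change of stalks to presentations of sheaves\<close>

context ringed_finite_space
begin

text \<open>On U_p the generators are all elements of the stalk at \<open>p\<close> and the
  relations all relations among them. Restricting both to the smaller open sets gives morphisms of
  free sheaves, and base change from \<open>p\<close> to \<open>q\<close> is what makes the sequence
  exact at \<open>q\<close>. The index sets are of the types that \<open>quasi_coherent\<close>
  prescribes.\<close>

lemma quasi_coherent_if_base_change:
  fixes N :: "('p, 'r, 'm) module_sheaf"
  assumes N: "sheaf_of_modules X N"
    and bc: "\<And>p q. p \<in> topspace (topo X) \<Longrightarrow> q \<in> umin p \<Longrightarrow>
      base_change (stalk X p) (stalk X q) (stalk_res X p q) (mstalk X N p) (mstalk X N q) (mres N (umin p) (umin q))"
  shows "quasi_coherent X N"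
  unfolding quasi_coherent_def
proof (intro conjI ballI N)
  fix p assume p: "p \<in> topspace (topo X)"
  note D = sheaf_of_modulesD[OF N]
  let ?U = "umin p" and ?A = "sec X (umin p)"
  define J where "J = carrier (msec N ?U)"
  define I where "I = {y \<in> carrier (free_module ?A J). free_lift ?A (msec N ?U) J (\<lambda>m. m) y = \<zero>\<^bsub>msec N ?U\<^esub>}"
  define g where "g V = free_lift (sec X V) (msec N V) J (mres N ?U V)" for V
  define F where "F V = free_lift (sec X V) (free_module (sec X V) J) I (\<lambda>i. \<lambda>j\<in>J. res X ?U V (i j))" for V
  have U: "openin (topo X) ?U" by (rule umin_open[OF p])
  have sub: "openin (topo (open_sub X ?U)) V \<longleftrightarrow> openin (topo X) V \<and> V \<subseteq> ?U" for V
    using openin_open_subtopology[OF U] by simp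
  have semi: "semilinear (sec X V) (res X V W) (msec N V) (msec N W) (mres N V W)"
    if "openin (topo X) V" "openin (topo X) W" "W \<subseteq> V" for V W
    using mod_homD[OF D(2)[OF that]] by (auto simp: semilinear_def add_hom_def)
  have mJ: "mres N ?U V m \<in> carrier (msec N V)" if "openin (topo X) V" "V \<subseteq> ?U" "m \<in> J" for V m
    using semilinearD(1)[OF semi[OF U that(1,2)]] that(3) by (simp add: J_def)
  have mI: "(\<lambda>j\<in>J. res X ?U V (i j)) \<in> carrier (free_module (sec X V) J)" if "openin (topo X) V" "V \<subseteq> ?U" "i \<in> I" for V i
    using semilinearD(1)[OF semilinear_free_map[OF cring_sec[OF U] cring_sec[OF that(1)] res_hom[OF U that(1,2)], of J]] that(3)
    by (simp add: I_def)
  have gh: "g V \<in> mod_hom (sec X V) (free_module (sec X V) J) (msec N V)" if "openin (topo X) V" "V \<subseteq> ?U" for V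
    unfolding g_def by (rule free_lift_hom[OF D(1)[OF that(1)] mJ[OF that]])
  have Fh: "F V \<in> mod_hom (sec X V) (free_module (sec X V) I) (free_module (sec X V) J)" if "openin (topo X) V" "V \<subseteq> ?U" for V
    unfolding F_def by (rule free_lift_hom[OF module_free_module[OF cring_sec[OF that(1)]] mI[OF that]])
  have "free_cokernel (open_sub X ?U) I J N"
    unfolding free_cokernel_def
  proof (intro bexI conjI)
    show "F \<in> sheaf_hom (open_sub X ?U) (free_sheaf (open_sub X ?U) I) (free_sheaf (open_sub X ?U) J)"
      unfolding sheaf_hom_def mem_Collect_eq sub msec_free_sheaf mres_free_sheaf open_sub_simps(1,2)
    proof (intro conjI allI impI ballI)
      fix V W s assume V: "openin (topo X) V \<and> V \<subseteq> ?U" and W: "openin (topo X) W \<and> W \<subseteq> ?U" and WV: "W \<subseteq> V"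
        and s: "s \<in> carrier (free_module (sec X V) I)"
      note VW = conjunct1[OF V] conjunct1[OF W]
      have "(\<lambda>x. \<lambda>j\<in>J. res X V W (x j)) (F V s) = F W (\<lambda>i\<in>I. res X V W (s i))"
        unfolding F_def
      proof (rule free_lift_natural[OF cring_sec[OF VW(1)] cring_sec[OF VW(2)] res_hom[OF VW WV] module_free_module[OF cring_sec[OF VW(1)]]
            module_free_module[OF cring_sec[OF VW(2)]] semilinear_free_map[OF cring_sec[OF VW(1)] cring_sec[OF VW(2)] res_hom[OF VW WV]] _ _ s])
        show "(\<lambda>j\<in>J. res X ?U V (i j)) \<in> carrier (free_module (sec X V) J)" if "i \<in> I" for i
          by (rule mI[OF conjunct1[OF V] conjunct2[OF V] that])
        show "(\<lambda>j\<in>J. res X ?U W (i j)) = (\<lambda>j\<in>J. res X V W ((\<lambda>j\<in>J. res X ?U V (i j)) j))" if i: "i \<in> I" for i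
        proof (rule restrict_ext)
          fix j assume j: "j \<in> J"
          have "i j \<in> carrier ?A" using i j by (auto simp: I_def free_module_simps)
          then show "res X ?U W (i j) = res X V W ((\<lambda>j\<in>J. res X ?U V (i j)) j)"
            using sheaf_on_pre(3)[OF sheaf_sec U VW WV conjunct2[OF V]] j by simp
        qed
      qed
      then show "F W (\<lambda>i\<in>I. res X V W (s i)) = (\<lambda>j\<in>J. res X V W (F V s j))" by simp
    qed (use Fh in auto)
    show "g \<in> sheaf_hom (open_sub X ?U) (free_sheaf (open_sub X ?U) J) N"
      unfolding sheaf_hom_def mem_Collect_eq sub msec_free_sheaf mres_free_sheaf open_sub_simps(1,2)
    proof (intro conjI allI impI ballI)
      fix V W s assume V: "openin (topo X) V \<and> V \<subseteq> ?U" and W: "openin (topo X) W \<and> W \<subseteq> ?U" and WV: "W \<subseteq> V"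
        and s: "s \<in> carrier (free_module (sec X V) J)"
      note VW = conjunct1[OF V] conjunct1[OF W]
      have "mres N V W (g V s) = g W (\<lambda>j\<in>J. res X V W (s j))"
        unfolding g_def
      proof (rule free_lift_natural[OF cring_sec[OF VW(1)] cring_sec[OF VW(2)] res_hom[OF VW WV] D(1)[OF VW(1)] D(1)[OF VW(2)] semi[OF VW WV] _ _ s])
        show "mres N ?U V m \<in> carrier (msec N V)" if "m \<in> J" for m by (rule mJ[OF VW(1) conjunct2[OF V] that])
        show "mres N ?U W m = mres N V W (mres N ?U V m)" if "m \<in> J" for m
          using D(5)[OF U VW WV conjunct2[OF V], of m] that by (simp add: J_def)
      qed
      then show "g W (\<lambda>j\<in>J. res X V W (s j)) = mres N V W (g V s)" by simp
    qed (use gh in auto)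
    have top: "topspace (topo (open_sub X ?U)) = ?U" using openin_subset[OF U] by auto
    have mo: "min_open (topo (open_sub X ?U)) q = umin q" if "q \<in> ?U" for q
      using min_open_subtopology[OF finite_topspace U that] by simp
    have q: "openin (topo X) (umin q)" "umin q \<subseteq> ?U" if "q \<in> ?U" for q
      using umin_open[OF open_pt[OF U that]] min_open_least[OF U that] by auto
    show "exact_at (open_sub X ?U) (free_sheaf (open_sub X ?U) I) F (free_sheaf (open_sub X ?U) J) g N"
      unfolding exact_at_def mstalk_def top msec_free_sheaf open_sub_simps(1)
    proof
      fix q assume qU: "q \<in> ?U"
      note oq = q[OF qU]
      show "F (min_open (topo (open_sub X ?U)) q) ` carrier (free_module (sec X (min_open (topo (open_sub X ?U)) q)) I) =
          {x \<in> carrier (free_module (sec X (min_open (topo (open_sub X ?U)) q)) J). g (min_open (topo (open_sub X ?U)) q) x = \<zero>\<^bsub>msec N (min_open (topo (open_sub X ?U)) q)\<^esub>}"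
        unfolding mo[OF qU]
      proof (intro equalityI subsetI)
        fix x assume "x \<in> F (umin q) ` carrier (free_module (sec X (umin q)) I)"
        then obtain u where u: "u \<in> carrier (free_module (sec X (umin q)) I)" "x = F (umin q) u" by blast
        have "g (umin q) x = \<zero>\<^bsub>msec N (umin q)\<^esub>"
          using base_change_relations_zero[OF cring_sec[OF U] cring_sec[OF oq(1)] res_hom[OF U oq] D(1)[OF U] D(1)[OF oq(1)] semi[OF U oq]
            bc[OF p qU, unfolded stalk_def mstalk_def stalk_res_def], of u] u unfolding F_def g_def I_def J_def by simp
        then show "x \<in> {x \<in> carrier (free_module (sec X (umin q)) J). g (umin q) x = \<zero>\<^bsub>msec N (umin q)\<^esub>}"
          using mod_homD(1)[OF Fh[OF q[OF qU]] u(1)] u(2) by simp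
      next
        fix x assume "x \<in> {x \<in> carrier (free_module (sec X (umin q)) J). g (umin q) x = \<zero>\<^bsub>msec N (umin q)\<^esub>}"
        then show "x \<in> F (umin q) ` carrier (free_module (sec X (umin q)) I)"
          using base_change_relations[OF cring_sec[OF U] cring_sec[OF oq(1)] res_hom[OF U oq] D(1)[OF U] D(1)[OF oq(1)] semi[OF U oq]
            bc[OF p qU, unfolded stalk_def mstalk_def stalk_res_def], of x] unfolding F_def g_def I_def J_def by simp
      qed
    qed
    show "sheaf_epi (open_sub X ?U) (free_sheaf (open_sub X ?U) J) g N"
      unfolding sheaf_epi_def mstalk_def top msec_free_sheaf open_sub_simps(1)
    proof
      fix q assume qU: "q \<in> ?U"
      note oq = q[OF qU]
      show "g (min_open (topo (open_sub X ?U)) q) ` carrier (free_module (sec X (min_open (topo (open_sub X ?U)) q)) J) =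
          carrier (msec N (min_open (topo (open_sub X ?U)) q))"
        unfolding mo[OF qU]
      proof (intro equalityI subsetI)
        fix x assume "x \<in> g (umin q) ` carrier (free_module (sec X (umin q)) J)"
        then show "x \<in> carrier (msec N (umin q))" using mod_homD(1)[OF gh[OF q[OF qU]]] by blast
      next
        fix x assume "x \<in> carrier (msec N (umin q))"
        then show "x \<in> g (umin q) ` carrier (free_module (sec X (umin q)) J)"
          using base_change_surj[OF cring_sec[OF U] cring_sec[OF oq(1)] res_hom[OF U oq] D(1)[OF U] D(1)[OF oq(1)] semi[OF U oq]
            bc[OF p qU, unfolded stalk_def mstalk_def stalk_res_def], of x] unfolding g_def J_def by force
      qed
    qed
  qed
  then show "\<exists>U. openin (topo X) U \<and> p \<in> U \<and> (\<exists>(I :: ('m \<Rightarrow> 'r) set) (J :: 'm set). free_cokernel (open_sub X U) I J N)"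
    using U min_open_self[of p "topo X"] by blast
qed

end

section \<open>Sheafification\<close>

text \<open>What the cohomology presheaf is known to satisfy before it is sheafified.\<close>

definition presheaf_of_modules :: "('p, 'r) ringed_space \<Rightarrow> ('p, 'r, 'm) module_sheaf \<Rightarrow> bool" where
  "presheaf_of_modules X M \<longleftrightarrow>
     (\<forall>U. openin (topo X) U \<longrightarrow> Module.module (sec X U) (msec M U)) \<and>
     (\<forall>U V. openin (topo X) U \<longrightarrow> openin (topo X) V \<longrightarrow> V \<subseteq> U \<longrightarrow>
        mres M U V \<in> mod_hom (sec X U) (msec M U) (restrict_scalars (res X U V) (msec M V))) \<and>
     presheaf_on (topo X) (\<lambda>U. carrier (msec M U)) (mres M)"

context ringed_finite_space
begin

context
  fixes PP :: "('p, 'r, 'm) module_sheaf"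
  assumes PP: "presheaf_of_modules X PP"
begin

private abbreviation "Pst p \<equiv> msec PP (umin p)"
private abbreviation "Pr p q \<equiv> mres PP (umin p) (umin q)"
private abbreviation "SP \<equiv> sheafify X PP"

private lemma mod: "openin (topo X) U \<Longrightarrow> Module.module (sec X U) (msec PP U)"
  and hom: "openin (topo X) U \<Longrightarrow> openin (topo X) V \<Longrightarrow> V \<subseteq> U \<Longrightarrow>
        mres PP U V \<in> mod_hom (sec X U) (msec PP U) (restrict_scalars (res X U V) (msec PP V))"
  and idr: "openin (topo X) U \<Longrightarrow> s \<in> carrier (msec PP U) \<Longrightarrow> mres PP U U s = s"
  and comp: "openin (topo X) U \<Longrightarrow> openin (topo X) V \<Longrightarrow> openin (topo X) W \<Longrightarrow> W \<subseteq> V \<Longrightarrow> V \<subseteq> U \<Longrightarrow>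
        s \<in> carrier (msec PP U) \<Longrightarrow> mres PP V W (mres PP U V s) = mres PP U W s"
  using PP by (simp_all add: presheaf_of_modules_def presheaf_on_def)

private lemma closed: "openin (topo X) U \<Longrightarrow> openin (topo X) V \<Longrightarrow> V \<subseteq> U \<Longrightarrow> s \<in> carrier (msec PP U) \<Longrightarrow> mres PP U V s \<in> carrier (msec PP V)"
  using mod_homD(1)[OF hom] by simp

private lemma pt: "openin (topo X) U \<Longrightarrow> u \<in> U \<Longrightarrow> openin (topo X) (umin u)" "openin (topo X) U \<Longrightarrow> u \<in> U \<Longrightarrow> umin u \<subseteq> U"
  by (simp add: umin_open open_pt) (rule min_open_least)

private lemma sheafify_simps:
  "\<zero>\<^bsub>msec SP U\<^esub> = (\<lambda>p\<in>U. \<zero>\<^bsub>Pst p\<^esub>)" "s \<oplus>\<^bsub>msec SP U\<^esub> t = (\<lambda>p\<in>U. s p \<oplus>\<^bsub>Pst p\<^esub> t p)"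
  "r \<odot>\<^bsub>msec SP U\<^esub> s = (\<lambda>p\<in>U. res X U (umin p) r \<odot>\<^bsub>Pst p\<^esub> s p)" "mres SP U V = (\<lambda>s. restrict s V)"
  by (simp_all add: sheafify_def mk_module_simps mstalk_def)

text \<open>Every neighbourhood of a point contains its minimal open set, so being locally induced
  by a section can be tested there, with the value at the point as that section. The sheafification
  thus consists of compatible families of germs.\<close>

private lemma carrier_sheafify:
  assumes U: "openin (topo X) U"
  shows "carrier (msec SP U) = {s \<in> \<Pi>\<^sub>E p\<in>U. carrier (Pst p). \<forall>p\<in>U. \<forall>q\<in>umin p. Pr p q (s p) = s q}"
proof -
  have "(\<exists>V. openin (topo X) V \<and> p \<in> V \<and> V \<subseteq> U \<and> (\<exists>t\<in>carrier (msec PP V). \<forall>q\<in>V. s q = mres PP V (umin q) t)) \<longleftrightarrow>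
      (\<forall>q\<in>umin p. Pr p q (s p) = s q)" (is "?l \<longleftrightarrow> ?r")
    if s: "s \<in> (\<Pi>\<^sub>E p\<in>U. carrier (Pst p))" and p: "p \<in> U" for s p
  proof
    assume ?l
    then obtain V t where V: "openin (topo X) V" "p \<in> V" "t \<in> carrier (msec PP V)" "\<And>q. q \<in> V \<Longrightarrow> s q = mres PP V (umin q) t" by blast
    show ?r
    proof
      fix q assume q: "q \<in> umin p"
      have "q \<in> V" using pt(2)[OF V(1,2)] q by auto
      then show "Pr p q (s p) = s q"
        using V comp[OF V(1) pt(1)[OF V(1,2)] pt(1)[OF pt(1)[OF V(1,2)] q] pt(2)[OF pt(1)[OF V(1,2)] q] pt(2)[OF V(1,2)] V(3)] by simp
    qed
  next
    assume ?r
    moreover have "s p \<in> carrier (Pst p)" using s p by auto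
    ultimately show ?l using pt[OF U p] min_open_self[of p "topo X"] by (intro exI[of _ "umin p"] conjI bexI[of _ "s p"]) auto
  qed
  then show ?thesis by (auto simp: sheafify_def mk_module_simps mstalk_def)
qed

private lemma sheafify_mem:
  assumes "openin (topo X) U" "s \<in> carrier (msec SP U)"
  shows "p \<in> U \<Longrightarrow> s p \<in> carrier (Pst p)" "p \<in> U \<Longrightarrow> q \<in> umin p \<Longrightarrow> Pr p q (s p) = s q" "s \<in> extensional U"
  using assms(2) unfolding carrier_sheafify[OF assms(1)] by (auto simp: PiE_iff)

private lemma sheafify_memI:
  assumes "openin (topo X) U" "\<And>p. p \<in> U \<Longrightarrow> s p \<in> carrier (Pst p)" "\<And>p q. p \<in> U \<Longrightarrow> q \<in> umin p \<Longrightarrow> Pr p q (s p) = s q"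
  shows "(\<lambda>p\<in>U. s p) \<in> carrier (msec SP U)"
  using assms(2,3) pt(2)[OF assms(1)] unfolding carrier_sheafify[OF assms(1)] by (auto simp: subset_iff)

private lemma sheafify_eqI:
  assumes "openin (topo X) U" "s \<in> carrier (msec SP U)" "t \<in> carrier (msec SP U)" "\<And>p. p \<in> U \<Longrightarrow> s p = t p"
  shows "s = t"
  using extensionalityI[OF sheafify_mem(3)[OF assms(1,2)] sheafify_mem(3)[OF assms(1,3)]] assms(4) by blast

private lemma module_sheafify:
  assumes U: "openin (topo X) U" shows "Module.module (sec X U) (msec SP U)"
proof -
  interpret R: cring "sec X U" by (rule cring_sec[OF U])
  have m: "Module.module (sec X (umin p)) (Pst p)" if "p \<in> U" for p by (rule mod[OF pt(1)[OF U that]])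
  have ag: "abelian_group (Pst p)" if "p \<in> U" for p by (rule module_abelian_group[OF m[OF that]])
  have am: "abelian_monoid (Pst p)" if "p \<in> U" for p using ag[OF that] by (simp add: abelian_group_def)
  have r: "res X U (umin p) \<in> ring_hom (sec X U) (sec X (umin p))" if "p \<in> U" for p by (rule res_hom[OF U pt[OF U that]])
  have q: "q \<in> U" "umin q \<subseteq> umin p" "openin (topo X) (umin p)" "openin (topo X) (umin q)" if "p \<in> U" "q \<in> umin p" for p q
    using pt[OF U that(1)] pt[OF pt(1)[OF U that(1)] that(2)] that(2) by auto
  have h: "Pr p q \<in> mod_hom (sec X (umin p)) (Pst p) (restrict_scalars (res X (umin p) (umin q)) (Pst q))" if "p \<in> U" "q \<in> umin p" for p q
    by (rule hom[OF q(3,4,2)[OF that]])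
  have h0: "Pr p q \<zero>\<^bsub>Pst p\<^esub> = \<zero>\<^bsub>Pst q\<^esub>" if "p \<in> U" "q \<in> umin p" for p q
    using add_hom_zero[OF ag[OF that(1)] abelian_group_restrict[OF ag[OF q(1)[OF that]]] mod_hom_add_hom[OF h[OF that]]] by simp
  have hm: "Pr p q (\<ominus>\<^bsub>Pst p\<^esub> x) = \<ominus>\<^bsub>Pst q\<^esub> Pr p q x" if "p \<in> U" "q \<in> umin p" "x \<in> carrier (Pst p)" for p q x
  proof -
    have "add_hom (Pst p) (Pst q) (Pr p q)" using mod_hom_add_hom[OF h[OF that(1,2)]] by (simp add: add_hom_def)
    then show ?thesis by (rule add_hom_uminus[OF ag[OF that(1)] ag[OF q(1)[OF that(1,2)]] _ that(3)])
  qed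
  have rr: "res X (umin p) (umin q) (res X U (umin p) x) = res X U (umin q) x" if "p \<in> U" "q \<in> umin p" "x \<in> carrier (sec X U)" for p q x
    by (rule sheaf_on_pre(3)[OF sheaf_sec U _ _ _ _ that(3)]) (use q[OF that(1,2)] pt[OF U that(1)] in auto)
  note mem = sheafify_mem[OF U]
  have add: "s \<oplus>\<^bsub>msec SP U\<^esub> t \<in> carrier (msec SP U)" if "s \<in> carrier (msec SP U)" "t \<in> carrier (msec SP U)" for s t
    unfolding sheafify_simps
    by (rule sheafify_memI[OF U])
      (use module_add_closed[OF m] mem[OF that(1)] mem[OF that(2)] mod_homD(2)[OF h] in auto)
  have smult: "x \<odot>\<^bsub>msec SP U\<^esub> s \<in> carrier (msec SP U)" if "x \<in> carrier (sec X U)" "s \<in> carrier (msec SP U)" for x s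
    unfolding sheafify_simps
    by (rule sheafify_memI[OF U])
      (use module_smult_closed[OF m] mem[OF that(2)] mod_homD(3)[OF h] ring_hom_closed[OF r that(1)] rr[OF _ _ that(1)] in auto)
  have zero: "\<zero>\<^bsub>msec SP U\<^esub> \<in> carrier (msec SP U)"
    unfolding sheafify_simps by (rule sheafify_memI[OF U]) (use module_zero_closed[OF m] h0 in auto)
  show ?thesis
  proof (intro moduleI abelian_groupI R.is_cring add smult zero)
    fix s assume s: "s \<in> carrier (msec SP U)"
    have "(\<lambda>p\<in>U. \<ominus>\<^bsub>Pst p\<^esub> s p) \<in> carrier (msec SP U)"
      by (rule sheafify_memI[OF U]) (use module_uminus_closed[OF m] mem[OF s] hm in auto)
    moreover have "(\<lambda>p\<in>U. \<ominus>\<^bsub>Pst p\<^esub> s p) \<oplus>\<^bsub>msec SP U\<^esub> s = \<zero>\<^bsub>msec SP U\<^esub>"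
      unfolding sheafify_simps by (rule restrict_ext) (simp add: abelian_group.l_neg[OF ag] mem[OF s])
    ultimately show "\<exists>t\<in>carrier (msec SP U). t \<oplus>\<^bsub>msec SP U\<^esub> s = \<zero>\<^bsub>msec SP U\<^esub>" by blast
    show "\<zero>\<^bsub>msec SP U\<^esub> \<oplus>\<^bsub>msec SP U\<^esub> s = s"
      by (rule sheafify_eqI[OF U add[OF zero s] s]) (simp add: sheafify_simps abelian_monoid.l_zero[OF am] mem[OF s])
    show "\<one>\<^bsub>sec X U\<^esub> \<odot>\<^bsub>msec SP U\<^esub> s = s"
      by (rule sheafify_eqI[OF U smult[OF R.one_closed s] s])
        (simp add: sheafify_simps ring_hom_one[OF r] Module.module.smult_one[OF m] mem[OF s])
    fix t assume t: "t \<in> carrier (msec SP U)"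
    show "s \<oplus>\<^bsub>msec SP U\<^esub> t = t \<oplus>\<^bsub>msec SP U\<^esub> s"
      unfolding sheafify_simps by (rule restrict_ext) (rule abelian_monoid.a_comm[OF am mem(1)[OF s] mem(1)[OF t]])
    show "s \<oplus>\<^bsub>msec SP U\<^esub> t \<oplus>\<^bsub>msec SP U\<^esub> u = s \<oplus>\<^bsub>msec SP U\<^esub> (t \<oplus>\<^bsub>msec SP U\<^esub> u)" if u: "u \<in> carrier (msec SP U)" for u
      unfolding sheafify_simps
      by (rule restrict_ext) (simp add: abelian_monoid.a_assoc[OF am mem(1)[OF s] mem(1)[OF t] mem(1)[OF u]])
    fix x assume x: "x \<in> carrier (sec X U)"
    show "x \<odot>\<^bsub>msec SP U\<^esub> (s \<oplus>\<^bsub>msec SP U\<^esub> t) = x \<odot>\<^bsub>msec SP U\<^esub> s \<oplus>\<^bsub>msec SP U\<^esub> x \<odot>\<^bsub>msec SP U\<^esub> t"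
      unfolding sheafify_simps
      by (rule restrict_ext) (simp add: Module.module.smult_r_distr[OF m] ring_hom_closed[OF r x] mem(1)[OF s] mem(1)[OF t])
    fix y assume y: "y \<in> carrier (sec X U)"
    show "(x \<oplus>\<^bsub>sec X U\<^esub> y) \<odot>\<^bsub>msec SP U\<^esub> s = x \<odot>\<^bsub>msec SP U\<^esub> s \<oplus>\<^bsub>msec SP U\<^esub> y \<odot>\<^bsub>msec SP U\<^esub> s"
      unfolding sheafify_simps
      by (rule restrict_ext) (simp add: Module.module.smult_l_distr[OF m] ring_hom_add[OF r x y] ring_hom_closed[OF r x] ring_hom_closed[OF r y] mem(1)[OF s])
    show "(x \<otimes>\<^bsub>sec X U\<^esub> y) \<odot>\<^bsub>msec SP U\<^esub> s = x \<odot>\<^bsub>msec SP U\<^esub> (y \<odot>\<^bsub>msec SP U\<^esub> s)"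
      unfolding sheafify_simps
      by (rule restrict_ext) (simp add: Module.module.smult_assoc1[OF m] ring_hom_mult[OF r x y] ring_hom_closed[OF r x] ring_hom_closed[OF r y] mem(1)[OF s])
  qed
qed

lemma sheaf_sheafify: "sheaf_of_modules X (sheafify X PP)"
  unfolding sheaf_of_modules_def
proof (intro conjI allI impI module_sheafify)
  show "sheaf_on (topo X) (\<lambda>U. carrier (msec SP U)) (mres SP)"
    unfolding sheafify_simps(4)[abs_def] by (rule sheaf_on_cong[OF sheaf_on_stalkwise carrier_sheafify])
  fix U V assume U: "openin (topo X) U" and V: "openin (topo X) V" and VU: "V \<subseteq> U"
  have "restrict s V \<in> carrier (msec SP V)" if "s \<in> carrier (msec SP U)" for s
    by (rule sheafify_memI[OF V]) (use VU sheafify_mem[OF U that] in auto)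
  moreover have "res X V (umin p) (res X U V r) = res X U (umin p) r" if "p \<in> V" "r \<in> carrier (sec X U)" for p r
    by (rule sheaf_on_pre(3)[OF sheaf_sec U V pt[OF V that(1)] VU that(2)])
  ultimately show "mres SP U V \<in> mod_hom (sec X U) (msec SP U) (restrict_scalars (res X U V) (msec SP V))"
    using VU by (auto simp: mod_hom_def sheafify_simps fun_eq_iff)
qed

text \<open>The canonical map from the presheaf to its sheafification over U_p. It turns out to be
  bijective there, since sheafification does not change stalks.\<close>

private abbreviation "unit p t \<equiv> \<lambda>q\<in>umin p. Pr p q t"

private lemma unit_hom:
  assumes p: "p \<in> topspace (topo X)"
  shows "unit p \<in> mod_hom (sec X (umin p)) (Pst p) (msec SP (umin p))"
proof -
  have U: "openin (topo X) (umin p)" by (rule umin_open[OF p])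
  note o = pt[OF U]
  have "unit p t \<in> carrier (msec SP (umin p))" if t: "t \<in> carrier (Pst p)" for t
  proof (rule sheafify_memI[OF U])
    fix q assume q: "q \<in> umin p"
    show "Pr p q t \<in> carrier (Pst q)" by (rule closed[OF U o[OF q] t])
    fix w assume w: "w \<in> umin q"
    show "Pr q w (Pr p q t) = Pr p w t" by (rule comp[OF U o(1)[OF q] pt[OF o(1)[OF q] w] o(2)[OF q] t])
  qed
  then show ?thesis
    using mod_homD(2,3)[OF hom[OF U o]] by (auto simp: mod_hom_def sheafify_simps intro!: restrict_ext)
qed

text \<open>Over minimal open sets the canonical map is an isomorphism, so the sheafification is
  there the cokernel of the zero map of the presheaf. In this form
  \<open>base_change_cokernel\<close> carries the property over.\<close>

lemma base_change_sheafify: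
  assumes p: "p \<in> topspace (topo X)" and q: "q \<in> umin p"
    and bc: "base_change (stalk X p) (stalk X q) (stalk_res X p q) (mstalk X PP p) (mstalk X PP q) (mres PP (umin p) (umin q))"
  shows "base_change (stalk X p) (stalk X q) (stalk_res X p q) (mstalk X (sheafify X PP) p) (mstalk X (sheafify X PP) q)
    (mres (sheafify X PP) (umin p) (umin q))"
proof -
  have U: "openin (topo X) (umin p)" by (rule umin_open[OF p])
  note V = pt[OF U q]
  have qt: "q \<in> topspace (topo X)" by (rule open_pt[OF U q])
  note D = sheaf_of_modulesD[OF sheaf_sheafify]
  have semi: "semilinear (sec X (umin p)) (res X (umin p) (umin q)) (msec N (umin p)) (msec N (umin q)) (mres N (umin p) (umin q))"
    if "mres N (umin p) (umin q) \<in> mod_hom (sec X (umin p)) (msec N (umin p)) (restrict_scalars (res X (umin p) (umin q)) (msec N (umin q)))"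
    for N :: "('p, 'r, 'x) module_sheaf"
    using mod_homD[OF that] by (auto simp: semilinear_def add_hom_def)
  have zero: "(\<lambda>_. \<zero>\<^bsub>Pst u\<^esub>) \<in> mod_hom (sec X (umin u)) (Pst u) (Pst u)" if "u \<in> topspace (topo X)" for u
  proof -
    interpret Module.module "sec X (umin u)" "Pst u" by (rule mod[OF umin_open[OF that]])
    show ?thesis by (auto simp: mod_hom_def)
  qed
  have surj: "\<exists>t\<in>carrier (Pst u). unit u t = s" if u: "u \<in> topspace (topo X)" and s: "s \<in> carrier (msec SP (umin u))" for u s
  proof
    have O: "openin (topo X) (umin u)" by (rule umin_open[OF u])
    note mem = sheafify_mem[OF O s]
    show "s u \<in> carrier (Pst u)" by (rule mem(1)[OF min_open_self])
    show "unit u (s u) = s"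
      by (rule sheafify_eqI[OF O mod_homD(1)[OF unit_hom[OF u] mem(1)[OF min_open_self]] s]) (simp add: mem(2)[OF min_open_self])
  qed
  have hom0: "Pr p q \<zero>\<^bsub>Pst p\<^esub> = \<zero>\<^bsub>Pst q\<^esub>"
    using add_hom_zero[OF module_abelian_group[OF mod[OF U]] abelian_group_restrict[OF module_abelian_group[OF mod[OF V(1)]]]
        mod_hom_add_hom[OF hom[OF U V]]] by simp
  show ?thesis
    unfolding stalk_def mstalk_def stalk_res_def
  proof (rule base_change_cokernel[OF cring_sec[OF U] cring_sec[OF V(1)] res_hom[OF U V] mod[OF U] mod[OF U] D(1)[OF U]
        mod[OF V(1)] mod[OF V(1)] D(1)[OF V(1)] zero[OF p] unit_hom[OF p] zero[OF qt] unit_hom[OF qt] _ _ _ _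
        semi[OF hom[OF U V]] semi[OF hom[OF U V]] semi[OF D(2)[OF U V]] _ _
        bc[unfolded stalk_def mstalk_def stalk_res_def] bc[unfolded stalk_def mstalk_def stalk_res_def]])
    show "unit p \<zero>\<^bsub>Pst p\<^esub> = \<zero>\<^bsub>msec SP (umin p)\<^esub>" by (rule mod_hom_zero[OF mod[OF U] D(1)[OF U] unit_hom[OF p]])
    \<comment> \<open>Exactness at the middle term says that the canonical map has trivial kernel:
      its value at the point \<open>q\<close> is the element itself.\<close>
    show "\<exists>y\<in>carrier (Pst q). \<zero>\<^bsub>Pst q\<^esub> = x" if "x \<in> carrier (Pst q)" "unit q x = \<zero>\<^bsub>msec SP (umin q)\<^esub>" for x
    proof -
      have "Pr q q x = \<zero>\<^bsub>Pst q\<^esub>"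
        using fun_cong[OF that(2), of q] min_open_self[of q "topo X"] by (simp add: sheafify_simps)
      then show ?thesis using idr[OF V(1) that(1)] that(1) by auto
    qed
    show "mres SP (umin p) (umin q) (unit p x) = unit q (Pr p q x)" if x: "x \<in> carrier (Pst p)" for x
      unfolding sheafify_simps
    proof
      fix w show "restrict (unit p x) (umin q) w = unit q (Pr p q x) w"
        using V(2) comp[OF U V(1) pt[OF V(1)] V(2) x, of w] by (cases "w \<in> umin q") auto
    qed
  qed (use surj[OF p] surj[OF qt] hom0 in auto)
qed

end

end

section \<open>The cohomology presheaf and its sheafification\<close>

context resolution_setup
begin

lemma presheaf_PH: "presheaf_of_modules X (PH n)"
proof -
  have ex: "\<exists>x\<in>Zc n U. y = Bc n U +>\<^bsub>msec (KQ n) U\<^esub> x" if "openin X.T U" "y \<in> carrier (msec (PH n) U)" for U y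
    using that(2) quot_module_simps(1)[OF module_KQ[OF that(1)] submodule_Zc[OF that(1)] submodule_Bc[OF that(1)] Bc_Zc[OF that(1)], of n] unfolding msec_PH by auto
  note qs = quot_module_simps[OF module_KQ submodule_Zc submodule_Bc Bc_Zc, folded msec_PH]
  have cl: "x \<in> carrier (msec (KQ n) U)" if "openin X.T U" "x \<in> Zc n U" for U x
    using submodule_subset[OF submodule_Zc[OF that(1)]] that(2) by blast
  have clr: "Bc n U +>\<^bsub>msec (KQ n) U\<^esub> x \<in> carrier (msec (PH n) U)" if "openin X.T U" "x \<in> Zc n U" for U x
    using that(2) qs(1)[OF that(1) that(1) that(1) that(1), of n] by auto
  note rs = mres_PH[OF _ _ _ cl]
  show ?thesis
    unfolding presheaf_of_modules_def presheaf_on_def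
  proof (intro conjI allI impI ballI)
    show "Module.module (sec X U) (msec (PH n) U)" if "openin X.T U" for U
      unfolding msec_PH by (rule module_quot[OF module_KQ submodule_Zc submodule_Bc Bc_Zc]) (rule that)+
    show res: "mres (PH n) U V \<in> carrier (msec (PH n) U) \<rightarrow> carrier (msec (PH n) V)"
      if o: "openin X.T U" "openin X.T V" "V \<subseteq> U" for U V
    proof
      fix y assume "y \<in> carrier (msec (PH n) U)"
      then obtain x where x: "x \<in> Zc n U" "y = Bc n U +>\<^bsub>msec (KQ n) U\<^esub> x" using ex[OF o(1)] by blast
      then show "mres (PH n) U V y \<in> carrier (msec (PH n) V)"
        using rs[OF o o(1) x(1)] clr[OF o(2) mres_Zc[OF o x(1)]] by simp
    qed
    show "mres (PH n) U U y = y" if o: "openin X.T U" "y \<in> carrier (msec (PH n) U)" for U y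
    proof -
      obtain x where x: "x \<in> Zc n U" "y = Bc n U +>\<^bsub>msec (KQ n) U\<^esub> x" using ex[OF o] by blast
      have "mres (KQ n) U U x = x"
        using sheaf_of_modulesD(4)[OF sheaf_Q open_strip[OF o(1)]] cl[OF o(1) x(1)] o(1) by (simp add: mres_KQ msec_KQ)
      then show ?thesis using rs[OF o(1) o(1) order_refl o(1) x(1)] x(2) by simp
    qed
    show "mres (PH n) V W (mres (PH n) U V y) = mres (PH n) U W y"
      if o: "openin X.T U" "openin X.T V" "openin X.T W" "W \<subseteq> V" "V \<subseteq> U" and y: "y \<in> carrier (msec (PH n) U)" for U V W y
    proof -
      obtain x where x: "x \<in> Zc n U" "y = Bc n U +>\<^bsub>msec (KQ n) U\<^esub> x" using ex[OF o(1) y] by blast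
      have "W \<times> S' \<subseteq> V \<times> S'" "V \<times> S' \<subseteq> U \<times> S'" using o by auto
      then have "mres (KQ n) V W (mres (KQ n) U V x) = mres (KQ n) U W x"
        using sheaf_of_modulesD(5)[OF sheaf_Q open_strip[OF o(1)] open_strip[OF o(2)] open_strip[OF o(3)]] cl[OF o(1) x(1)] o
        by (simp add: mres_KQ msec_KQ)
      moreover have "W \<subseteq> U" using o by auto
      ultimately show ?thesis
        using rs[OF o(1,2,5) o(1) x(1)] rs[OF o(2,3,4) o(2) mres_Zc[OF o(1,2,5) x(1)]] rs[OF o(1,3) _ o(1) x(1)] x(2) by simp
    qed
    show "mres (PH n) U V \<in> mod_hom (sec X U) (msec (PH n) U) (restrict_scalars (res X U V) (msec (PH n) V))"
      if o: "openin X.T U" "openin X.T V" "V \<subseteq> U" for U V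
      unfolding mod_hom_def mem_Collect_eq restrict_scalars_simps
    proof (intro conjI ballI)
      show "mres (PH n) U V \<in> carrier (msec (PH n) U) \<rightarrow> carrier (msec (PH n) V)" by (rule res[OF o])
      note h = mod_homD[OF mres_KQ_hom[OF o, of n], unfolded restrict_scalars_simps]
      fix y assume y: "y \<in> carrier (msec (PH n) U)"
      obtain x where x: "x \<in> Zc n U" "y = Bc n U +>\<^bsub>msec (KQ n) U\<^esub> x" using ex[OF o(1) y] by blast
      note c = cl[OF o(1) x(1)]
      {
        fix y' assume "y' \<in> carrier (msec (PH n) U)"
        then obtain x' where x': "x' \<in> Zc n U" "y' = Bc n U +>\<^bsub>msec (KQ n) U\<^esub> x'" using ex[OF o(1)] by blast
        note c' = cl[OF o(1) x'(1)]
        have "y \<oplus>\<^bsub>msec (PH n) U\<^esub> y' = Bc n U +>\<^bsub>msec (KQ n) U\<^esub> (x \<oplus>\<^bsub>msec (KQ n) U\<^esub> x')"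
          unfolding x(2) x'(2) by (rule qs(3)[OF o(1) o(1) o(1) o(1) c c'])
        then have "mres (PH n) U V (y \<oplus>\<^bsub>msec (PH n) U\<^esub> y') = Bc n V +>\<^bsub>msec (KQ n) V\<^esub> (mres (KQ n) U V x \<oplus>\<^bsub>msec (KQ n) V\<^esub> mres (KQ n) U V x')"
          using mres_PH[OF o, of _ n] h(2)[OF c c'] submoduleD(2)[OF submodule_Zc[OF o(1)] x(1) x'(1)] cl[OF o(1)] by simp
        also have "\<dots> = mres (PH n) U V y \<oplus>\<^bsub>msec (PH n) V\<^esub> mres (PH n) U V y'"
          unfolding x(2) x'(2) mres_PH[OF o c] mres_PH[OF o c'] by (rule qs(3)[OF o(2) o(2) o(2) o(2) h(1)[OF c] h(1)[OF c'], symmetric])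
        finally show "mres (PH n) U V (y \<oplus>\<^bsub>msec (PH n) U\<^esub> y') = mres (PH n) U V y \<oplus>\<^bsub>msec (PH n) V\<^esub> mres (PH n) U V y'" .
      }
    next
      note h = mod_homD[OF mres_KQ_hom[OF o, of n], unfolded restrict_scalars_simps]
      fix r y assume r: "r \<in> carrier (sec X U)" and y: "y \<in> carrier (msec (PH n) U)"
      obtain x where x: "x \<in> Zc n U" "y = Bc n U +>\<^bsub>msec (KQ n) U\<^esub> x" using ex[OF o(1) y] by blast
      note c = cl[OF o(1) x(1)]
      have "r \<odot>\<^bsub>msec (PH n) U\<^esub> y = Bc n U +>\<^bsub>msec (KQ n) U\<^esub> (r \<odot>\<^bsub>msec (KQ n) U\<^esub> x)"
        unfolding x(2) by (rule qs(4)[OF o(1) o(1) o(1) o(1) r c])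
      then have "mres (PH n) U V (r \<odot>\<^bsub>msec (PH n) U\<^esub> y) = Bc n V +>\<^bsub>msec (KQ n) V\<^esub> (res X U V r \<odot>\<^bsub>msec (KQ n) V\<^esub> mres (KQ n) U V x)"
        using mres_PH[OF o, of _ n] h(3)[OF r c] submoduleD(3)[OF submodule_Zc[OF o(1)] r x(1)] cl[OF o(1)] by simp
      also have "\<dots> = res X U V r \<odot>\<^bsub>msec (PH n) V\<^esub> mres (PH n) U V y"
        unfolding x(2) mres_PH[OF o c] by (rule qs(4)[OF o(2) o(2) o(2) o(2) ring_hom_closed[OF X.res_hom[OF o] r] h(1)[OF c], symmetric])
      finally show "mres (PH n) U V (r \<odot>\<^bsub>msec (PH n) U\<^esub> y) = res X U V r \<odot>\<^bsub>msec (PH n) V\<^esub> mres (PH n) U V y" .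
    qed
  qed
qed

lemma quasi_coherent_higher_direct_image:
  "quasi_coherent X (higher_direct_image Y X fst (proj_sharp k X a X' a') Q d i)"
  unfolding higher_direct_image_def cohomology_sheaf_def
  by (rule X.quasi_coherent_if_base_change[OF X.sheaf_sheafify[OF presheaf_PH]])
    (rule X.base_change_sheafify[OF presheaf_PH], assumption, assumption, unfold mstalk_def, rule cohomology_base_change)

end

theorem theorem4p7:
  fixes k :: "'k ring"
    and X :: "('p, 'r) ringed_space" and a :: "'p set \<Rightarrow> 'k \<Rightarrow> 'r"
    and X' :: "('q, 's) ringed_space" and a' :: "'q set \<Rightarrow> 'k \<Rightarrow> 's"
    and M :: "('p \<times> 'q, 'p \<times> 'q \<Rightarrow> ('r \<times> 's \<Rightarrow>\<^sub>0 int) set, 'm) module_sheaf"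
    and e :: "('p \<times> 'q) set \<Rightarrow> 'm \<Rightarrow> 'i"
    and Q :: "nat \<Rightarrow> ('p \<times> 'q, 'p \<times> 'q \<Rightarrow> ('r \<times> 's \<Rightarrow>\<^sub>0 int) set, 'i) module_sheaf"
    and d :: "nat \<Rightarrow> ('p \<times> 'q) set \<Rightarrow> 'i \<Rightarrow> 'i"
    and i :: nat
  assumes "cring k"
    and "finite_space X" and "over_base k X a"
    and "ringed_finite_space X'" and "over_base k X' a'"
    and "quasi_coherent (product_space k X a X' a') M"
    and "injective_resolution (product_space k X a X' a') M e Q d"
  shows "quasi_coherent X
    (higher_direct_image (product_space k X a X' a') X fst (proj_sharp k X a X' a') Q d i)"
proof -
  interpret X: finite_space X by fact
  have X: "ringed_finite_space_over X k a"
    by (intro ringed_finite_space_over.intro ringed_finite_space_over_axioms.intro X.ringed_finite_space_axioms assms(1,3))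
  have X': "ringed_finite_space_over X' k a'"
    by (intro ringed_finite_space_over.intro ringed_finite_space_over_axioms.intro assms(1,4,5))
  \<comment> \<open>The commutative rings of sections of the product are supplied by
    \<open>M\<close>, whose modules of sections presuppose them.\<close>
  have "product_setup X k a X' a'"
    by (intro product_setup.intro product_setup_axioms.intro X X')
      (use assms(6) in \<open>auto simp: quasi_coherent_def sheaf_of_modules_def intro: module_cring\<close>)
  then have "resolution_setup X k a X' a' M e Q d"
    by (intro resolution_setup.intro resolution_setup_axioms.intro assms(6,7) X.flat_stalk_res)
  then show ?thesis by (rule resolution_setup.quasi_coherent_higher_direct_image)
qed

end
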